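(* Let $\Omega\subset\mathbb{C}^n$ be a domain with $C^{2,\alpha}$ boundary for some $\alpha>0$ and let $1\leq q\leq n-1$. Assume that $\Omega$ admits a maximal estimate on $(0,q)$-forms near $p\in\partial\Omega$, and let $U$ and $A$ be a neighborhood of $p$ and a constant as in the definition of maximal estimate. Let the eigenvalues of the Levi-form on $U\cap\partial\Omega$ with respect to a $C^{2,\alpha}$ defining function $\rho$ be $\{\lambda_1,\ldots,\lambda_{n-1}\}$, arranged in non-decreasing order. Then $$\sum_{j=1}^q\lambda_j+\sum_{\{1\leq j\leq n-1:\lambda_j<0\}}|\lambda_j|\geq\frac{1}{A}\sum_{j=1}^{n-1}|\lambda_j|$$ at every point of $U\cap\partial\Omega$.
   Context: Conventions: the metric on $\mathbb{C}^n$ is normalized so that $\langle\partial/\partial z_j,\partial/\partial z_k\rangle=\delta_{jk}=\langle dz_j,dz_k\rangle$; $dV$ is the corresponding volume element. $\mathcal{I}_q$ is the set of increasing multi-indices of length $q$ over $\{1,\dots,n\}$; a $(0,q)$-form is $u=\sum_{J\in\mathcal{I}_q}u_J\,d\bar z^J$, and $\|u\|^2_{L^2(\Omega)}=\sum_J\int_\Omega|u_J|^2dV$. $\bar\partial$ is the maximal $L^2$ extension of the Cauchy–Riemann operator on $L^2_{0,q}(\Omega)$ and $\bar\partial^*$ its Hilbert space adjoint with domain $\mathrm{Dom}\,\bar\partial^*$. A defining function $\rho$ for $\Omega$ on an open set $U$ is a real function with $\Omega\cap U=\{\rho<0\}$, $\partial\Omega\cap U=\{\rho=0\}$ and $d\rho\neq0$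 on $\partial\Omega\cap U$. Maximal estimate: Let $\Omega\subset\mathbb{C}^n$ have $C^{1,1}$ boundary and $1\le q\le n$. $\Omega$ admits a maximal estimate on $(0,q)$-forms near $p\in\partial\Omega$ if there are a neighborhood $U$ of $p$, constants $A,B>0$, and an orthonormal basis $\{L_1,\dots,L_n\}$ for $T^{1,0}(U)$ with Lipschitz coefficients satisfying $L_j|_{\partial\Omega}\in T^{1,0}(\partial\Omega\cap U)$ for $1\le j\le n-1$, such that $$\sum_{j=1}^n\sum_{J\in\mathcal{I}_q}\Big\|\frac{\partial u_J}{\partial\bar z_j}\Big\|^2_{L^2(\Omega)}+\sum_{j=1}^{n-1}\sum_{J\in\mathcal{I}_q}\|L_ju_J\|^2_{L^2(\Omega)}\le A\big(\|\bar\partial u\|^2_{L^2(\Omega)}+\|\bar\partial^*u\|^2_{L^2(\Omega)}\big)+B\|u\|^2_{L^2(\Omega)}$$ for every $u\in C^1_{0,q}(\overline\Omega)\cap\mathrm{Dom}\,\bar\partial^*$ supported in $\overline\Omega\cap U$. The Levi-form with respect to $\rho$ at a boundary point is the Hermitian form $(Z,W)\mapsto\sum_{j,k}a^j\frac{\partial^2\rho}{\partial z_j\partial\bar z_k}\bar b^k$, for $Z=\sum a^j\partial/\partial z_j$, $W=\sum b^j\partial/\partial z_j$ in $T^{1,0}(\partial\Omega)$; its eigenvalues are taken in an orthonormal basis of $T^{1,0}(\partial\Omega)$. *)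

theory Defs
  imports "HOL-Analysis.Analysis" "Jordan_Normal_Form.Char_Poly"
begin

(* From here on "$" is the component of a vector in complex ^ 'n, and "mat" needs qualification. *)
no_notation vec_index (infixl "$" 100)

section \<open>Regularity of functions and domains\<close>

text \<open>\<open>Ck_on k S f\<close> and \<open>Ck_holder_on k \<alpha> S f\<close> are meant for open \<open>S\<close>; the Hoelder condition
  on the derivatives of order \<open>k\<close> is local.\<close>

primrec Ck_on :: "nat \<Rightarrow> 'a::real_normed_vector set \<Rightarrow> ('a \<Rightarrow> 'b::real_normed_vector) \<Rightarrow> bool" where
  "Ck_on 0 S f \<longleftrightarrow> continuous_on S f"
| "Ck_on (Suc k) S f \<longleftrightarrow>
     (\<forall>x\<in>S. f differentiable (at x)) \<and> (\<forall>v. Ck_on k S (\<lambda>x. frechet_derivative f (at x) v))"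

definition locally_holder_on ::
    "real \<Rightarrow> 'a::real_normed_vector set \<Rightarrow> ('a \<Rightarrow> 'b::real_normed_vector) \<Rightarrow> bool" where
  "locally_holder_on \<alpha> S f \<longleftrightarrow>
     (\<forall>x\<in>S. \<exists>e>0. \<exists>C. \<forall>y\<in>S \<inter> ball x e. \<forall>z\<in>S \<inter> ball x e. dist (f y) (f z) \<le> C * dist y z powr \<alpha>)"

primrec Ck_holder_on ::
    "nat \<Rightarrow> real \<Rightarrow> 'a::real_normed_vector set \<Rightarrow> ('a \<Rightarrow> 'b::real_normed_vector) \<Rightarrow> bool" where
  "Ck_holder_on 0 \<alpha> S f \<longleftrightarrow> continuous_on S f \<and> locally_holder_on \<alpha> S f"
| "Ck_holder_on (Suc k) \<alpha> S f \<longleftrightarrow>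
     (\<forall>x\<in>S. f differentiable (at x)) \<and>
     (\<forall>v. Ck_holder_on k \<alpha> S (\<lambda>x. frechet_derivative f (at x) v))"

text \<open>\<open>C\<^sup>1\<close> up to the boundary: the function and its first derivatives extend continuously.\<close>

definition C1_closure :: "'a::real_normed_vector set \<Rightarrow> ('a \<Rightarrow> 'b::real_normed_vector) \<Rightarrow> bool" where
  "C1_closure \<Omega> f \<longleftrightarrow> continuous_on (closure \<Omega>) f \<and> (\<forall>x\<in>\<Omega>. f differentiable (at x)) \<and>
     (\<forall>v. \<exists>g. continuous_on (closure \<Omega>) g \<and> (\<forall>x\<in>\<Omega>. g x = frechet_derivative f (at x) v))"

definition defining_function ::
    "'a::real_normed_vector set \<Rightarrow> 'a set \<Rightarrow> ('a \<Rightarrow> real) \<Rightarrow> bool" where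
  "defining_function \<Omega> V \<rho> \<longleftrightarrow> open V \<and>
     \<Omega> \<inter> V = {x\<in>V. \<rho> x < 0} \<and> frontier \<Omega> \<inter> V = {x\<in>V. \<rho> x = 0} \<and>
     (\<forall>x\<in>frontier \<Omega> \<inter> V. frechet_derivative \<rho> (at x) \<noteq> (\<lambda>_. 0))"

definition Ck_holder_boundary :: "nat \<Rightarrow> real \<Rightarrow> 'a::real_normed_vector set \<Rightarrow> bool" where
  "Ck_holder_boundary k \<alpha> \<Omega> \<longleftrightarrow>
     (\<forall>x\<in>frontier \<Omega>. \<exists>V \<rho>. x \<in> V \<and> defining_function \<Omega> V \<rho> \<and> Ck_holder_on k \<alpha> V \<rho>)"


section \<open>Wirtinger derivatives, (1,0)-vectors and the Levi form\<close>

definition d_z :: "'n \<Rightarrow> (complex ^ 'n::finite \<Rightarrow> complex) \<Rightarrow> complex ^ 'n \<Rightarrow> complex" where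
  "d_z j f x = (frechet_derivative f (at x) (axis j 1)
                - \<i> * frechet_derivative f (at x) (axis j \<i>)) / 2"

definition d_zbar :: "'n \<Rightarrow> (complex ^ 'n::finite \<Rightarrow> complex) \<Rightarrow> complex ^ 'n \<Rightarrow> complex" where
  "d_zbar j f x = (frechet_derivative f (at x) (axis j 1)
                   + \<i> * frechet_derivative f (at x) (axis j \<i>)) / 2"

text \<open>A (1,0)-vector \<open>\<Sum>j. a$j \<partial>/\<partial>z\<^sub>j\<close> is represented by \<open>a\<close>. The metric is
  normalized so that the \<open>\<partial>/\<partial>z\<^sub>j\<close> are orthonormal.\<close>

definition herm_inner :: "complex ^ 'n::finite \<Rightarrow> complex ^ 'n \<Rightarrow> complex" where
  "herm_inner a b = (\<Sum>j\<in>UNIV. a $ j * cnj (b $ j))"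

definition orthonormal_family :: "'i set \<Rightarrow> ('i \<Rightarrow> complex ^ 'n::finite) \<Rightarrow> bool" where
  "orthonormal_family I Z \<longleftrightarrow>
     (\<forall>i\<in>I. \<forall>j\<in>I. herm_inner (Z i) (Z j) = (if i = j then 1 else 0))"

definition vf_apply ::
    "(complex ^ 'n::finite \<Rightarrow> complex ^ 'n) \<Rightarrow> (complex ^ 'n \<Rightarrow> complex) \<Rightarrow> complex ^ 'n \<Rightarrow> complex" where
  "vf_apply L f x = (\<Sum>k\<in>UNIV. L x $ k * d_z k f x)"

text \<open>The fibre of \<open>T\<^sup>1\<^sup>,\<^sup>0(\<partial>\<Omega>)\<close> at a boundary point. Two \<open>C\<^sup>1\<close> defining functions have proportional
  differentials on the boundary, so the choice of \<open>\<rho>\<close> is immaterial.\<close>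

definition T10_boundary :: "(complex ^ 'n::finite) set \<Rightarrow> complex ^ 'n \<Rightarrow> (complex ^ 'n) set" where
  "T10_boundary \<Omega> x = {a. \<exists>V \<rho>. x \<in> V \<and> defining_function \<Omega> V \<rho> \<and> Ck_on 1 V \<rho> \<and>
      (\<Sum>j\<in>UNIV. a $ j * d_z j (\<lambda>y. complex_of_real (\<rho> y)) x) = 0}"

definition levi_form ::
    "(complex ^ 'n::finite \<Rightarrow> real) \<Rightarrow> complex ^ 'n \<Rightarrow> complex ^ 'n \<Rightarrow> complex ^ 'n \<Rightarrow> complex" where
  "levi_form \<rho> x a b =
     (\<Sum>j\<in>UNIV. \<Sum>k\<in>UNIV. a $ j * d_z j (d_zbar k (\<lambda>y. complex_of_real (\<rho> y))) x * cnj (b $ k))"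

text \<open>\<open>\<mu> 1 \<le> \<dots> \<le> \<mu> (n - 1)\<close> are the eigenvalues, with multiplicity, of the matrix of the
  Levi form in an orthonormal basis \<open>Z 0, \<dots>, Z (n - 2)\<close> of the (1,0)-tangent space.\<close>

definition levi_eigenvalues ::
    "(complex ^ 'n::finite) set \<Rightarrow> (complex ^ 'n \<Rightarrow> real) \<Rightarrow> complex ^ 'n \<Rightarrow> (nat \<Rightarrow> real) \<Rightarrow> bool" where
  "levi_eigenvalues \<Omega> \<rho> x \<mu> \<longleftrightarrow>
     (\<forall>i j. 1 \<le> i \<longrightarrow> i \<le> j \<longrightarrow> j \<le> CARD('n) - 1 \<longrightarrow> \<mu> i \<le> \<mu> j) \<and>
     (\<exists>Z. orthonormal_family {..<CARD('n) - 1} Z \<and>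
          vec.span (Z ` {..<CARD('n) - 1}) = T10_boundary \<Omega> x \<and>
          char_poly (Matrix.mat (CARD('n) - 1) (CARD('n) - 1)
                       (\<lambda>(i, j). levi_form \<rho> x (Z i) (Z j)))
            = (\<Prod>j = 1..CARD('n) - 1. [:- complex_of_real (\<mu> j), 1:]))"


section \<open>Forms, the Cauchy--Riemann operator and its adjoint\<close>

text \<open>The index type \<open>'n\<close> is linearly ordered, and an increasing multi-index is represented by the
  set of its entries. A (0,q)-form is given by its coefficients \<open>u J\<close> with \<open>J \<in> multi_idx q\<close>; other
  coefficients, and values outside the closure of the domain, are irrelevant.\<close>

type_synonym 'n form = "'n set \<Rightarrow> complex ^ 'n \<Rightarrow> complex"

definition multi_idx :: "nat \<Rightarrow> 'n::finite set set" where
  "multi_idx q = {J. card J = q}"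

text \<open>\<open>dV\<close> is Lebesgue measure. Any constant factor coming from the normalization of the metric
  would cancel in the definition of the adjoint and in the maximal estimate. Squared norms take
  values in \<^typ>\<open>ennreal\<close>, so that they are infinite rather than 0 off \<open>L\<^sup>2\<close>.\<close>

definition L2_normsq :: "(complex ^ 'n::finite) set \<Rightarrow> (complex ^ 'n \<Rightarrow> complex) \<Rightarrow> ennreal" where
  "L2_normsq \<Omega> f = (\<integral>\<^sup>+x. ennreal ((cmod (f x))\<^sup>2) \<partial>lebesgue_on \<Omega>)"

definition form_normsq :: "(complex ^ 'n::finite) set \<Rightarrow> nat \<Rightarrow> 'n form \<Rightarrow> ennreal" where
  "form_normsq \<Omega> q u = (\<Sum>J\<in>multi_idx q. L2_normsq \<Omega> (u J))"

definition form_inner :: "(complex ^ 'n::finite) set \<Rightarrow> nat \<Rightarrow> 'n form \<Rightarrow> 'n form \<Rightarrow> complex" where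
  "form_inner \<Omega> q u v = (\<Sum>J\<in>multi_idx q. LINT x|lebesgue_on \<Omega>. u J x * cnj (v J x))"

definition L2_form :: "(complex ^ 'n::finite) set \<Rightarrow> nat \<Rightarrow> 'n form \<Rightarrow> bool" where
  "L2_form \<Omega> q u \<longleftrightarrow>
     (\<forall>J\<in>multi_idx q. u J \<in> borel_measurable (lebesgue_on \<Omega>) \<and> L2_normsq \<Omega> (u J) < \<infinity>)"

definition test_function :: "(complex ^ 'n::finite) set \<Rightarrow> (complex ^ 'n \<Rightarrow> complex) \<Rightarrow> bool" where
  "test_function \<Omega> \<phi> \<longleftrightarrow> (\<forall>k. Ck_on k UNIV \<phi>) \<and>
     compact (closure {x. \<phi> x \<noteq> 0}) \<and> closure {x. \<phi> x \<noteq> 0} \<subseteq> \<Omega>"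

text \<open>The graph of the maximal extension: \<open>f\<close> is the distributional \<open>\<partial>\<close>-bar of \<open>u\<close>, both in \<open>L\<^sup>2\<close>.
  The coefficient of \<open>K\<close> in \<open>\<partial>\<close>-bar \<open>u\<close> is the sum over \<open>j \<in> K\<close> of the \<open>j\<close>-th antiholomorphic
  derivative of \<open>u (K - {j})\<close>, with the sign that moves \<open>j\<close> to its place in the increasing
  multi-index \<open>K\<close>.\<close>

definition dbar_rel ::
    "(complex ^ 'n::{finite,linorder}) set \<Rightarrow> nat \<Rightarrow> 'n form \<Rightarrow> 'n form \<Rightarrow> bool" where
  "dbar_rel \<Omega> q u f \<longleftrightarrow> L2_form \<Omega> q u \<and> L2_form \<Omega> (q + 1) f \<and>
     (\<forall>K\<in>multi_idx (q + 1). \<forall>\<phi>. test_function \<Omega> \<phi> \<longrightarrow>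
        (LINT x|lebesgue_on \<Omega>. f K x * \<phi> x) =
        - (\<Sum>j\<in>K. (-1) ^ card {i\<in>K. i < j} *
             (LINT x|lebesgue_on \<Omega>. u (K - {j}) x * d_zbar j \<phi> x)))"

definition dom_dbar :: "(complex ^ 'n::{finite,linorder}) set \<Rightarrow> nat \<Rightarrow> 'n form set" where
  "dom_dbar \<Omega> q = {u. \<exists>f. dbar_rel \<Omega> q u f}"

text \<open>\<open>dbar\<close> and \<open>dbar_star\<close> are determined by \<open>u\<close> up to null sets.\<close>

definition dbar :: "(complex ^ 'n::{finite,linorder}) set \<Rightarrow> nat \<Rightarrow> 'n form \<Rightarrow> 'n form" where
  "dbar \<Omega> q u = (SOME f. dbar_rel \<Omega> q u f)"

text \<open>The graph of the adjoint of \<open>\<partial>\<close>-bar acting on (0,q-1)-forms; only used for \<open>q \<ge> 1\<close>.\<close>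

definition dbar_star_rel ::
    "(complex ^ 'n::{finite,linorder}) set \<Rightarrow> nat \<Rightarrow> 'n form \<Rightarrow> 'n form \<Rightarrow> bool" where
  "dbar_star_rel \<Omega> q u g \<longleftrightarrow> L2_form \<Omega> q u \<and> L2_form \<Omega> (q - 1) g \<and>
     (\<forall>v f. dbar_rel \<Omega> (q - 1) v f \<longrightarrow> form_inner \<Omega> q f u = form_inner \<Omega> (q - 1) v g)"

definition dom_dbar_star :: "(complex ^ 'n::{finite,linorder}) set \<Rightarrow> nat \<Rightarrow> 'n form set" where
  "dom_dbar_star \<Omega> q = {u. \<exists>g. dbar_star_rel \<Omega> q u g}"

definition dbar_star :: "(complex ^ 'n::{finite,linorder}) set \<Rightarrow> nat \<Rightarrow> 'n form \<Rightarrow> 'n form" where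
  "dbar_star \<Omega> q u = (SOME g. dbar_star_rel \<Omega> q u g)"

definition C1_form :: "(complex ^ 'n::finite) set \<Rightarrow> nat \<Rightarrow> 'n form set" where
  "C1_form \<Omega> q = {u. \<forall>J\<in>multi_idx q. C1_closure \<Omega> (u J)}"

definition form_support :: "(complex ^ 'n::finite) set \<Rightarrow> nat \<Rightarrow> 'n form \<Rightarrow> (complex ^ 'n) set" where
  "form_support \<Omega> q u = closure {x\<in>closure \<Omega>. \<exists>J\<in>multi_idx q. u J x \<noteq> 0}"


section \<open>Maximal estimates\<close>

definition adapted_frame ::
    "(complex ^ 'n::finite) set \<Rightarrow> (complex ^ 'n) set \<Rightarrow> (nat \<Rightarrow> complex ^ 'n \<Rightarrow> complex ^ 'n) \<Rightarrow> bool" where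
  "adapted_frame \<Omega> U L \<longleftrightarrow>
     (\<forall>x\<in>U. orthonormal_family {1..CARD('n)} (\<lambda>j. L j x)) \<and>
     (\<forall>j\<in>{1..CARD('n)}. \<exists>C. C-lipschitz_on U (L j)) \<and>
     (\<forall>j\<in>{1..CARD('n) - 1}. \<forall>x\<in>frontier \<Omega> \<inter> U. L j x \<in> T10_boundary \<Omega> x)"

text \<open>For \<open>u\<close> outside \<open>dom_dbar\<close> the right-hand side is infinite, so only \<open>u\<close> in this domain matter.
  Since \<open>u\<close> is supported in \<open>U\<close>, the values of \<open>L j\<close> outside \<open>U\<close> play no role.\<close>

definition maximal_estimate ::
    "(complex ^ 'n::{finite,linorder}) set \<Rightarrow> nat \<Rightarrow> complex ^ 'n::{finite,linorder} \<Rightarrow>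
     (complex ^ 'n::{finite,linorder}) set \<Rightarrow> real \<Rightarrow> real \<Rightarrow>
     (nat \<Rightarrow> complex ^ 'n::{finite,linorder} \<Rightarrow> complex ^ 'n::{finite,linorder}) \<Rightarrow> bool" where
  "maximal_estimate \<Omega> q p U A B L \<longleftrightarrow>
     open U \<and> p \<in> U \<and> A > 0 \<and> B > 0 \<and> adapted_frame \<Omega> U L \<and>
     (\<forall>u \<in> C1_form \<Omega> q \<inter> dom_dbar \<Omega> q \<inter> dom_dbar_star \<Omega> q.
        form_support \<Omega> q u \<subseteq> closure \<Omega> \<inter> U \<longrightarrow>
        (\<Sum>j\<in>UNIV. \<Sum>J\<in>multi_idx q. L2_normsq \<Omega> (d_zbar j (u J)))
        + (\<Sum>j = 1..CARD('n) - 1. \<Sum>J\<in>multi_idx q. L2_normsq \<Omega> (vf_apply (L j) (u J)))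
        \<le> ennreal A * (form_normsq \<Omega> (q + 1) (dbar \<Omega> q u)
                        + form_normsq \<Omega> (q - 1) (dbar_star \<Omega> q u))
          + ennreal B * form_normsq \<Omega> q u)"

end

theory Submission
  imports Defs
begin

text \<open>At a boundary point \<open>x0\<close> the estimate is tested on forms \<open>f t \<cdot> om\<close>. Here \<open>f t\<close> is a cutoff of
  \<open>exp (t \<cdot> Psi)\<close>, where \<open>2 Re Psi\<close> is at most a negative multiple of the squared distance to \<open>x0\<close> in the
  domain, so that \<open>f t\<close> peaks at \<open>x0\<close>; and \<open>om\<close> is tangential and equals at \<open>x0\<close> the wedge product of the
  first \<open>q\<close> eigendirections of the Levi form. Let \<open>zc i\<close> be the coordinate in the eigendirection with
  eigenvalue \<open>lam i\<close>. The phase involves weights \<open>c i\<close>, subject only to \<open>lam i + 2 c i > 0\<close>, such that to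
  leading order the derivatives of \<open>f t\<close> along this direction are \<open>-t (c i) (zc i) (f t)\<close>
  (antiholomorphic) and \<open>-t (lam i + c i) (cnj (zc i)) (f t)\<close> (holomorphic). Integrating by parts along
  fields tangent to the boundary, the mean of the square of \<open>|zc i|\<close> with respect to the square of
  \<open>|f t|\<close> is asymptotic to \<open>1 / (t (lam i + 2 c i))\<close>. As \<open>t\<close> tends to infinity the maximal estimate becomes
  an inequality between weighted sums of the squares of \<open>c i\<close> and \<open>lam i + c i\<close>, and
  \<open>c i = max 0 (- lam i)\<close>, perturbed where \<open>lam i = 0\<close>, gives the claim.\<close>

section \<open>Functions of class C1\<close>

text \<open>Why exactly this inequality comes out: a form peaked in this way has, in direction
  \<open>i\<close>, energy \<open>(c i)^2 / kp i\<close> from antiholomorphic and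
  \<open>(lam i + c i)^2 / kp i\<close> from holomorphic derivatives, where
  \<open>kp i = lam i + 2 * c i\<close>. The left side of the estimate contains both for every
  \<open>i\<close>. On the right, dbar acts to leading order as a wedge product, which annihilates
  the first \<open>q\<close> directions, and its adjoint as a contraction, which sees only those.
  The term with \<open>B\<close> is of lower order in \<open>t\<close>. Two obstacles shape the
  rest. Flattening the boundary would destroy the complex structure, and the mass near
  \<open>x0\<close> is not computable; so every integral is only compared with
  \<open>mass t\<close>, through divergences of fields tangent to the boundary, and neither surface
  integrals nor Gaussian integrals occur. Moreover \<open>A\<close> has to survive without loss:
  errors carry a factor \<open>s\<close>, the size of the neighbourhood, with constants independent
  of \<open>s\<close>. The limit in \<open>t\<close> is taken for fixed \<open>s\<close>, before
  \<open>s\<close> and finally the perturbation of the weights tend to 0.\<close>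

abbreviation fderiv where "fderiv f x \<equiv> frechet_derivative f (at x)"

lemma Ck_on_1I:
  assumes "\<And>x. x \<in> S ==> (f has_derivative f' x) (at x)" and "\<And>v. continuous_on S (\<lambda>x. f' x v)"
  shows "Ck_on 1 S f"
proof -
  have "continuous_on S (\<lambda>x. fderiv f x v)" for v
    using assms(2)[of v]
    by (rule continuous_on_eq) (metis assms(1) frechet_derivative_at)
  thus ?thesis using assms(1) by (auto simp: differentiable_def)
qed

lemma Ck_on_1D:
  assumes "Ck_on 1 S f"
  shows "x \<in> S ==> (f has_derivative fderiv f x) (at x)"
    and "continuous_on S (\<lambda>x. fderiv f x v)" and "continuous_on S f"
proof -
  have *: "f differentiable (at x)" if "x \<in> S" for x using assms that by auto
  show "x \<in> S ==> (f has_derivative fderiv f x) (at x)"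
    using * frechet_derivative_works by blast
  show "continuous_on S (\<lambda>x. fderiv f x v)" using assms by simp
  show "continuous_on S f"
    by (meson "*" continuous_at_imp_continuous_on differentiable_imp_continuous_within)
qed

lemma Ck_on_1_subset: "Ck_on 1 S f ==> T \<subseteq> S ==> Ck_on 1 T f"
  by (auto intro: continuous_on_subset)

lemma Ck_on_1_const: "Ck_on 1 S (\<lambda>x. c)"
  by (rule Ck_on_1I[where f'="\<lambda>x v. 0"]) auto

lemma Ck_on_1_linear: "bounded_linear f ==> Ck_on 1 S f"
  by (rule Ck_on_1I[where f'="\<lambda>x. f"]) (auto intro: bounded_linear_imp_has_derivative)

lemma Ck_on_1_compose_linear:
  assumes "bounded_linear g" "Ck_on 1 S f" shows "Ck_on 1 S (\<lambda>x. g (f x))"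
proof (rule Ck_on_1I)
  show "((\<lambda>x. g (f x)) has_derivative (\<lambda>v. g (fderiv f x v))) (at x)" if "x \<in> S" for x
    using bounded_linear.has_derivative[OF assms(1) Ck_on_1D(1)[OF assms(2) that]] .
  show "continuous_on S (\<lambda>x. g (fderiv f x v))" for v
    using bounded_linear.continuous_on[OF assms(1) Ck_on_1D(2)[OF assms(2)]] .
qed

lemma Ck_on_1_add:
  assumes "Ck_on 1 S f" "Ck_on 1 S g" shows "Ck_on 1 S (\<lambda>x. f x + g x)"
  using Ck_on_1D[OF assms(1)] Ck_on_1D[OF assms(2)]
  by (intro Ck_on_1I[where f'="\<lambda>x v. fderiv f x v + fderiv g x v"])
     (auto intro!: derivative_intros continuous_intros)

lemma Ck_on_1_sum:
  "(\<And>i. i \<in> I ==> Ck_on 1 S (f i)) ==> Ck_on 1 S (\<lambda>x. \<Sum>i\<in>I. f i x)"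
proof (induction I rule: infinite_finite_induct)
  case (insert i I)
  hence "Ck_on 1 S (\<lambda>x. f i x + (\<Sum>i\<in>I. f i x))" by (intro Ck_on_1_add) auto
  thus ?case using insert by simp
qed (auto intro: Ck_on_1_const simp del: One_nat_def)

lemma Ck_on_1_mult:
  fixes f g :: "'a::real_normed_vector => 'b::real_normed_algebra"
  assumes "Ck_on 1 S f" "Ck_on 1 S g" shows "Ck_on 1 S (\<lambda>x. f x * g x)"
  using Ck_on_1D[OF assms(1)] Ck_on_1D[OF assms(2)]
  by (intro Ck_on_1I[where f'="\<lambda>x v. f x * fderiv g x v + fderiv f x v * g x"])
     (auto intro!: derivative_intros continuous_intros)

lemma Ck_on_1_minus: "Ck_on 1 S f ==> Ck_on 1 S (\<lambda>x. - f x)"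
  using Ck_on_1_compose_linear[OF bounded_linear_minus[OF bounded_linear_ident]] .

lemma Ck_on_1_diff: "Ck_on 1 S f ==> Ck_on 1 S g ==> Ck_on 1 S (\<lambda>x. f x - g x)"
  using Ck_on_1_add[OF _ Ck_on_1_minus, of S f g] by (simp del: One_nat_def)

lemma Ck_on_1_of_real: "Ck_on 1 S f ==> Ck_on 1 S (\<lambda>x. complex_of_real (f x))"
  using Ck_on_1_compose_linear[OF bounded_linear_of_real] .

lemma Ck_on_1_cnj: "Ck_on 1 S f ==> Ck_on 1 S (\<lambda>x. cnj (f x))"
  using Ck_on_1_compose_linear[OF bounded_linear_cnj] .

lemma Ck_on_1_Re: "Ck_on 1 S f ==> Ck_on 1 S (\<lambda>x. Re (f x))"
  using Ck_on_1_compose_linear[OF bounded_linear_Re] .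

lemma Ck_on_1_compose_DERIV:
  fixes g :: "'b::real_normed_field => 'b"
  assumes f: "Ck_on 1 S f" and g: "\<And>y. y \<in> T ==> (g has_field_derivative g' y) (at y)"
    and c: "continuous_on T g'" and im: "f ` S \<subseteq> T"
  shows "Ck_on 1 S (\<lambda>x. g (f x))"
proof (rule Ck_on_1I)
  show "((\<lambda>x. g (f x)) has_derivative (\<lambda>v. g' (f x) * fderiv f x v)) (at x)" if "x \<in> S" for x
    using has_derivative_compose[OF Ck_on_1D(1)[OF f that], of g] g im that
    unfolding has_field_derivative_def by auto
  show "continuous_on S (\<lambda>x. g' (f x) * fderiv f x v)" for v
    using Ck_on_1D(2,3)[OF f] c im
    by (intro continuous_intros continuous_on_compose2[OF c]) auto
qed

lemma Ck_on_1_exp: "Ck_on 1 S f ==> Ck_on 1 S (\<lambda>x. exp (f x :: complex))"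
  by (rule Ck_on_1_compose_DERIV[where T=UNIV and g'=exp]) (auto intro!: derivative_eq_intros continuous_intros)

lemma Ck_on_1_inverse:
  fixes f :: "'a::real_normed_vector => complex"
  assumes "Ck_on 1 S f" "\<And>x. x \<in> S ==> f x \<noteq> 0" shows "Ck_on 1 S (\<lambda>x. inverse (f x))"
proof (rule Ck_on_1_compose_DERIV[OF assms(1), where T="- {0}" and g'="\<lambda>y. - inverse (y ^ Suc (Suc 0))"])
  show "(inverse has_field_derivative - inverse (y ^ Suc (Suc 0))) (at y)" if "y \<in> - {0}" for y :: complex
    using DERIV_inverse[of y UNIV] that by simp
qed (use assms(2) in \<open>auto intro!: continuous_intros\<close>)

lemmas Ck_on_1_intros = Ck_on_1_const Ck_on_1_add Ck_on_1_sum Ck_on_1_mult Ck_on_1_minus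
  Ck_on_1_diff Ck_on_1_of_real Ck_on_1_cnj Ck_on_1_Re Ck_on_1_exp Ck_on_1_inverse

lemma Ck_on_1_cong:
  assumes "open S" "Ck_on 1 S f" "\<And>x. x \<in> S ==> f x = g x"
  shows "Ck_on 1 S g"
proof (rule Ck_on_1I)
  show "(g has_derivative fderiv f x) (at x)" if "x \<in> S" for x
    using has_derivative_transform_within_open[OF Ck_on_1D(1)[OF assms(2) that] assms(1) that] assms(3) .
qed (rule Ck_on_1D(2)[OF assms(2)])

lemma Ck_on_1_Un:
  assumes "open S" "open T" "Ck_on 1 S f" "Ck_on 1 T f" shows "Ck_on 1 (S \<union> T) f"
  using assms by (auto intro: continuous_on_open_Un)

definition C1_compact :: "('a::euclidean_space => 'b::real_normed_vector) => bool" where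
  "C1_compact h \<longleftrightarrow> Ck_on 1 UNIV h \<and> bounded {x. h x \<noteq> 0}"

text \<open>Conormals and vector fields exist only near a boundary point. Times a cutoff they become
  global C1 functions, because \<open>V\<close> and the complement of \<open>K\<close> are open and
  cover the space.\<close>

lemma C1_compactI:
  assumes "open V" "Ck_on 1 V f" "compact K" "K \<subseteq> V" "\<And>x. x \<notin> K ==> f x = 0"
  shows "C1_compact f"
proof -
  have "Ck_on 1 (- K) f"
    by (rule Ck_on_1_cong[where f="\<lambda>x. 0"])
       (use assms in \<open>auto simp: compact_imp_closed intro: Ck_on_1_const simp del: One_nat_def\<close>)
  hence "Ck_on 1 (V \<union> - K) f"
    by (intro Ck_on_1_Un assms) (use assms in \<open>auto simp: compact_imp_closed\<close>)
  moreover have "V \<union> - K = UNIV" using assms by auto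
  moreover have "bounded {x. f x \<noteq> 0}"
    by (rule bounded_subset[OF compact_imp_bounded[OF assms(3)]]) (use assms in auto)
  ultimately show ?thesis by (simp add: C1_compact_def del: One_nat_def)
qed

lemma frechet_derivative_eq_0_outside:
  assumes "closed K" "\<And>x. x \<notin> K ==> f x = 0" "x \<notin> K"
  shows "fderiv f x = (\<lambda>v. 0)"
proof -
  have "(f has_derivative (\<lambda>v. 0)) (at x)"
    by (rule has_derivative_transform_within_open[where f="\<lambda>x. 0" and s="- K"]) (use assms in auto)
  thus ?thesis by (metis frechet_derivative_at)
qed

lemma C1_compact_support:
  assumes "C1_compact h"
  obtains K where "compact K" "\<And>x. x \<notin> K ==> h x = 0" "\<And>x v. x \<notin> K ==> fderiv h x v = 0"
proof
  let ?K = "closure {x. h x \<noteq> 0}"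
  show "compact ?K" using assms by (simp add: C1_compact_def compact_closure)
  show *: "h x = 0" if "x \<notin> ?K" for x using that closure_subset[of "{x. h x \<noteq> 0}"] by blast
  show "fderiv h x v = 0" if "x \<notin> ?K" for x v
    by (rule fun_cong[OF frechet_derivative_eq_0_outside[OF closed_closure * that]])
qed

section \<open>Integration by parts\<close>

lemma continuous_on_compact_bounded:
  fixes h :: "'a::topological_space => 'b::real_normed_vector"
  assumes "continuous_on S h" "compact K" "K \<subseteq> S"
  shows "\<exists>B\<ge>0. \<forall>x\<in>K. norm (h x) \<le> B"
  using compact_imp_bounded[OF compact_continuous_image[OF continuous_on_subset[OF assms(1,3)] assms(2)]]
  by (auto simp: bounded_pos intro: less_imp_le)

lemma continuous_compact_bounded:
  fixes h :: "'a::euclidean_space => 'b::real_normed_vector"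
  assumes "continuous_on UNIV h" "compact K" "\<And>x. x \<notin> K ==> h x = 0"
  obtains B where "B > 0" "\<And>x. norm (h x) \<le> B"
proof -
  have "bounded (h ` K)"
    by (intro compact_imp_bounded compact_continuous_image continuous_on_subset[OF assms(1)] assms) auto
  then obtain B where "B > 0" "\<forall>x\<in>h ` K. norm x \<le> B" by (auto simp: bounded_pos)
  moreover have "norm (h x) \<le> B" for x
    using calculation assms(3)[of x] by (cases "x \<in> K") auto
  ultimately show ?thesis by (intro that)
qed

lemma integrable_continuous_compact:
  fixes h :: "'a::euclidean_space => 'b::{banach, second_countable_topology}"
  assumes "continuous_on UNIV h" "compact K" "\<And>x. x \<notin> K ==> h x = 0"
  shows "integrable lborel h"
proof -
  have "integrable lborel (\<lambda>x. indicator K x *\<^sub>R h x)"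
    by (intro borel_integrable_compact assms continuous_on_subset[OF assms(1)]) auto
  moreover have "(\<lambda>x. indicator K x *\<^sub>R h x) = h" using assms(3) by (auto simp: indicator_def)
  ultimately show ?thesis by simp
qed

lemma integral_lborel_translate:
  fixes h :: "'a::euclidean_space => 'b::{banach, second_countable_topology}"
  assumes "h \<in> borel_measurable borel"
  shows "(LINT x|lborel. h (c + x)) = (LINT x|lborel. h x)"
  using integral_distr[of "(+) c" lborel borel h] assms by (simp add: lborel_distr_plus)

lemma has_derivative_difference_quotient:
  assumes "(h has_derivative h') (at x)"
  shows "((\<lambda>t. (1 / t) *\<^sub>R (h (x + t *\<^sub>R v) - h x)) \<longlongrightarrow> h' v) (at (0::real))"
proof -
  interpret bounded_linear h' using assms by (rule has_derivative_bounded_linear)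
  have "((\<lambda>t. x + t *\<^sub>R v) has_derivative (\<lambda>t. t *\<^sub>R v)) (at 0)"
    by (auto intro!: derivative_eq_intros)
  hence "((\<lambda>t. h (x + t *\<^sub>R v)) has_derivative (\<lambda>t. h' (t *\<^sub>R v))) (at 0)"
    by (rule has_derivative_compose) (use assms in simp)
  hence "((\<lambda>t. norm (h (x + t *\<^sub>R v) - h x - h' (t *\<^sub>R v)) / \<bar>t\<bar>) \<longlongrightarrow> 0) (at 0)"
    by (simp add: has_derivative_iff_norm)
  moreover have "\<forall>\<^sub>F t in at 0. norm (h (x + t *\<^sub>R v) - h x - h' (t *\<^sub>R v)) / \<bar>t\<bar>
      = norm ((1 / t) *\<^sub>R (h (x + t *\<^sub>R v) - h x) - h' v)"
  proof (rule eventually_at_filter[THEN iffD2, OF always_eventually], intro allI impI)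
    fix t :: real assume t: "t \<noteq> 0"
    have "h (x + t *\<^sub>R v) - h x - h' (t *\<^sub>R v) = t *\<^sub>R ((1 / t) *\<^sub>R (h (x + t *\<^sub>R v) - h x) - h' v)"
      using t by (simp add: scaleR algebra_simps)
    thus "norm (h (x + t *\<^sub>R v) - h x - h' (t *\<^sub>R v)) / \<bar>t\<bar>
      = norm ((1 / t) *\<^sub>R (h (x + t *\<^sub>R v) - h x) - h' v)" using t by simp
  qed
  ultimately have "((\<lambda>t. norm ((1 / t) *\<^sub>R (h (x + t *\<^sub>R v) - h x) - h' v)) \<longlongrightarrow> 0) (at 0)"
    by (rule Lim_transform_eventually)
  thus ?thesis by (simp add: tendsto_norm_zero_iff LIM_zero_iff)
qed

text \<open>The integral of a difference quotient vanishes by translation invariance.\<close>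

lemma integral_frechet_derivative_eq_0:
  fixes h :: "'a::euclidean_space => 'b::{banach, second_countable_topology}"
  assumes "C1_compact h"
  shows "(LINT x|lborel. fderiv h x v) = 0"
proof -
  have C1: "Ck_on 1 UNIV h" using assms by (simp add: C1_compact_def)
  obtain K where K: "compact K" "\<And>x. x \<notin> K ==> h x = 0" "\<And>x v. x \<notin> K ==> fderiv h x v = 0"
    using C1_compact_support[OF assms] by metis
  obtain B where B: "B > 0" "\<And>x. norm (fderiv h x v) \<le> B"
    using continuous_compact_bounded[OF Ck_on_1D(2)[OF C1, of v] K(1) K(3)[where v=v]] by blast
  \<comment> \<open>The mean value inequality along the segment bounds every difference quotient by
    \<open>B\<close>; this is the height of the majorant for dominated convergence.\<close>
  have bound: "norm (h (x + t *\<^sub>R v) - h x) \<le> B * t" if "t \<ge> 0" for x t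
  proof -
    have "norm (h (x + t *\<^sub>R v) - h (x + 0 *\<^sub>R v)) \<le> B * norm (t - 0)"
    proof (rule differentiable_bound[where S="{0..t}" and f'="\<lambda>s r. r *\<^sub>R fderiv h (x + s *\<^sub>R v) v"])
      show "((\<lambda>s. h (x + s *\<^sub>R v)) has_derivative (\<lambda>r. r *\<^sub>R fderiv h (x + s *\<^sub>R v) v)) (at s within {0..t})" for s
      proof -
        note hd = Ck_on_1D(1)[OF C1, of "x + s *\<^sub>R v", simplified]
        interpret bounded_linear "fderiv h (x + s *\<^sub>R v)"
          using hd by (rule has_derivative_bounded_linear)
        have "((\<lambda>s. h (x + s *\<^sub>R v)) has_derivative (\<lambda>r. fderiv h (x + s *\<^sub>R v) (r *\<^sub>R v))) (at s)"
          by (rule has_derivative_compose[where f="\<lambda>s. x + s *\<^sub>R v", OF _ hd]) (auto intro!: derivative_eq_intros)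
        thus ?thesis by (simp add: scaleR has_derivative_at_withinI)
      qed
      show "onorm (\<lambda>r. r *\<^sub>R fderiv h (x + s *\<^sub>R v) v) \<le> B" for s
        by (rule onorm_le) (simp add: mult.commute[of B] mult_left_mono B(2))
    qed (use that in auto)
    thus ?thesis using that by simp
  qed
  define g where "g k x = real (Suc k) *\<^sub>R (h (x + (1 / real (Suc k)) *\<^sub>R v) - h x)" for k x
  obtain r where r: "\<And>x. x \<in> K ==> norm x \<le> r" using K(1) compact_imp_bounded bounded_iff by metis
  \<comment> \<open>The shifts \<open>v / (k + 1)\<close> are no longer than \<open>norm v\<close>,
    so this ball contains the supports of all the difference quotients at once.\<close>
  let ?K = "cball 0 (r + norm v) :: 'a set"
  have cont: "continuous_on UNIV h" using Ck_on_1D(3)[OF C1] .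
  hence hm: "h \<in> borel_measurable borel" by (rule borel_measurable_continuous_onI)
  have hi: "integrable lborel h" by (rule integrable_continuous_compact[OF cont K(1,2)])
  have hs: "integrable lborel (\<lambda>x. h (x + c))" for c
    using integrable_distr[of "(+) c" lborel borel h] hi by (simp add: lborel_distr_plus add.commute)
  have "(\<lambda>k. LINT x|lborel. g k x) \<longlonglongrightarrow> (LINT x|lborel. fderiv h x v)"
  proof (rule integral_dominated_convergence[where w="\<lambda>x. B * indicator ?K x"])
    show "(\<lambda>x. fderiv h x v) \<in> borel_measurable lborel"
      using borel_measurable_continuous_onI[OF Ck_on_1D(2)[OF C1, of v]] by simp
    show "g k \<in> borel_measurable lborel" for k
      unfolding g_def using hs hi by (intro borel_measurable_scaleR borel_measurable_diff) auto
    show "integrable lborel (\<lambda>x. B * indicator ?K x)"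
      by (auto intro!: integrable_mult_right integrable_real_indicator emeasure_compact_finite)
    show "AE x in lborel. (\<lambda>k. g k x) \<longlonglongrightarrow> fderiv h x v"
    proof (rule AE_I2)
      fix x
      have *: "filterlim (\<lambda>k. 1 / real (Suc k)) (at 0) sequentially"
        using LIMSEQ_Suc[OF lim_1_over_n[where 'a=real]] by (auto simp: filterlim_at simp del: of_nat_Suc)
      have "((\<lambda>t. (1 / t) *\<^sub>R (h (x + t *\<^sub>R v) - h x)) \<longlongrightarrow> fderiv h x v) (at (0::real))"
        by (rule has_derivative_difference_quotient[OF Ck_on_1D(1)[OF C1]]) simp
      from filterlim_compose[OF this *] show "(\<lambda>k. g k x) \<longlonglongrightarrow> fderiv h x v"
        by (simp add: g_def)
    qed
    show "AE x in lborel. norm (g k x) \<le> B * indicator ?K x" for k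
    proof (rule AE_I2)
      fix x
      show "norm (g k x) \<le> B * indicator ?K x"
      proof (cases "x \<in> ?K")
        case True
        have "norm (g k x) = real (Suc k) * norm (h (x + (1 / real (Suc k)) *\<^sub>R v) - h x)" by (simp add: g_def)
        also have "\<dots> \<le> real (Suc k) * (B * (1 / real (Suc k)))" by (intro mult_left_mono bound) auto
        also have "\<dots> = B" by simp
        finally show ?thesis using True by simp
      next
        case False
        hence n: "norm x > r + norm v" by simp
        have "norm x - norm v \<le> norm x - norm ((1 / real (Suc k)) *\<^sub>R v)"
          using divide_left_mono[of 1 "real (Suc k)" "norm v"] by simp
        also have "\<dots> \<le> norm (x + (1 / real (Suc k)) *\<^sub>R v)" by (rule norm_diff_ineq)
        finally have "x + (1 / real (Suc k)) *\<^sub>R v \<notin> K" using r n by fastforce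
        moreover have "x \<notin> K" using r[of x] n norm_ge_zero[of v] by linarith
        ultimately have "g k x = 0" by (simp add: g_def K(2))
        thus ?thesis using B(1) by simp
      qed
    qed
  qed
  moreover have "(LINT x|lborel. g k x) = 0" for k
  proof -
    define c where "c = (1 / real (Suc k)) *\<^sub>R v"
    have "(LINT x|lborel. h (x + c)) = (LINT x|lborel. h x)"
      using integral_lborel_translate[OF hm, of c] by (simp only: add.commute)
    hence "(LINT x|lborel. h (x + c) - h x) = 0"
      using Bochner_Integration.integral_diff[OF hs hi, of c] by simp
    thus ?thesis unfolding g_def c_def[symmetric] by simp
  qed
  ultimately show ?thesis by (simp add: LIMSEQ_const_iff)
qed

lemma integral_by_parts_frechet_derivative:
  fixes h g :: "'a::euclidean_space => complex"
  assumes "C1_compact h" "Ck_on 1 UNIV g"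
  shows "(LINT x|lborel. fderiv h x v * g x) = - (LINT x|lborel. h x * fderiv g x v)"
proof -
  obtain K where K: "compact K" "\<And>x. x \<notin> K ==> h x = 0" "\<And>x v. x \<notin> K ==> fderiv h x v = 0"
    using C1_compact_support[OF assms(1)] by metis
  have C1: "Ck_on 1 UNIV h" using assms by (simp add: C1_compact_def)
  have "C1_compact (\<lambda>x. h x * g x)"
    by (rule C1_compactI[OF open_UNIV Ck_on_1_mult[OF C1 assms(2)] K(1)]) (simp_all add: K(2))
  hence "(LINT x|lborel. fderiv (\<lambda>x. h x * g x) x v) = 0"
    by (rule integral_frechet_derivative_eq_0)
  moreover have "fderiv (\<lambda>x. h x * g x) x v = h x * fderiv g x v + fderiv h x v * g x" for x
    by (rule fun_cong[OF frechet_derivative_at[OF has_derivative_mult[OF Ck_on_1D(1)[OF C1 UNIV_I] Ck_on_1D(1)[OF assms(2) UNIV_I]], symmetric]])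
  moreover have "integrable lborel (\<lambda>x. h x * fderiv g x v)"
    by (rule integrable_continuous_compact[where K=K])
       (use K Ck_on_1D[OF C1] Ck_on_1D[OF assms(2)] in \<open>auto intro!: continuous_intros\<close>)
  moreover have "integrable lborel (\<lambda>x. fderiv h x v * g x)"
    by (rule integrable_continuous_compact[where K=K])
       (use K Ck_on_1D[OF C1] Ck_on_1D[OF assms(2)] in \<open>auto intro!: continuous_intros\<close>)
  ultimately show ?thesis by (simp add: eq_neg_iff_add_eq_0 add.commute)
qed

section \<open>Mollification by test functions\<close>

text \<open>The factor \<open>1 / s ^ m\<close> closes the family under differentiation; the
  standard bump is the case \<open>m = 0\<close>.\<close>

definition bump_profile :: "nat => real => real" where
  "bump_profile m s = (if 0 < s then exp (- 1 / s) / s ^ m else 0)"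

lemma bump_profile_tendsto_0: "(bump_profile m \<longlongrightarrow> 0) (at 0)"
proof (rule filterlim_split_at)
  show "(bump_profile m \<longlongrightarrow> 0) (at_left 0)"
    by (rule Lim_transform_eventually[where f="\<lambda>_. 0"])
       (auto simp: bump_profile_def eventually_at_filter)
  have "((\<lambda>s::real. (inverse s) ^ m / exp (inverse s)) \<longlongrightarrow> 0) (at_right 0)"
    by (rule filterlim_compose[OF tendsto_power_div_exp_0 filterlim_inverse_at_top_right])
  thus "(bump_profile m \<longlongrightarrow> 0) (at_right 0)"
    by (rule Lim_transform_eventually)
       (auto simp: bump_profile_def eventually_at_filter exp_minus field_simps)
qed

text \<open>Only \<open>s = 0\<close> is delicate: there the difference quotient of
  \<open>bump_profile m\<close> is literally \<open>bump_profile (m + 1)\<close>, which tends to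
  0.\<close>

lemma bump_profile_deriv:
  "(bump_profile m has_real_derivative (bump_profile (m + 2) s - real m * bump_profile (m + 1) s)) (at s)"
proof -
  consider "s > 0" | "s < 0" | "s = 0" by linarith
  thus ?thesis
  proof cases
    case 1
    have "((\<lambda>s. exp (- 1 / s) / s ^ m) has_real_derivative
        (bump_profile (m + 2) s - real m * bump_profile (m + 1) s)) (at s)"
    proof (cases m)
      case 0
      thus ?thesis using 1
        by (auto intro!: derivative_eq_intros simp: bump_profile_def power2_eq_square field_simps)
    next
      case (Suc k)
      have e: "((\<lambda>s. exp (- 1 / s)) has_real_derivative exp (- 1 / s) * (1 / s^2)) (at s)"
        using 1 by (auto intro!: derivative_eq_intros simp: power2_eq_square)
      have p: "((\<lambda>s. s ^ Suc k) has_real_derivative (real (Suc k) * s ^ k)) (at s)"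
        using DERIV_pow[of "Suc k" s UNIV] by simp
      have "(exp (- 1 / s) * (1 / s^2) * s ^ Suc k - exp (- 1 / s) * (real (Suc k) * s ^ k)) / (s ^ Suc k * s ^ Suc k)
          = bump_profile (Suc k + 2) s - real (Suc k) * bump_profile (Suc k + 1) s"
        using 1 by (simp add: bump_profile_def field_simps power2_eq_square del: of_nat_Suc)
      with DERIV_divide[OF e p] 1 show ?thesis unfolding Suc by simp
    qed
    thus ?thesis
      by (rule has_field_derivative_transform_within_open[OF _ open_greaterThan[of 0]]) (use 1 in \<open>auto simp: bump_profile_def\<close>)
  next
    case 2
    hence "bump_profile (m + 2) s - real m * bump_profile (m + 1) s = 0" by (simp add: bump_profile_def)
    moreover have "(bump_profile m has_real_derivative 0) (at s)"
      by (rule has_field_derivative_transform_within_open[OF DERIV_const[of 0] open_lessThan[of 0]]) (use 2 in \<open>auto simp: bump_profile_def\<close>)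
    ultimately show ?thesis by simp
  next
    case 3
    have "(\<lambda>y. (bump_profile m y - bump_profile m 0) / (y - 0)) = bump_profile (m + 1)"
      by (auto simp: bump_profile_def fun_eq_iff)
    hence "(bump_profile m has_real_derivative 0) (at 0)"
      unfolding has_field_derivative_iff using bump_profile_tendsto_0[of "m + 1"] by simp
    thus ?thesis using 3 by (simp add: bump_profile_def)
  qed
qed

text \<open>An algebraic closure of the radial profiles that contains its own directional
  derivatives: differentiating \<open>1 - inner x x\<close> produces only linear factors. Smoothness
  of all orders thereby reduces to a single closure property.\<close>

inductive_set bumps :: "('a::euclidean_space => real) set" where
  base: "(\<lambda>x. bump_profile m (1 - inner x x)) \<in> bumps"
| add: "f \<in> bumps ==> g \<in> bumps ==> (\<lambda>x. f x + g x) \<in> bumps"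
| scale: "f \<in> bumps ==> (\<lambda>x. c * f x) \<in> bumps"
| linear: "f \<in> bumps ==> (\<lambda>x. inner x w * f x) \<in> bumps"

lemma bumps_deriv:
  "\<psi> \<in> bumps ==> \<exists>\<psi>'. (\<forall>x. (\<psi> has_derivative (\<lambda>v. \<psi>' v x)) (at x)) \<and> (\<forall>v. \<psi>' v \<in> bumps)"
proof (induction rule: bumps.induct)
  case (base m)
  let ?d = "\<lambda>s. bump_profile (m + 2) s - real m * bump_profile (m + 1) s"
  let ?p = "\<lambda>v x. inner x v * ((- 2) * bump_profile (m + 2) (1 - inner x x) + (2 * real m) * bump_profile (m + 1) (1 - inner x x))"
  have A: "((\<lambda>x. bump_profile m (1 - inner x x)) has_derivative (\<lambda>v. ?p v x)) (at x)" for x :: 'a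
  proof -
    have "((\<lambda>x. 1 - inner x x) has_derivative (\<lambda>v. - 2 * inner x v)) (at x)"
      by (auto intro!: derivative_eq_intros simp: inner_commute)
    hence "((\<lambda>x. bump_profile m (1 - inner x x)) has_derivative (\<lambda>v. ?d (1 - inner x x) * (- 2 * inner x v))) (at x)"
      using has_derivative_compose[OF _ bump_profile_deriv[unfolded has_field_derivative_def]] by blast
    thus ?thesis by (rule has_derivative_eq_rhs) (auto simp: algebra_simps)
  qed
  have B: "?p v \<in> bumps" for v by (intro bumps.intros)
  show ?case by (rule exI[of _ ?p]) (intro conjI allI A B)
next
  case (add f g)
  then obtain f' g' where *: "\<And>x. (f has_derivative (\<lambda>v. f' v x)) (at x)" "\<And>v. f' v \<in> bumps"
    "\<And>x. (g has_derivative (\<lambda>v. g' v x)) (at x)" "\<And>v. g' v \<in> bumps" by blast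
  show ?case
    by (rule exI[of _ "\<lambda>v x. f' v x + g' v x"]) (intro conjI allI derivative_intros bumps.intros *)
next
  case (scale f c)
  then obtain f' where *: "\<And>x. (f has_derivative (\<lambda>v. f' v x)) (at x)" "\<And>v. f' v \<in> bumps" by blast
  show ?case
    by (rule exI[of _ "\<lambda>v x. c * f' v x"]) (intro conjI allI derivative_intros bumps.intros *)
next
  case (linear f w)
  then obtain f' where *: "\<And>x. (f has_derivative (\<lambda>v. f' v x)) (at x)" "\<And>v. f' v \<in> bumps" by blast
  have A: "((\<lambda>x. inner x w * f x) has_derivative (\<lambda>v. inner v w * f x + inner x w * f' v x)) (at x)" for x
    by (rule has_derivative_eq_rhs[OF has_derivative_mult[OF has_derivative_inner_left[OF has_derivative_ident] *(1)]])
       (simp add: fun_eq_iff)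
  have B: "(\<lambda>x. inner v w * f x + inner x w * f' v x) \<in> bumps" for v
    by (rule bumps.add[OF bumps.scale[OF linear(1)] bumps.linear[OF *(2)]])
  show ?case
    using A B by (intro exI[of _ "\<lambda>v x. inner v w * f x + inner x w * f' v x"]) blast
qed

lemma bumps_continuous: "\<psi> \<in> bumps ==> continuous_on UNIV \<psi>"
  by (drule bumps_deriv, elim exE conjE)
     (intro continuous_at_imp_continuous_on ballI has_derivative_continuous, erule spec)

lemma bumps_support: "\<psi> \<in> bumps ==> norm x \<ge> 1 ==> \<psi> x = 0"
proof (induction rule: bumps.induct)
  case (base m)
  hence "inner x x \<ge> 1" unfolding dot_square_norm by (simp add: power2_nonneg_ge_1_iff)
  thus ?case by (simp add: bump_profile_def)
qed auto

text \<open>The integral runs over a fixed box, so that continuity of the integrand suffices for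
  differentiation under the integral sign. For a compactly supported \<open>g\<close> it is an
  ordinary convolution with a rescaled bump.\<close>

definition box_convolution :: "'a::euclidean_space => 'a => real => ('a => complex) => ('a => real) => 'a => complex" where
  "box_convolution a b c g \<psi> x = integral (cbox a b) (\<lambda>y. g y * of_real (\<psi> (c *\<^sub>R (x - y))))"

lemma box_convolution_deriv:
  fixes g :: "'a::euclidean_space => complex"
  assumes g: "continuous_on UNIV g" and d: "\<And>x. (\<psi> has_derivative (\<lambda>v. \<psi>' v x)) (at x)"
    and b: "\<And>v. \<psi>' v \<in> bumps" "\<psi> \<in> bumps"
  shows "(box_convolution a b c g \<psi> has_derivative (\<lambda>v. box_convolution a b c g (\<lambda>z. c * \<psi>' v z) x)) (at x)"
proof -
  \<comment> \<open>The rule for parameter integrals takes the derivative as a continuous family of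
    bounded linear maps; its continuity is checked on basis vectors.\<close>
  define F where "F x y = Blinfun (\<lambda>v. g y * of_real (c * \<psi>' v (c *\<^sub>R (x - y))))" for x y
  have hd: "((\<lambda>x. g y * of_real (\<psi> (c *\<^sub>R (x - y)))) has_derivative (\<lambda>v. g y * of_real (c * \<psi>' v (c *\<^sub>R (x - y))))) (at x)" for x y
  proof -
    have 1: "((\<lambda>x. c *\<^sub>R (x - y)) has_derivative (\<lambda>v. c *\<^sub>R v)) (at x)"
      by (auto intro!: derivative_eq_intros)
    have "linear (\<lambda>v. \<psi>' v z)" for z using d[of z] by (rule has_derivative_linear)
    hence 2: "\<psi>' (c *\<^sub>R v) z = c * \<psi>' v z" for v z using linear_scale[of "\<lambda>v. \<psi>' v z" c v] by simp
    have "((\<lambda>x. \<psi> (c *\<^sub>R (x - y))) has_derivative (\<lambda>v. c * \<psi>' v (c *\<^sub>R (x - y)))) (at x)"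
      using has_derivative_compose[OF 1 d] by (simp add: 2)
    thus ?thesis by (intro has_derivative_mult_right has_derivative_of_real)
  qed
  have F: "blinfun_apply (F x y) = (\<lambda>v. g y * of_real (c * \<psi>' v (c *\<^sub>R (x - y))))" for x y
    unfolding F_def by (rule bounded_linear_Blinfun_apply[OF has_derivative_bounded_linear[OF hd]])
  have cF: "continuous_on (UNIV \<times> cbox a b) (\<lambda>(x, y). F x y)"
  proof (rule continuous_on_blinfun_componentwise)
    fix i :: 'a
    have "continuous_on (UNIV \<times> cbox a b) (\<lambda>p. g (snd p) * of_real (c * \<psi>' i (c *\<^sub>R (fst p - snd p))))"
      by (intro continuous_intros continuous_on_compose2[OF g] continuous_on_compose2[OF bumps_continuous[OF b(1)[of i]]]) auto
    thus "continuous_on (UNIV \<times> cbox a b) (\<lambda>p. blinfun_apply (case p of (x, y) => F x y) i)"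
      by (simp add: F case_prod_unfold)
  qed
  have 1: "(box_convolution a b c g \<psi> has_derivative blinfun_apply (integral (cbox a b) (F x))) (at x within UNIV)"
    unfolding box_convolution_def[abs_def]
  proof (rule leibniz_rule[OF _ _ cF])
    show "(\<lambda>y. g y * of_real (\<psi> (c *\<^sub>R (x - y)))) integrable_on cbox a b" for x
      by (intro integrable_continuous continuous_intros continuous_on_compose2[OF g] continuous_on_compose2[OF bumps_continuous[OF b(2)]]) auto
    show "((\<lambda>x. g y * of_real (\<psi> (c *\<^sub>R (x - y)))) has_derivative blinfun_apply (F x y)) (at x within UNIV)" for x y
      unfolding F by (rule hd)
  qed auto
  have "blinfun_apply (integral (cbox a b) (F x)) v = box_convolution a b c g (\<lambda>z. c * \<psi>' v z) x" for v
  proof -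
    have "continuous_on (cbox a b) (F x)"
      using continuous_on_compose2[OF cF continuous_on_Pair[OF continuous_on_const[of "cbox a b" x] continuous_on_id]] by auto
    hence "F x integrable_on cbox a b" by (rule integrable_continuous)
    from integral_linear[OF this blinfun.bounded_linear_left[of v]]
    show ?thesis by (simp add: o_def F box_convolution_def)
  qed
  hence "blinfun_apply (integral (cbox a b) (F x)) = (\<lambda>v. box_convolution a b c g (\<lambda>z. c * \<psi>' v z) x)" by (rule ext)
  with 1 show ?thesis by (simp only:)
qed

text \<open>The induction ranges over all of \<open>bumps\<close>, since each derivative replaces
  the kernel by another member of that family.\<close>

lemma box_convolution_smooth:
  assumes g: "continuous_on UNIV g" and "\<psi> \<in> bumps"
  shows "Ck_on k UNIV (box_convolution a b c g \<psi>)"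
  using assms(2)
proof (induction k arbitrary: \<psi>)
  case 0
  obtain \<psi>' where *: "\<And>x. (\<psi> has_derivative (\<lambda>v. \<psi>' v x)) (at x)" "\<And>v. \<psi>' v \<in> bumps"
    using bumps_deriv[OF 0] by blast
  show ?case unfolding Ck_on.simps
    by (intro continuous_at_imp_continuous_on ballI has_derivative_continuous[OF box_convolution_deriv[OF g * 0]])
next
  case (Suc k)
  obtain \<psi>' where *: "\<And>x. (\<psi> has_derivative (\<lambda>v. \<psi>' v x)) (at x)" "\<And>v. \<psi>' v \<in> bumps"
    using bumps_deriv[OF Suc.prems] by blast
  note d = box_convolution_deriv[OF g * Suc.prems]
  have "fderiv (box_convolution a b c g \<psi>) x = (\<lambda>v. box_convolution a b c g (\<lambda>z. c * \<psi>' v z) x)" for x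
    by (rule frechet_derivative_at[OF d, symmetric])
  hence "(\<lambda>x. fderiv (box_convolution a b c g \<psi>) x v) = box_convolution a b c g (\<lambda>z. c * \<psi>' v z)" for v
    by (simp add: fun_eq_iff)
  moreover have "(\<lambda>z. c * \<psi>' v z) \<in> bumps" for v by (intro bumps.scale *(2))
  moreover have "box_convolution a b c g \<psi> differentiable (at x)" for x
    unfolding differentiable_def using d by blast
  ultimately show ?case using Suc.IH by simp
qed

definition std_bump :: "'a::euclidean_space => real" where
  "std_bump x = bump_profile 0 (1 - inner x x)"

lemma std_bump_bumps: "std_bump \<in> bumps"
  unfolding std_bump_def[abs_def] by (rule bumps.base)

lemma std_bump_nonneg: "std_bump x \<ge> 0" by (simp add: std_bump_def bump_profile_def)

lemma std_bump_minus: "std_bump (- x) = std_bump x" by (simp add: std_bump_def)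

lemma std_bump_scaled_integrable:
  fixes x :: "'a::euclidean_space"
  assumes "c > 0"
  shows "integrable lborel (\<lambda>y. std_bump (c *\<^sub>R (x - y)))"
proof (rule integrable_continuous_compact[where K="cball x (1 / c)"])
  show "continuous_on UNIV (\<lambda>y. std_bump (c *\<^sub>R (x - y)))"
    by (intro continuous_on_compose2[OF bumps_continuous[OF std_bump_bumps]] continuous_intros) auto
  show "std_bump (c *\<^sub>R (x - y)) = 0" if "y \<notin> cball x (1 / c)" for y
  proof (rule bumps_support[OF std_bump_bumps])
    have "norm (c *\<^sub>R (x - y)) = c * dist x y" using assms by (simp add: dist_norm)
    also have "\<dots> \<ge> 1" using that assms by (simp add: field_simps)
    finally show "1 \<le> norm (c *\<^sub>R (x - y))" .
  qed
qed auto

text \<open>The normalising integral is kept for every scale \<open>c\<close>, so no scaling law in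
  the dimension enters. The type argument records the space integrated over.\<close>

definition std_bump_mass :: "'a::euclidean_space itself => real => real" where
  "std_bump_mass _ c = (LINT y|lborel. std_bump (c *\<^sub>R (y :: 'a)))"

lemma std_bump_mass_translate:
  fixes x :: "'a::euclidean_space"
  shows "(LINT y|lborel. std_bump (c *\<^sub>R (x - y))) = std_bump_mass TYPE('a) c"
proof -
  have "(LINT y|lborel. std_bump (c *\<^sub>R (x - y))) = (LINT y|lborel. std_bump (c *\<^sub>R (- x + y)))"
  proof (rule Bochner_Integration.integral_cong[OF refl])
    fix y
    have "c *\<^sub>R (x - y) = - (c *\<^sub>R (- x + y))" by (simp add: algebra_simps)
    thus "std_bump (c *\<^sub>R (x - y)) = std_bump (c *\<^sub>R (- x + y))" by (simp only: std_bump_minus)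
  qed
  also have "\<dots> = std_bump_mass TYPE('a) c"
    unfolding std_bump_mass_def
    by (rule integral_lborel_translate[where h="\<lambda>y. std_bump (c *\<^sub>R y)"])
       (intro borel_measurable_continuous_onI continuous_on_compose2[OF bumps_continuous[OF std_bump_bumps]] continuous_intros subset_UNIV)
  finally show ?thesis .
qed

text \<open>A nonnegative function with integral 0 vanishes almost everywhere, but the bump is
  positive on a ball of positive volume.\<close>

lemma std_bump_mass_pos:
  assumes "c > 0" shows "std_bump_mass TYPE('a::euclidean_space) c > 0"
proof -
  have i: "integrable lborel (\<lambda>y::'a. std_bump (c *\<^sub>R y))"
    using std_bump_scaled_integrable[OF assms, of "0::'a"] by (simp add: std_bump_minus)
  have sub: "ball 0 (1 / c) \<subseteq> {y::'a. std_bump (c *\<^sub>R y) \<noteq> 0}"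
  proof
    fix y :: 'a assume "y \<in> ball 0 (1 / c)"
    hence "norm (c *\<^sub>R y) < 1" using assms by (simp add: field_simps)
    hence "inner (c *\<^sub>R y) (c *\<^sub>R y) < 1" unfolding dot_square_norm by (simp add: power_less_one_iff abs_square_less_1)
    thus "y \<in> {y. std_bump (c *\<^sub>R y) \<noteq> 0}" by (simp add: std_bump_def bump_profile_def)
  qed
  have "ball (0::'a) (1 / c) \<notin> null_sets lborel"
    using content_ball_pos[of "1 / c" "0::'a"] assms by (auto simp: null_sets_def measure_def)
  hence nb: "\<not> (AE y in lborel. y \<notin> ball (0::'a) (1 / c))"
    using AE_iff_null_sets[of "ball (0::'a) (1 / c)" lborel] by simp
  have n: "\<not> (AE y::'a in lborel. std_bump (c *\<^sub>R y) = 0)"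
  proof
    assume "AE y::'a in lborel. std_bump (c *\<^sub>R y) = 0"
    hence "AE y in lborel. y \<notin> ball (0::'a) (1 / c)"
      by (rule AE_mp) (intro AE_I2 impI notI, drule subsetD[OF sub], simp)
    thus False using nb by contradiction
  qed
  have "0 \<le> (LINT y|lborel. std_bump (c *\<^sub>R (y::'a)))"
    by (rule Bochner_Integration.integral_nonneg_AE) (simp add: std_bump_nonneg)
  moreover have "(LINT y|lborel. std_bump (c *\<^sub>R (y::'a))) \<noteq> 0"
    using integral_nonneg_eq_0_iff_AE[OF i] n by (simp add: std_bump_nonneg)
  ultimately show ?thesis unfolding std_bump_mass_def by simp
qed

definition mollify :: "real => ('a::euclidean_space => complex) => 'a => complex" where
  "mollify c h x = (LINT y|lborel. h y * of_real (std_bump (c *\<^sub>R (x - y)))) / of_real (std_bump_mass TYPE('a) c)"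

text \<open>A weighted mean of values within \<open>e\<close> of \<open>z\<close> is itself within
  \<open>e\<close> of \<open>z\<close>. With \<open>z = h x\<close> this gives convergence, with
  \<open>z = 0\<close> the uniform bound, and with \<open>z = 0\<close> and \<open>e = 0\<close> the
  control of the support.\<close>

lemma mollify_close:
  fixes h :: "'a::euclidean_space => complex"
  assumes h: "continuous_on UNIV h" and K: "compact K" "\<And>x. x \<notin> K ==> h x = 0" and c: "c > 0"
    and e: "\<And>y. dist x y < 1 / c ==> cmod (h y - z) \<le> e"
  shows "cmod (mollify c h x - z) \<le> e"
proof -
  let ?m = "std_bump_mass TYPE('a) c"
  let ?p = "\<lambda>y. std_bump (c *\<^sub>R (x - y))"
  have mp: "?m > 0" by (rule std_bump_mass_pos[OF c])
  have pi: "integrable lborel ?p" by (rule std_bump_scaled_integrable[OF c])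
  have hi: "integrable lborel (\<lambda>y. h y * of_real (?p y))"
    by (rule integrable_continuous_compact[OF _ K(1)])
       (auto intro!: continuous_intros h continuous_on_compose2[OF bumps_continuous[OF std_bump_bumps]] simp: K(2))
  have zi: "integrable lborel (\<lambda>y. z * of_real (?p y))"
    by (intro integrable_mult_right integrable_of_real pi)
  have "(mollify c h x - z) * of_real ?m = (LINT y|lborel. h y * of_real (?p y)) - z * of_real ?m"
    using mp by (simp add: mollify_def algebra_simps)
  also have "z * of_real ?m = (LINT y|lborel. z * of_real (?p y))"
    using std_bump_mass_translate[of c x] by simp
  also have "(LINT y|lborel. h y * of_real (?p y)) - \<dots> = (LINT y|lborel. (h y - z) * of_real (?p y))"
    by (subst Bochner_Integration.integral_diff[OF hi zi, symmetric]) (simp only: left_diff_distrib)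
  finally have "cmod (mollify c h x - z) * ?m = cmod (LINT y|lborel. (h y - z) * of_real (?p y))"
    using mp by (metis abs_of_pos norm_mult norm_of_real)
  also have "\<dots> \<le> (LINT y|lborel. cmod ((h y - z) * of_real (?p y)))"
    by (rule Bochner_Integration.integral_norm_bound)
  also have "\<dots> \<le> (LINT y|lborel. e * ?p y)"
  proof (rule Bochner_Integration.integral_mono)
    have "integrable lborel (\<lambda>y. (h y - z) * complex_of_real (?p y))"
      using Bochner_Integration.integrable_diff[OF hi zi] by (simp only: left_diff_distrib)
    thus "integrable lborel (\<lambda>y. cmod ((h y - z) * complex_of_real (?p y)))" by (rule integrable_norm)
    show "integrable lborel (\<lambda>y. e * ?p y)" by (intro integrable_mult_right pi)
    show "cmod ((h y - z) * complex_of_real (?p y)) \<le> e * ?p y" for y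
    proof (cases "dist x y < 1 / c")
      case True
      thus ?thesis using mult_right_mono[OF e[OF True] std_bump_nonneg] by (simp add: norm_mult std_bump_nonneg)
    next
      case False
      have "norm (c *\<^sub>R (x - y)) = c * dist x y" using c by (simp add: dist_norm)
      also have "\<dots> \<ge> 1" using False c by (simp add: field_simps)
      finally have "?p y = 0" by (intro bumps_support[OF std_bump_bumps])
      thus ?thesis by simp
    qed
  qed
  also have "\<dots> = e * ?m" using std_bump_mass_translate[of c x] by simp
  finally show ?thesis using mp by simp
qed

lemma mollify_eq_box_convolution:
  fixes h :: "'a::euclidean_space => complex"
  assumes h: "continuous_on UNIV h" and K: "compact K" "\<And>x. x \<notin> K ==> h x = 0" "K \<subseteq> cbox a b"
    and psi: "\<psi> \<in> bumps"
  shows "box_convolution a b c h \<psi> x = (LINT y|lborel. h y * of_real (\<psi> (c *\<^sub>R (x - y))))"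
proof -
  let ?f = "\<lambda>y. h y * of_real (\<psi> (c *\<^sub>R (x - y)))"
  have "integrable lborel ?f"
    by (rule integrable_continuous_compact[OF _ K(1)])
       (auto intro!: continuous_intros h continuous_on_compose2[OF bumps_continuous[OF psi]] simp: K(2))
  hence "(?f has_integral (LINT y|lborel. ?f y)) UNIV" by (rule has_integral_integral_lborel)
  moreover have "(\<lambda>y. if y \<in> cbox a b then ?f y else 0) = ?f" using K by (auto simp: fun_eq_iff)
  ultimately have "(?f has_integral (LINT y|lborel. ?f y)) (cbox a b)"
    using has_integral_restrict_UNIV[of "cbox a b" ?f] by simp
  thus ?thesis unfolding box_convolution_def by (rule integral_unique)
qed

text \<open>Derivatives fall on the kernel, which gives smoothness for merely continuous
  \<open>h\<close>. If \<open>h\<close> is C1, integration by parts hands the derivative over to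
  \<open>h\<close>, so mollification commutes with differentiation.\<close>

lemma mollify_smooth_deriv:
  fixes h :: "'a::euclidean_space => complex"
  assumes h: "continuous_on UNIV h" and K: "compact K" "\<And>x. x \<notin> K ==> h x = 0"
  shows "Ck_on k UNIV (mollify c h)"
    and "Ck_on 1 UNIV h ==> fderiv (mollify c h) x v = mollify c (\<lambda>y. fderiv h y v) x"
proof -
  define g where "g y = h y / of_real (std_bump_mass TYPE('a) c)" for y
  obtain a b where ab: "K \<subseteq> cbox a b" using K(1) bounded_subset_cbox_symmetric compact_imp_bounded by metis
  have g: "continuous_on UNIV g" unfolding g_def divide_inverse by (intro continuous_intros h)
  have gK: "x \<notin> K ==> g x = 0" for x by (simp add: g_def K(2))
  have eq: "mollify c h = box_convolution a b c g std_bump"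
    by (rule ext, subst mollify_eq_box_convolution[OF g K(1) gK ab std_bump_bumps]) (simp_all add: mollify_def g_def)
  show "Ck_on k UNIV (mollify c h)" unfolding eq by (rule box_convolution_smooth[OF g std_bump_bumps])
  assume C1: "Ck_on 1 UNIV h"
  obtain \<psi>' where p: "\<And>x. (std_bump has_derivative (\<lambda>v. \<psi>' v x)) (at (x::'a))" "\<And>v. \<psi>' v \<in> bumps"
    using bumps_deriv[OF std_bump_bumps] by blast
  have D: "fderiv (mollify c h) x v = box_convolution a b c g (\<lambda>z. c * \<psi>' v z) x"
    unfolding eq by (rule fun_cong[OF frechet_derivative_at[OF box_convolution_deriv[OF g p std_bump_bumps], symmetric]])
  also have "\<dots> = (LINT y|lborel. g y * of_real (c * \<psi>' v (c *\<^sub>R (x - y))))"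
    by (rule mollify_eq_box_convolution[OF g K(1) gK ab bumps.scale[OF p(2)]])
  \<comment> \<open>The kernel depends on \<open>x - y\<close> alone, so its derivative in
    \<open>x\<close> is minus its derivative in \<open>y\<close>.\<close>
  also have "\<dots> = - (LINT y|lborel. g y * fderiv (\<lambda>y. complex_of_real (std_bump (c *\<^sub>R (x - y)))) y v)"
  proof -
    have hd: "((\<lambda>y. complex_of_real (std_bump (c *\<^sub>R (x - y)))) has_derivative (\<lambda>v. - of_real (c * \<psi>' v (c *\<^sub>R (x - y))))) (at y)" for y
    proof -
      have 1: "((\<lambda>y. c *\<^sub>R (x - y)) has_derivative (\<lambda>v. (- c) *\<^sub>R v)) (at y)"
        by (auto intro!: derivative_eq_intros)
      have "linear (\<lambda>v. \<psi>' v z)" for z using p(1)[of z] by (rule has_derivative_linear)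
      hence 2: "\<psi>' ((- c) *\<^sub>R v) z = - (c * \<psi>' v z)" for v z using linear_scale[of "\<lambda>v. \<psi>' v z" "- c" v] by simp
      have "((\<lambda>y. std_bump (c *\<^sub>R (x - y))) has_derivative (\<lambda>v. - (c * \<psi>' v (c *\<^sub>R (x - y))))) (at y)"
        using has_derivative_compose[OF 1 p(1)] by (simp only: 2)
      from has_derivative_of_real[OF this] show ?thesis by simp
    qed
    have "fderiv (\<lambda>y. complex_of_real (std_bump (c *\<^sub>R (x - y)))) y v = - of_real (c * \<psi>' v (c *\<^sub>R (x - y)))" for y
      by (rule fun_cong[OF frechet_derivative_at[OF hd, symmetric]])
    thus ?thesis by simp
  qed
  also have "\<dots> = (LINT y|lborel. fderiv g y v * of_real (std_bump (c *\<^sub>R (x - y))))"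
  proof -
    have "Ck_on 1 UNIV g" unfolding g_def divide_inverse by (intro Ck_on_1_mult C1 Ck_on_1_const)
    hence gc: "C1_compact g" by (rule C1_compactI[OF open_UNIV _ K(1)]) (auto simp: gK)
    have "Ck_on 1 UNIV (\<lambda>y. complex_of_real (std_bump (c *\<^sub>R (x - y))))"
    proof (rule Ck_on_1_of_real, rule Ck_on_1I)
      show "((\<lambda>y. std_bump (c *\<^sub>R (x - y))) has_derivative (\<lambda>v. \<psi>' ((- c) *\<^sub>R v) (c *\<^sub>R (x - y)))) (at y)" for y
        by (rule has_derivative_compose[OF _ p(1)]) (auto intro!: derivative_eq_intros)
      show "continuous_on UNIV (\<lambda>y. \<psi>' ((- c) *\<^sub>R v) (c *\<^sub>R (x - y)))" for v
        by (intro continuous_on_compose2[OF bumps_continuous[OF p(2)]] continuous_intros) auto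
    qed
    from integral_by_parts_frechet_derivative[OF gc this, of v] show ?thesis by simp
  qed
  also have "\<dots> = mollify c (\<lambda>y. fderiv h y v) x"
  proof -
    have "fderiv g y v = fderiv h y v / of_real (std_bump_mass TYPE('a) c)" for y
    proof -
      have "(g has_derivative (\<lambda>v. fderiv h y v / of_real (std_bump_mass TYPE('a) c))) (at y)"
        unfolding g_def divide_inverse by (intro has_derivative_mult_left Ck_on_1D(1)[OF C1]) auto
      from fun_cong[OF frechet_derivative_at[OF this], of v] show ?thesis by simp
    qed
    thus ?thesis by (simp add: mollify_def)
  qed
  finally show "fderiv (mollify c h) x v = mollify c (\<lambda>y. fderiv h y v) x" .
qed

lemma mollify_bounded:
  fixes h :: "'a::euclidean_space => complex"
  assumes h: "continuous_on UNIV h" and K: "compact K" "\<And>x. x \<notin> K ==> h x = 0" and c: "c > 0"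
    and B: "\<And>x. cmod (h x) \<le> B"
  shows "cmod (mollify c h x) \<le> B"
  using mollify_close[OF h K c, of x 0 B] B by simp

lemma mollify_tendsto:
  fixes h :: "'a::euclidean_space => complex"
  assumes h: "continuous_on UNIV h" and K: "compact K" "\<And>x. x \<notin> K ==> h x = 0" and d: "d > 0"
  shows "(\<lambda>k. mollify (real (Suc k) / d) h x) \<longlonglongrightarrow> h x"
proof (rule tendstoI)
  fix e :: real assume e: "e > 0"
  have "isCont h x" using h by (simp add: continuous_on_eq_continuous_at)
  then obtain r where r: "r > 0" "\<And>y. dist y x < r ==> dist (h y) (h x) < e / 2"
    unfolding continuous_at_eps_delta using e by (metis half_gt_zero)
  have "\<forall>\<^sub>F k in sequentially. d / real (Suc k) < r"
  proof -
    have "(\<lambda>k. d * (1 / real (Suc k))) \<longlonglongrightarrow> d * 0"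
      by (intro tendsto_intros LIMSEQ_Suc lim_1_over_n)
    thus ?thesis using r(1) by (intro order_tendstoD[where a=r]) auto
  qed
  thus "\<forall>\<^sub>F k in sequentially. dist (mollify (real (Suc k) / d) h x) (h x) < e"
  proof eventually_elim
    case (elim k)
    have "cmod (mollify (real (Suc k) / d) h x - h x) \<le> e / 2"
      by (rule mollify_close[OF h K]) (use d elim r in \<open>auto simp: dist_norm dist_commute norm_minus_commute intro!: less_imp_le\<close>)
    thus ?case using e by (simp add: dist_norm)
  qed
qed

text \<open>The weak operators are defined by smooth test functions, whereas the forms tested later
  are C1. The approximants converge together with their first derivatives, uniformly bounded and
  inside one compact subset of \<open>D\<close>, which is what dominated convergence asks
  for.\<close>

lemma test_function_approx:
  fixes h :: "complex ^ 'n::finite => complex"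
  assumes h: "continuous_on UNIV h" and K: "compact K" "\<And>x. x \<notin> K ==> h x = 0" "K \<subseteq> D" and D: "open D"
  obtains \<phi> :: "nat => complex ^ 'n => complex" and K' where "compact K'" "K' \<subseteq> D" "\<And>k. test_function D (\<phi> k)"
    "\<And>k x. x \<notin> K' ==> \<phi> k x = 0" "\<And>x. (\<lambda>k. \<phi> k x) \<longlonglongrightarrow> h x" "\<exists>B. \<forall>k x. cmod (\<phi> k x) \<le> B"
    "\<And>v x. Ck_on 1 UNIV h ==> (\<lambda>k. fderiv (\<phi> k) x v) \<longlonglongrightarrow> fderiv h x v"
    "\<And>v. Ck_on 1 UNIV h ==> \<exists>B. \<forall>k x. cmod (fderiv (\<phi> k) x v) \<le> B"
\<comment> \<open>The distance to the empty set is 0 by convention, so the neighbourhoods used below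
  make sense only for nonempty \<open>K\<close>.\<close>
proof (cases "K = {}")
  case True
  hence h0: "h = (\<lambda>x. 0)" using K by auto
  have "Ck_on k UNIV (\<lambda>x::complex ^ 'n. 0 :: complex)" for k by (induction k) (auto simp: frechet_derivative_const)
  thus ?thesis
    by (intro that[of "{}" "\<lambda>k x. 0"]) (auto simp: test_function_def h0 frechet_derivative_const)
next
  case False
  obtain d where d: "d > 0" "{x. infdist x K \<le> d} \<subseteq> D"
    using compact_in_open_separated[OF False K(1) D K(3)] by blast
  let ?K = "{x. infdist x K \<le> d}"
  \<comment> \<open>The averaging radius is \<open>d / (k + 1)\<close>: it tends to 0 and never
    exceeds \<open>d\<close>, so all supports stay in \<open>?K\<close>.\<close>
  let ?\<phi> = "\<lambda>k. mollify (real (Suc k) / d) h"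
  have cK: "compact ?K" by (rule compact_infdist_le[OF False K(1) d(1)])
  have supp: "?\<phi> k x = 0" if "x \<notin> ?K" for k x
  proof -
    have "cmod (?\<phi> k x - 0) \<le> 0"
    proof (rule mollify_close[OF h K(1,2)])
      fix y assume "dist x y < 1 / (real (Suc k) / d)"
      also have "\<dots> \<le> d" using d(1) by (simp add: field_simps)
      finally have "y \<notin> K" using that infdist_le[of y K x] by force
      thus "cmod (h y - 0) \<le> 0" by (simp add: K(2))
    qed (use d in auto)
    thus ?thesis by simp
  qed
  have cl: "closure {x. ?\<phi> k x \<noteq> 0} \<subseteq> ?K" for k
    by (rule closure_minimal) (use supp cK in \<open>auto simp: compact_imp_closed\<close>)
  obtain B where B: "\<And>x. cmod (h x) \<le> B" using continuous_compact_bounded[OF h K(1,2)] by metis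
  show ?thesis
  proof (rule that[OF cK d(2)])
    show "test_function D (?\<phi> k)" for k
      unfolding test_function_def
      using cl[of k] d(2) mollify_smooth_deriv(1)[OF h K(1,2)] cK
      by (metis (no_types, lifting) closed_closure compact_Int_closed inf.absorb_iff2 inf_commute subset_trans)
    show "\<exists>B. \<forall>k x. cmod (?\<phi> k x) \<le> B"
      by (intro exI[of _ B] allI mollify_bounded[OF h K(1,2) _ B] divide_pos_pos d(1)) simp_all
    show "(\<lambda>k. ?\<phi> k x) \<longlonglongrightarrow> h x" for x by (rule mollify_tendsto[OF h K(1,2) d(1)])
    fix v assume C1: "Ck_on 1 UNIV h"
    hence c: "C1_compact h" by (rule C1_compactI[OF open_UNIV _ K(1)]) (auto simp: K(2))
    obtain L where L: "compact L" "\<And>x. x \<notin> L ==> fderiv h x v = 0"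
      using C1_compact_support[OF c] by metis
    have D: "fderiv (mollify c h) x v = mollify c (\<lambda>y. fderiv h y v) x" for c x
      by (rule mollify_smooth_deriv(2)[OF h K(1,2) C1])
    show "(\<lambda>k. fderiv (?\<phi> k) x v) \<longlonglongrightarrow> fderiv h x v" for x
      unfolding D by (rule mollify_tendsto[OF Ck_on_1D(2)[OF C1] L d(1)])
    obtain B' where B': "\<And>x. cmod (fderiv h x v) \<le> B'"
      using continuous_compact_bounded[OF Ck_on_1D(2)[OF C1] L] by metis
    show "\<exists>B. \<forall>k x. cmod (fderiv (?\<phi> k) x v) \<le> B"
      unfolding D by (intro exI[of _ B'] allI mollify_bounded[OF Ck_on_1D(2)[OF C1] L _ B'] divide_pos_pos d(1)) simp_all
  qed (use supp in auto)
qed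

section \<open>Exterior algebra\<close>

definition ext_sign :: "'n::{finite,linorder} => 'n set => complex" where
  "ext_sign j K = (-1) ^ card {i\<in>K. i < j}"

text \<open>Exterior multiplication on the left by a covector, on the whole exterior algebra; the
  degree is carried by the index sets.\<close>

definition wedge :: "complex ^ 'n::{finite,linorder} => ('n set => complex) => 'n set => complex" where
  "wedge a u K = (\<Sum>j\<in>K. ext_sign j K * a $ j * u (K - {j}))"

text \<open>Interior product, bilinear and without conjugation. It is the adjoint of
  \<open>wedge\<close> only after conjugating the vector.\<close>

definition contr :: "complex ^ 'n::{finite,linorder} => ('n set => complex) => 'n set => complex" where
  "contr b u I = (\<Sum>j\<in>-I. ext_sign j I * b $ j * u (insert j I))"

definition ext_inner :: "('n::finite set => complex) => ('n set => complex) => complex" where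
  "ext_inner u v = (\<Sum>J\<in>UNIV. u J * cnj (v J))"

definition ext_normsq :: "('n::finite set => complex) => real" where
  "ext_normsq u = (\<Sum>J\<in>UNIV. (cmod (u J))^2)"

definition cnj_vec :: "complex ^ 'n => complex ^ 'n" where
  "cnj_vec a = (\<chi> i. cnj (a $ i))"

definition bil :: "complex ^ 'n::finite => complex ^ 'n => complex" where
  "bil a b = (\<Sum>j\<in>UNIV. a $ j * b $ j)"

lemma ext_sign_sq [simp]: "ext_sign j K * ext_sign j K = 1"
  unfolding ext_sign_def by (simp flip: power_add mult_2)

lemma cnj_ext_sign [simp]: "cnj (ext_sign j K) = ext_sign j K"
  unfolding ext_sign_def by simp

lemma ext_sign_remove [simp]: "ext_sign j (K - {j}) = ext_sign j K"
  unfolding ext_sign_def by (rule arg_cong[where f="\<lambda>S. (-1) ^ card S"]) auto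

lemma ext_sign_insert [simp]: "ext_sign j (insert j K) = ext_sign j K"
  unfolding ext_sign_def by (rule arg_cong[where f="\<lambda>S. (-1) ^ card S"]) auto

lemma ext_sign_insert_other:
  assumes "k \<notin> K" "k \<noteq> j"
  shows "ext_sign j (insert k K) = (if k < j then - ext_sign j K else ext_sign j K)"
proof (cases "k < j")
  case True
  hence "{i \<in> insert k K. i < j} = insert k {i \<in> K. i < j}" by auto
  thus ?thesis using True assms by (simp add: ext_sign_def)
next
  case False
  hence "{i \<in> insert k K. i < j} = {i \<in> K. i < j}" by auto
  thus ?thesis using False by (simp add: ext_sign_def)
qed

text \<open>Whichever of \<open>j\<close> and \<open>k\<close> is the smaller changes exactly one of
  the two counts. This is the origin of the minus sign in the Clifford relation.\<close>

lemma ext_sign_exchange: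
  assumes "j \<notin> I" "k \<in> I"
  shows "ext_sign j I * ext_sign k (insert j I) = - ext_sign k I * ext_sign j (I - {k})"
proof -
  have jk: "j \<noteq> k" using assms by auto
  have 1: "ext_sign k (insert j I) = (if j < k then - ext_sign k I else ext_sign k I)"
    using assms jk by (intro ext_sign_insert_other) auto
  have 2: "ext_sign j I = (if k < j then - ext_sign j (I - {k}) else ext_sign j (I - {k}))"
    using ext_sign_insert_other[of k "I - {k}" j] jk insert_Diff[OF assms(2)] by simp
  show ?thesis using jk unfolding 1 2 by (cases "j < k") auto
qed

text \<open>The diagonal terms of the two products run over complementary index sets and add up to
  the full pairing; the off-diagonal terms cancel by the exchange of signs.\<close>

lemma clifford:
  "contr b (wedge a u) I + wedge a (contr b u) I = bil a b * u I"
proof -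
  let ?s = "\<lambda>k. \<Sum>j\<in>-I. ext_sign j I * b $ j * (ext_sign k (insert j I) * a $ k * u (insert j I - {k}))"
  have c: "contr b (wedge a u) I = (\<Sum>j\<in>-I. a $ j * b $ j * u I) + (\<Sum>k\<in>I. ?s k)"
  proof -
    have "contr b (wedge a u) I = (\<Sum>j\<in>-I. a $ j * b $ j * u I +
        (\<Sum>k\<in>I. ext_sign j I * b $ j * (ext_sign k (insert j I) * a $ k * u (insert j I - {k}))))"
      unfolding contr_def
    proof (rule sum.cong[OF refl])
      fix j assume j: "j \<in> - I"
      have "wedge a u (insert j I) = ext_sign j I * a $ j * u I
          + (\<Sum>k\<in>I. ext_sign k (insert j I) * a $ k * u (insert j I - {k}))"
        unfolding wedge_def using j by simp
      moreover have "ext_sign j I * b $ j * (ext_sign j I * a $ j * u I) = a $ j * b $ j * u I * (ext_sign j I * ext_sign j I)"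
        by (simp add: mult_ac)
      ultimately show "ext_sign j I * b $ j * wedge a u (insert j I) = a $ j * b $ j * u I +
        (\<Sum>k\<in>I. ext_sign j I * b $ j * (ext_sign k (insert j I) * a $ k * u (insert j I - {k})))"
        by (simp add: distrib_left sum_distrib_left)
    qed
    thus ?thesis unfolding sum.distrib by (simp add: sum.swap[of _ "-I" I])
  qed
  have w: "wedge a (contr b u) I = (\<Sum>k\<in>I. a $ k * b $ k * u I) - (\<Sum>k\<in>I. ?s k)"
  proof -
    have "wedge a (contr b u) I = (\<Sum>k\<in>I. a $ k * b $ k * u I - ?s k)"
      unfolding wedge_def
    proof (rule sum.cong[OF refl])
      fix k assume k: "k \<in> I"
      have "- (I - {k}) = insert k (- I)" using k by auto
      hence "contr b u (I - {k}) = ext_sign k I * b $ k * u I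
          + (\<Sum>j\<in>-I. ext_sign j (I - {k}) * b $ j * u (insert j (I - {k})))"
        unfolding contr_def using k by (simp add: insert_absorb)
      moreover have "ext_sign k I * a $ k * (ext_sign k I * b $ k * u I) = a $ k * b $ k * u I * (ext_sign k I * ext_sign k I)"
        by (simp add: mult_ac)
      moreover have "ext_sign k I * a $ k * (\<Sum>j\<in>-I. ext_sign j (I - {k}) * b $ j * u (insert j (I - {k}))) = - ?s k"
        unfolding sum_distrib_left sum_negf[symmetric]
      proof (rule sum.cong[OF refl])
        fix j assume j: "j \<in> - I"
        have e: "insert j (I - {k}) = insert j I - {k}" using j k by auto
        have "ext_sign k I * a $ k * (ext_sign j (I - {k}) * b $ j * u (insert j (I - {k})))
            = - (- ext_sign k I * ext_sign j (I - {k})) * a $ k * b $ j * u (insert j I - {k})"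
          unfolding e by (simp add: mult_ac)
        also have "\<dots> = - (ext_sign j I * ext_sign k (insert j I)) * a $ k * b $ j * u (insert j I - {k})"
          using j k by (subst ext_sign_exchange) auto
        finally show "ext_sign k I * a $ k * (ext_sign j (I - {k}) * b $ j * u (insert j (I - {k})))
          = - (ext_sign j I * b $ j * (ext_sign k (insert j I) * a $ k * u (insert j I - {k})))"
          by (simp add: mult_ac)
      qed
      ultimately show "ext_sign k I * a $ k * contr b u (I - {k}) = a $ k * b $ k * u I - ?s k"
        by (simp add: distrib_left)
    qed
    thus ?thesis by (simp add: sum_subtractf)
  qed
  have "(\<Sum>j\<in>-I. a $ j * b $ j * u I) + (\<Sum>k\<in>I. a $ k * b $ k * u I) = bil a b * u I"
    unfolding bil_def sum_distrib_right
    by (subst sum.union_disjoint[symmetric]) (auto intro: sum.cong)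
  thus ?thesis using c w by simp
qed

text \<open>Both sides are sums over ordered pairs of distinct indices, and swapping the pair flips
  the sign. Contracting twice with the same vector therefore gives 0, which is how the test form
  becomes tangential.\<close>

lemma contr_contr_anticommute: "contr a (contr b u) I = - contr b (contr a u) I"
proof -
  have *: "contr a (contr b u) I = (\<Sum>(j, k)\<in>{(j, k). j \<notin> I \<and> k \<notin> I \<and> j \<noteq> k}.
      ext_sign j I * ext_sign k (insert j I) * a $ j * b $ k * u (insert k (insert j I)))" for a b
  proof -
    have "contr a (contr b u) I = (\<Sum>j\<in>-I. \<Sum>k\<in>- insert j I. ext_sign j I * ext_sign k (insert j I) * a $ j * b $ k * u (insert k (insert j I)))"
      unfolding contr_def sum_distrib_left by (simp add: mult_ac)
    also have "\<dots> = (\<Sum>(j, k)\<in>Sigma (-I) (\<lambda>j. - insert j I). ext_sign j I * ext_sign k (insert j I) * a $ j * b $ k * u (insert k (insert j I)))"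
      by (rule sum.Sigma) auto
    also have "Sigma (-I) (\<lambda>j. - insert j I) = {(j, k). j \<notin> I \<and> k \<notin> I \<and> j \<noteq> k}" by auto
    finally show ?thesis .
  qed
  have "contr a (contr b u) I = (\<Sum>(k, j)\<in>{(j, k). j \<notin> I \<and> k \<notin> I \<and> j \<noteq> k}.
      ext_sign j I * ext_sign k (insert j I) * a $ j * b $ k * u (insert k (insert j I)))"
    unfolding * by (rule sum.reindex_bij_witness[where i=prod.swap and j=prod.swap]) auto
  also have "\<dots> = - contr b (contr a u) I"
    unfolding * sum_negf[symmetric]
  proof (rule sum.cong[OF refl])
    fix p :: "'a \<times> 'a" assume p: "p \<in> {(j, k). j \<notin> I \<and> k \<notin> I \<and> j \<noteq> k}"
    obtain k j where [simp]: "p = (k, j)" by (cases p)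
    have jk: "j \<notin> I" "k \<notin> I" "j \<noteq> k" using p by auto
    have "ext_sign j I * ext_sign k (insert j I) = - ext_sign k I * ext_sign j (insert k I)"
      using jk ext_sign_insert_other[of j I k] ext_sign_insert_other[of k I j] by (cases "j < k") (auto simp: not_less)
    hence "ext_sign j I * ext_sign k (insert j I) * (a $ j * b $ k * u (insert k (insert j I))) = - ext_sign k I * ext_sign j (insert k I) * (a $ j * b $ k * u (insert k (insert j I)))"
      by simp
    thus "(case p of (k, j) => ext_sign j I * ext_sign k (insert j I) * a $ j * b $ k * u (insert k (insert j I)))
      = - (case p of (j, k) => ext_sign j I * ext_sign k (insert j I) * b $ j * a $ k * u (insert k (insert j I)))"
      by (simp add: insert_commute mult_ac)
  qed
  finally show ?thesis .
qed

lemma contr_contr_self: "contr a (contr a u) I = 0"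
  using contr_contr_anticommute[of a a u I] by simp

lemma ext_inner_wedge: "ext_inner (wedge a u) v = ext_inner u (contr (cnj_vec a) v)"
proof -
  have "ext_inner (wedge a u) v = (\<Sum>K\<in>UNIV. \<Sum>j\<in>K. ext_sign j K * a $ j * u (K - {j}) * cnj (v K))"
    by (simp add: ext_inner_def wedge_def sum_distrib_right)
  also have "\<dots> = (\<Sum>(K, j)\<in>{(K, j). j \<in> K}. ext_sign j K * a $ j * u (K - {j}) * cnj (v K))"
    by (subst sum.Sigma) (auto intro!: sum.cong)
  also have "\<dots> = (\<Sum>(I, j)\<in>{(I, j). j \<notin> I}. u I * cnj (ext_sign j I * cnj_vec a $ j * v (insert j I)))"
    by (rule sum.reindex_bij_witness[where j="\<lambda>(K, j). (K - {j}, j)" and i="\<lambda>(I, j). (insert j I, j)"])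
       (auto simp: cnj_vec_def insert_absorb mult_ac)
  also have "\<dots> = (\<Sum>I\<in>UNIV. \<Sum>j\<in>-I. u I * cnj (ext_sign j I * cnj_vec a $ j * v (insert j I)))"
    by (subst sum.Sigma) (auto intro!: sum.cong)
  also have "\<dots> = ext_inner u (contr (cnj_vec a) v)"
    by (simp add: ext_inner_def contr_def sum_distrib_left)
  finally show ?thesis .
qed

lemma ext_normsq_zero [simp]: "ext_normsq (\<lambda>I. 0) = 0"
  by (simp add: ext_normsq_def)

lemma ext_inner_commute: "cnj (ext_inner u v) = ext_inner v u"
  by (simp add: ext_inner_def mult.commute)

lemma ext_normsq_eq: "complex_of_real (ext_normsq u) = ext_inner u u"
  unfolding ext_normsq_def ext_inner_def complex_norm_square of_real_sum ..

lemma ext_inner_add_right: "ext_inner u (\<lambda>I. v I + w I) = ext_inner u v + ext_inner u w"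
  by (simp add: ext_inner_def distrib_left sum.distrib)
lemma ext_inner_scale_right: "ext_inner u (\<lambda>I. c * v I) = cnj c * ext_inner u v"
  by (simp add: ext_inner_def sum_distrib_left mult_ac)

lemma bil_cnj: "bil a (cnj_vec b) = herm_inner a b" "bil (cnj_vec b) a = herm_inner a b"
  by (simp_all add: bil_def cnj_vec_def herm_inner_def mult.commute)

text \<open>The Clifford relation paired with \<open>u\<close>. It splits the norm into a wedge part
  and a contraction part, so that the directions seen by dbar and by its adjoint are
  complementary.\<close>

lemma ext_normsq_wedge:
  "ext_normsq (wedge a u) = Re (herm_inner a a) * ext_normsq u - ext_normsq (contr (cnj_vec a) u)"
proof -
  have "contr (cnj_vec a) (wedge a u) = (\<lambda>I. bil a (cnj_vec a) * u I + (- 1) * wedge a (contr (cnj_vec a) u) I)"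
    using clifford[of "cnj_vec a" a u] by (auto simp: algebra_simps eq_diff_eq)
  hence "complex_of_real (ext_normsq (wedge a u))
      = cnj (bil a (cnj_vec a)) * ext_inner u u - ext_inner u (wedge a (contr (cnj_vec a) u))"
    unfolding ext_normsq_eq ext_inner_wedge
    by (simp only: ext_inner_add_right ext_inner_scale_right) simp
  also have "ext_inner u (wedge a (contr (cnj_vec a) u)) = ext_inner (contr (cnj_vec a) u) (contr (cnj_vec a) u)"
    by (metis ext_inner_commute ext_inner_wedge)
  also have "cnj (bil a (cnj_vec a)) = complex_of_real (Re (herm_inner a a))"
    by (simp add: bil_cnj herm_inner_def complex_eq_iff flip: power2_eq_square)
  finally show ?thesis
    unfolding ext_normsq_eq[symmetric] by (simp flip: of_real_mult of_real_diff)
qed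

text \<open>Up to sign the decomposable form of \<open>Z 0, ..., Z (q - 1)\<close>; later factors
  stand on the left so that the recursion meets the Clifford relation.\<close>

primrec wedge_list :: "(nat => complex ^ 'n::{finite,linorder}) => nat => 'n set => complex" where
  "wedge_list Z 0 = (\<lambda>K. if K = {} then 1 else 0)"
| "wedge_list Z (Suc q) = wedge (Z q) (wedge_list Z q)"

lemma contr_wedge_list_0: "contr b (wedge_list Z 0) = (\<lambda>I. 0)"
  by (auto simp: contr_def fun_eq_iff)

lemma wedge_zero: "wedge a (\<lambda>I. 0) = (\<lambda>I. 0)"
  by (auto simp: wedge_def fun_eq_iff)

lemma contr_zero: "contr a (\<lambda>I. 0) = (\<lambda>I. 0)"
  by (auto simp: contr_def fun_eq_iff)

lemma contr_wedge_list_orthogonal: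
  assumes "\<And>j. j < q ==> bil (Z j) b = 0"
  shows "contr b (wedge_list Z q) = (\<lambda>I. 0)"
  using assms
proof (induction q)
  case 0 thus ?case by (simp only: contr_wedge_list_0)
next
  case (Suc q)
  show ?case
  proof
    fix I
    show "contr b (wedge_list Z (Suc q)) I = 0"
      using clifford[of b "Z q" "wedge_list Z q" I] Suc by (simp add: wedge_zero)
  qed
qed

lemma wedge_list_card: "card K \<noteq> q ==> wedge_list Z q K = 0"
proof (induction q arbitrary: K)
  case (Suc q)
  have "wedge_list Z q (K - {j}) = 0" if "j \<in> K" for j
  proof (rule Suc.IH)
    show "card (K - {j}) \<noteq> q" using that Suc.prems card_Suc_Diff1[of K j] by force
  qed
  thus ?case by (simp add: wedge_def)
next
  case 0 thus ?case by (cases "K = {}") simp_all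
qed

text \<open>Contraction with \<open>b\<close> removes one factor at a time, and the resulting
  \<open>q\<close> terms are mutually orthogonal. In the induction the two pieces are orthogonal
  because contraction with the conjugate of the new factor annihilates the old product; the norm of
  that product is carried along in the same induction.\<close>

lemma ext_normsq_contr_wedge_list:
  assumes "orthonormal_family {..<q} Z"
  shows "ext_normsq (contr b (wedge_list Z q)) = (\<Sum>j<q. (cmod (bil (Z j) b))^2) \<and> ext_normsq (wedge_list Z q) = 1"
  using assms
proof (induction q arbitrary: b)
  case 0
  have "(cmod (if J = {} then 1 else 0))^2 = (if J = {} then 1 else 0)" for J :: "'a set" by simp
  thus ?case by (simp only: contr_wedge_list_0) (simp add: ext_normsq_def)
next
  case (Suc q)
  let ?w = "wedge_list Z q" and ?a = "Z q"
  have onq: "orthonormal_family {..<q} Z" using Suc.prems unfolding orthonormal_family_def by simp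
  note IH = conjunct1[OF Suc.IH[OF onq]] conjunct2[OF Suc.IH[OF onq]]
  have on: "herm_inner ?a ?a = 1" "\<And>j. j < q ==> herm_inner (Z j) ?a = 0"
    using Suc.prems unfolding orthonormal_family_def by simp_all
  have z: "contr (cnj_vec ?a) ?w = (\<lambda>I. 0)"
    by (rule contr_wedge_list_orthogonal) (simp add: bil_cnj on)
  have n1: "ext_normsq (wedge_list Z (Suc q)) = 1"
    by (simp add: ext_normsq_wedge on IH z)
  have c: "contr b (wedge ?a ?w) = (\<lambda>I. bil ?a b * ?w I + (-1) * wedge ?a (contr b ?w) I)"
    using clifford[of b ?a ?w] by (auto simp: algebra_simps eq_diff_eq)
  have zz: "contr (cnj_vec ?a) (contr b ?w) = (\<lambda>I. 0)"
    using contr_contr_anticommute[of "cnj_vec ?a" b ?w] by (auto simp: z contr_zero)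
  have o: "ext_inner (wedge ?a (contr b ?w)) ?w = 0"
    unfolding ext_inner_wedge z by (simp add: ext_inner_def)
  define \<beta> v where "\<beta> = bil ?a b" and "v = wedge ?a (contr b ?w)"
  have "ext_inner (\<lambda>I. \<beta> * ?w I + (-1) * v I) (\<lambda>I. \<beta> * ?w I + (-1) * v I)
      = \<beta> * cnj \<beta> * ext_inner ?w ?w + ext_inner v v - cnj \<beta> * ext_inner v ?w - \<beta> * cnj (ext_inner v ?w)"
    unfolding ext_inner_def
    by (simp add: algebra_simps sum.distrib sum_subtractf sum_distrib_left)
  also have "\<dots> = of_real ((cmod \<beta>)^2 * ext_normsq ?w + ext_normsq v)"
    using o by (simp add: v_def[symmetric] ext_normsq_eq complex_norm_square del: of_real_power)
  finally have g: "ext_inner (\<lambda>I. \<beta> * ?w I + (-1) * v I) (\<lambda>I. \<beta> * ?w I + (-1) * v I)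
      = of_real ((cmod \<beta>)^2 * ext_normsq ?w + ext_normsq v)" .
  have c': "contr b (wedge ?a ?w) = (\<lambda>I. \<beta> * ?w I + (-1) * v I)"
    unfolding c \<beta>_def v_def ..
  have "complex_of_real (ext_normsq (contr b (wedge ?a ?w))) = of_real ((cmod \<beta>)^2 * ext_normsq ?w + ext_normsq v)"
    unfolding ext_normsq_eq c' by (rule g)
  hence e: "ext_normsq (contr b (wedge ?a ?w)) = (cmod (bil ?a b))^2 * ext_normsq ?w + ext_normsq (wedge ?a (contr b ?w))"
    unfolding of_real_eq_iff \<beta>_def v_def .
  have f: "ext_normsq (wedge ?a (contr b ?w)) = ext_normsq (contr b ?w)"
    unfolding ext_normsq_wedge zz on(1) by simp
  have "ext_normsq (contr b (wedge ?a ?w)) = (cmod (bil ?a b))^2 + (\<Sum>j<q. (cmod (bil (Z j) b))^2)"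
    unfolding e f IH(1) IH(2) mult_1_right ..
  hence "ext_normsq (contr b (wedge_list Z (Suc q))) = (\<Sum>j<Suc q. (cmod (bil (Z j) b))^2)"
    unfolding wedge_list.simps sum.lessThan_Suc by (simp only: add.commute)
  thus ?case using n1 by (rule conjI)
qed

section \<open>Orthonormal families and eigenbases\<close>

lemma herm_inner_simps:
  "herm_inner (a + b) c = herm_inner a c + herm_inner b c"
  "herm_inner a (b + c) = herm_inner a b + herm_inner a c"
  "herm_inner (a - b) c = herm_inner a c - herm_inner b c"
  "herm_inner (k *s a) c = k * herm_inner a c"
  "herm_inner a (k *s c) = cnj k * herm_inner a c"
  "herm_inner 0 c = 0" "herm_inner c 0 = 0"
  by (simp_all add: herm_inner_def algebra_simps sum.distrib sum_subtractf sum_distrib_left)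

lemma herm_inner_sum_left: "herm_inner (\<Sum>i\<in>I. f i) c = (\<Sum>i\<in>I. herm_inner (f i) c)"
  by (induction I rule: infinite_finite_induct) (simp_all add: herm_inner_simps)

lemma herm_inner_sum_right: "herm_inner c (\<Sum>i\<in>I. f i) = (\<Sum>i\<in>I. herm_inner c (f i))"
  by (induction I rule: infinite_finite_induct) (simp_all add: herm_inner_simps)

lemma herm_inner_commute: "herm_inner b a = cnj (herm_inner a b)"
  by (simp add: herm_inner_def mult.commute)

lemma herm_inner_self: "herm_inner a a = complex_of_real ((norm a)^2)"
  unfolding herm_inner_def norm_vec_def L2_set_def
  by (simp add: real_sqrt_pow2[OF sum_nonneg] complex_norm_square del: of_real_power)

lemma norm_sum_orthonormal:
  assumes "orthonormal_family I Z" "finite I"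
  shows "(norm (\<Sum>i\<in>I. c i *s Z i))^2 = (\<Sum>i\<in>I. (cmod (c i))^2)"
proof -
  have "complex_of_real ((norm (\<Sum>i\<in>I. c i *s Z i))^2) = (\<Sum>i\<in>I. \<Sum>j\<in>I. c i * (cnj (c j) * herm_inner (Z i) (Z j)))"
    unfolding herm_inner_self[symmetric] herm_inner_sum_left
    by (simp add: herm_inner_sum_right herm_inner_simps sum_distrib_left mult_ac)
  also have "\<dots> = (\<Sum>i\<in>I. \<Sum>j\<in>I. if i = j then c i * cnj (c i) else 0)"
    using assms(1) by (intro sum.cong refl) (auto simp: orthonormal_family_def)
  also have "\<dots> = (\<Sum>i\<in>I. c i * cnj (c i))" using assms(2) by simp
  also have "\<dots> = complex_of_real (\<Sum>i\<in>I. (cmod (c i))^2)" by (simp add: complex_norm_square del: of_real_power)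
  finally show ?thesis by (simp only: of_real_eq_iff)
qed

lemma orthonormal_coeff:
  assumes "orthonormal_family I Z" "finite I" "j \<in> I"
  shows "herm_inner (\<Sum>i\<in>I. c i *s Z i) (Z j) = c j"
proof -
  have "herm_inner (\<Sum>i\<in>I. c i *s Z i) (Z j) = (\<Sum>i\<in>I. if i = j then c i else 0)"
    unfolding herm_inner_sum_left using assms(1,3)
    by (intro sum.cong refl) (auto simp: orthonormal_family_def herm_inner_simps)
  thus ?thesis using assms(2,3) by simp
qed

lemma orthonormal_inj: "orthonormal_family I Z ==> inj_on Z I"
  unfolding orthonormal_family_def inj_on_def by (metis zero_neq_one)

lemma orthonormal_span_expansion:
  assumes on: "orthonormal_family I Z" and fin: "finite I" and v: "v \<in> vec.span (Z ` I)"
  shows "v = (\<Sum>i\<in>I. herm_inner v (Z i) *s Z i)"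
proof -
  obtain u where "v = (\<Sum>b\<in>Z ` I. u b *s b)" using v fin by (auto simp: vec.span_finite)
  hence e: "v = (\<Sum>i\<in>I. u (Z i) *s Z i)" by (simp add: sum.reindex[OF orthonormal_inj[OF on]])
  have "herm_inner v (Z i) = u (Z i)" if "i \<in> I" for i
    unfolding e by (rule orthonormal_coeff[OF on fin that])
  thus ?thesis using e by simp
qed

lemma orthonormal_independent:
  assumes on: "orthonormal_family I Z" and fin: "finite I"
  shows "vec.independent (Z ` I)"
proof
  assume "vec.dependent (Z ` I)"
  then obtain u i where u: "i \<in> I" "u (Z i) \<noteq> 0" "(\<Sum>b\<in>Z ` I. u b *s b) = 0"
    using fin by (auto simp: vec.dependent_finite)
  have "(\<Sum>j\<in>I. u (Z j) *s Z j) = 0" using u(3) by (simp add: sum.reindex[OF orthonormal_inj[OF on]])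
  hence "u (Z i) = 0" using orthonormal_coeff[OF on fin u(1), of "\<lambda>j. u (Z j)"] by (simp add: herm_inner_simps)
  thus False using u by simp
qed

lemma orthonormal_basis_expansion:
  fixes Z :: "'i => complex ^ 'n::finite"
  assumes on: "orthonormal_family I Z" and card: "card I = CARD('n)"
  shows "v = (\<Sum>i\<in>I. herm_inner v (Z i) *s Z i)"
proof -
  have fin: "finite I" by (rule card_ge_0_finite) (simp add: card)
  have "card (Z ` I) = CARD('n)" using card card_image[OF orthonormal_inj[OF on]] by simp
  moreover have "vec.dim (UNIV :: (complex ^ 'n) set) = CARD('n)" by (rule vec_dim_card)
  ultimately have "UNIV \<subseteq> vec.span (Z ` I)"
    using vec.card_ge_dim_independent[OF subset_UNIV orthonormal_independent[OF on fin]] by simp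
  thus ?thesis by (intro orthonormal_span_expansion on fin) auto
qed

definition sesq :: "('n::finite => 'n => complex) => complex ^ 'n => complex ^ 'n => complex" where
  "sesq h a b = (\<Sum>j\<in>UNIV. \<Sum>k\<in>UNIV. a $ j * h j k * cnj (b $ k))"

lemma sesq_simps:
  "sesq h (a + b) c = sesq h a c + sesq h b c"
  "sesq h a (b + c) = sesq h a b + sesq h a c"
  "sesq h (k *s a) c = k * sesq h a c"
  "sesq h a (k *s c) = cnj k * sesq h a c"
  "sesq h 0 c = 0" "sesq h a 0 = 0"
  by (simp_all add: sesq_def algebra_simps sum.distrib sum_distrib_left)

lemma sesq_sum_left: "sesq h (\<Sum>i\<in>I. f i) c = (\<Sum>i\<in>I. sesq h (f i) c)"
  by (induction I rule: infinite_finite_induct) (simp_all add: sesq_simps)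

lemma sesq_sum_right: "sesq h c (\<Sum>i\<in>I. f i) = (\<Sum>i\<in>I. sesq h c (f i))"
  by (induction I rule: infinite_finite_induct) (simp_all add: sesq_simps)

lemma sesq_hermitian:
  assumes "\<And>j k. h k j = cnj (h j k)"
  shows "sesq h b a = cnj (sesq h a b)"
proof -
  have "cnj (sesq h a b) = (\<Sum>j\<in>UNIV. \<Sum>k\<in>UNIV. b $ k * h k j * cnj (a $ j))"
    unfolding sesq_def cnj_sum
  proof (intro sum.cong refl)
    fix j k
    show "cnj (a $ j * h j k * cnj (b $ k)) = b $ k * h k j * cnj (a $ j)"
      unfolding assms[of j k] by simp
  qed
  also have "\<dots> = sesq h b a" unfolding sesq_def by (rule sum.swap)
  finally show ?thesis ..
qed

lemma scaleR_vec_eq_smult: "c *\<^sub>R (x :: complex ^ 'n) = complex_of_real c *s x"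
  by (simp add: Finite_Cartesian_Product.vec_eq_iff scaleR_conv_of_real[where 'a=complex])

lemma subspace_vec_subspace:
  fixes S :: "(complex ^ 'n) set" assumes "vec.subspace S" shows "subspace S"
proof (rule subspaceI)
  show "c *\<^sub>R x \<in> S" if "x \<in> S" for c x
    using vec.subspace_scale[OF assms that] by (simp add: scaleR_vec_eq_smult)
qed (use assms vec.subspace_0 vec.subspace_add in blast)+

text \<open>First variation: moving \<open>v\<close> to \<open>v + t w\<close> changes the quadratic
  form by \<open>2 t\<close> times the real part of \<open>sesq h v w\<close>, but the norm only to
  second order. A nonzero first-order term would beat the maximum for small
  \<open>t\<close>.\<close>

lemma rayleigh_maximizer_orthogonal:
  fixes S :: "(complex ^ 'n::finite) set"
  assumes herm: "\<And>j k. h k j = cnj (h j k)" and S: "vec.subspace S"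
    and v: "v \<in> S" "norm v = 1" and max: "\<And>w. w \<in> S ==> norm w = 1 ==> Re (sesq h w w) \<le> Re (sesq h v v)"
    and w: "w \<in> S" "herm_inner w v = 0"
  shows "sesq h v w = 0"
proof -
  let ?M = "Re (sesq h v v)"
  have bound: "Re (sesq h u u) \<le> ?M * (norm u)^2" if "u \<in> S" for u
  proof (cases "u = 0")
    case False
    let ?u = "complex_of_real (1 / norm u) *s u"
    have "norm ?u = 1" unfolding scaleR_vec_eq_smult[symmetric] using False by simp
    hence "Re (sesq h ?u ?u) \<le> ?M" using max vec.subspace_scale[OF S that] by blast
    moreover have "sesq h ?u ?u = complex_of_real ((1 / norm u)^2) * sesq h u u"
      unfolding sesq_simps by (simp add: power2_eq_square)
    ultimately have "(1 / norm u)^2 * Re (sesq h u u) \<le> ?M" by (simp del: of_real_power)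
    thus ?thesis using False by (simp add: power2_eq_square field_simps)
  qed (simp add: sesq_simps)
  have re0: "Re (sesq h v w) = 0" if w: "w \<in> S" "herm_inner w v = 0" for w
  proof (rule ccontr)
    assume r: "Re (sesq h v w) \<noteq> 0"
    define r C where "r = Re (sesq h v w)" and "C = ?M * (norm w)^2 - Re (sesq h w w)"
    \<comment> \<open>Small enough that the quadratic term \<open>t^2 * C\<close> cannot compensate
      the linear gain \<open>2 * t * r\<close>.\<close>
    define t where "t = r / (\<bar>C\<bar> + 1)"
    let ?u = "v + complex_of_real t *s w"
    have "herm_inner v w = 0" using w(2) herm_inner_commute[of v w] by simp
    hence "complex_of_real ((norm ?u)^2) = complex_of_real (1 + t^2 * (norm w)^2)"
      unfolding herm_inner_self[symmetric] herm_inner_simps w(2)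
      by (simp add: herm_inner_self v(2) power2_eq_square)
    hence n: "(norm ?u)^2 = 1 + t^2 * (norm w)^2" by (simp only: of_real_eq_iff)
    have "sesq h w v = cnj (sesq h v w)" by (rule sesq_hermitian[OF herm])
    hence s: "Re (sesq h ?u ?u) = ?M + 2 * t * r + t^2 * Re (sesq h w w)"
      unfolding sesq_simps r_def by (simp add: power2_eq_square algebra_simps)
    have "?u \<in> S" using S v(1) w(1) by (intro vec.subspace_add vec.subspace_scale)
    from bound[OF this] have "2 * t * r \<le> t^2 * C" unfolding n s C_def by (simp add: algebra_simps)
    hence "2 * (r^2 / (\<bar>C\<bar> + 1)) \<le> (r^2 / (\<bar>C\<bar> + 1)) * (C / (\<bar>C\<bar> + 1))"
      unfolding t_def by (simp add: power2_eq_square)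
    moreover have "(r^2 / (\<bar>C\<bar> + 1)) * (C / (\<bar>C\<bar> + 1)) \<le> (r^2 / (\<bar>C\<bar> + 1)) * 1"
      by (intro mult_left_mono) (auto simp: divide_le_eq)
    moreover have "r^2 / (\<bar>C\<bar> + 1) > 0" using r by (simp add: r_def)
    ultimately show False by linarith
  qed
  \<comment> \<open>Multiplying the competitor by \<open>\<i>\<close> turns the imaginary part into
    a real one.\<close>
  have "Re (sesq h v (\<i> *s w)) = 0"
    by (rule re0) (use w S in \<open>auto intro: vec.subspace_scale simp: herm_inner_simps\<close>)
  hence "Im (sesq h v w) = 0" by (simp add: sesq_simps)
  thus ?thesis using re0[OF w] by (simp add: complex_eq_iff)
qed

text \<open>The spectral theorem on a subspace: a maximiser on the unit sphere is split off and the
  induction continues in its orthogonal complement. The length \<open>m\<close> is left existential;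
  it is identified later as the dimension.\<close>

lemma hermitian_eigenbasis_subspace:
  fixes S :: "(complex ^ 'n::finite) set"
  assumes herm: "\<And>j k. h k j = cnj (h j k)" and S: "vec.subspace S"
  shows "\<exists>Z l m. orthonormal_family {..<m::nat} Z \<and> vec.span (Z ` {..<m}) = S \<and>
    (\<forall>i<m. \<forall>j<m. sesq h (Z i) (Z j) = (if i = j then complex_of_real (l i) else 0))"
  using S
proof (induction "vec.dim S" arbitrary: S rule: less_induct)
  case less
  show ?case
  proof (cases "S = {0}")
    case True
    show ?thesis
      by (rule exI[of _ "\<lambda>_. 0"], rule exI[of _ "\<lambda>_. 0"], rule exI[of _ 0]) (auto simp: orthonormal_family_def True)
  next
    case False
    then obtain u where u: "u \<in> S" "u \<noteq> 0" using vec.subspace_0[OF less.prems] by blast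
    have sub: "subspace S" by (rule subspace_vec_subspace[OF less.prems])
    let ?K = "S \<inter> sphere 0 1"
    have "compact ?K" using closed_subspace[OF sub] by (intro closed_Int_compact) auto
    moreover have "(1 / norm u) *\<^sub>R u \<in> ?K" using u sub by (auto intro: subspace_scale)
    moreover have "continuous_on ?K (\<lambda>w. Re (sesq h w w))"
      unfolding sesq_def by (intro continuous_intros)
    ultimately obtain v where v: "v \<in> ?K" "\<And>w. w \<in> ?K ==> Re (sesq h w w) \<le> Re (sesq h v v)"
      using continuous_attains_sup[of ?K "\<lambda>w. Re (sesq h w w)"] by blast
    have v1: "v \<in> S" "norm v = 1" using v(1) by auto
    have vv: "herm_inner v v = 1" by (simp add: herm_inner_self v1)
    define S' where "S' = {w \<in> S. herm_inner w v = 0}"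
    have S'sub: "vec.subspace S'"
      using less.prems unfolding S'_def vec.subspace_def by (auto simp: herm_inner_simps)
    have orth: "sesq h v w = 0" "sesq h w v = 0" if "w \<in> S'" for w
    proof -
      show "sesq h v w = 0"
        by (rule rayleigh_maximizer_orthogonal[OF herm less.prems v1]) (use that v(2) in \<open>auto simp: S'_def\<close>)
      thus "sesq h w v = 0" using sesq_hermitian[where a=v and b=w, OF herm] by simp
    qed
    have "v \<notin> S'" by (simp add: S'_def vv)
    hence "S' \<subset> S" using v1 by (auto simp: S'_def)
    hence "vec.dim S' < vec.dim S"
      using vec.dim_psubset[of S' S] vec.span_eq_iff[THEN iffD2, OF S'sub] vec.span_eq_iff[THEN iffD2, OF less.prems] by simp
    from less.hyps[OF this S'sub] obtain Z :: "nat => complex ^ 'n" and l m where Z: "orthonormal_family {..<m} Z" "vec.span (Z ` {..<m}) = S'"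
      "\<forall>i<m. \<forall>j<m. sesq h (Z i) (Z j) = (if i = j then complex_of_real (l i) else 0)" by blast
    have ZS: "Z i \<in> S'" if "i < m" for i
      using vec.span_base[of "Z i" "Z ` {..<m}"] that unfolding Z(2) by simp
    let ?Z = "Z(m := v)" and ?l = "l(m := Re (sesq h v v))"
    have real: "sesq h v v = complex_of_real (Re (sesq h v v))"
      using sesq_hermitian[where a=v and b=v, OF herm] by (simp add: complex_eq_iff)
    have "orthonormal_family {..<Suc m} ?Z"
      unfolding orthonormal_family_def
    proof (intro ballI)
      fix i j assume "i \<in> {..<Suc m}" "j \<in> {..<Suc m}"
      hence ij: "i < m \<or> i = m" "j < m \<or> j = m" by auto
      have 1: "herm_inner (Z i) v = 0" if "i < m" for i using ZS[OF that] by (simp add: S'_def)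
      have 2: "herm_inner v (Z i) = 0" if "i < m" for i using 1[OF that] herm_inner_commute[of v "Z i"] by simp
      have 3: "herm_inner (Z i) (Z j) = (if i = j then 1 else 0)" if "i < m" "j < m"
        using Z(1) that by (simp add: orthonormal_family_def)
      show "herm_inner (?Z i) (?Z j) = (if i = j then 1 else 0)"
        using ij 1[of i] 2[of j] 3 vv by (elim disjE) simp_all
    qed
    moreover have "vec.span (?Z ` {..<Suc m}) = S"
    proof
      have im: "?Z ` {..<Suc m} = insert v (Z ` {..<m})" by (auto simp: lessThan_Suc)
      show "vec.span (?Z ` {..<Suc m}) \<subseteq> S"
        unfolding im by (rule vec.span_minimal[OF _ less.prems]) (use v1 ZS in \<open>auto simp: S'_def\<close>)
      show "S \<subseteq> vec.span (?Z ` {..<Suc m})"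
      proof
        fix w assume w: "w \<in> S"
        have "w - herm_inner w v *s v \<in> S'"
          using w v1 less.prems by (auto simp: S'_def herm_inner_simps vv intro: vec.subspace_diff vec.subspace_scale)
        hence "w - herm_inner w v *s v \<in> vec.span (Z ` {..<m})" using Z(2) by simp
        thus "w \<in> vec.span (?Z ` {..<Suc m})"
          unfolding im vec.span_insert by blast
      qed
    qed
    moreover have "\<forall>i<Suc m. \<forall>j<Suc m. sesq h (?Z i) (?Z j) = (if i = j then complex_of_real (?l i) else 0)"
      using Z(3) orth ZS real by (auto simp: less_Suc_eq)
    ultimately show ?thesis by blast
  qed
qed

text \<open>The transition matrix between two orthonormal bases of one space is unitary, so
  congruence of the two form matrices is a similarity and the characteristic polynomial does not
  depend on the basis.\<close>

lemma char_poly_sesq_eigenbasis: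
  assumes Z: "orthonormal_family {..<m} Z" "vec.span (Z ` {..<m}) = S"
    and Z': "orthonormal_family {..<m} Z'" "vec.span (Z' ` {..<m}) = S"
    and diag: "\<And>i j. i < m ==> j < m ==> sesq h (Z' i) (Z' j) = (if i = j then l i else 0)"
  shows "char_poly (Matrix.mat m m (\<lambda>(i, j). sesq h (Z i) (Z j))) = (\<Prod>j<m. [:- l j, 1:])"
proof -
  let ?A = "Matrix.mat m m (\<lambda>(i, j). sesq h (Z i) (Z j))"
  let ?D = "Matrix.mat m m (\<lambda>(i, j). if i = j then l i else 0)"
  let ?P = "Matrix.mat m m (\<lambda>(i, k). herm_inner (Z i) (Z' k))"
  let ?Q = "Matrix.mat m m (\<lambda>(k, i). cnj (herm_inner (Z i) (Z' k)))"
  have ZS: "Z i \<in> S" "Z' i \<in> S" if "i < m" for i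
    using that vec.span_base[of "Z i" "Z ` {..<m}"] vec.span_base[of "Z' i" "Z' ` {..<m}"]
    unfolding Z(2) Z'(2) by simp_all
  have ex: "Z i = (\<Sum>k<m. herm_inner (Z i) (Z' k) *s Z' k)" if "i < m" for i
    by (rule orthonormal_span_expansion[OF Z'(1) finite_lessThan]) (simp only: Z'(2) ZS that)
  have ex': "Z' i = (\<Sum>k<m. herm_inner (Z' i) (Z k) *s Z k)" if "i < m" for i
    by (rule orthonormal_span_expansion[OF Z(1) finite_lessThan]) (simp only: Z(2) ZS that)
  have PQ: "(\<Sum>k<m. herm_inner (Z i) (Z' k) * cnj (herm_inner (Z j) (Z' k))) = (if i = j then 1 else 0)"
    if "i < m" "j < m" for i j
  proof -
    have "herm_inner (Z i) (Z j) = (\<Sum>k<m. herm_inner (Z i) (Z' k) * cnj (herm_inner (Z j) (Z' k)))"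
      by (subst (1) ex[OF that(1)]) (simp add: herm_inner_sum_left herm_inner_simps herm_inner_commute[of "Z' _" "Z j"])
    thus ?thesis using Z(1) that by (simp add: orthonormal_family_def)
  qed
  have QP: "(\<Sum>k<m. cnj (herm_inner (Z k) (Z' i)) * herm_inner (Z k) (Z' j)) = (if i = j then 1 else 0)"
    if "i < m" "j < m" for i j
  proof -
    have "herm_inner (Z' i) (Z' j) = (\<Sum>k<m. cnj (herm_inner (Z k) (Z' i)) * herm_inner (Z k) (Z' j))"
      by (subst (1) ex'[OF that(1)]) (simp add: herm_inner_sum_left herm_inner_simps herm_inner_commute[of "Z' i" "Z _"])
    thus ?thesis using Z'(1) that by (simp add: orthonormal_family_def)
  qed
  have A: "sesq h (Z i) (Z j) = (\<Sum>k<m. herm_inner (Z i) (Z' k) * l k * cnj (herm_inner (Z j) (Z' k)))"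
    if "i < m" "j < m" for i j
  proof -
    have "sesq h (Z i) (Z j) = (\<Sum>k<m. \<Sum>k'<m. herm_inner (Z i) (Z' k) * (cnj (herm_inner (Z j) (Z' k')) * sesq h (Z' k) (Z' k')))"
    proof -
      have "sesq h (Z i) (Z j) = sesq h (\<Sum>k<m. herm_inner (Z i) (Z' k) *s Z' k) (\<Sum>k<m. herm_inner (Z j) (Z' k) *s Z' k)"
        by (simp only: ex[OF that(1), symmetric] ex[OF that(2), symmetric])
      also have "\<dots> = (\<Sum>k<m. \<Sum>k'<m. herm_inner (Z i) (Z' k) * (cnj (herm_inner (Z j) (Z' k')) * sesq h (Z' k) (Z' k')))"
        unfolding sesq_sum_left by (simp only: sesq_sum_right sesq_simps sum_distrib_left mult.left_commute)
      finally show ?thesis .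
    qed
    also have "\<dots> = (\<Sum>k<m. \<Sum>k'<m. if k = k' then herm_inner (Z i) (Z' k) * l k * cnj (herm_inner (Z j) (Z' k)) else 0)"
      by (intro sum.cong refl) (auto simp: diag)
    finally show ?thesis by simp
  qed
  have "?P * ?Q = 1\<^sub>m m" by (rule eq_matI) (auto simp: scalar_prod_def PQ atLeast0LessThan)
  moreover have "?Q * ?P = 1\<^sub>m m" by (rule eq_matI) (auto simp: scalar_prod_def QP atLeast0LessThan)
  moreover have "?A = ?P * ?D * ?Q"
  proof (rule eq_matI)
    fix i j assume "i < dim_row (?P * ?D * ?Q)" "j < dim_col (?P * ?D * ?Q)"
    hence ij: "i < m" "j < m" by auto
    have "(?P * ?D) = Matrix.mat m m (\<lambda>(i, k). herm_inner (Z i) (Z' k) * l k)"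
      by (rule eq_matI) (auto simp: scalar_prod_def atLeast0LessThan if_distrib cong: if_cong)
    thus "?A $$ (i, j) = (?P * ?D * ?Q) $$ (i, j)"
      using ij by (simp add: scalar_prod_def A atLeast0LessThan)
  qed simp_all
  ultimately have "similar_mat_wit ?A ?D ?P ?Q"
    by (intro similar_mat_witI[of _ _ m]) auto
  hence "similar_mat ?A ?D" by (auto simp: similar_mat_def)
  hence "char_poly ?A = char_poly ?D" by (rule char_poly_similar)
  also have "\<dots> = (\<Prod>a\<leftarrow>diag_mat ?D. [:- a, 1:])"
    by (rule char_poly_upper_triangular[of _ m]) auto
  also have "diag_mat ?D = map l [0..<m]" by (auto simp: diag_mat_def)
  also have "(\<Prod>a\<leftarrow>map l [0..<m]. [:- a, 1:]) = (\<Prod>j<m. [:- l j, 1:])"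
    by (simp add: prod.list_conv_set_nth atLeast0LessThan)
  finally show ?thesis .
qed

text \<open>A root of one product is a root of the other, and the common factor cancels in a domain;
  this compares eigenvalues with multiplicity.\<close>

lemma prod_linear_factors_mset_eq:
  fixes A B :: "'a::idom multiset"
  assumes "(\<Prod>x\<in>#A. [:- x, 1:]) = (\<Prod>x\<in>#B. [:- x, 1:])"
  shows "A = B"
  using assms
proof (induction A arbitrary: B)
  case empty
  show ?case
  proof (cases B)
    case (add b B')
    have "poly (\<Prod>x\<in>#B. [:- x, 1:]) b = 0" by (simp add: add)
    thus ?thesis using empty by (metis image_mset_empty poly_1 prod_mset_empty zero_neq_one)
  qed simp
next
  case (add a A)
  have "poly (\<Prod>x\<in>#add_mset a A. [:- x, 1:]) a = 0" by simp
  hence "poly (\<Prod>x\<in>#B. [:- x, 1:]) a = 0" unfolding add.prems .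
  hence "a \<in># B" by (auto simp: poly_prod_mset prod_mset_zero_iff)
  then obtain B' where B: "B = add_mset a B'" by (metis insert_DiffM)
  have "[:- a, 1:] * (\<Prod>x\<in>#A. [:- x, 1:]) = [:- a, 1:] * (\<Prod>x\<in>#B'. [:- x, 1:])"
    using add.prems by (simp only: B image_mset_add_mset prod_mset.add_mset)
  hence "(\<Prod>x\<in>#A. [:- x, 1:]) = (\<Prod>x\<in>#B'. [:- x, 1:])"
    by (simp only: mult_cancel_left) simp
  thus ?case using add.IH B by simp
qed

lemma prod_linear_factors_permutation:
  fixes f g :: "nat => 'a::idom"
  assumes "(\<Prod>j<m. [:- f j, 1:]) = (\<Prod>j<m. [:- g j, 1:])"
  obtains p where "p permutes {..<m}" "\<And>j. j < m ==> f j = g (p j)"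
proof -
  have "(\<Prod>x\<in>#mset (map f [0..<m]). [:- x, 1:]) = (\<Prod>j<m. [:- f j, 1:])" for f :: "nat => 'a"
    by (simp add: image_mset.compositionality o_def prod_unfold_prod_mset lessThan_atLeast0)
  hence "mset (map f [0..<m]) = mset (map g [0..<m])"
    using assms by (intro prod_linear_factors_mset_eq) simp
  then obtain p where p: "p permutes {..<length (map g [0..<m])}" "permute_list p (map g [0..<m]) = map f [0..<m]"
    by (rule mset_eq_permutation)
  have "f j = g (p j)" if "j < m" for j
  proof -
    have pj: "p j < m" using permutes_in_image[OF p(1), of j] that by simp
    have "f j = permute_list p (map g [0..<m]) ! j" using that p(2) by simp
    also have "\<dots> = g (p j)" using that pj by (simp add: permute_list_nth[OF p(1)])
    finally show ?thesis .
  qed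
  thus ?thesis using p(1) by (intro that[of p]) simp_all
qed

lemma levi_form_sesq: "levi_form \<rho> x = sesq (\<lambda>j k. d_z j (d_zbar k (\<lambda>y. complex_of_real (\<rho> y))) x)"
  by (simp add: fun_eq_iff levi_form_def sesq_def)

text \<open>The definition of \<open>levi_eigenvalues\<close> offers a basis of which only the
  characteristic polynomial is known. A diagonalising orthonormal basis of the same space has the
  same polynomial, hence the same entries up to a permutation, and the permutation is absorbed into
  the order of the basis. The ordering of \<open>\<mu>\<close> is thus inherited by the
  eigenvectors.\<close>

lemma levi_eigenbasis:
  fixes \<rho> :: "complex ^ 'n::finite => real"
  assumes eig: "levi_eigenvalues D \<rho> x \<mu>"
    and herm: "\<And>j k. d_z k (d_zbar j (\<lambda>y. complex_of_real (\<rho> y))) x = cnj (d_z j (d_zbar k (\<lambda>y. complex_of_real (\<rho> y))) x)"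
  obtains Z where "orthonormal_family {..<CARD('n) - 1} Z" "vec.span (Z ` {..<CARD('n) - 1}) = T10_boundary D x"
    "\<And>i j. i < CARD('n) - 1 ==> j < CARD('n) - 1 ==>
       levi_form \<rho> x (Z i) (Z j) = (if i = j then complex_of_real (\<mu> (Suc i)) else 0)"
proof -
  let ?m = "CARD('n) - 1" and ?h = "\<lambda>j k. d_z j (d_zbar k (\<lambda>y. complex_of_real (\<rho> y))) x"
  obtain Z where Z: "orthonormal_family {..<?m} Z" "vec.span (Z ` {..<?m}) = T10_boundary D x"
    "char_poly (Matrix.mat ?m ?m (\<lambda>(i, j). levi_form \<rho> x (Z i) (Z j))) = (\<Prod>j = 1..?m. [:- complex_of_real (\<mu> j), 1:])"
    using eig unfolding levi_eigenvalues_def by blast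
  have sub: "vec.subspace (T10_boundary D x)" using vec.subspace_span[of "Z ` {..<?m}"] unfolding Z(2) .
  obtain Z' :: "nat => complex ^ 'n" and l m where Z': "orthonormal_family {..<m} Z'" "vec.span (Z' ` {..<m}) = T10_boundary D x"
    "\<And>i j. i < m ==> j < m ==> sesq ?h (Z' i) (Z' j) = (if i = j then complex_of_real (l i) else 0)"
    using hermitian_eigenbasis_subspace[of ?h, OF herm sub] by blast
  have dim: "vec.dim (T10_boundary D x) = k" if "orthonormal_family {..<k} Y" "vec.span (Y ` {..<k}) = T10_boundary D x"
    for k and Y :: "nat => complex ^ 'n"
  proof -
    have "vec.span (Y ` {..<k}) = vec.span (T10_boundary D x)"
      unfolding that(2) by (rule vec.span_eq_iff[THEN iffD2, OF sub, symmetric])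
    from vec.dim_eq_card[OF this orthonormal_independent[OF that(1) finite_lessThan]]
    show ?thesis by (simp add: card_image[OF orthonormal_inj[OF that(1)]])
  qed
  have m: "m = ?m" using dim[OF Z(1,2)] dim[OF Z'(1,2)] by simp
  note Z' = Z'[unfolded m]
  have "(\<Prod>j<?m. [:- complex_of_real (l j), 1:]) = (\<Prod>j = 1..?m. [:- complex_of_real (\<mu> j), 1:])"
    using char_poly_sesq_eigenbasis[OF Z(1,2) Z'(1,2), of ?h "\<lambda>i. complex_of_real (l i)"] Z'(3) Z(3)
    by (simp add: levi_form_sesq)
  \<comment> \<open>Eigenvalues are numbered from 1, basis vectors from 0; hence the
    \<open>Suc\<close>.\<close>
  also have "\<dots> = (\<Prod>j<?m. [:- complex_of_real (\<mu> (Suc j)), 1:])"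
    by (rule prod.reindex_bij_witness[where i=Suc and j="\<lambda>j. j - 1"]) auto
  finally obtain p where p: "p permutes {..<?m}" "\<And>j. j < ?m ==> complex_of_real (\<mu> (Suc j)) = complex_of_real (l (p j))"
    using prod_linear_factors_permutation[of "\<lambda>j. complex_of_real (\<mu> (Suc j))" ?m "\<lambda>j. complex_of_real (l j)"] by metis
  have pin: "p i < ?m" if "i < ?m" for i using permutes_in_image[OF p(1), of i] that by simp
  have pinj: "p i = p j \<longleftrightarrow> i = j" for i j using permutes_inj[OF p(1)] by (auto dest: injD)
  have img: "(\<lambda>i. Z' (p i)) ` {..<?m} = Z' ` {..<?m}"
    unfolding image_image[symmetric, of Z' p] permutes_image[OF p(1)] ..
  show ?thesis
  proof (rule that[of "\<lambda>i. Z' (p i)"])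
    show "orthonormal_family {..<?m} (\<lambda>i. Z' (p i))"
      using Z'(1) pin pinj unfolding orthonormal_family_def by simp
    show "vec.span ((\<lambda>i. Z' (p i)) ` {..<?m}) = T10_boundary D x" unfolding img by (rule Z'(2))
    show "levi_form \<rho> x (Z' (p i)) (Z' (p j)) = (if i = j then complex_of_real (\<mu> (Suc i)) else 0)"
      if "i < ?m" "j < ?m" for i j
      using Z'(3)[OF pin[OF that(1)] pin[OF that(2)]] p(2)[OF that(1)]
      by (cases "i = j") (simp_all add: levi_form_sesq pinj)
  qed
qed

section \<open>Integrals over the domain\<close>

abbreviation leb where "leb D \<equiv> lebesgue_on D"
abbreviation meas where "meas D \<equiv> borel_measurable (lebesgue_on D)"

lemma continuous_measurable_lebesgue_on:
  assumes "open D" "continuous_on D h" shows "h \<in> meas D"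
  using assms by (intro continuous_imp_measurable_on_sets_lebesgue) auto

lemma continuous_UNIV_meas:
  assumes "open D" "continuous_on UNIV h" shows "h \<in> meas D"
  by (intro continuous_measurable_lebesgue_on assms continuous_on_subset[OF assms(2)]) auto

lemma
  fixes h :: "'a::euclidean_space => 'b::{banach, second_countable_topology}"
  assumes "open D" "continuous_on UNIV h" "compact K" "\<And>x. x \<notin> K ==> h x = 0"
  shows integrable_lebesgue_on_continuous_compact: "integrable (leb D) h"
    and integral_lebesgue_on_continuous_compact: "(\<And>x. x \<notin> D ==> h x = 0) ==> (LINT x|leb D. h x) = (LINT x|lborel. h x)"
proof -
  have m: "h \<in> borel_measurable lborel" using borel_measurable_continuous_onI[OF assms(2)] by simp
  have s: "D \<inter> space lebesgue \<in> sets lebesgue" using assms(1) by simp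
  have i: "integrable lborel h" by (rule integrable_continuous_compact[OF assms(2-4)])
  hence "integrable lborel (\<lambda>x. indicator D x *\<^sub>R h x)"
    using assms(1) by (intro integrable_mult_indicator) auto
  hence "integrable lebesgue (\<lambda>x. indicator D x *\<^sub>R h x)"
    by (subst integrable_completion) (auto intro: borel_measurable_integrable)
  thus "integrable (leb D) h" by (simp add: integrable_restrict_space[OF s])
  assume z: "\<And>x. x \<notin> D ==> h x = 0"
  have "(LINT x|leb D. h x) = (LINT x|lebesgue. indicator D x *\<^sub>R h x)"
    by (rule integral_restrict_space[OF s])
  also have "(\<lambda>x. indicator D x *\<^sub>R h x) = h" using z by (auto simp: fun_eq_iff indicator_def)
  also have "(LINT x|lebesgue. h x) = (LINT x|lborel. h x)" by (rule integral_completion[OF m])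
  finally show "(LINT x|leb D. h x) = (LINT x|lborel. h x)" .
qed

lemma integrable_indicator_compact_lebesgue_on:
  assumes "open D" "compact (K :: 'a::euclidean_space set)"
  shows "integrable (leb D) (\<lambda>x. indicator K x :: real)"
proof -
  have s: "D \<inter> space lebesgue \<in> sets lebesgue" using assms(1) by simp
  have "integrable lborel (\<lambda>x. indicator D x *\<^sub>R (indicator K x :: real))"
    using assms by (intro integrable_mult_indicator integrable_real_indicator emeasure_compact_finite) (auto simp: compact_imp_closed borel_closed)
  hence "integrable lebesgue (\<lambda>x. indicator D x *\<^sub>R (indicator K x :: real))"
    by (subst integrable_completion) (auto intro: borel_measurable_integrable)
  thus ?thesis by (simp add: integrable_restrict_space[OF s])
qed

text \<open>On the compact set \<open>|f|\<close> is at most \<open>|f|^2 + 1\<close>. The majorant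
  depends on the test function only through its bound and its support, as dominated convergence
  requires.\<close>

lemma L2_times_bounded:
  assumes "open D" "f \<in> meas D" "L2_normsq D f < \<infinity>"
    "compact K" "h \<in> meas D" "\<And>x. x \<in> D ==> cmod (h x) \<le> B * indicator K x" "B \<ge> 0"
  shows "integrable (leb D) (\<lambda>x. f x * h x)"
    and "integrable (leb D) (\<lambda>x. B * ((cmod (f x))^2 + indicator K x))"
    and "x \<in> D ==> cmod (f x * h x) \<le> B * ((cmod (f x))^2 + indicator K x)"
proof -
  have sq: "integrable (leb D) (\<lambda>x. (cmod (f x))^2)"
    using assms(2,3) by (intro integrableI_bounded) (auto simp: L2_normsq_def)
  show i: "integrable (leb D) (\<lambda>x. B * ((cmod (f x))^2 + indicator K x))"
    by (intro integrable_mult_right Bochner_Integration.integrable_add sq integrable_indicator_compact_lebesgue_on assms)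
  show le: "cmod (f x * h x) \<le> B * ((cmod (f x))^2 + indicator K x)" if "x \<in> D" for x
  proof (cases "x \<in> K")
    case True
    hence b: "cmod (h x) \<le> B" using assms(6)[OF that] by simp
    have "cmod (f x) \<le> (cmod (f x))^2 + 1"
      using zero_le_power2[of "cmod (f x) - 1 / 2"] by (simp add: power2_eq_square algebra_simps)
    hence "cmod (f x) * cmod (h x) \<le> ((cmod (f x))^2 + 1) * B"
      using b by (intro mult_mono) auto
    thus ?thesis using True by (simp add: norm_mult mult.commute)
  next
    case False
    hence "h x = 0" using assms(6)[OF that] by simp
    thus ?thesis using assms(7) by simp
  qed
  show "integrable (leb D) (\<lambda>x. f x * h x)"
  proof (rule Bochner_Integration.integrable_bound[OF i])
    show "AE x in leb D. cmod (f x * h x) \<le> norm (B * ((cmod (f x))^2 + indicator K x))"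
    proof (rule AE_I2)
      fix x assume "x \<in> space (leb D)"
      hence "x \<in> D" by simp
      from le[OF this] show "cmod (f x * h x) \<le> norm (B * ((cmod (f x))^2 + indicator K x))" by simp
    qed
  qed (use assms in measurable)
qed

lemma L2_dominated_limit:
  fixes f h :: "complex ^ 'n::finite => complex"
  assumes "open D" "f \<in> meas D" "L2_normsq D f < \<infinity>" "compact K"
    and m: "\<And>k. \<phi> k \<in> meas D" "h \<in> meas D"
    and b: "\<And>k x. x \<in> D ==> cmod (\<phi> k x) \<le> B * indicator K x" "B \<ge> 0"
    and l: "\<And>x. x \<in> D ==> (\<lambda>k. \<phi> k x) \<longlonglongrightarrow> h x"
  shows "(\<lambda>k. LINT x|leb D. f x * \<phi> k x) \<longlonglongrightarrow> (LINT x|leb D. f x * h x)"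
proof (rule integral_dominated_convergence[where w="\<lambda>x. B * ((cmod (f x))^2 + indicator K x)"])
  show "integrable (leb D) (\<lambda>x. B * ((cmod (f x))^2 + indicator K x))"
    by (rule L2_times_bounded(2)[OF assms(1-4) m(1) b])
  show "AE x in leb D. (\<lambda>k. f x * \<phi> k x) \<longlonglongrightarrow> f x * h x"
    by (rule AE_I2) (use l in \<open>auto intro!: tendsto_intros\<close>)
  show "AE x in leb D. cmod (f x * \<phi> k x) \<le> B * ((cmod (f x))^2 + indicator K x)" for k
    by (rule AE_I2) (use L2_times_bounded(3)[OF assms(1-4) m(1) b] in simp)
qed (use assms in measurable)

lemma L2_integral_zero_extend:
  fixes f h :: "complex ^ 'n::finite => complex"
  assumes "open D" "f \<in> meas D" "L2_normsq D f < \<infinity>"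
    and z: "\<And>\<phi>. test_function D \<phi> ==> (LINT x|leb D. f x * \<phi> x) = 0"
    and h: "continuous_on UNIV h" "compact K" "\<And>x. x \<notin> K ==> h x = 0" "K \<subseteq> D"
  shows "(LINT x|leb D. f x * h x) = 0"
proof -
  obtain \<phi> K' where a: "compact K'" "K' \<subseteq> D" "\<And>k. test_function D (\<phi> k)"
    "\<And>k x. x \<notin> K' ==> \<phi> k x = 0" "\<And>x. (\<lambda>k. \<phi> k x) \<longlonglongrightarrow> h x" "\<exists>B. \<forall>k x. cmod (\<phi> k x) \<le> B"
    by (rule test_function_approx[OF h(1,2) _ h(4) assms(1)], erule h(3)) (rule that; assumption)
  then obtain B where B: "\<And>k x. cmod (\<phi> k x) \<le> B" by blast
  have B0: "B \<ge> 0" using B[of 0 0] norm_ge_zero[of "\<phi> 0 0"] by linarith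
  have c: "continuous_on UNIV (\<phi> k)" for k
    using a(3)[of k] unfolding test_function_def by (metis Ck_on.simps(1))
  have "(\<lambda>k. LINT x|leb D. f x * \<phi> k x) \<longlonglongrightarrow> (LINT x|leb D. f x * h x)"
  proof (rule L2_dominated_limit[OF assms(1-3) a(1)])
    show "\<phi> k \<in> meas D" for k
      by (rule continuous_UNIV_meas[OF assms(1) c])
    show "h \<in> meas D"
      by (rule continuous_UNIV_meas[OF assms(1) h(1)])
    show "cmod (\<phi> k x) \<le> B * indicator K' x" for k x
      using B[of k x] a(4)[of x k] by (cases "x \<in> K'") auto
  qed (use a(5) B0 in auto)
  thus ?thesis by (simp add: z[OF a(3)] LIMSEQ_const_iff)
qed

text \<open>Tent functions of the distance to \<open>K\<close>, of width \<open>d / (k + 1)\<close>,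
  decrease to the indicator; they carry the vanishing from continuous functions over to compact
  sets.\<close>

lemma L2_integral_zero_compact:
  fixes f :: "complex ^ 'n::finite => complex"
  assumes "open D" "f \<in> meas D" "L2_normsq D f < \<infinity>"
    and z: "\<And>\<phi>. test_function D \<phi> ==> (LINT x|leb D. f x * \<phi> x) = 0"
    and K: "compact K" "K \<subseteq> D" "K \<noteq> {}"
  shows "(LINT x|leb D. f x * indicator K x) = 0"
proof -
  obtain d where d: "d > 0" "{x. infdist x K \<le> d} \<subseteq> D"
    using compact_in_open_separated[OF K(3) K(1) assms(1) K(2)] by blast
  define c where "c k x = complex_of_real (max 0 (1 - real (Suc k) / d * infdist x K))" for k x
  let ?K = "{x. infdist x K \<le> d}"
  have cK: "compact ?K" by (rule compact_infdist_le[OF K(3) K(1) d(1)])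
  have cc: "continuous_on UNIV (c k)" for k unfolding c_def by (intro continuous_intros)
  have c0: "c k x = 0" if "x \<notin> ?K" for k x
  proof -
    have "d \<le> infdist x K" using that by simp
    hence "1 \<le> infdist x K / d" using d(1) by simp
    also have "\<dots> \<le> real (Suc k) * (infdist x K / d)"
      using mult_right_mono[of 1 "real (Suc k)" "infdist x K / d"] d(1) infdist_nonneg[of x K] by simp
    finally show ?thesis by (simp add: c_def max_def)
  qed
  have lim: "(\<lambda>k. LINT x|leb D. f x * c k x) \<longlonglongrightarrow> (LINT x|leb D. f x * indicator K x)"
  proof (rule L2_dominated_limit[OF assms(1-3) cK, where B=1])
    show "c k \<in> meas D" for k
      by (rule continuous_UNIV_meas[OF assms(1) cc])
    have "K \<in> sets borel" using K(1) by (simp add: compact_imp_closed borel_closed)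
    hence "(\<lambda>x. indicator K x :: complex) \<in> borel_measurable lebesgue"
      by (intro measurable_completion) (auto intro!: borel_measurable_indicator)
    thus "(\<lambda>x. indicator K x :: complex) \<in> meas D"
      by (rule measurable_restrict_space1)
    show "cmod (c k x) \<le> 1 * indicator ?K x" for k x
    proof (cases "x \<in> ?K")
      case True
      have "0 \<le> real (Suc k) / d * infdist x K" using d(1) infdist_nonneg[of x K] by simp
      hence "max 0 (1 - real (Suc k) / d * infdist x K) \<le> 1" by linarith
      thus ?thesis using True unfolding c_def norm_of_real by simp
    qed (use c0 in simp)
    show "(\<lambda>k. c k x) \<longlonglongrightarrow> indicator K x" for x
    proof (cases "x \<in> K")
      case True
      thus ?thesis by (simp add: c_def)
    next
      case False
      hence p: "infdist x K > 0"
        using K(1,3) in_closed_iff_infdist_zero[of K x] infdist_nonneg[of x K] by (auto simp: compact_imp_closed less_le)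
      have "\<forall>\<^sub>F k in sequentially. c k x = 0"
      proof -
        obtain N :: nat where N: "d / infdist x K < real N" using reals_Archimedean2 by blast
        have "c k x = 0" if "k \<ge> N" for k
        proof -
          have "d / infdist x K < real (Suc k)" using N that by linarith
          hence "1 \<le> real (Suc k) / d * infdist x K" using p d(1) by (simp add: field_simps)
          thus ?thesis by (simp add: c_def max_def)
        qed
        thus ?thesis by (auto simp: eventually_sequentially)
      qed
      thus ?thesis using False by (simp add: tendsto_eventually)
    qed
  qed simp
  have "(LINT x|leb D. f x * c k x) = 0" for k
    by (rule L2_integral_zero_extend[OF assms(1-3) z cc cK c0 d(2)])
  thus ?thesis using lim by (simp add: LIMSEQ_const_iff)
qed

text \<open>The integral over any compact subset vanishes although the integrand is positive there,
  so every compact subset is null. A measurable set is, up to a null set, a countable union of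
  compact sets.\<close>

lemma L2_Re_pos_null:
  fixes f :: "complex ^ 'n::finite => complex"
  assumes "open D" "f \<in> meas D" "L2_normsq D f < \<infinity>"
    and z: "\<And>\<phi>. test_function D \<phi> ==> (LINT x|leb D. f x * \<phi> x) = 0"
  shows "{x \<in> D. Re (c * f x) > 0} \<in> null_sets lebesgue"
proof -
  let ?S = "{x \<in> D. Re (c * f x) > 0}"
  have "(\<lambda>x. Re (c * f x)) \<in> meas D" using assms(2) by measurable
  hence "{x \<in> space (leb D). Re (c * f x) > 0} \<in> sets (leb D)" by measurable
  hence S: "?S \<in> sets lebesgue"
    using assms(1) by (subst (asm) sets_restrict_space_iff) (auto simp: space_restrict_space)
  have null: "K \<in> null_sets lebesgue" if K: "compact K" "K \<subseteq> ?S" for K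
  proof (cases "K = {}")
    case False
    let ?g = "\<lambda>x. Re (c * (f x * indicator K x))"
    have Ks: "K \<subseteq> D" using K by auto
    have Kb: "K \<in> sets borel" using K(1) by (simp add: compact_imp_closed borel_closed)
    hence "(\<lambda>x. indicator K x :: complex) \<in> borel_measurable lebesgue"
      by (intro measurable_completion) (auto intro!: borel_measurable_indicator)
    hence im: "(\<lambda>x. indicator K x :: complex) \<in> meas D"
      by (rule measurable_restrict_space1)
    have "integrable (leb D) (\<lambda>x. f x * indicator K x)"
      by (rule L2_times_bounded(1)[OF assms(1-3) K(1) im, where B=1]) (simp_all add: indicator_def)
    hence i: "integrable (leb D) (\<lambda>x. c * (f x * indicator K x))" by (rule integrable_mult_right)
    have nn: "0 \<le> ?g x" for x
      using K by (cases "x \<in> K") (auto intro: less_imp_le)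
    have "(LINT x|leb D. ?g x) = Re (LINT x|leb D. c * (f x * indicator K x))"
      by (rule integral_Re[OF i])
    also have "\<dots> = 0" using L2_integral_zero_compact[OF assms(1-3) z K(1) Ks False] by simp
    finally have "AE x in leb D. ?g x = 0"
      using integral_nonneg_eq_0_iff_AE[OF integrable_Re[OF i]] nn by simp
    moreover have "\<And>x. x \<in> K ==> ?g x \<noteq> 0" using K by fastforce
    ultimately have "AE x in leb D. x \<notin> K" by (auto elim!: AE_mp)
    hence "AE x in lebesgue. x \<in> D --> x \<notin> K"
      using assms(1) by (subst (asm) AE_restrict_space_iff) auto
    hence "AE x in lebesgue. x \<notin> K" using Ks by (auto elim!: AE_mp)
    thus ?thesis using Kb by (subst AE_iff_null_sets) auto
  qed simp
  obtain C T where CT: "fsigma C" "T \<in> null_sets lebesgue" "C \<union> T = ?S"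
    by (rule lebesgue_set_almost_fsigma[OF S]) (rule that; assumption)
  have "C \<in> null_sets lebesgue"
  proof -
    obtain F where F: "\<And>n::nat. compact (F n)" "C = (\<Union>n. F n)"
      using CT(1) unfolding fsigma_Union_compact by (metis image_subset_iff mem_Collect_eq UNIV_I)
    have "F n \<in> null_sets lebesgue" for n
      by (rule null[OF F(1)]) (use F(2) CT(3) in blast)
    thus ?thesis unfolding F(2) by (intro null_sets_UN) auto
  qed
  thus ?thesis using CT(2,3) null_sets.Un by metis
qed

text \<open>The operators \<open>dbar\<close> and \<open>dbar_star\<close> are chosen by
  \<open>SOME\<close>. Their norms can be computed only because weak solutions are unique up to null
  sets, and this is the source of that uniqueness.\<close>

lemma fundamental_lemma_variations:
  fixes f :: "complex ^ 'n::finite => complex"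
  assumes "open D" "f \<in> meas D" "L2_normsq D f < \<infinity>"
    and z: "\<And>\<phi>. test_function D \<phi> ==> (LINT x|leb D. f x * \<phi> x) = 0"
  shows "AE x in leb D. f x = 0"
proof -
  have n: "AE x in lebesgue. \<not> (x \<in> D \<and> Re (c * f x) > 0)" for c
    using AE_not_in[OF L2_Re_pos_null[OF assms, of c]] by simp
  \<comment> \<open>The factors 1 and -1 confine the real part of \<open>f\<close> from both sides,
    the factors \<open>\<i>\<close> and \<open>-\<i>\<close> the imaginary part.\<close>
  have "AE x in lebesgue. x \<in> D --> f x = 0"
    using n[of 1] n[of "-1"] n[of "\<i>"] n[of "-\<i>"] by eventually_elim (auto simp: complex_eq_iff)
  thus ?thesis using assms(1) by (subst AE_restrict_space_iff) auto
qed

lemma L2_normsq_diff_finite: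
  assumes "f \<in> meas D" "L2_normsq D f < \<infinity>"
    "g \<in> meas D" "L2_normsq D g < \<infinity>"
  shows "L2_normsq D (\<lambda>x. f x - g x) < \<infinity>"
proof -
  have "L2_normsq D (\<lambda>x. f x - g x) \<le> (\<integral>\<^sup>+x. 2 * ennreal ((cmod (f x))^2) + 2 * ennreal ((cmod (g x))^2) \<partial>leb D)"
    unfolding L2_normsq_def
  proof (rule nn_integral_mono)
    fix x
    have "(cmod (f x - g x))^2 \<le> (cmod (f x) + cmod (g x))^2" by (intro power_mono norm_triangle_ineq4) simp
    also have "\<dots> \<le> 2 * (cmod (f x))^2 + 2 * (cmod (g x))^2"
      using zero_le_power2[of "cmod (f x) - cmod (g x)"] by (simp add: power2_eq_square algebra_simps)
    finally have "ennreal ((cmod (f x - g x))^2) \<le> ennreal (2 * (cmod (f x))^2 + 2 * (cmod (g x))^2)" by (rule ennreal_leI)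
    thus "ennreal ((cmod (f x - g x))^2) \<le> 2 * ennreal ((cmod (f x))^2) + 2 * ennreal ((cmod (g x))^2)"
      by (simp add: ennreal_plus ennreal_mult)
  qed
  also have "\<dots> = 2 * L2_normsq D f + 2 * L2_normsq D g"
    unfolding L2_normsq_def using assms(1,3) by (simp add: nn_integral_add nn_integral_cmult)
  also have "\<dots> < \<infinity>" using assms(2,4) by (simp add: ennreal_mult_less_top)
  finally show ?thesis .
qed

lemma L2_normsq_cong_AE:
  "AE x in leb D. f x = g x ==> L2_normsq D f = L2_normsq D g"
  unfolding L2_normsq_def by (rule nn_integral_cong_AE) auto

lemma L2_normsq_continuous_compact:
  assumes "open D" "continuous_on UNIV h" "compact K" "\<And>x. x \<notin> K ==> h x = 0"
  shows "L2_normsq D h = ennreal (LINT x|leb D. (cmod (h x))^2)"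
  unfolding L2_normsq_def
  by (rule nn_integral_eq_integral[OF integrable_lebesgue_on_continuous_compact[OF assms(1) _ assms(3)]])
     (auto intro!: continuous_intros assms)

section \<open>Wirtinger derivatives\<close>

lemma d_z_eq:
  assumes "(f has_derivative f') (at x)"
  shows "d_z j f x = (f' (axis j 1) - \<i> * f' (axis j \<i>)) / 2"
    and "d_zbar j f x = (f' (axis j 1) + \<i> * f' (axis j \<i>)) / 2"
  using frechet_derivative_at[OF assms] by (simp_all add: d_z_def d_zbar_def)

lemma d_z_mult:
  assumes "f differentiable (at x)" "g differentiable (at x)"
  shows "d_z j (\<lambda>x. f x * g x) x = f x * d_z j g x + d_z j f x * g x"
    and "d_zbar j (\<lambda>x. f x * g x) x = f x * d_zbar j g x + d_zbar j f x * g x"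
proof -
  note d = has_derivative_mult[OF assms[unfolded frechet_derivative_works]]
  show "d_z j (\<lambda>x. f x * g x) x = f x * d_z j g x + d_z j f x * g x"
    unfolding d_z_eq(1)[OF d] unfolding d_z_def by (simp add: algebra_simps add_divide_distrib diff_divide_distrib)
  show "d_zbar j (\<lambda>x. f x * g x) x = f x * d_zbar j g x + d_zbar j f x * g x"
    unfolding d_z_eq(2)[OF d] unfolding d_zbar_def by (simp add: algebra_simps add_divide_distrib diff_divide_distrib)
qed

lemma d_z_cnj:
  assumes "f differentiable (at x)"
  shows "d_z j (\<lambda>x. cnj (f x)) x = cnj (d_zbar j f x)" "d_zbar j (\<lambda>x. cnj (f x)) x = cnj (d_z j f x)"
proof -
  note d = bounded_linear.has_derivative[OF bounded_linear_cnj assms[unfolded frechet_derivative_works]]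
  show "d_z j (\<lambda>x. cnj (f x)) x = cnj (d_zbar j f x)"
    unfolding d_z_eq(1)[OF d] unfolding d_zbar_def by simp
  show "d_zbar j (\<lambda>x. cnj (f x)) x = cnj (d_z j f x)"
    unfolding d_z_eq(2)[OF d] unfolding d_z_def by simp
qed

lemma d_z_continuous:
  assumes "Ck_on 1 S f" shows "continuous_on S (d_z j f)" "continuous_on S (d_zbar j f)"
  unfolding d_z_def[abs_def] d_zbar_def[abs_def]
  using Ck_on_1D(2)[OF assms] by (auto intro!: continuous_intros)

lemma d_z_outside:
  assumes "closed K" "\<And>x. x \<notin> K ==> f x = 0" "x \<notin> K"
  shows "d_z j f x = 0" "d_zbar j f x = 0"
  using frechet_derivative_eq_0_outside[OF assms] by (simp_all add: d_z_def d_zbar_def)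

lemma integral_d_z_eq_0:
  fixes h :: "complex ^ 'n::finite => complex"
  assumes "C1_compact h"
  shows "(LINT x|lborel. d_z j h x) = 0" "(LINT x|lborel. d_zbar j h x) = 0"
proof -
  have C1: "Ck_on 1 UNIV h" using assms by (simp add: C1_compact_def)
  obtain K where K: "compact K" "\<And>x. x \<notin> K ==> h x = 0" "\<And>x v. x \<notin> K ==> fderiv h x v = 0"
    using C1_compact_support[OF assms] by metis
  have i: "integrable lborel (\<lambda>x. fderiv h x v)" for v
    by (rule integrable_continuous_compact[OF Ck_on_1D(2)[OF C1] K(1) K(3)])
  show "(LINT x|lborel. d_z j h x) = 0" "(LINT x|lborel. d_zbar j h x) = 0"
    unfolding d_z_def d_zbar_def using i by (simp_all add: integral_frechet_derivative_eq_0[OF assms])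
qed

lemma integral_by_parts_d_zbar:
  fixes h g :: "complex ^ 'n::finite => complex"
  assumes "C1_compact h" "Ck_on 1 UNIV g"
  shows "(LINT x|lborel. d_zbar j h x * g x) = - (LINT x|lborel. h x * d_zbar j g x)"
proof -
  have C1: "Ck_on 1 UNIV h" using assms by (simp add: C1_compact_def)
  obtain K where K: "compact K" "\<And>x. x \<notin> K ==> h x = 0"
    using C1_compact_support[OF assms(1)] by metis
  have Kd: "d_zbar j h x = 0" if "x \<notin> K" for x
    using d_z_outside(2)[OF compact_imp_closed[OF K(1)] K(2) that] by simp
  have "C1_compact (\<lambda>x. h x * g x)"
    by (rule C1_compactI[OF open_UNIV Ck_on_1_mult[OF C1 assms(2)] K(1)]) (simp_all add: K(2))
  from integral_d_z_eq_0(2)[OF this, of j]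
  have "(LINT x|lborel. h x * d_zbar j g x + d_zbar j h x * g x) = 0"
    using C1 assms(2) by (simp add: d_z_mult)
  moreover have "integrable lborel (\<lambda>x. h x * d_zbar j g x)"
    by (rule integrable_continuous_compact[OF _ K(1)])
       (auto intro!: continuous_intros Ck_on_1D(3)[OF C1] d_z_continuous(2)[OF assms(2)] simp: K)
  moreover have "integrable lborel (\<lambda>x. d_zbar j h x * g x)"
    by (rule integrable_continuous_compact[OF _ K(1)])
       (auto intro!: continuous_intros Ck_on_1D(3)[OF assms(2)] d_z_continuous(2)[OF C1] simp: Kd)
  ultimately show ?thesis by (simp add: eq_neg_iff_add_eq_0 add.commute)
qed

section \<open>Cutting off at the boundary\<close>

text \<open>A C1 step is enough for all cutoffs: the quotient of \<open>m y\<close> by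
  \<open>m y + m (1 - y)\<close>, where \<open>m\<close> is the squared positive part and the
  denominator never vanishes.\<close>

lemma smoothstep_exists:
  obtains S S' :: "real => real" and B where
    "\<And>y. (S has_real_derivative S' y) (at y)" "continuous_on UNIV S'" "\<And>y. 0 \<le> S y" "\<And>y. S y \<le> 1"
    "\<And>y. y \<le> 0 ==> S y = 0" "\<And>y. 1 \<le> y ==> S y = 1" "\<And>y. y \<le> 0 \<or> 1 \<le> y ==> S' y = 0"
    "\<And>y. \<bar>S' y\<bar> \<le> B" "B > 0"
proof -
  define m where "m y = (max 0 y)^2" for y :: real
  have m: "(m has_real_derivative 2 * max 0 y) (at y)" for y
  proof -
    consider "y > 0" | "y < 0" | "y = 0" by linarith
    thus ?thesis
    proof cases
      case 1
      have "((\<lambda>y::real. y^2) has_real_derivative 2 * y) (at y)" by (auto intro!: derivative_eq_intros)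
      hence "(m has_real_derivative 2 * y) (at y)"
        by (rule has_field_derivative_transform_within_open[OF _ open_greaterThan[of 0]]) (use 1 in \<open>auto simp: m_def\<close>)
      thus ?thesis using 1 by simp
    next
      case 2
      have "(m has_real_derivative 0) (at y)"
        by (rule has_field_derivative_transform_within_open[OF DERIV_const[of 0] open_lessThan[of 0]]) (use 2 in \<open>auto simp: m_def\<close>)
      thus ?thesis using 2 by simp
    next
      case 3
      have "(\<lambda>y. (m y - m 0) / (y - 0)) = max 0" by (auto simp: m_def fun_eq_iff max_def power2_eq_square)
      moreover have "(max 0 \<longlongrightarrow> (max 0 0 :: real)) (at 0)" by (intro tendsto_intros)
      ultimately show ?thesis using 3 unfolding has_field_derivative_iff by simp
    qed
  qed
  define D where "D y = m y + m (1 - y)" for y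
  have D: "D y > 0" for y
  proof (cases "y > 0")
    case True
    hence "m y > 0" "m (1 - y) \<ge> 0" by (simp_all add: m_def)
    thus ?thesis by (simp add: D_def)
  next
    case False
    hence "m y \<ge> 0" "m (1 - y) > 0" by (simp_all add: m_def)
    thus ?thesis by (simp add: D_def)
  qed
  define S where "S y = m y / D y" for y
  define S' where "S' y = ((2 * max 0 y) * D y - m y * (2 * max 0 y - 2 * max 0 (1 - y))) / (D y * D y)" for y
  have cont: "continuous_on UNIV S'"
    unfolding S'_def D_def m_def using D unfolding D_def m_def
    by (intro continuous_intros) (auto simp: less_imp_neq[THEN not_sym])
  have S0: "S' y = 0" if "y \<le> 0 \<or> 1 \<le> y" for y
    using that by (auto simp: S'_def D_def m_def max_def power2_eq_square algebra_simps)
  have "bounded (S' ` {0..1})"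
    by (intro compact_imp_bounded compact_continuous_image continuous_on_subset[OF cont]) auto
  then obtain B where B: "B > 0" "\<And>y. y \<in> {0..1} ==> \<bar>S' y\<bar> \<le> B" by (auto simp: bounded_pos)
  show ?thesis
  proof (rule that[of S S' B])
    show "(S has_real_derivative S' y) (at y)" for y
    proof -
      have 1: "((\<lambda>y. m (1 - y)) has_real_derivative (2 * max 0 (1 - y)) * (- 1)) (at y)"
        by (rule DERIV_chain2[OF m]) (auto intro!: derivative_eq_intros)
      have "(D has_real_derivative 2 * max 0 y - 2 * max 0 (1 - y)) (at y)"
        unfolding D_def by (rule DERIV_cong[OF DERIV_add[OF m 1]]) simp
      from DERIV_divide[OF m this] D[of y] show ?thesis unfolding S_def S'_def by simp
    qed
    show "0 \<le> S y" for y using D[of y] by (simp add: S_def m_def)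
    show "S y \<le> 1" for y using D[of y] by (simp add: S_def) (simp add: D_def m_def)
    show "S y = 0" if "y \<le> 0" for y using that by (simp add: S_def m_def)
    show "S y = 1" if "1 \<le> y" for y using that by (simp add: S_def m_def D_def)
    show "\<bar>S' y\<bar> \<le> B" for y using B S0[of y] by (cases "y \<in> {0..1}") auto
  qed (use cont S0 B in auto)
qed

lemma defining_functionD:
  assumes "defining_function D V \<rho>"
  shows "open V" "x \<in> V ==> x \<in> D \<longleftrightarrow> \<rho> x < 0" "x \<in> V ==> x \<in> frontier D \<longleftrightarrow> \<rho> x = 0"
    "x \<in> V ==> x \<in> frontier D ==> fderiv \<rho> x \<noteq> (\<lambda>_. 0)"
  using assms unfolding defining_function_def by blast+

text \<open>The complex conormal. Complex tangency of \<open>a\<close> means that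
  \<open>bil a (d_rho \<rho> x)\<close> vanishes, real tangency only that its real part
  does.\<close>

definition d_rho :: "(complex ^ 'n::finite => real) => complex ^ 'n => complex ^ 'n" where
  "d_rho \<rho> x = (\<chi> k. d_z k (\<lambda>y. complex_of_real (\<rho> y)) x)"

text \<open>The cutoff is a smooth step in \<open>- \<rho> / s k - 1\<close> with
  \<open>s k = 1 / (k + 1)\<close>. Its derivative grows like \<open>1 / s k\<close>, but only where
  \<open>- \<rho>\<close> lies between \<open>s k\<close> and \<open>2 * s k\<close>; hence
  \<open>\<eta>' * \<rho>\<close> stays bounded, and at a fixed interior point
  \<open>\<eta>'\<close> is eventually 0. Factors of size \<open>|\<rho>|\<close> therefore tame the
  cutoff.\<close>

lemma boundary_cutoff:
  fixes \<rho> :: "complex ^ 'n::finite => real"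
  assumes D: "open D" and df: "defining_function D V \<rho>" and C1: "Ck_on 1 V \<rho>" and K: "compact K" "K \<subseteq> V"
  obtains \<eta> \<eta>' :: "nat => complex ^ 'n => real" and L :: "nat => (complex ^ 'n) set" and B where
    "\<And>k. compact (L k)" "\<And>k. L k \<subseteq> K" "\<And>k. L k \<subseteq> D" "\<And>k x. x \<in> K ==> x \<notin> L k ==> \<eta> k x = 0"
    "\<And>k x. 0 \<le> \<eta> k x" "\<And>k x. \<eta> k x \<le> 1" "\<And>x. x \<in> D ==> x \<in> K ==> (\<lambda>k. \<eta> k x) \<longlonglongrightarrow> 1"
    "\<And>k x. \<bar>\<eta>' k x * \<rho> x\<bar> \<le> B" "B > 0" "\<And>x. x \<in> D ==> x \<in> K ==> \<forall>\<^sub>F k in sequentially. \<eta>' k x = 0"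
    "\<forall>k u. C1_compact u --> (\<forall>x. x \<notin> K --> u x = (0::complex)) --> C1_compact (\<lambda>x. of_real (\<eta> k x) * u x)"
    "\<forall>k u j x. C1_compact u --> (\<forall>x. x \<notin> K --> u x = (0::complex)) -->
       d_z j (\<lambda>x. of_real (\<eta> k x) * u x) x = of_real (\<eta> k x) * d_z j u x + of_real (\<eta>' k x) * (d_rho \<rho> x $ j * u x)"
proof -
  obtain S S' :: "real => real" and B where S: "\<And>y. (S has_real_derivative S' y) (at y)" "continuous_on UNIV S'" "\<And>y. 0 \<le> S y" "\<And>y. S y \<le> 1"
    "\<And>y. y \<le> 0 ==> S y = 0" "\<And>y. 1 \<le> y ==> S y = 1" "\<And>y. y \<le> 0 \<or> 1 \<le> y ==> S' y = 0"
    "\<And>y. \<bar>S' y\<bar> \<le> B" "B > 0"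
    by (rule smoothstep_exists) (rule that; assumption)
  define s where "s k = 1 / real (Suc k)" for k
  have s: "s k > 0" for k by (simp add: s_def)
  define \<eta> where "\<eta> k x = S (- \<rho> x / s k - 1)" for k x
  define \<eta>' where "\<eta>' k x = - S' (- \<rho> x / s k - 1) / s k" for k x
  define L where "L k = K \<inter> \<rho> -` {.. - s k}" for k
  note dfD = defining_functionD[OF df]
  have hd: "((\<lambda>t. S (- t / s k - 1)) has_real_derivative - S' (- t / s k - 1) / s k) (at t)" for k t
    by (rule DERIV_cong[OF DERIV_chain2[OF S(1)]]) (auto intro!: derivative_eq_intros simp: s[THEN less_imp_neq, THEN not_sym])
  have e1: "Ck_on 1 V (\<eta> k)" for k
    unfolding \<eta>_def
    by (rule Ck_on_1_compose_DERIV[OF C1 hd, where T=UNIV])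
       (use s in \<open>auto intro!: continuous_intros continuous_on_compose2[OF S(2)] simp: less_imp_neq[THEN not_sym]\<close>)
  have ev: "\<forall>\<^sub>F k in sequentially. 1 \<le> - \<rho> x / s k - 1" if "x \<in> D" "x \<in> K" for x
  proof -
    have r: "\<rho> x < 0" using dfD(2)[of x] that K by auto
    obtain N :: nat where N: "2 / (- \<rho> x) < real N" using reals_Archimedean2 by blast
    have "1 \<le> - \<rho> x / s k - 1" if "k \<ge> N" for k
    proof -
      have "2 / (- \<rho> x) < real (Suc k)" using N that by linarith
      hence "2 < - \<rho> x * real (Suc k)" using pos_divide_less_eq[of "- \<rho> x" 2 "real (Suc k)"] r by (simp add: mult.commute del: of_nat_Suc)
      thus ?thesis by (simp add: s_def del: of_nat_Suc)
    qed
    thus ?thesis by (auto simp: eventually_sequentially)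
  qed
  have c1: "C1_compact (\<lambda>x. of_real (\<eta> k x) * u x)" if u: "C1_compact u" "\<And>x. x \<notin> K ==> u x = (0::complex)" for k u
  proof (rule C1_compactI[OF dfD(1) _ K])
    show "Ck_on 1 V (\<lambda>x. of_real (\<eta> k x) * u x)"
      by (intro Ck_on_1_mult Ck_on_1_of_real e1) (use u(1) in \<open>auto simp: C1_compact_def intro: Ck_on_1_subset simp del: One_nat_def\<close>)
  qed (simp add: u(2))
  show ?thesis
  proof (rule that[of L \<eta> \<eta>' "2 * B"])
    have "closed (K \<inter> \<rho> -` {.. - s k})" for k
      by (rule continuous_closed_preimage[OF continuous_on_subset[OF Ck_on_1D(3)[OF C1] K(2)] compact_imp_closed[OF K(1)] closed_atMost])
    from compact_Int_closed[OF K(1) this] show "compact (L k)" for k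
      unfolding L_def by (simp only: inf.left_idem)
    show "L k \<subseteq> K" for k by (auto simp: L_def)
    show "L k \<subseteq> D" for k
    proof
      fix x assume x: "x \<in> L k"
      hence "\<rho> x < 0" using s[of k] by (auto simp: L_def)
      thus "x \<in> D" using dfD(2)[of x] x K(2) by (auto simp: L_def)
    qed
    show "\<eta> k x = 0" if "x \<in> K" "x \<notin> L k" for k x
    proof -
      have "- \<rho> x < s k" using that by (auto simp: L_def)
      hence "- \<rho> x / s k \<le> 1" using s[of k] by (subst pos_divide_le_eq) auto
      thus ?thesis unfolding \<eta>_def by (intro S(5)) simp
    qed
    show "(\<lambda>k. \<eta> k x) \<longlonglongrightarrow> 1" if "x \<in> D" "x \<in> K" for x
      using ev[OF that] by (intro tendsto_eventually) (auto elim!: eventually_mono simp: \<eta>_def S(6))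
    show "\<bar>\<eta>' k x * \<rho> x\<bar> \<le> 2 * B" for k x
    proof (cases "- \<rho> x / s k - 1 \<le> 0 \<or> 1 \<le> - \<rho> x / s k - 1")
      case True
      thus ?thesis using S(7)[OF True] S(9) by (simp add: \<eta>'_def)
    next
      case False
      hence "\<bar>- \<rho> x / s k\<bar> \<le> 2" by linarith
      hence "\<bar>S' (- \<rho> x / s k - 1)\<bar> * \<bar>- \<rho> x / s k\<bar> \<le> B * 2" by (intro mult_mono S(8)) (use S(9) in auto)
      thus ?thesis by (simp add: \<eta>'_def abs_mult)
    qed
    show "\<forall>\<^sub>F k in sequentially. \<eta>' k x = 0" if "x \<in> D" "x \<in> K" for x
      using ev[OF that] by (auto elim!: eventually_mono simp: \<eta>'_def S(7))
    show "\<forall>k u. C1_compact u --> (\<forall>x. x \<notin> K --> u x = (0::complex)) --> C1_compact (\<lambda>x. of_real (\<eta> k x) * u x)"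
      using c1 by blast
    have "d_z j (\<lambda>x. of_real (\<eta> k x) * u x) x = of_real (\<eta> k x) * d_z j u x + of_real (\<eta>' k x) * (d_rho \<rho> x $ j * u x)"
      if u: "C1_compact u" "\<And>x. x \<notin> K ==> u x = (0::complex)" for k u j x
    proof (cases "x \<in> K")
      case True
      hence xV: "x \<in> V" using K by auto
      note dr = Ck_on_1D(1)[OF C1 xV]
      have 1: "((\<lambda>x. complex_of_real (\<eta> k x)) has_derivative (\<lambda>v. of_real (\<eta>' k x * fderiv \<rho> x v))) (at x)"
        unfolding \<eta>_def \<eta>'_def
        by (intro has_derivative_of_real has_derivative_compose[OF dr hd[unfolded has_field_derivative_def]])
      have 2: "d_z j (\<lambda>x. complex_of_real (\<eta> k x)) x = of_real (\<eta>' k x) * d_rho \<rho> x $ j"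
        unfolding d_z_eq(1)[OF 1] d_rho_def vec_lambda_beta d_z_eq(1)[OF has_derivative_of_real[OF dr]]
        by (simp add: algebra_simps)
      have "u differentiable (at x)" using u(1) by (simp add: C1_compact_def)
      thus ?thesis
        by (subst d_z_mult(1)) (use 1 in \<open>auto simp: differentiable_def 2 mult_ac\<close>)
    next
      case False
      have "d_z j u x = 0" by (rule d_z_outside(1)[OF compact_imp_closed[OF K(1)] _ False]) (rule u(2))
      moreover have "d_z j (\<lambda>x. of_real (\<eta> k x) * u x) x = 0"
        by (rule d_z_outside(1)[OF compact_imp_closed[OF K(1)] _ False]) (simp add: u(2))
      ultimately show ?thesis using u(2)[OF False] by simp
    qed
    thus "\<forall>k u j x. C1_compact u --> (\<forall>x. x \<notin> K --> u x = (0::complex)) -->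
       d_z j (\<lambda>x. of_real (\<eta> k x) * u x) x = of_real (\<eta> k x) * d_z j u x + of_real (\<eta>' k x) * (d_rho \<rho> x $ j * u x)"
      by blast
  qed (use S in \<open>auto simp: \<eta>_def\<close>)
qed

text \<open>A divergence theorem without surface measure: the identity is trivial for the cut-off
  fields, and the error is \<open>\<eta>'\<close> times the normal component, which is dominated
  because that component is of size \<open>|\<rho>|\<close>. Only real parts are controlled, which
  admits fields that are tangential merely in the real sense.\<close>

lemma Re_integral_divergence_eq_0:
  fixes \<rho> :: "complex ^ 'n::finite => real"
  assumes D: "open D" and df: "defining_function D V \<rho>" and C1: "Ck_on 1 V \<rho>" and K: "compact K" "K \<subseteq> V"
    and Y: "\<And>k. C1_compact (Y k)" "\<And>k x. x \<notin> K ==> Y k x = 0"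
    and tang: "\<And>x. x \<in> D ==> x \<in> K ==> \<bar>Re (\<Sum>k\<in>UNIV. Y k x * d_rho \<rho> x $ k)\<bar> \<le> C * \<bar>\<rho> x\<bar>" and C0: "C \<ge> 0"
  shows "Re (LINT x|leb D. (\<Sum>k\<in>UNIV. d_z k (Y k) x)) = 0"
proof -
  obtain \<eta> \<eta>' L B where e:
    "\<And>k. compact (L k)" "\<And>k. L k \<subseteq> K" "\<And>k. L k \<subseteq> D" "\<And>k x. x \<in> K ==> x \<notin> L k ==> \<eta> k x = 0"
    "\<And>k x. 0 \<le> \<eta> k x" "\<And>k x. \<eta> k x \<le> 1" "\<And>x. x \<in> D ==> x \<in> K ==> (\<lambda>k. \<eta> k x) \<longlonglongrightarrow> 1"
    "\<And>k x. \<bar>\<eta>' k x * \<rho> x\<bar> \<le> B" "B > 0" "\<And>x. x \<in> D ==> x \<in> K ==> \<forall>\<^sub>F k in sequentially. \<eta>' k x = 0"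
    "\<forall>k u. C1_compact u --> (\<forall>x. x \<notin> K --> u x = (0::complex)) --> C1_compact (\<lambda>x. of_real (\<eta> k x) * u x)"
    "\<forall>k u j x. C1_compact u --> (\<forall>x. x \<notin> K --> u x = (0::complex)) -->
       d_z j (\<lambda>x. of_real (\<eta> k x) * u x) x = of_real (\<eta> k x) * d_z j u x + of_real (\<eta>' k x) * (d_rho \<rho> x $ j * u x)"
    by (rule boundary_cutoff[OF D df C1 K]) (rule that; assumption)
  define w where "w k j x = of_real (\<eta> k x) * Y j x" for k j x
  have w: "C1_compact (w k j)" for k j unfolding w_def using e(11) Y by blast
  have wL: "w k j x = 0" if "x \<notin> L k" for k j x using that e(4)[of x k] Y(2)[of x j] by (cases "x \<in> K") (auto simp: w_def)
  have dw: "d_z j (w k j) x = of_real (\<eta> k x) * d_z j (Y j) x + of_real (\<eta>' k x) * (d_rho \<rho> x $ j * Y j x)" for k j x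
    unfolding w_def using e(12) Y by blast
  have dwL: "d_z j (w k j) x = 0" if "x \<notin> L k" for k j x
    by (rule d_z_outside(1)[OF compact_imp_closed[OF e(1)] _ that]) (rule wL)
  have dYK: "d_z j (Y j) x = 0" if "x \<notin> K" for j x
    by (rule d_z_outside(1)[OF compact_imp_closed[OF K(1)] _ that]) (rule Y(2))
  have cY: "continuous_on UNIV (\<lambda>x. \<Sum>j\<in>UNIV. d_z j (Y j) x)"
    using Y(1) by (intro continuous_intros d_z_continuous) (auto simp: C1_compact_def)
  have cw: "continuous_on UNIV (\<lambda>x. \<Sum>j\<in>UNIV. d_z j (w k j) x)" for k
    using w by (intro continuous_intros d_z_continuous) (auto simp: C1_compact_def)
  obtain M where M: "\<And>x. cmod (\<Sum>j\<in>UNIV. d_z j (Y j) x) \<le> M" "M > 0"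
    by (rule continuous_compact_bounded[OF cY K(1)]) (auto simp: dYK)
  have i: "integrable (leb D) (\<lambda>x. \<Sum>j\<in>UNIV. d_z j (w k j) x)" for k
    by (rule integrable_lebesgue_on_continuous_compact[OF D cw e(1)[of k]]) (simp add: dwL)
  have z: "(LINT x|leb D. Re (\<Sum>j\<in>UNIV. d_z j (w k j) x)) = 0" for k
  proof -
    have "(LINT x|leb D. (\<Sum>j\<in>UNIV. d_z j (w k j) x)) = (LINT x|lborel. (\<Sum>j\<in>UNIV. d_z j (w k j) x))"
    proof (rule integral_lebesgue_on_continuous_compact[OF D cw e(1)[of k]])
      show "(\<Sum>j\<in>UNIV. d_z j (w k j) x) = 0" if "x \<notin> L k" for x using that by (simp add: dwL)
      thus "(\<Sum>j\<in>UNIV. d_z j (w k j) x) = 0" if "x \<notin> D" for x using that e(3)[of k] by blast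
    qed
    also have "\<dots> = (\<Sum>j\<in>UNIV. (LINT x|lborel. d_z j (w k j) x))"
      by (intro Bochner_Integration.integral_sum integrable_continuous_compact[OF _ e(1)[of k]])
         (use w in \<open>auto simp: dwL C1_compact_def intro: d_z_continuous\<close>)
    also have "\<dots> = 0" by (simp add: integral_d_z_eq_0(1)[OF w])
    finally show ?thesis using integral_Re[OF i] by simp
  qed
  have "(\<lambda>k. LINT x|leb D. Re (\<Sum>j\<in>UNIV. d_z j (w k j) x)) \<longlonglongrightarrow> (LINT x|leb D. Re (\<Sum>j\<in>UNIV. d_z j (Y j) x))"
  proof (rule integral_dominated_convergence[where w="\<lambda>x. (M + C * B) * indicator K x"])
    show "integrable (leb D) (\<lambda>x. (M + C * B) * indicator K x)"
      by (intro integrable_mult_right integrable_indicator_compact_lebesgue_on D K)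
    have wsum: "(\<Sum>j\<in>UNIV. d_z j (w k j) x) = of_real (\<eta> k x) * (\<Sum>j\<in>UNIV. d_z j (Y j) x)
        + of_real (\<eta>' k x) * (\<Sum>j\<in>UNIV. Y j x * d_rho \<rho> x $ j)" for k x
      by (simp add: dw sum.distrib sum_distrib_left mult_ac)
    show "AE x in leb D. (\<lambda>k. Re (\<Sum>j\<in>UNIV. d_z j (w k j) x)) \<longlonglongrightarrow> Re (\<Sum>j\<in>UNIV. d_z j (Y j) x)"
    proof (rule AE_I2)
      fix x assume "x \<in> space (leb D)"
      hence x: "x \<in> D" by simp
      show "(\<lambda>k. Re (\<Sum>j\<in>UNIV. d_z j (w k j) x)) \<longlonglongrightarrow> Re (\<Sum>j\<in>UNIV. d_z j (Y j) x)"
      proof (cases "x \<in> K")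
        case True
        have "(\<lambda>k. \<eta>' k x) \<longlonglongrightarrow> 0" using e(10)[OF x True] by (rule tendsto_eventually)
        hence "(\<lambda>k. \<Sum>j\<in>UNIV. d_z j (w k j) x) \<longlonglongrightarrow> of_real 1 * (\<Sum>j\<in>UNIV. d_z j (Y j) x) + of_real 0 * (\<Sum>j\<in>UNIV. Y j x * d_rho \<rho> x $ j)"
          unfolding wsum using e(7)[OF x True] by (intro tendsto_intros)
        thus ?thesis by (intro tendsto_Re) simp
      next
        case False
        hence "x \<notin> L k" for k using e(2) by blast
        thus ?thesis using False by (simp add: dwL dYK)
      qed
    qed
    show "AE x in leb D. norm (Re (\<Sum>j\<in>UNIV. d_z j (w k j) x)) \<le> (M + C * B) * indicator K x" for k
    proof (rule AE_I2)
      fix x assume "x \<in> space (leb D)"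
      hence x: "x \<in> D" by simp
      show "norm (Re (\<Sum>j\<in>UNIV. d_z j (w k j) x)) \<le> (M + C * B) * indicator K x"
      proof (cases "x \<in> K")
        case True
        have "Re (\<Sum>j\<in>UNIV. d_z j (w k j) x) = \<eta> k x * Re (\<Sum>j\<in>UNIV. d_z j (Y j) x) + \<eta>' k x * Re (\<Sum>j\<in>UNIV. Y j x * d_rho \<rho> x $ j)"
          unfolding wsum by simp
        moreover have "\<bar>\<eta> k x * Re (\<Sum>j\<in>UNIV. d_z j (Y j) x)\<bar> \<le> 1 * M"
          unfolding abs_mult using e(5,6)[where k=k and x=x] abs_Re_le_cmod[of "\<Sum>j\<in>UNIV. d_z j (Y j) x"] M(1)[of x] by (intro mult_mono) auto
        moreover have "\<bar>\<eta>' k x * Re (\<Sum>j\<in>UNIV. Y j x * d_rho \<rho> x $ j)\<bar> \<le> C * B"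
        proof -
          have "\<bar>\<eta>' k x * Re (\<Sum>j\<in>UNIV. Y j x * d_rho \<rho> x $ j)\<bar> \<le> \<bar>\<eta>' k x\<bar> * (C * \<bar>\<rho> x\<bar>)"
            unfolding abs_mult by (intro mult_left_mono tang x True) simp
          also have "\<dots> = C * \<bar>\<eta>' k x * \<rho> x\<bar>" by (simp add: abs_mult)
          also have "\<dots> \<le> C * B" by (intro mult_left_mono e(8) C0)
          finally show ?thesis .
        qed
        ultimately have "\<bar>Re (\<Sum>j\<in>UNIV. d_z j (w k j) x)\<bar> \<le> 1 * M + C * B" by linarith
        thus ?thesis using True by simp
      next
        case False
        hence "x \<notin> L k" using e(2) by blast
        thus ?thesis using False by (simp add: dwL)
      qed
    qed
    have "integrable (leb D) (\<lambda>x. \<Sum>j\<in>UNIV. d_z j (Y j) x)"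
      by (rule integrable_lebesgue_on_continuous_compact[OF D cY K(1)]) (simp add: dYK)
    thus "(\<lambda>x. Re (\<Sum>j\<in>UNIV. d_z j (Y j) x)) \<in> meas D" by measurable
    show "(\<lambda>x. Re (\<Sum>j\<in>UNIV. d_z j (w k j) x)) \<in> meas D" for k
      using i[of k] by measurable
  qed
  hence z': "(LINT x|leb D. Re (\<Sum>j\<in>UNIV. d_z j (Y j) x)) = 0" unfolding z by (simp add: LIMSEQ_const_iff)
  have "integrable (leb D) (\<lambda>x. \<Sum>j\<in>UNIV. d_z j (Y j) x)"
    by (rule integrable_lebesgue_on_continuous_compact[OF D cY K(1)]) (simp add: dYK)
  from integral_Re[OF this] show ?thesis unfolding z' by simp
qed

section \<open>The Cauchy--Riemann operator and its adjoint on C1 forms\<close>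

definition dbar_form :: "'n::{finite,linorder} form => 'n form" where
  "dbar_form u K x = (\<Sum>j\<in>K. ext_sign j K * d_zbar j (u (K - {j})) x)"

text \<open>The formal adjoint. It agrees with the Hilbert space adjoint for forms whose contraction
  with the conormal vanishes at the boundary.\<close>

definition dbar_adjoint_form :: "'n::{finite,linorder} form => 'n form" where
  "dbar_adjoint_form u I x = - (\<Sum>j\<in>-I. ext_sign j I * d_z j (u (insert j I)) x)"

lemma L2_form_C1_compact:
  assumes "open D" "\<And>J. C1_compact (u J)" shows "L2_form D q u"
  unfolding L2_form_def
proof (intro ballI conjI)
  fix J :: "'a set"
  have C1: "Ck_on 1 UNIV (u J)" using assms(2)[of J] by (simp add: C1_compact_def)
  obtain K where K: "compact K" "\<And>x. x \<notin> K ==> u J x = 0" using C1_compact_support[OF assms(2)[of J]] by metis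
  show "u J \<in> meas D"
    by (rule continuous_UNIV_meas[OF assms(1) Ck_on_1D(3)[OF C1]])
  show "L2_normsq D (u J) < \<infinity>"
    by (subst L2_normsq_continuous_compact[OF assms(1) Ck_on_1D(3)[OF C1] K(1)]) (auto simp: K(2))
qed

lemma L2_form_continuous_compact:
  assumes "open D" "compact K" "\<And>J. continuous_on UNIV (u J)" "\<And>J x. x \<notin> K ==> u J x = 0" shows "L2_form D q u"
  unfolding L2_form_def
proof (intro ballI conjI)
  fix J :: "'a set"
  show "u J \<in> meas D"
    by (rule continuous_UNIV_meas[OF assms(1) assms(3)])
  show "L2_normsq D (u J) < \<infinity>"
    by (subst L2_normsq_continuous_compact[OF assms(1,3,2)]) (auto simp: assms(4))
qed

lemma test_function_C1_compact: "test_function D \<phi> ==> C1_compact \<phi>"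
  unfolding test_function_def C1_compact_def
  by (auto intro: bounded_subset[OF compact_imp_bounded closure_subset] simp del: Ck_on.simps)

lemma dbar_rel_dbar_form:
  fixes u :: "'n::{finite,linorder} form"
  assumes D: "open D" and u: "\<And>J. C1_compact (u J)" and K: "compact K" "\<And>J x. x \<notin> K ==> u J x = 0"
  shows "dbar_rel D q u (dbar_form u)"
  unfolding dbar_rel_def
proof (intro conjI ballI allI impI)
  have C1: "Ck_on 1 UNIV (u J)" for J using u[of J] by (simp add: C1_compact_def)
  have dK: "d_zbar j (u J) x = 0" if "x \<notin> K" for j J x
    by (rule d_z_outside(2)[OF compact_imp_closed[OF K(1)] _ that]) (rule K(2))
  show "L2_form D q u" by (rule L2_form_C1_compact[OF D u])
  show "L2_form D (q + 1) (dbar_form u)"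
    by (rule L2_form_continuous_compact[OF D K(1)])
       (unfold dbar_form_def, (intro continuous_intros d_z_continuous C1 | simp add: dK)+)
  fix J :: "'n set" and \<phi> :: "complex ^ 'n::{finite,linorder} => complex" assume t: "test_function D \<phi>"
  define L where "L = closure {x. \<phi> x \<noteq> 0}"
  have L: "compact L" "L \<subseteq> D" using t unfolding test_function_def L_def by blast+
  have pL: "\<phi> x = 0" if "x \<notin> L" for x using that closure_subset[of "{x. \<phi> x \<noteq> 0}"] unfolding L_def by blast
  have dpL: "d_zbar j \<phi> x = 0" if "x \<notin> L" for x j by (rule d_z_outside(2)[OF compact_imp_closed[OF L(1)] pL that])
  have pC1: "Ck_on 1 UNIV \<phi>" using test_function_C1_compact[OF t] by (simp add: C1_compact_def)
  have cd: "continuous_on UNIV (d_zbar j (u I))" "continuous_on UNIV (u I)" "continuous_on UNIV \<phi>" "continuous_on UNIV (d_zbar j \<phi>)" for j I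
    by (rule d_z_continuous(2)[OF C1] Ck_on_1D(3)[OF C1] Ck_on_1D(3)[OF pC1] d_z_continuous(2)[OF pC1])+
  have z: "(LINT x|leb D. h x) = (LINT x|lborel. h x)"
    if "continuous_on UNIV h" "\<And>x. x \<notin> L ==> h x = 0" for h :: "complex ^ 'n::{finite,linorder} => complex"
    by (rule integral_lebesgue_on_continuous_compact[OF D that(1) L(1)]) (use that(2) L(2) in blast)+
  have "(LINT x|leb D. dbar_form u J x * \<phi> x) = (LINT x|lborel. dbar_form u J x * \<phi> x)"
    unfolding dbar_form_def
    by (rule z, intro continuous_on_mult continuous_on_sum continuous_on_const cd) (simp add: pL)
  also have "\<dots> = (LINT x|lborel. (\<Sum>j\<in>J. ext_sign j J * (d_zbar j (u (J - {j})) x * \<phi> x)))"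
    unfolding dbar_form_def sum_distrib_right by (simp only: mult.assoc)
  also have "\<dots> = (\<Sum>j\<in>J. (LINT x|lborel. ext_sign j J * (d_zbar j (u (J - {j})) x * \<phi> x)))"
  proof (rule Bochner_Integration.integral_sum)
    fix j
    show "integrable lborel (\<lambda>x. ext_sign j J * (d_zbar j (u (J - {j})) x * \<phi> x))"
      by (rule integrable_continuous_compact[OF _ L(1)], intro continuous_on_mult continuous_on_const cd)
         (simp add: pL)
  qed
  also have "\<dots> = (\<Sum>j\<in>J. - (ext_sign j J * (LINT x|leb D. u (J - {j}) x * d_zbar j \<phi> x)))"
  proof (rule sum.cong[OF refl])
    fix j
    have "(LINT x|leb D. u (J - {j}) x * d_zbar j \<phi> x) = (LINT x|lborel. u (J - {j}) x * d_zbar j \<phi> x)"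
      by (rule z, intro continuous_on_mult cd) (simp add: dpL)
    thus "(LINT x|lborel. ext_sign j J * (d_zbar j (u (J - {j})) x * \<phi> x)) = - (ext_sign j J * (LINT x|leb D. u (J - {j}) x * d_zbar j \<phi> x))"
      by (simp add: integral_by_parts_d_zbar[OF u pC1])
  qed
  finally show "(LINT x|leb D. dbar_form u J x * \<phi> x)
    = - (\<Sum>j\<in>J. (- 1) ^ card {i \<in> J. i < j} * (LINT x|leb D. u (J - {j}) x * d_zbar j \<phi> x))"
    by (simp add: sum_negf ext_sign_def)
qed

text \<open>The choice made by \<open>SOME\<close> and the classical derivative satisfy the same
  weak equation, hence differ on a null set only.\<close>

lemma form_normsq_dbar:
  fixes u :: "'n::{finite,linorder} form"
  assumes D: "open D" and u: "\<And>J. C1_compact (u J)" and K: "compact K" "\<And>J x. x \<notin> K ==> u J x = 0"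
  shows "u \<in> dom_dbar D q" "form_normsq D (q + 1) (dbar D q u) = form_normsq D (q + 1) (dbar_form u)"
proof -
  have r: "dbar_rel D q u (dbar_form u)" by (rule dbar_rel_dbar_form[OF D u K])
  thus "u \<in> dom_dbar D q" by (auto simp: dom_dbar_def)
  have r': "dbar_rel D q u (dbar D q u)" unfolding dbar_def by (rule someI[of "dbar_rel D q u", OF r])
  show "form_normsq D (q + 1) (dbar D q u) = form_normsq D (q + 1) (dbar_form u)"
    unfolding form_normsq_def
  proof (rule sum.cong[OF refl], rule L2_normsq_cong_AE)
    fix J :: "'n set" assume J: "J \<in> multi_idx (q + 1)"
    let ?f = "dbar D q u J" and ?g = "dbar_form u J"
    have m: "?f \<in> meas D" "L2_normsq D ?f < \<infinity>"
      "?g \<in> meas D" "L2_normsq D ?g < \<infinity>"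
      using r r' J unfolding dbar_rel_def L2_form_def by blast+
    have "AE x in leb D. ?f x - ?g x = 0"
    proof (rule fundamental_lemma_variations[OF D _ L2_normsq_diff_finite[OF m]])
      fix \<phi> assume t: "test_function D \<phi>"
      obtain L where L: "compact L" "\<And>x. x \<notin> L ==> \<phi> x = 0" using C1_compact_support[OF test_function_C1_compact[OF t]] by metis
      have c: "continuous_on UNIV \<phi>" using t unfolding test_function_def by (metis Ck_on.simps(1))
      obtain B where B: "B > 0" "\<And>x. cmod (\<phi> x) \<le> B" using continuous_compact_bounded[OF c L] by metis
      have b: "cmod (\<phi> x) \<le> B * indicator L x" for x using B(2)[of x] L(2)[of x] by (cases "x \<in> L") auto
      have mp: "\<phi> \<in> meas D" by (rule continuous_UNIV_meas[OF D c])
      have "(LINT x|leb D. (?f x - ?g x) * \<phi> x) = (LINT x|leb D. ?f x * \<phi> x) - (LINT x|leb D. ?g x * \<phi> x)"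
        unfolding left_diff_distrib
        by (rule Bochner_Integration.integral_diff[OF L2_times_bounded(1)[OF D m(1,2) L(1) mp b] L2_times_bounded(1)[OF D m(3,4) L(1) mp b]]) (use B in simp_all)
      also have "\<dots> = 0" using r r' J t unfolding dbar_rel_def by simp
      finally show "(LINT x|leb D. (?f x - ?g x) * \<phi> x) = 0" .
    qed (use m in measurable)
    thus "AE x in leb D. ?f x = ?g x" by simp
  qed
qed

text \<open>Extends the weak equation from smooth test functions to C1 ones. This is needed because
  the test objects for the adjoint are cut-off forms with C1 coefficients.\<close>

lemma dbar_rel_C1_compact:
  fixes v f :: "'n::{finite,linorder} form"
  assumes D: "open D" and r: "dbar_rel D q v f" and J: "J \<in> multi_idx (q + 1)"
    and h: "Ck_on 1 UNIV h" "compact K" "\<And>x. x \<notin> K ==> h x = 0" "K \<subseteq> D"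
  shows "(LINT x|leb D. f J x * h x) = - (\<Sum>j\<in>J. ext_sign j J * (LINT x|leb D. v (J - {j}) x * d_zbar j h x))"
proof -
  note ch = Ck_on_1D(3)[OF h(1)]
  obtain \<phi> :: "nat => complex ^ 'n::{finite,linorder} => complex" and K' where a: "compact K'" "K' \<subseteq> D" "\<And>k. test_function D (\<phi> k)"
    "\<And>k x. x \<notin> K' ==> \<phi> k x = 0" "\<And>x. (\<lambda>k. \<phi> k x) \<longlonglongrightarrow> h x" "\<exists>B. \<forall>k x. cmod (\<phi> k x) \<le> B"
    "\<And>v x. Ck_on 1 UNIV h ==> (\<lambda>k. fderiv (\<phi> k) x v) \<longlonglongrightarrow> fderiv h x v"
    "\<And>v. Ck_on 1 UNIV h ==> \<exists>B. \<forall>k x. cmod (fderiv (\<phi> k) x v) \<le> B"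
    by (rule test_function_approx[OF ch h(2) _ h(4) D], erule h(3)) (rule that; assumption)
  obtain B where B: "\<And>k x. cmod (\<phi> k x) \<le> B" using a(6) by blast
  have B0: "B \<ge> 0" using B[of 0 0] norm_ge_zero[of "\<phi> 0 0"] by linarith
  have pC1: "Ck_on 1 UNIV (\<phi> k)" for k using test_function_C1_compact[OF a(3)] by (simp add: C1_compact_def)
  have c: "continuous_on UNIV (\<phi> k)" for k using Ck_on_1D(3)[OF pC1] .
  have fm: "f J \<in> meas D" "L2_normsq D (f J) < \<infinity>"
    using r J unfolding dbar_rel_def L2_form_def by blast+
  have vm: "v (J - {j}) \<in> meas D" "L2_normsq D (v (J - {j})) < \<infinity>" if "j \<in> J" for j
  proof -
    have "J - {j} \<in> multi_idx q" using J that by (simp add: multi_idx_def)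
    thus "v (J - {j}) \<in> meas D" "L2_normsq D (v (J - {j})) < \<infinity>"
      using r unfolding dbar_rel_def L2_form_def by blast+
  qed
  have l1: "(\<lambda>k. LINT x|leb D. f J x * \<phi> k x) \<longlonglongrightarrow> (LINT x|leb D. f J x * h x)"
  proof (rule L2_dominated_limit[OF D fm a(1)])
    show "\<phi> k \<in> meas D" for k
      by (rule continuous_UNIV_meas[OF D c])
    show "h \<in> meas D"
      by (rule continuous_UNIV_meas[OF D ch])
    show "cmod (\<phi> k x) \<le> B * indicator K' x" for k x
      using B[of k x] a(4)[of x k] by (cases "x \<in> K'") auto
  qed (use a(5) B0 in auto)
  have l2: "(\<lambda>k. LINT x|leb D. v (J - {j}) x * d_zbar j (\<phi> k) x) \<longlonglongrightarrow> (LINT x|leb D. v (J - {j}) x * d_zbar j h x)"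
    if "j \<in> J" for j
  proof -
    obtain B1 where B1: "\<And>k x. cmod (fderiv (\<phi> k) x (axis j 1)) \<le> B1" using a(8)[OF h(1)] by blast
    obtain B2 where B2: "\<And>k x. cmod (fderiv (\<phi> k) x (axis j \<i>)) \<le> B2" using a(8)[OF h(1)] by blast
    have b: "cmod (d_zbar j (\<phi> k) x) \<le> B1 + B2" for k x
    proof -
      have "cmod (d_zbar j (\<phi> k) x) \<le> (cmod (fderiv (\<phi> k) x (axis j 1)) + cmod (\<i> * fderiv (\<phi> k) x (axis j \<i>))) / 2"
        unfolding d_zbar_def norm_divide by (simp add: norm_triangle_ineq divide_right_mono)
      also have "\<dots> \<le> B1 + B2"
        using B1[of k x] B2[of k x] order_trans[OF norm_ge_zero B1[of k x]] order_trans[OF norm_ge_zero B2[of k x]] by (simp add: norm_mult)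
      finally show ?thesis .
    qed
    show ?thesis
    proof (rule L2_dominated_limit[OF D vm[OF that] a(1)])
      show "d_zbar j (\<phi> k) \<in> meas D" for k
        by (rule continuous_UNIV_meas[OF D d_z_continuous(2)[OF pC1]])
      show "d_zbar j h \<in> meas D"
        by (rule continuous_UNIV_meas[OF D d_z_continuous(2)[OF h(1)]])
      show "cmod (d_zbar j (\<phi> k) x) \<le> (B1 + B2) * indicator K' x" for k x
      proof (cases "x \<in> K'")
        case True thus ?thesis using b[of k x] by simp
      next
        case False
        have "d_zbar j (\<phi> k) x = 0" by (rule d_z_outside(2)[OF compact_imp_closed[OF a(1)] _ False]) (rule a(4))
        thus ?thesis using False by simp
      qed
      show "B1 + B2 \<ge> 0" using b[of 0 0] norm_ge_zero[of "d_zbar j (\<phi> 0) 0"] by linarith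
      show "(\<lambda>k. d_zbar j (\<phi> k) x) \<longlonglongrightarrow> d_zbar j h x" for x
        unfolding d_zbar_def by (intro tendsto_intros a(7) h(1)) simp
    qed
  qed
  have "(LINT x|leb D. f J x * \<phi> k x) = - (\<Sum>j\<in>J. ext_sign j J * (LINT x|leb D. v (J - {j}) x * d_zbar j (\<phi> k) x))" for k
    using r J a(3)[of k] unfolding dbar_rel_def ext_sign_def by blast
  hence "(\<lambda>k. LINT x|leb D. f J x * \<phi> k x) \<longlonglongrightarrow> - (\<Sum>j\<in>J. ext_sign j J * (LINT x|leb D. v (J - {j}) x * d_zbar j h x))"
    by (simp only:) (intro tendsto_intros l2)
  from LIMSEQ_unique[OF l1 this] show ?thesis .
qed

text \<open>Pairs of a set and one of its elements correspond to pairs of a set and an element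
  outside it; on coefficients this exchanges dbar with its adjoint.\<close>

lemma sum_multi_idx_reindex:
  fixes F :: "'n::finite set => 'n => complex"
  assumes "1 \<le> q"
  shows "(\<Sum>J\<in>multi_idx q. \<Sum>j\<in>J. F (J - {j}) j) = (\<Sum>I\<in>multi_idx (q - 1). \<Sum>j\<in>-I. F I j)"
proof -
  have "(\<Sum>J\<in>multi_idx q. \<Sum>j\<in>J. F (J - {j}) j) = (\<Sum>(J, j)\<in>Sigma (multi_idx q) (\<lambda>J. J). F (J - {j}) j)"
    by (rule sum.Sigma) auto
  also have "\<dots> = (\<Sum>(I, j)\<in>Sigma (multi_idx (q - 1)) (\<lambda>I. - I). F I j)"
    by (rule sum.reindex_bij_witness[where j="\<lambda>(J, j). (J - {j}, j)" and i="\<lambda>(I, j). (insert j I, j)"])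
       (use assms in \<open>auto simp: multi_idx_def card_insert_if insert_absorb\<close>)
  also have "\<dots> = (\<Sum>I\<in>multi_idx (q - 1). \<Sum>j\<in>-I. F I j)"
    by (rule sum.Sigma[symmetric]) auto
  finally show ?thesis .
qed

lemma continuous_compact_measurable_bounded:
  fixes h :: "complex ^ 'n::finite => complex"
  assumes "open D" "continuous_on UNIV h" "compact K" "\<And>x. x \<notin> K ==> h x = 0"
  obtains B where "h \<in> meas D" "\<And>x. cmod (h x) \<le> B * indicator K x" "B \<ge> 0"
proof -
  obtain B where B: "B > 0" "\<And>x. cmod (h x) \<le> B" using continuous_compact_bounded[OF assms(2-4)] by metis
  have "cmod (h x) \<le> B * indicator K x" for x using B(2)[of x] assms(4)[of x] by (cases "x \<in> K") auto
  moreover have "h \<in> meas D"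
    by (rule continuous_UNIV_meas[OF assms(1) assms(2)])
  ultimately show ?thesis using B(1) by (intro that[of B]) auto
qed

lemma measurable_cnj: "f \<in> borel_measurable M ==> (\<lambda>x. cnj (f x)) \<in> borel_measurable M"
  by (rule measurable_compose[OF _ borel_measurable_continuous_onI]) (auto intro!: continuous_intros)

text \<open>The form \<open>v\<close> is only square integrable and has no boundary values, so the
  boundary is approached from inside: the weak equation is tested on \<open>w k\<close>, the form
  \<open>u\<close> cut off near the boundary, and the cutoff is then removed by dominated
  convergence.\<close>

lemma dbar_star_rel_adjoint_form:
  fixes u :: "'n::{finite,linorder} form"
  assumes D: "open D" and df: "defining_function D V \<rho>" and C1: "Ck_on 1 V \<rho>" and K: "compact K" "K \<subseteq> V"
    and u: "\<And>J. C1_compact (u J)" "\<And>J x. x \<notin> K ==> u J x = 0" and q: "1 \<le> q"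
    and tang: "\<And>x I. x \<in> K ==> contr (d_rho \<rho> x) (\<lambda>J. u J x) I = 0"
  shows "dbar_star_rel D q u (dbar_adjoint_form u)"
  unfolding dbar_star_rel_def
proof (intro conjI allI impI)
  have uC1: "Ck_on 1 UNIV (u J)" for J using u(1)[of J] by (simp add: C1_compact_def)
  note cu = Ck_on_1D(3)[OF uC1]
  have duK: "d_z j (u J) x = 0" if "x \<notin> K" for j J x
    by (rule d_z_outside(1)[OF compact_imp_closed[OF K(1)] _ that]) (rule u(2))
  have ca: "continuous_on UNIV (dbar_adjoint_form u I)" for I
    unfolding dbar_adjoint_form_def by (intro continuous_intros d_z_continuous uC1)
  have aK: "dbar_adjoint_form u I x = 0" if "x \<notin> K" for I x using that by (simp add: dbar_adjoint_form_def duK)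
  show "L2_form D q u" by (rule L2_form_C1_compact[OF D u(1)])
  show "L2_form D (q - 1) (dbar_adjoint_form u)" by (rule L2_form_continuous_compact[OF D K(1) ca aK])
  fix v f assume r: "dbar_rel D (q - 1) v f"
  have q1: "q - 1 + 1 = q" using q by simp
  have fm: "f J \<in> meas D" "L2_normsq D (f J) < \<infinity>" if "J \<in> multi_idx q" for J
    using r that unfolding dbar_rel_def L2_form_def q1 by blast+
  have vm: "v I \<in> meas D" "L2_normsq D (v I) < \<infinity>" if "I \<in> multi_idx (q - 1)" for I
    using r that unfolding dbar_rel_def L2_form_def by blast+
  obtain \<eta> \<eta>' L B where e:
    "\<And>k. compact (L k)" "\<And>k. L k \<subseteq> K" "\<And>k. L k \<subseteq> D" "\<And>k x. x \<in> K ==> x \<notin> L k ==> \<eta> k x = 0"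
    "\<And>k x. 0 \<le> \<eta> k x" "\<And>k x. \<eta> k x \<le> 1" "\<And>x. x \<in> D ==> x \<in> K ==> (\<lambda>k. \<eta> k x) \<longlonglongrightarrow> 1"
    "\<And>k x. \<bar>\<eta>' k x * \<rho> x\<bar> \<le> B" "B > 0" "\<And>x. x \<in> D ==> x \<in> K ==> \<forall>\<^sub>F k in sequentially. \<eta>' k x = 0"
    "\<forall>k u. C1_compact u --> (\<forall>x. x \<notin> K --> u x = (0::complex)) --> C1_compact (\<lambda>x. of_real (\<eta> k x) * u x)"
    "\<forall>k u j x. C1_compact u --> (\<forall>x. x \<notin> K --> u x = (0::complex)) -->
       d_z j (\<lambda>x. of_real (\<eta> k x) * u x) x = of_real (\<eta> k x) * d_z j u x + of_real (\<eta>' k x) * (d_rho \<rho> x $ j * u x)"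
    by (rule boundary_cutoff[OF D df C1 K]) (rule that; assumption)
  define w where "w k J x = of_real (\<eta> k x) * u J x" for k J x
  have w: "C1_compact (w k J)" for k J unfolding w_def using e(11) u by blast
  have wC1: "Ck_on 1 UNIV (w k J)" for k J using w[of k J] by (simp add: C1_compact_def)
  have wL: "w k J x = 0" if "x \<notin> L k" for k J x using that e(4)[of x k] u(2)[of x J] by (cases "x \<in> K") (auto simp: w_def)
  have dw: "d_z j (w k J) x = of_real (\<eta> k x) * d_z j (u J) x + of_real (\<eta>' k x) * (d_rho \<rho> x $ j * u J x)" for k J j x
    unfolding w_def using e(12) u by blast
  have dwL: "d_z j (w k J) x = 0" if "x \<notin> L k" for k J j x
    by (rule d_z_outside(1)[OF compact_imp_closed[OF e(1)] _ that]) (rule wL)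
  have tang': "contr (d_rho \<rho> x) (\<lambda>J. u J x) I = 0" for x I
  proof (cases "x \<in> K")
    case False
    thus ?thesis by (simp add: contr_def u(2))
  qed (rule tang)
  \<comment> \<open>The derivative of the cutoff contributes precisely \<open>\<eta>'\<close> times
    the contraction of \<open>u\<close> with the conormal. That contraction is 0 on all of
    \<open>K\<close>, so the blow-up of \<open>\<eta>'\<close> never enters.\<close>
  have adj: "(\<Sum>j\<in>-I. ext_sign j I * d_z j (w k (insert j I)) x) = - (of_real (\<eta> k x) * dbar_adjoint_form u I x)" for k I x
  proof -
    have "(\<Sum>j\<in>-I. ext_sign j I * d_z j (w k (insert j I)) x) = of_real (\<eta> k x) * (\<Sum>j\<in>-I. ext_sign j I * d_z j (u (insert j I)) x)
        + of_real (\<eta>' k x) * contr (d_rho \<rho> x) (\<lambda>J. u J x) I"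
      unfolding dw contr_def sum_distrib_left sum.distrib[symmetric] by (rule sum.cong) (simp_all add: algebra_simps)
    thus ?thesis by (simp add: tang' dbar_adjoint_form_def)
  qed
  have eq: "(\<Sum>J\<in>multi_idx q. LINT x|leb D. f J x * cnj (w k J x))
      = (\<Sum>I\<in>multi_idx (q - 1). LINT x|leb D. v I x * cnj (of_real (\<eta> k x) * dbar_adjoint_form u I x))" for k
  proof -
    define G where "G I j = ext_sign j I * (LINT x|leb D. v I x * cnj (d_z j (w k (insert j I)) x))" for I j
    have 1: "(LINT x|leb D. f J x * cnj (w k J x)) = - (\<Sum>j\<in>J. G (J - {j}) j)" if J: "J \<in> multi_idx q" for J
    proof -
      have "(LINT x|leb D. f J x * cnj (w k J x))
          = - (\<Sum>j\<in>J. ext_sign j J * (LINT x|leb D. v (J - {j}) x * d_zbar j (\<lambda>x. cnj (w k J x)) x))"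
      proof (rule dbar_rel_C1_compact[OF D r _ Ck_on_1_cnj[OF wC1] e(1)[of k] _ e(3)])
        show "J \<in> multi_idx (q - 1 + 1)" unfolding q1 by (rule J)
      qed (simp add: wL)
      also have "\<dots> = - (\<Sum>j\<in>J. G (J - {j}) j)"
      proof -
        have c: "d_zbar j (\<lambda>x. cnj (w k J x)) x = cnj (d_z j (w k J) x)" for j x
          by (rule d_z_cnj(2)) (use wC1 in simp)
        show ?thesis unfolding G_def c by (intro arg_cong[where f=uminus] sum.cong refl) (simp add: insert_absorb)
      qed
      finally show ?thesis .
    qed
    have 2: "- (\<Sum>j\<in>-I. G I j) = (LINT x|leb D. v I x * cnj (of_real (\<eta> k x) * dbar_adjoint_form u I x))"
      if I: "I \<in> multi_idx (q - 1)" for I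
    proof -
      have i: "integrable (leb D) (\<lambda>x. v I x * cnj (d_z j (w k J) x))" for j J
      proof -
        have c: "continuous_on UNIV (\<lambda>x. cnj (d_z j (w k J) x))" by (intro continuous_intros d_z_continuous wC1)
        obtain C where C: "(\<lambda>x. cnj (d_z j (w k J) x)) \<in> meas D"
          "\<And>x. cmod (cnj (d_z j (w k J) x)) \<le> C * indicator (L k) x" "C \<ge> 0"
          by (rule continuous_compact_measurable_bounded[OF D c e(1)[of k]], simp add: dwL, rule that)
        show ?thesis by (rule L2_times_bounded(1)[OF D vm[OF I] e(1)[of k] C])
      qed
      have "(\<Sum>j\<in>-I. G I j) = (\<Sum>j\<in>-I. (LINT x|leb D. ext_sign j I * (v I x * cnj (d_z j (w k (insert j I)) x))))"
        unfolding G_def by simp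
      also have "\<dots> = (LINT x|leb D. (\<Sum>j\<in>-I. ext_sign j I * (v I x * cnj (d_z j (w k (insert j I)) x))))"
        by (rule Bochner_Integration.integral_sum[symmetric]) (intro integrable_mult_right i)
      also have "\<dots> = (LINT x|leb D. - (v I x * cnj (of_real (\<eta> k x) * dbar_adjoint_form u I x)))"
      proof (rule Bochner_Integration.integral_cong[OF refl])
        fix x
        have "(\<Sum>j\<in>-I. ext_sign j I * (v I x * cnj (d_z j (w k (insert j I)) x))) = v I x * cnj (\<Sum>j\<in>-I. ext_sign j I * d_z j (w k (insert j I)) x)"
          by (simp add: sum_distrib_left mult_ac)
        thus "(\<Sum>j\<in>-I. ext_sign j I * (v I x * cnj (d_z j (w k (insert j I)) x))) = - (v I x * cnj (of_real (\<eta> k x) * dbar_adjoint_form u I x))"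
          unfolding adj by simp
      qed
      finally show ?thesis by simp
    qed
    have "(\<Sum>J\<in>multi_idx q. LINT x|leb D. f J x * cnj (w k J x)) = - (\<Sum>J\<in>multi_idx q. \<Sum>j\<in>J. G (J - {j}) j)"
      by (simp add: 1 sum_negf)
    also have "\<dots> = (\<Sum>I\<in>multi_idx (q - 1). - (\<Sum>j\<in>-I. G I j))"
      by (simp add: sum_multi_idx_reindex[OF q] sum_negf)
    finally show ?thesis by (simp only: 2 cong: sum.cong)
  qed
  have lim: "(\<lambda>k. LINT x|leb D. g x * cnj (of_real (\<eta> k x) * h x)) \<longlonglongrightarrow> (LINT x|leb D. g x * cnj (h x))"
    if g: "g \<in> meas D" "L2_normsq D g < \<infinity>" and h: "continuous_on UNIV h" "\<And>x. x \<notin> K ==> h x = 0"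
      and m: "\<And>k. (\<lambda>x. of_real (\<eta> k x) * h x) \<in> meas D" for g h :: "complex ^ 'n::{finite,linorder} => complex"
  proof -
    obtain C where C: "h \<in> meas D" "\<And>x. cmod (h x) \<le> C * indicator K x" "C \<ge> 0"
      by (rule continuous_compact_measurable_bounded[OF D h(1) K(1)], erule h(2), rule that)
    show ?thesis
    proof (rule L2_dominated_limit[OF D g K(1), where B=C])
      show "(\<lambda>x. cnj (of_real (\<eta> k x) * h x)) \<in> meas D" for k by (intro measurable_cnj m)
      show "(\<lambda>x. cnj (h x)) \<in> meas D" by (intro measurable_cnj C(1))
      show "cmod (cnj (of_real (\<eta> k x) * h x)) \<le> C * indicator K x" for k x
      proof -
        have "cmod (cnj (of_real (\<eta> k x) * h x)) \<le> 1 * (C * indicator K x)"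
          unfolding complex_mod_cnj norm_mult using e(5,6)[where k=k and x=x] by (intro mult_mono C(2)) auto
        thus ?thesis by simp
      qed
      show "(\<lambda>k. cnj (of_real (\<eta> k x) * h x)) \<longlonglongrightarrow> cnj (h x)" if "x \<in> D" for x
      proof (cases "x \<in> K")
        case True
        have "(\<lambda>k. cnj (of_real (\<eta> k x) * h x)) \<longlonglongrightarrow> cnj (of_real 1 * h x)"
          by (intro tendsto_intros e(7) that True)
        thus ?thesis by simp
      qed (simp add: h(2))
    qed (rule C(3))
  qed
  have cwk: "continuous_on UNIV (\<lambda>x. of_real (\<eta> k x) * u J x)" for k J using Ck_on_1D(3)[OF wC1[of k J]] unfolding w_def .
  have ma: "(\<lambda>x. of_real (\<eta> k x) * dbar_adjoint_form u I x) \<in> meas D" for k I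
  proof -
    have e: "(\<lambda>x. of_real (\<eta> k x) * dbar_adjoint_form u I x) = (\<lambda>x. - (\<Sum>j\<in>-I. ext_sign j I * d_z j (w k (insert j I)) x))"
      by (simp add: adj)
    have c: "continuous_on UNIV (\<lambda>x. - (\<Sum>j\<in>-I. ext_sign j I * d_z j (w k (insert j I)) x))"
      by (intro continuous_intros d_z_continuous wC1)
    show ?thesis unfolding e by (rule continuous_UNIV_meas[OF D c])
  qed
  have mu: "(\<lambda>x. of_real (\<eta> k x) * u J x) \<in> meas D" for k J
    by (rule continuous_UNIV_meas[OF D cwk])
  have "(\<lambda>k. \<Sum>J\<in>multi_idx q. LINT x|leb D. f J x * cnj (w k J x)) \<longlonglongrightarrow> form_inner D q f u"
    unfolding form_inner_def w_def by (intro tendsto_sum lim fm cu mu) (simp_all add: u(2))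
  moreover have "(\<lambda>k. \<Sum>J\<in>multi_idx q. LINT x|leb D. f J x * cnj (w k J x)) \<longlonglongrightarrow> form_inner D (q - 1) v (dbar_adjoint_form u)"
    unfolding form_inner_def eq by (intro tendsto_sum lim vm ca ma) (simp_all add: aK)
  ultimately show "form_inner D q f u = form_inner D (q - 1) v (dbar_adjoint_form u)"
    by (rule LIMSEQ_unique)
qed

text \<open>A single test function, placed in the coefficient \<open>I\<close>, is a form in the
  domain of dbar. Pairing with all of these determines the adjoint almost everywhere.\<close>

lemma dbar_star_rel_unique:
  fixes g g' :: "'n::{finite,linorder} form"
  assumes D: "open D" and q: "1 \<le> q" and g: "dbar_star_rel D q u g" and g': "dbar_star_rel D q u g'" and I: "I \<in> multi_idx (q - 1)"
  shows "AE x in leb D. g I x = g' I x"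
proof -
  have m: "g I \<in> meas D" "L2_normsq D (g I) < \<infinity>"
    "g' I \<in> meas D" "L2_normsq D (g' I) < \<infinity>"
    using g g' I unfolding dbar_star_rel_def L2_form_def by blast+
  have mc: "(\<lambda>x. cnj (g I x - g' I x)) \<in> meas D" using m(1,3) by (intro measurable_cnj borel_measurable_diff)
  have "L2_normsq D (\<lambda>x. cnj (g I x - g' I x)) = L2_normsq D (\<lambda>x. g I x - g' I x)"
    by (simp add: L2_normsq_def del: complex_cnj_diff)
  hence fc: "L2_normsq D (\<lambda>x. cnj (g I x - g' I x)) < \<infinity>" using L2_normsq_diff_finite[OF m] by simp
  have "AE x in leb D. cnj (g I x - g' I x) = 0"
  proof (rule fundamental_lemma_variations[OF D mc fc])
    fix \<phi> :: "complex ^ 'n::{finite,linorder} => complex" assume t: "test_function D \<phi>"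
    note pc = test_function_C1_compact[OF t]
    obtain L where L: "compact L" "\<And>x. x \<notin> L ==> \<phi> x = 0" using C1_compact_support[OF pc] by metis
    have c: "continuous_on UNIV \<phi>" using pc unfolding C1_compact_def using Ck_on_1D(3) by blast
    obtain B where B: "\<phi> \<in> meas D" "\<And>x. cmod (\<phi> x) \<le> B * indicator L x" "B \<ge> 0"
      by (rule continuous_compact_measurable_bounded[OF D c L(1)], erule L(2), rule that)
    define v where "v J = (if J = I then \<phi> else (\<lambda>x. 0))" for J
    have v: "C1_compact (v J)" for J
      using pc by (auto simp: v_def C1_compact_def intro: Ck_on_1_const simp del: One_nat_def)
    have r: "dbar_rel D (q - 1) v (dbar_form v)"
      by (rule dbar_rel_dbar_form[OF D v L(1)]) (simp add: v_def L(2))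
    have ev: "form_inner D (q - 1) v h = (LINT x|leb D. \<phi> x * cnj (h I x))" for h
    proof -
      have "form_inner D (q - 1) v h = (\<Sum>J\<in>multi_idx (q - 1). if J = I then (LINT x|leb D. \<phi> x * cnj (h I x)) else 0)"
        unfolding form_inner_def v_def by (rule sum.cong) auto
      thus ?thesis using I by simp
    qed
    have eq: "(LINT x|leb D. \<phi> x * cnj (g I x)) = (LINT x|leb D. \<phi> x * cnj (g' I x))"
      using g g' r unfolding dbar_star_rel_def ev[symmetric] by metis
    have i: "integrable (leb D) (\<lambda>x. cnj (h x) * \<phi> x)"
      if "h \<in> meas D" "L2_normsq D h < \<infinity>" for h
    proof (rule L2_times_bounded(1)[OF D _ _ L(1) B])
      show "(\<lambda>x. cnj (h x)) \<in> meas D" by (intro measurable_cnj that(1))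
      show "L2_normsq D (\<lambda>x. cnj (h x)) < \<infinity>" using that(2) by (simp add: L2_normsq_def)
    qed
    have "(LINT x|leb D. cnj (g I x - g' I x) * \<phi> x) = (LINT x|leb D. cnj (g I x) * \<phi> x) - (LINT x|leb D. cnj (g' I x) * \<phi> x)"
      unfolding complex_cnj_diff left_diff_distrib by (rule Bochner_Integration.integral_diff[OF i[OF m(1,2)] i[OF m(3,4)]])
    thus "(LINT x|leb D. cnj (g I x - g' I x) * \<phi> x) = 0" using eq by (simp add: mult.commute)
  qed
  thus ?thesis by simp
qed

lemma form_normsq_dbar_star:
  fixes u :: "'n::{finite,linorder} form"
  assumes D: "open D" and df: "defining_function D V \<rho>" and C1: "Ck_on 1 V \<rho>" and K: "compact K" "K \<subseteq> V"
    and u: "\<And>J. C1_compact (u J)" "\<And>J x. x \<notin> K ==> u J x = 0" and q: "1 \<le> q"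
    and tang: "\<And>x I. x \<in> K ==> contr (d_rho \<rho> x) (\<lambda>J. u J x) I = 0"
  shows "u \<in> dom_dbar_star D q" "form_normsq D (q - 1) (dbar_star D q u) = form_normsq D (q - 1) (dbar_adjoint_form u)"
proof -
  have r: "dbar_star_rel D q u (dbar_adjoint_form u)" by (rule dbar_star_rel_adjoint_form[OF D df C1 K u q tang])
  thus "u \<in> dom_dbar_star D q" by (auto simp: dom_dbar_star_def)
  have r': "dbar_star_rel D q u (dbar_star D q u)" unfolding dbar_star_def by (rule someI[of "dbar_star_rel D q u", OF r])
  show "form_normsq D (q - 1) (dbar_star D q u) = form_normsq D (q - 1) (dbar_adjoint_form u)"
    unfolding form_normsq_def
    by (rule sum.cong[OF refl], rule L2_normsq_cong_AE, rule dbar_star_rel_unique[OF D q r' r])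
qed

section \<open>Second derivatives of the defining function\<close>

text \<open>A real-linear map is the sum of a complex-linear and an antilinear one; the Wirtinger
  derivatives are the two families of coefficients.\<close>

lemma real_linear_expansion:
  fixes A :: "complex ^ 'n::finite => complex"
  assumes "linear A"
  shows "A v = (\<Sum>j\<in>UNIV. v $ j * ((A (axis j 1) - \<i> * A (axis j \<i>)) / 2) + cnj (v $ j) * ((A (axis j 1) + \<i> * A (axis j \<i>)) / 2))"
proof -
  interpret A: linear A by fact
  have "v = (\<Sum>j\<in>UNIV. Re (v $ j) *\<^sub>R axis j 1 + Im (v $ j) *\<^sub>R axis j \<i>)"
  proof (subst Finite_Cartesian_Product.vec_eq_iff, intro allI)
    fix i
    have "(\<Sum>j\<in>UNIV. Re (v $ j) *\<^sub>R axis j 1 + Im (v $ j) *\<^sub>R axis j \<i>) $ i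
        = (\<Sum>j\<in>UNIV. if j = i then Re (v $ j) *\<^sub>R 1 + Im (v $ j) *\<^sub>R \<i> else 0)"
      unfolding sum_component by (rule sum.cong) (auto simp: axis_def)
    also have "\<dots> = v $ i" by (simp add: complex_eq_iff)
    finally show "v $ i = (\<Sum>j\<in>UNIV. Re (v $ j) *\<^sub>R axis j 1 + Im (v $ j) *\<^sub>R axis j \<i>) $ i" ..
  qed
  hence "A v = (\<Sum>j\<in>UNIV. Re (v $ j) *\<^sub>R A (axis j 1) + Im (v $ j) *\<^sub>R A (axis j \<i>))"
    by (metis (no_types, lifting) A.sum A.add A.scale sum.cong)
  also have "\<dots> = (\<Sum>j\<in>UNIV. v $ j * ((A (axis j 1) - \<i> * A (axis j \<i>)) / 2) + cnj (v $ j) * ((A (axis j 1) + \<i> * A (axis j \<i>)) / 2))"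
    by (rule sum.cong[OF refl]) (simp add: complex_eq_iff field_simps)
  finally show ?thesis .
qed

lemma frechet_derivative_Wirtinger:
  fixes f :: "complex ^ 'n::finite => complex"
  assumes "f differentiable (at x)"
  shows "fderiv f x v = (\<Sum>j\<in>UNIV. v $ j * d_z j f x + cnj (v $ j) * d_zbar j f x)"
  unfolding d_z_def d_zbar_def
  by (rule real_linear_expansion) (rule linear_frechet_derivative[OF assms])

lemma of_real_frechet_derivative:
  assumes "(\<rho> :: 'a::real_normed_vector => real) differentiable (at x)"
  shows "fderiv (\<lambda>y. complex_of_real (\<rho> y)) x v = complex_of_real (fderiv \<rho> x v)"
  by (rule fun_cong[OF frechet_derivative_at[OF has_derivative_of_real[OF assms[unfolded frechet_derivative_works]], symmetric]])

lemma d_rho_components: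
  assumes "\<rho> differentiable (at x)"
  shows "d_rho \<rho> x $ k = (of_real (fderiv \<rho> x (axis k 1)) - \<i> * of_real (fderiv \<rho> x (axis k \<i>))) / 2"
    and "d_zbar k (\<lambda>y. complex_of_real (\<rho> y)) x = (of_real (fderiv \<rho> x (axis k 1)) + \<i> * of_real (fderiv \<rho> x (axis k \<i>))) / 2"
  by (simp_all add: d_rho_def d_z_def d_zbar_def of_real_frechet_derivative[OF assms])

lemma frechet_derivative_d_rho:
  fixes \<rho> :: "complex ^ 'n::finite => real"
  assumes "\<rho> differentiable (at x)"
  shows "fderiv \<rho> x v = 2 * Re (bil v (d_rho \<rho> x))"
proof -
  have d: "(\<lambda>y. complex_of_real (\<rho> y)) differentiable (at x)"
    using assms by (auto simp: differentiable_def intro: has_derivative_of_real)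
  have "complex_of_real (fderiv \<rho> x v) = (\<Sum>j\<in>UNIV. v $ j * d_rho \<rho> x $ j + cnj (v $ j * d_rho \<rho> x $ j))"
    unfolding of_real_frechet_derivative[OF assms, symmetric] frechet_derivative_Wirtinger[OF d]
    by (rule sum.cong[OF refl]) (simp add: d_rho_components[OF assms], simp add: d_rho_def[symmetric] d_z_def of_real_frechet_derivative[OF assms])
  also have "\<dots> = bil v (d_rho \<rho> x) + cnj (bil v (d_rho \<rho> x))" by (simp add: bil_def sum.distrib)
  finally show ?thesis by (simp add: complex_eq_iff)
qed

lemma second_difference_mean_value:
  fixes f :: "'a::real_normed_vector => real"
  assumes h: "h > 0" and V: "\<And>s t. 0 \<le> s ==> s \<le> h ==> 0 \<le> t ==> t \<le> h ==> x + s *\<^sub>R v + t *\<^sub>R w \<in> V"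
    and f: "\<And>y. y \<in> V ==> f differentiable (at y)"
    and f': "\<And>y. y \<in> V ==> (\<lambda>y. fderiv f y v) differentiable (at y)"
  shows "\<exists>s t. 0 < s \<and> s < h \<and> 0 < t \<and> t < h \<and>
    f (x + h *\<^sub>R v + h *\<^sub>R w) - f (x + h *\<^sub>R v) - f (x + h *\<^sub>R w) + f x
      = h^2 * fderiv (\<lambda>y. fderiv f y v) (x + s *\<^sub>R v + t *\<^sub>R w) w"
proof -
  have line: "((\<lambda>t. g (p + t *\<^sub>R u)) has_real_derivative fderiv g (p + t *\<^sub>R u) u) (at t)"
    if "g differentiable (at (p + t *\<^sub>R u))" for g :: "'a => real" and p u t
  proof -
    note hd = that[unfolded frechet_derivative_works]
    have "((\<lambda>t. g (p + t *\<^sub>R u)) has_derivative (\<lambda>r. fderiv g (p + t *\<^sub>R u) (r *\<^sub>R u))) (at t)"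
      by (rule has_derivative_compose[where f="\<lambda>t. p + t *\<^sub>R u", OF _ hd]) (auto intro!: derivative_eq_intros)
    thus ?thesis
      unfolding has_field_derivative_def
      using linear_scale[OF linear_frechet_derivative[OF that]] by (simp add: mult.commute[of _ "fderiv g (p + t *\<^sub>R u) u"])
  qed
  let ?g = "\<lambda>s. f ((x + h *\<^sub>R w) + s *\<^sub>R v) - f (x + s *\<^sub>R v)"
  have "\<exists>s>0. s < h \<and> ?g h - ?g 0 = (h - 0) * (fderiv f ((x + h *\<^sub>R w) + s *\<^sub>R v) v - fderiv f (x + s *\<^sub>R v) v)"
  proof (rule MVT2[OF h])
    fix s assume s: "0 \<le> s" "s \<le> h"
    have "x + s *\<^sub>R v + h *\<^sub>R w \<in> V" "x + s *\<^sub>R v + 0 *\<^sub>R w \<in> V" using V[of s h] V[of s 0] s h by auto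
    hence "(x + h *\<^sub>R w) + s *\<^sub>R v \<in> V" "x + s *\<^sub>R v \<in> V" by (simp_all add: add_ac)
    thus "(?g has_real_derivative (fderiv f ((x + h *\<^sub>R w) + s *\<^sub>R v) v - fderiv f (x + s *\<^sub>R v) v)) (at s)"
      by (intro DERIV_diff line f)
  qed
  then obtain s where s: "0 < s" "s < h" "?g h - ?g 0 = h * (fderiv f ((x + h *\<^sub>R w) + s *\<^sub>R v) v - fderiv f (x + s *\<^sub>R v) v)" by auto
  let ?k = "\<lambda>t. fderiv f ((x + s *\<^sub>R v) + t *\<^sub>R w) v"
  have "\<exists>t>0. t < h \<and> ?k h - ?k 0 = (h - 0) * fderiv (\<lambda>y. fderiv f y v) ((x + s *\<^sub>R v) + t *\<^sub>R w) w"
    by (rule MVT2[OF h]) (intro line f' V, use s in auto)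
  then obtain t where t: "0 < t" "t < h" "?k h - ?k 0 = h * fderiv (\<lambda>y. fderiv f y v) ((x + s *\<^sub>R v) + t *\<^sub>R w) w" by auto
  have "?k h = fderiv f ((x + h *\<^sub>R w) + s *\<^sub>R v) v" by (simp add: add_ac)
  hence "?g h - ?g 0 = h * (h * fderiv (\<lambda>y. fderiv f y v) ((x + s *\<^sub>R v) + t *\<^sub>R w) w)"
    using s(3) t(3) by simp
  thus ?thesis using s(1,2) t(1,2)
    by (intro exI[of _ s] exI[of _ t]) (simp add: power2_eq_square add_ac)
qed

text \<open>Schwarz's theorem: one second difference, read in either order, equals
  \<open>h^2\<close> times a mixed derivative at a point near \<open>x\<close>, and continuity
  forbids the two mixed derivatives to differ.\<close>

lemma second_derivative_symmetric:
  fixes f :: "'a::real_normed_vector => real"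
  assumes V: "open V" "x \<in> V" and f: "Ck_on 1 V f" and f': "\<And>v. Ck_on 1 V (\<lambda>y. fderiv f y v)"
  shows "fderiv (\<lambda>y. fderiv f y v) x w = fderiv (\<lambda>y. fderiv f y w) x v"
proof (rule ccontr)
  let ?F = "\<lambda>v w y. fderiv (\<lambda>y. fderiv f y v) y w"
  assume ne: "?F v w x \<noteq> ?F w v x"
  define e where "e = \<bar>?F v w x - ?F w v x\<bar> / 2"
  have e: "e > 0" using ne by (simp add: e_def)
  have near: "\<forall>\<^sub>F y in at x. \<bar>?F v w y - ?F v w x\<bar> < e" for v w
  proof -
    have "isCont (?F v w) x" using Ck_on_1D(2)[OF f'] V by (simp add: continuous_on_eq_continuous_at)
    hence "(?F v w \<longlongrightarrow> ?F v w x) (at x)" by (simp add: isCont_def)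
    from tendstoD[OF this e] show ?thesis by (simp add: dist_real_def)
  qed
  have "\<forall>\<^sub>F y in at x. y \<in> V" using V by (simp add: eventually_at_in_open')
  hence "\<forall>\<^sub>F y in at x. y \<in> V \<and> \<bar>?F v w y - ?F v w x\<bar> < e \<and> \<bar>?F w v y - ?F w v x\<bar> < e"
    using near[of v w] near[of w v] by eventually_elim auto
  then obtain d where d: "d > 0" "\<And>y. y \<noteq> x ==> dist y x < d ==> y \<in> V \<and> \<bar>?F v w y - ?F v w x\<bar> < e \<and> \<bar>?F w v y - ?F w v x\<bar> < e"
    unfolding eventually_at by auto
  have d': "y \<in> V \<and> \<bar>?F v w y - ?F v w x\<bar> < e \<and> \<bar>?F w v y - ?F w v x\<bar> < e" if "dist y x < d" for y
    using d(2)[OF _ that] V(2) e by (cases "y = x") auto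
  define N where "N = norm v + norm w + 1"
  \<comment> \<open>Chosen so that the whole parallelogram spanned by \<open>h v\<close> and
    \<open>h w\<close> stays within distance \<open>d\<close> of \<open>x\<close>.\<close>
  define h where "h = d / (2 * N)"
  have np: "N > 0" by (simp add: N_def add_nonneg_pos)
  have h: "h > 0" using d(1) np by (simp add: h_def)
  have nd: "dist (x + s *\<^sub>R v + t *\<^sub>R w) x < d" if "0 \<le> s" "s \<le> h" "0 \<le> t" "t \<le> h" for s t
  proof -
    have "norm (s *\<^sub>R v + t *\<^sub>R w) \<le> s * norm v + t * norm w"
      using norm_triangle_ineq[of "s *\<^sub>R v" "t *\<^sub>R w"] that by simp
    also have "\<dots> \<le> h * norm v + h * norm w" using that by (intro add_mono mult_right_mono) auto
    also have "\<dots> \<le> h * N" using h by (simp add: N_def algebra_simps)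
    also have "\<dots> = d / 2" using np by (simp add: h_def)
    also have "\<dots> < d" using d(1) by simp
    finally show ?thesis by (simp add: dist_norm add.assoc)
  qed
  have df: "f differentiable (at y)" "(\<lambda>y. fderiv f y v) differentiable (at y)" if "y \<in> V" for y v
    using f f'[of v] that by auto
  have Vin: "x + s *\<^sub>R v + t *\<^sub>R w \<in> V" "x + t *\<^sub>R w + s *\<^sub>R v \<in> V" if "0 \<le> s" "s \<le> h" "0 \<le> t" "t \<le> h" for s t
    using d'[OF nd[OF that]] by (simp_all add: add_ac)
  obtain s t where st: "0 < s" "s < h" "0 < t" "t < h"
    "f (x + h *\<^sub>R v + h *\<^sub>R w) - f (x + h *\<^sub>R v) - f (x + h *\<^sub>R w) + f x = h^2 * ?F v w (x + s *\<^sub>R v + t *\<^sub>R w)"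
    using second_difference_mean_value[OF h, of x v w V f, OF Vin(1) df] by blast
  have sw: "x + s *\<^sub>R w + t *\<^sub>R v = x + t *\<^sub>R v + s *\<^sub>R w" for s t by (simp add: add_ac)
  obtain s' t' where st': "0 < s'" "s' < h" "0 < t'" "t' < h"
    "f (x + h *\<^sub>R w + h *\<^sub>R v) - f (x + h *\<^sub>R w) - f (x + h *\<^sub>R v) + f x = h^2 * ?F w v (x + s' *\<^sub>R w + t' *\<^sub>R v)"
    using second_difference_mean_value[OF h, of x w v V f, OF Vin(2) df] by blast
  have "h^2 * ?F v w (x + s *\<^sub>R v + t *\<^sub>R w) = h^2 * ?F w v (x + s' *\<^sub>R w + t' *\<^sub>R v)"
    using st(5) st'(5) unfolding sw by linarith
  hence "?F v w (x + s *\<^sub>R v + t *\<^sub>R w) = ?F w v (x + s' *\<^sub>R w + t' *\<^sub>R v)" using h by simp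
  moreover have "\<bar>?F v w (x + s *\<^sub>R v + t *\<^sub>R w) - ?F v w x\<bar> < e" using d' nd st by (meson less_imp_le)
  moreover have "\<bar>?F w v (x + s' *\<^sub>R w + t' *\<^sub>R v) - ?F w v x\<bar> < e" unfolding sw using d' nd st' by (meson less_imp_le)
  ultimately have "\<bar>?F v w x - ?F w v x\<bar> < 2 * e" by linarith
  thus False by (simp add: e_def)
qed

lemma Ck_holder_on_2D:
  assumes "Ck_holder_on 2 \<alpha> V f"
  shows "Ck_on 1 V (\<lambda>x. fderiv f x v)" "Ck_on 1 V f"
proof -
  have *: "\<And>x. x \<in> V ==> f differentiable (at x)"
    "\<And>v x. x \<in> V ==> (\<lambda>x. fderiv f x v) differentiable (at x)"
    "\<And>v w. continuous_on V (\<lambda>x. fderiv (\<lambda>x. fderiv f x v) x w)"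
    using assms by (auto simp: numeral_2_eq_2)
  show 1: "Ck_on 1 V (\<lambda>x. fderiv f x v)" for v using *(2,3) by simp
  show "Ck_on 1 V f" using *(1) Ck_on_1D(3)[OF 1] by simp
qed

locale C2_function =
  fixes \<rho> :: "complex ^ 'n::finite => real" and V :: "(complex ^ 'n) set"
  assumes V: "open V" and C1: "Ck_on 1 V \<rho>" and C2: "\<And>v. Ck_on 1 V (\<lambda>x. fderiv \<rho> x v)"
begin

abbreviation nu where "nu \<equiv> d_rho \<rho>"

lemma differentiable: "x \<in> V ==> \<rho> differentiable (at x)"
  using C1 by simp

lemma d_rho_C1: "Ck_on 1 V (\<lambda>x. d_rho \<rho> x $ k)"
proof (rule Ck_on_1_cong[OF V])
  show "Ck_on 1 V (\<lambda>x. (of_real (fderiv \<rho> x (axis k 1)) - \<i> * of_real (fderiv \<rho> x (axis k \<i>))) * (1 / 2) :: complex)"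
    by (intro Ck_on_1_intros C2)
qed (simp add: d_rho_components differentiable)

lemma d_zbar_rho: "x \<in> V ==> d_zbar k (\<lambda>y. complex_of_real (\<rho> y)) x = cnj (d_rho \<rho> x $ k)"
  by (simp add: d_rho_components differentiable)

text \<open>Symmetry of the real Hessian yields both facts on which the phase rests: the holomorphic
  Hessian is symmetric and the Levi matrix is Hermitian.\<close>

lemma d_rho_second:
  assumes "x \<in> V"
  shows "d_z l (\<lambda>x. d_rho \<rho> x $ k) x = d_z k (\<lambda>x. d_rho \<rho> x $ l) x"
    and "d_zbar l (\<lambda>x. d_rho \<rho> x $ k) x = cnj (d_zbar k (\<lambda>x. d_rho \<rho> x $ l) x)"
    and "d_z l (d_zbar k (\<lambda>y. complex_of_real (\<rho> y))) x = cnj (d_zbar l (\<lambda>x. d_rho \<rho> x $ k) x)"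
proof -
  let ?F = "\<lambda>v w. fderiv (\<lambda>y. fderiv \<rho> y v) x w"
  have hd: "((\<lambda>x. d_rho \<rho> x $ k) has_derivative (\<lambda>w. (of_real (?F (axis k 1) w) - \<i> * of_real (?F (axis k \<i>) w)) / 2)) (at x)" for k
  proof (rule has_derivative_transform_within_open[OF _ V assms])
    show "((\<lambda>x. (of_real (fderiv \<rho> x (axis k 1)) - \<i> * of_real (fderiv \<rho> x (axis k \<i>))) / 2) has_derivative
        (\<lambda>w. (of_real (?F (axis k 1) w) - \<i> * of_real (?F (axis k \<i>) w)) / (2::complex))) (at x)"
      by (intro bounded_linear.has_derivative[OF bounded_linear_divide] has_derivative_diff has_derivative_mult_right
          has_derivative_of_real Ck_on_1D(1)[OF C2 assms])
  qed (simp add: d_rho_components differentiable)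
  have sym: "?F v w = ?F w v" for v w by (rule second_derivative_symmetric[OF V assms C1 C2])
  show "d_z l (\<lambda>x. d_rho \<rho> x $ k) x = d_z k (\<lambda>x. d_rho \<rho> x $ l) x"
    unfolding d_z_eq(1)[OF hd] using sym[of "axis k 1" "axis l 1"] sym[of "axis k \<i>" "axis l 1"] sym[of "axis k 1" "axis l \<i>"] sym[of "axis k \<i>" "axis l \<i>"]
    by (simp add: field_simps)
  show "d_zbar l (\<lambda>x. d_rho \<rho> x $ k) x = cnj (d_zbar k (\<lambda>x. d_rho \<rho> x $ l) x)"
    unfolding d_z_eq(2)[OF hd] using sym[of "axis k 1" "axis l 1"] sym[of "axis k \<i>" "axis l 1"] sym[of "axis k 1" "axis l \<i>"] sym[of "axis k \<i>" "axis l \<i>"]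
    by (simp add: field_simps)
  have "(d_zbar k (\<lambda>y. complex_of_real (\<rho> y)) has_derivative (\<lambda>w. cnj ((of_real (?F (axis k 1) w) - \<i> * of_real (?F (axis k \<i>) w)) / 2))) (at x)"
    by (rule has_derivative_transform_within_open[OF bounded_linear.has_derivative[OF bounded_linear_cnj hd] V assms])
       (simp add: d_zbar_rho)
  from d_z_eq(1)[OF this] show "d_z l (d_zbar k (\<lambda>y. complex_of_real (\<rho> y))) x = cnj (d_zbar l (\<lambda>x. d_rho \<rho> x $ k) x)"
    unfolding d_z_eq(2)[OF hd] by simp
qed

end

section \<open>The complex tangent space\<close>

text \<open>Moving from a boundary point in a direction in which \<open>\<rho>\<close> decreases
  leads into the domain, where \<open>\<rho>'\<close> is negative as well; so \<open>\<rho>'\<close>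
  cannot increase to first order.\<close>

lemma defining_function_derivative_sign:
  fixes \<rho> \<rho>' :: "complex ^ 'n::finite => real"
  assumes \<rho>: "defining_function D V \<rho>" "\<rho> differentiable (at x)" "x \<in> V"
    and \<rho>': "defining_function D V' \<rho>'" "\<rho>' differentiable (at x)" "x \<in> V'"
    and x: "x \<in> frontier D" and v: "fderiv \<rho> x v < 0"
  shows "fderiv \<rho>' x v \<le> 0"
proof (rule ccontr)
  assume "\<not> fderiv \<rho>' x v \<le> 0"
  hence p: "fderiv \<rho>' x v > 0" by simp
  note dfD = defining_functionD[OF \<rho>(1)] and dfD' = defining_functionD[OF \<rho>'(1)]
  have "((\<lambda>t. (1 / t) *\<^sub>R (\<rho> (x + t *\<^sub>R v) - \<rho> x)) \<longlongrightarrow> fderiv \<rho> x v) (at_right (0::real))"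
    using has_derivative_difference_quotient[OF \<rho>(2)[unfolded frechet_derivative_works], of v] by (rule filterlim_mono) (auto simp: at_within_le_at)
  from order_tendstoD(2)[OF this v]
  have 1: "\<forall>\<^sub>F t in at_right 0. (1 / t) * (\<rho> (x + t *\<^sub>R v) - \<rho> x) < 0" by simp
  have "((\<lambda>t. (1 / t) *\<^sub>R (\<rho>' (x + t *\<^sub>R v) - \<rho>' x)) \<longlongrightarrow> fderiv \<rho>' x v) (at_right (0::real))"
    using has_derivative_difference_quotient[OF \<rho>'(2)[unfolded frechet_derivative_works], of v] by (rule filterlim_mono) (auto simp: at_within_le_at)
  from order_tendstoD(1)[OF this p]
  have 2: "\<forall>\<^sub>F t in at_right 0. 0 < (1 / t) * (\<rho>' (x + t *\<^sub>R v) - \<rho>' x)" by simp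
  have "((\<lambda>t. x + t *\<^sub>R v) \<longlongrightarrow> x + 0 *\<^sub>R v) (at_right (0::real))" by (intro tendsto_intros)
  hence 3: "\<forall>\<^sub>F t in at_right (0::real). x + t *\<^sub>R v \<in> V \<inter> V'"
    by (rule topological_tendstoD) (use dfD(1) dfD'(1) \<rho>(3) \<rho>'(3) in auto)
  have 4: "\<forall>\<^sub>F t in at_right (0::real). 0 < t" by (simp add: eventually_at_right_less)
  from 1 2 3 4 have "\<forall>\<^sub>F t in at_right (0::real). False"
  proof eventually_elim
    case (elim t)
    have "\<rho> x = 0" "\<rho>' x = 0" using dfD(3)[of x] dfD'(3)[of x] x \<rho>(3) \<rho>'(3) by auto
    hence "\<rho> (x + t *\<^sub>R v) < 0" "\<rho>' (x + t *\<^sub>R v) > 0"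
      using elim by (auto simp: zero_less_divide_iff divide_less_0_iff)
    thus ?case using dfD(2)[of "x + t *\<^sub>R v"] dfD'(2)[of "x + t *\<^sub>R v"] elim(3) by auto
  qed
  thus False by simp
qed

text \<open>Obtained from signs alone, without dividing one defining function by the other: a
  tangential vector is perturbed by a little of an inward vector \<open>w\<close>, which makes its
  \<open>\<rho>'\<close>-derivative nonpositive, and the opposite vector gives the reverse
  inequality.\<close>

lemma defining_function_derivative_kernel:
  fixes \<rho> \<rho>' :: "complex ^ 'n::finite => real"
  assumes \<rho>: "defining_function D V \<rho>" "\<rho> differentiable (at x)" "x \<in> V"
    and \<rho>': "defining_function D V' \<rho>'" "\<rho>' differentiable (at x)" "x \<in> V'"
    and x: "x \<in> frontier D" and v: "fderiv \<rho> x v = 0"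
  shows "fderiv \<rho>' x v = 0"
proof -
  note l = linear_frechet_derivative[OF \<rho>(2)] and l' = linear_frechet_derivative[OF \<rho>'(2)]
  obtain w0 where "fderiv \<rho> x w0 \<noteq> 0"
    using defining_functionD(4)[OF \<rho>(1,3) x] by (auto simp: fun_eq_iff)
  then obtain w where w: "fderiv \<rho> x w < 0"
  proof (cases "fderiv \<rho> x w0 < 0")
    case False
    hence "fderiv \<rho> x (- w0) < 0"
      using linear_neg[OF l, of w0] \<open>fderiv \<rho> x w0 \<noteq> 0\<close> by simp
    thus ?thesis by (rule that)
  qed
  have le: "fderiv \<rho>' x u \<le> 0" if u: "fderiv \<rho> x u = 0" for u
  proof (rule ccontr)
    assume "\<not> fderiv \<rho>' x u \<le> 0"
    hence p: "fderiv \<rho>' x u > 0" by simp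
    define M where "M = \<bar>fderiv \<rho>' x w\<bar> + 1"
    have M: "M > 0" by (simp add: M_def add_nonneg_pos)
    \<comment> \<open>The perturbation then costs at most half of the positive derivative in
      direction \<open>u\<close>, and the contradiction survives.\<close>
    define s where "s = fderiv \<rho>' x u / (2 * M)"
    have s: "s > 0" using p M by (simp add: s_def)
    have "fderiv \<rho> x (u + s *\<^sub>R w) < 0"
      using u w s by (simp add: linear_add[OF l] linear_scale[OF l] mult_pos_neg)
    from defining_function_derivative_sign[OF \<rho> \<rho>' x this]
    have "fderiv \<rho>' x u + s * fderiv \<rho>' x w \<le> 0"
      by (simp add: linear_add[OF l'] linear_scale[OF l'])
    moreover have "s * \<bar>fderiv \<rho>' x w\<bar> \<le> s * M" using s by (simp add: M_def)
    moreover have "s * M = fderiv \<rho>' x u / 2"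
      using M by (simp add: s_def)
    moreover have "- (s * \<bar>fderiv \<rho>' x w\<bar>) \<le> s * fderiv \<rho>' x w"
      using s abs_le_iff[of "fderiv \<rho>' x w" "\<bar>fderiv \<rho>' x w\<bar>"]
      by (metis abs_ge_minus_self abs_mult abs_of_pos minus_le_iff)
    ultimately show False using p by linarith
  qed
  have "fderiv \<rho> x (- v) = 0" using v by (simp add: linear_neg[OF l])
  from le[OF this] have "fderiv \<rho>' x v \<ge> 0" by (simp add: linear_neg[OF l'])
  with le[OF v] show ?thesis by simp
qed

text \<open>A vector annihilates the complex conormal if and only if it and its multiple by
  \<open>\<i>\<close> lie in the real kernel of the differential, and that kernel is the same for
  all defining functions.\<close>

lemma T10_boundary_eq:
  fixes \<rho> :: "complex ^ 'n::finite => real"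
  assumes \<rho>: "defining_function D V \<rho>" "Ck_on 1 V \<rho>" "x \<in> V" and x: "x \<in> frontier D"
  shows "T10_boundary D x = {a. bil a (d_rho \<rho> x) = 0}"
proof -
  have d: "\<rho> differentiable (at x)" using \<rho>(2,3) by simp
  have ker: "bil a (d_rho \<rho> x) = 0 \<longleftrightarrow> fderiv \<rho> x a = 0 \<and> fderiv \<rho> x (\<i> *s a) = 0"
    if "\<rho> differentiable (at x)" for a and \<rho> :: "complex ^ 'n => real"
  proof -
    have "bil (\<i> *s a) (d_rho \<rho> x) = \<i> * bil a (d_rho \<rho> x)" by (simp add: bil_def sum_distrib_left mult_ac)
    thus ?thesis unfolding frechet_derivative_d_rho[OF that] by (auto simp: complex_eq_iff)
  qed
  have sumbil: "(\<Sum>j\<in>UNIV. a $ j * d_z j (\<lambda>y. complex_of_real (\<rho>' y)) x) = bil a (d_rho \<rho>' x)" for a \<rho>'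
    by (simp add: bil_def d_rho_def)
  show ?thesis
  proof (intro equalityI subsetI)
    fix a assume "a \<in> T10_boundary D x"
    then obtain V' \<rho>' where r: "x \<in> V'" "defining_function D V' \<rho>'" "Ck_on 1 V' \<rho>'" "bil a (d_rho \<rho>' x) = 0"
      unfolding T10_boundary_def sumbil by blast
    have d': "\<rho>' differentiable (at x)" using r(1,3) by simp
    have "fderiv \<rho>' x a = 0" "fderiv \<rho>' x (\<i> *s a) = 0" using ker[OF d', of a] r(4) by auto
    hence "fderiv \<rho> x a = 0" "fderiv \<rho> x (\<i> *s a) = 0"
      using defining_function_derivative_kernel[OF r(2) d' r(1) \<rho>(1) d \<rho>(3) x] by auto
    thus "a \<in> {a. bil a (d_rho \<rho> x) = 0}" using ker[OF d] by simp
  next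
    fix a assume "a \<in> {a. bil a (d_rho \<rho> x) = 0}"
    thus "a \<in> T10_boundary D x" unfolding T10_boundary_def sumbil using \<rho> by blast
  qed
qed

section \<open>Peaking functions with an oscillating phase\<close>

lemma d_z_add:
  assumes "f differentiable (at x)" "g differentiable (at x)"
  shows "d_z j (\<lambda>x. f x + g x) x = d_z j f x + d_z j g x"
    and "d_zbar j (\<lambda>x. f x + g x) x = d_zbar j f x + d_zbar j g x"
proof -
  note d = has_derivative_add[OF assms[unfolded frechet_derivative_works]]
  show "d_z j (\<lambda>x. f x + g x) x = d_z j f x + d_z j g x"
    unfolding d_z_eq(1)[OF d] unfolding d_z_def by (simp add: algebra_simps add_divide_distrib diff_divide_distrib)
  show "d_zbar j (\<lambda>x. f x + g x) x = d_zbar j f x + d_zbar j g x"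
    unfolding d_z_eq(2)[OF d] unfolding d_zbar_def by (simp add: algebra_simps add_divide_distrib diff_divide_distrib)
qed

lemma d_z_exp:
  assumes "h differentiable (at x)"
  shows "d_z j (\<lambda>x. exp (of_real t * h x)) x = of_real t * exp (of_real t * h x) * d_z j h x"
    and "d_zbar j (\<lambda>x. exp (of_real t * h x)) x = of_real t * exp (of_real t * h x) * d_zbar j h x"
proof -
  note d = has_derivative_compose[OF has_derivative_mult_right[OF assms[unfolded frechet_derivative_works], of "of_real t :: complex"]
      DERIV_exp[unfolded has_field_derivative_def]]
  show "d_z j (\<lambda>x. exp (of_real t * h x)) x = of_real t * exp (of_real t * h x) * d_z j h x"
    unfolding d_z_eq(1)[OF d] unfolding d_z_def by (simp add: algebra_simps diff_divide_distrib)
  show "d_zbar j (\<lambda>x. exp (of_real t * h x)) x = of_real t * exp (of_real t * h x) * d_zbar j h x"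
    unfolding d_z_eq(2)[OF d] unfolding d_zbar_def by (simp add: algebra_simps add_divide_distrib)
qed

lemma integrable_lebesgue_on_of_lborel:
  fixes h :: "'a::euclidean_space => 'b::{banach, second_countable_topology}"
  assumes "open D" "integrable lborel h" shows "integrable (leb D) h"
proof -
  have s: "D \<inter> space lebesgue \<in> sets lebesgue" using assms(1) by simp
  have "integrable lborel (\<lambda>x. indicator D x *\<^sub>R h x)"
    using assms by (intro integrable_mult_indicator) auto
  hence "integrable lebesgue (\<lambda>x. indicator D x *\<^sub>R h x)"
    by (subst integrable_completion) (auto intro: borel_measurable_integrable)
  thus "integrable (leb D) h" by (simp add: integrable_restrict_space[OF s])
qed

lemma integrable_lebesgue_on_compact_piece:
  fixes h :: "'a::euclidean_space => 'b::{banach, second_countable_topology}"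
  assumes "open D" "compact K" "continuous_on K h" "\<And>x. x \<notin> K ==> h x = 0"
  shows "integrable (leb D) h"
proof -
  have "integrable lborel (\<lambda>x. indicator K x *\<^sub>R h x)" by (rule borel_integrable_compact[OF assms(2,3)])
  moreover have "(\<lambda>x. indicator K x *\<^sub>R h x) = h" using assms(4) by (auto simp: fun_eq_iff indicator_def)
  ultimately show ?thesis using integrable_lebesgue_on_of_lborel[OF assms(1)] by simp
qed

lemma L2_normsq_compact_piece:
  assumes "open D" "compact K" "continuous_on K h" "\<And>x. x \<notin> K ==> h x = 0"
  shows "L2_normsq D h = ennreal (LINT x|leb D. (cmod (h x))^2)"
  unfolding L2_normsq_def
  by (rule nn_integral_eq_integral, rule integrable_lebesgue_on_compact_piece[OF assms(1,2)])
     (auto intro!: continuous_intros assms)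

abbreviation dvg where "dvg X x \<equiv> \<Sum>k\<in>UNIV. d_z k (\<lambda>x. X x $ k) x"

text \<open>An abstract setting: everything here holds for any C1 phase that vanishes at
  \<open>x0\<close> and decays quadratically in \<open>D\<close>. The specific phase of a Levi form
  enters only afterwards.\<close>

locale phase_cutoff =
  fixes D V :: "(complex ^ 'n::finite) set" and \<rho> \<theta> :: "complex ^ 'n => real" and x0 :: "complex ^ 'n"
    and \<Psi> :: "complex ^ 'n => complex" and \<epsilon> c :: real
  assumes D: "open D" and df: "defining_function D V \<rho>" and C1: "Ck_on 1 V \<rho>"
    and \<epsilon>: "\<epsilon> > 0" and cball: "cball x0 \<epsilon> \<subseteq> V" and x0: "x0 \<in> frontier D"
    and \<Psi>: "Ck_on 1 UNIV \<Psi>" "\<Psi> x0 = 0"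
    and \<theta>: "Ck_on 1 UNIV \<theta>" "\<And>x. 0 \<le> \<theta> x" "\<And>x. \<theta> x \<le> 1"
      "\<And>x. x \<in> ball x0 (\<epsilon> / 2) ==> \<theta> x = 1" "\<And>x. x \<notin> cball x0 \<epsilon> ==> \<theta> x = 0"
    and c: "c > 0" and decay: "\<And>x. x \<in> D ==> x \<in> cball x0 \<epsilon> ==> 2 * Re (\<Psi> x) \<le> - c * (dist x x0)^2"
begin

abbreviation K where "K \<equiv> cball x0 \<epsilon>"

definition f :: "real => complex ^ 'n => complex" where
  "f t x = of_real (\<theta> x) * exp (of_real t * \<Psi> x)"

definition w :: "real => complex ^ 'n => real" where
  "w t x = (\<theta> x)^2 * exp (t * (2 * Re (\<Psi> x)))"

text \<open>Averages against the squared modulus of \<open>f t\<close>, left unnormalised because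
  every statement compares them with \<open>mass t\<close>.\<close>

definition avg :: "real => (complex ^ 'n => real) => real" where
  "avg t g = (LINT x|leb D. w t x * g x)"

definition mass :: "real => real" where "mass t = avg t (\<lambda>x. 1)"

definition annulus :: "(complex ^ 'n) set" where "annulus = cball x0 \<epsilon> - ball x0 (\<epsilon> / 2)"

definition tail :: "real => real" where
  "tail t = (LINT x|leb D. indicator annulus x * exp (t * (2 * Re (\<Psi> x))))"

text \<open>The holomorphic gradient of \<open>2 Re \<Psi>\<close>; times \<open>t\<close> it is the
  logarithmic derivative of the weight \<open>w t\<close> where the cutoff is 1.\<close>

definition dPhi :: "complex ^ 'n => complex ^ 'n" where
  "dPhi x = (\<chi> k. d_z k \<Psi> x + cnj (d_zbar k \<Psi> x))"

lemma \<Psi>_differentiable: "\<Psi> differentiable (at x)" using \<Psi>(1) by simp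

lemma \<Psi>_continuous: "continuous_on S \<Psi>"
  using Ck_on_1D(3)[OF \<Psi>(1)] continuous_on_subset by blast

lemma \<theta>_continuous: "continuous_on S \<theta>"
  using Ck_on_1D(3)[OF \<theta>(1)] continuous_on_subset by blast

lemma w_continuous: "continuous_on S (w t)"
  unfolding w_def[abs_def] by (intro continuous_intros \<Psi>_continuous \<theta>_continuous)

lemma w_nonneg: "0 \<le> w t x" by (simp add: w_def)

lemma w_outside: "x \<notin> K ==> w t x = 0" by (simp add: w_def \<theta>(5) del: mem_cball)

lemma f_outside: "x \<notin> K ==> f t x = 0" by (simp add: f_def \<theta>(5) del: mem_cball)

lemma f_C1: "Ck_on 1 UNIV (f t)"
  unfolding f_def[abs_def] by (intro Ck_on_1_intros \<theta>(1) \<Psi>(1))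

lemma cmod_f: "(cmod (f t x))^2 = w t x"
  by (simp add: f_def w_def norm_mult power_mult_distrib exp_double[symmetric] flip: exp_of_nat_mult)

lemma annulus_compact: "compact annulus"
  unfolding annulus_def by (intro compact_diff) auto

lemma avg_integrable:
  assumes "continuous_on K g" shows "integrable (leb D) (\<lambda>x. w t x * g x)"
  by (rule integrable_lebesgue_on_compact_piece[OF D compact_cball[of x0 \<epsilon>]])
     (intro continuous_intros w_continuous assms, simp add: w_outside del: mem_cball)

lemma tail_integrable: "integrable (leb D) (\<lambda>x. indicator annulus x * exp (t * (2 * Re (\<Psi> x))))"
proof -
  have "integrable lborel (\<lambda>x. indicator annulus x *\<^sub>R exp (t * (2 * Re (\<Psi> x))))"
    by (intro borel_integrable_compact annulus_compact continuous_intros \<Psi>_continuous)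
  thus ?thesis using integrable_lebesgue_on_of_lborel[OF D] by simp
qed

lemma avg_add: "continuous_on K g ==> continuous_on K h ==> avg t (\<lambda>x. g x + h x) = avg t g + avg t h"
  unfolding avg_def distrib_left by (intro Bochner_Integration.integral_add avg_integrable)

lemma avg_diff: "continuous_on K g ==> continuous_on K h ==> avg t (\<lambda>x. g x - h x) = avg t g - avg t h"
  unfolding avg_def right_diff_distrib by (intro Bochner_Integration.integral_diff avg_integrable)

lemma avg_cmult: "avg t (\<lambda>x. a * g x) = a * avg t g"
  unfolding avg_def by (simp add: mult.left_commute)

lemma avg_mono:
  assumes "continuous_on K g" "continuous_on K h" "\<And>x. x \<in> D ==> x \<in> K ==> g x \<le> h x"
  shows "avg t g \<le> avg t h"
  unfolding avg_def
proof (rule Bochner_Integration.integral_mono[OF avg_integrable avg_integrable])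
  fix x assume "x \<in> space (leb D)"
  thus "w t x * g x \<le> w t x * h x"
    using assms(3)[of x] w_nonneg[of t x] w_outside[of x t] by (cases "x \<in> K") (auto intro: mult_left_mono simp del: mem_cball)
qed (fact assms)+

lemma avg_sum:
  assumes "\<And>i. i \<in> I ==> continuous_on K (g i)" shows "avg t (\<lambda>x. \<Sum>i\<in>I. g i x) = (\<Sum>i\<in>I. avg t (g i))"
  using assms
proof (induction I rule: infinite_finite_induct)
  case (insert i I)
  thus ?case by (simp add: avg_add continuous_on_sum)
qed (simp_all add: avg_def)

lemma avg_const: "avg t (\<lambda>x. a) = a * mass t"
  using avg_cmult[of t a "\<lambda>x. 1"] by (simp add: mass_def)

text \<open>The mass may tend to 0, but more slowly than any exponential: the phase is close to 0
  near \<open>x0\<close>, and \<open>D\<close> contains a ball arbitrarily close to its boundary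
  point \<open>x0\<close>.\<close>

lemma mass_lower_bound:
  assumes "a > 0" obtains b where "b > 0" "\<And>t. t \<ge> 0 ==> b * exp (- t * a) \<le> mass t"
proof -
  define S where "S = {x. - a < 2 * Re (\<Psi> x)}"
  have "open S" unfolding S_def by (intro open_Collect_less continuous_intros \<Psi>_continuous)
  hence S: "open S" "x0 \<in> S" "\<And>x. x \<in> S ==> - a < 2 * Re (\<Psi> x)" using assms \<Psi>(2) by (simp_all add: S_def)
  define T where "T = S \<inter> ball x0 (\<epsilon> / 2)"
  have T: "open T" "x0 \<in> T" using S \<epsilon> by (auto simp: T_def)
  have "x0 \<in> closure D" using x0 by (simp add: frontier_def)
  hence "T \<inter> closure D \<noteq> {}" using T(2) by blast
  hence "T \<inter> D \<noteq> {}" using open_Int_closure_eq_empty[OF T(1), of D] by simp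
  then obtain y where y: "y \<in> D" "y \<in> S \<inter> ball x0 (\<epsilon> / 2)" unfolding T_def by blast
  have "open (D \<inter> (S \<inter> ball x0 (\<epsilon> / 2)))" using D S by auto
  then obtain r where r: "r > 0" "cball y r \<subseteq> D \<inter> (S \<inter> ball x0 (\<epsilon> / 2))" using y by (meson IntI open_contains_cball)
  let ?b = "LINT x|leb D. indicator (cball y r) x :: real"
  have i: "integrable (leb D) (\<lambda>x. indicator (cball y r) x :: real)"
    by (rule integrable_indicator_compact_lebesgue_on[OF D]) simp
  have b: "?b > 0"
  proof -
    have "?b = (LINT x|lebesgue. indicator D x *\<^sub>R indicator (cball y r) x)"
      using D by (intro integral_restrict_space) simp
    also have "\<dots> = (LINT x|lebesgue. indicator (cball y r) x)"
      using r by (intro Bochner_Integration.integral_cong) (auto simp: indicator_def)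
    also have "\<dots> = measure lebesgue (cball y r)" by simp
    also have "\<dots> > 0" using content_cball_pos[OF r(1), of y] by simp
    finally show ?thesis .
  qed
  have "?b * exp (- t * a) \<le> mass t" if t: "t \<ge> 0" for t
  proof -
    have "?b * exp (- t * a) = (LINT x|leb D. indicator (cball y r) x * exp (- t * a))" by simp
    also have "\<dots> \<le> (LINT x|leb D. w t x * 1)"
    proof (rule Bochner_Integration.integral_mono[OF integrable_mult_left[OF i] avg_integrable])
      fix x
      show "indicator (cball y r) x * exp (- t * a) \<le> w t x * 1"
      proof (cases "x \<in> cball y r")
        case True
        hence x: "x \<in> S" "x \<in> ball x0 (\<epsilon> / 2)" using r by auto
        have "- t * a \<le> t * (2 * Re (\<Psi> x))" using mult_left_mono[OF less_imp_le[OF S(3)[OF x(1)]] t] by simp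
        thus ?thesis using True \<theta>(4)[OF x(2)] by (simp add: w_def)
      next
        case False
        thus ?thesis using w_nonneg by simp
      qed
    qed (intro continuous_intros)
    finally show ?thesis by (simp add: mass_def avg_def)
  qed
  thus ?thesis using b by (intro that[of ?b])
qed

lemma mass_pos: "t \<ge> 0 ==> mass t > 0"
proof -
  obtain b where "b > 0" "\<And>t. t \<ge> 0 ==> b * exp (- t * 1) \<le> mass t" using mass_lower_bound[of 1] by auto
  thus "t \<ge> 0 ==> mass t > 0" by (meson exp_gt_zero less_le_trans mult_pos_pos)
qed

lemma tail_nonneg: "tail t \<ge> 0"
  unfolding tail_def by (rule Bochner_Integration.integral_nonneg_AE) (auto intro!: AE_I2)

text \<open>On the annulus the phase is uniformly negative, whereas it vanishes at the centre.\<close>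

lemma tail_negligible:
  assumes "\<delta> > 0" shows "\<forall>\<^sub>F t in at_top. t^2 * tail t \<le> \<delta> * mass t"
proof -
  \<comment> \<open>The tail decays at least like \<open>exp (- t * a)\<close>. Bounding the mass
    from below with half that rate leaves \<open>exp (- t * a / 2)\<close>, which absorbs the factor
    \<open>t^2\<close>.\<close>
  define a where "a = c * (\<epsilon> / 2)^2"
  have a: "a > 0" using c \<epsilon> by (simp add: a_def)
  obtain b where b: "b > 0" "\<And>t. t \<ge> 0 ==> b * exp (- t * (a / 2)) \<le> mass t" using mass_lower_bound[of "a / 2"] a by auto
  let ?v = "LINT x|leb D. indicator annulus x :: real"
  have i: "integrable (leb D) (\<lambda>x. indicator annulus x :: real)"
    by (rule integrable_indicator_compact_lebesgue_on[OF D annulus_compact])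
  have t: "tail t \<le> ?v * exp (- t * a)" if t: "t \<ge> 0" for t
  proof -
    have "tail t \<le> (LINT x|leb D. indicator annulus x * exp (- t * a))"
      unfolding tail_def
    proof (rule Bochner_Integration.integral_mono[OF tail_integrable integrable_mult_left[OF i]])
      fix x assume "x \<in> space (leb D)"
      hence x: "x \<in> D" by simp
      show "indicator annulus x * exp (t * (2 * Re (\<Psi> x))) \<le> indicator annulus x * exp (- t * a)"
      proof (cases "x \<in> annulus")
        case True
        hence "x \<in> K" "\<epsilon> / 2 \<le> dist x x0" by (auto simp: annulus_def dist_commute)
        have "c * (\<epsilon> / 2)^2 \<le> c * (dist x x0)^2" using \<open>\<epsilon> / 2 \<le> dist x x0\<close> c \<epsilon> by (intro mult_left_mono power_mono) auto
        hence "2 * Re (\<Psi> x) \<le> - a" using decay[OF x \<open>x \<in> K\<close>] by (simp add: a_def)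
        hence "t * (2 * Re (\<Psi> x)) \<le> - t * a" using mult_left_mono[OF _ t] by fastforce
        thus ?thesis by (intro mult_left_mono) auto
      qed simp
    qed
    thus ?thesis by simp
  qed
  have v: "?v \<ge> 0" by (rule Bochner_Integration.integral_nonneg_AE) (auto intro!: AE_I2)
  have "((\<lambda>t::real. t^2 / exp t) \<longlongrightarrow> 0) at_top" by (rule tendsto_power_div_exp_0)
  from filterlim_compose[OF this filterlim_tendsto_pos_mult_at_top[OF tendsto_const[of "a / 2"] _ filterlim_ident]]
  have "((\<lambda>t. (a / 2 * t)^2 / exp (a / 2 * t)) \<longlongrightarrow> 0) at_top" using a by simp
  hence "((\<lambda>t. (4 * ?v / a^2) * ((a / 2 * t)^2 / exp (a / 2 * t))) \<longlongrightarrow> (4 * ?v / a^2) * 0) at_top"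
    by (intro tendsto_intros)
  hence "\<forall>\<^sub>F t in at_top. (4 * ?v / a^2) * ((a / 2 * t)^2 / exp (a / 2 * t)) < \<delta> * b"
    using assms b(1) by (intro order_tendstoD(2)[where y="(4 * ?v / a^2) * 0"]) auto
  thus ?thesis using eventually_ge_at_top[of 0]
  proof eventually_elim
    case (elim t)
    have "?v * t^2 / exp (a / 2 * t) \<le> \<delta> * b"
      using elim(1) a by (simp add: power2_eq_square field_simps)
    hence "?v * t^2 * exp (- (a / 2 * t)) \<le> \<delta> * b" by (simp only: exp_minus divide_inverse)
    hence le: "?v * t^2 * exp (- (a / 2 * t)) * exp (- (a / 2 * t)) \<le> \<delta> * b * exp (- (a / 2 * t))"
      by (intro mult_right_mono) auto
    define e where "e = exp (- (a / 2 * t))"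
    have "exp (- t * (a / 2)) = exp (- (a / 2 * t))" by (simp add: mult_ac)
    moreover have "exp (- t * a) = exp (- (a / 2 * t)) * exp (- (a / 2 * t))"
      by (simp flip: exp_add add: field_simps)
    ultimately have ee: "exp (- t * (a / 2)) = e" "exp (- t * a) = e * e" by (simp_all only: e_def)
    have "t^2 * (?v * exp (- t * a)) = ?v * t^2 * e * e" unfolding ee by (simp only: mult_ac)
    also have "\<dots> \<le> \<delta> * b * e" using le unfolding e_def .
    finally have "t^2 * (?v * exp (- t * a)) \<le> \<delta> * (b * exp (- t * (a / 2)))"
      unfolding ee by (simp only: mult_ac)
    moreover have "t^2 * tail t \<le> t^2 * (?v * exp (- t * a))" using t elim(2) by (intro mult_left_mono) auto
    moreover have "\<delta> * (b * exp (- t * (a / 2))) \<le> \<delta> * mass t" using b(2) elim(2) assms by (intro mult_left_mono) auto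
    ultimately show ?case by linarith
  qed
qed

lemma \<theta>_derivative_outside:
  assumes "x \<notin> annulus"
  shows "d_z k (\<lambda>x. complex_of_real (\<theta> x)) x = 0" "d_zbar k (\<lambda>x. complex_of_real (\<theta> x)) x = 0"
proof -
  have "((\<lambda>x. complex_of_real (\<theta> x)) has_derivative (\<lambda>v. 0)) (at x)"
  proof (cases "x \<in> ball x0 (\<epsilon> / 2)")
    case True
    show ?thesis
      by (rule has_derivative_transform_within_open[OF has_derivative_const[of 1] open_ball True]) (simp add: \<theta>(4) del: mem_ball)
  next
    case False
    hence "x \<in> - K" using assms by (auto simp: annulus_def)
    show ?thesis
      by (rule has_derivative_transform_within_open[OF has_derivative_const[of 0] open_Compl[OF closed_cball] \<open>x \<in> - K\<close>]) (simp add: \<theta>(5) del: mem_cball)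
  qed
  thus "d_z k (\<lambda>x. complex_of_real (\<theta> x)) x = 0" "d_zbar k (\<lambda>x. complex_of_real (\<theta> x)) x = 0"
    by (simp_all add: d_z_eq)
qed

lemma d_f:
  "d_z k (f t) x = of_real t * f t x * d_z k \<Psi> x + exp (of_real t * \<Psi> x) * d_z k (\<lambda>x. complex_of_real (\<theta> x)) x"
  "d_zbar k (f t) x = of_real t * f t x * d_zbar k \<Psi> x + exp (of_real t * \<Psi> x) * d_zbar k (\<lambda>x. complex_of_real (\<theta> x)) x"
proof -
  have 1: "(\<lambda>x. complex_of_real (\<theta> x)) differentiable (at x)" using Ck_on_1_of_real[OF \<theta>(1)] by simp
  have 2: "(\<lambda>x. exp (of_real t * \<Psi> x)) differentiable (at x)"
    using Ck_on_1_exp[OF Ck_on_1_mult[OF Ck_on_1_const \<Psi>(1)]] by simp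
  show "d_z k (f t) x = of_real t * f t x * d_z k \<Psi> x + exp (of_real t * \<Psi> x) * d_z k (\<lambda>x. complex_of_real (\<theta> x)) x"
    unfolding f_def[abs_def] d_z_mult(1)[OF 1 2] d_z_exp(1)[OF \<Psi>_differentiable] by (simp add: mult_ac)
  show "d_zbar k (f t) x = of_real t * f t x * d_zbar k \<Psi> x + exp (of_real t * \<Psi> x) * d_zbar k (\<lambda>x. complex_of_real (\<theta> x)) x"
    unfolding f_def[abs_def] d_z_mult(2)[OF 1 2] d_z_exp(2)[OF \<Psi>_differentiable] by (simp add: mult_ac)
qed

lemma dPhi_continuous: "continuous_on S dPhi"
  unfolding dPhi_def[abs_def]
  using d_z_continuous[OF Ck_on_1_subset[OF \<Psi>(1), of S]] by (intro continuous_intros) auto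

text \<open>The divergence of the weighted field \<open>w t * X\<close> integrates to 0 in real
  part. Derivatives of the weight give \<open>t * bil X dPhi\<close>, derivatives of the cutoff live
  on the annulus. All moments used later come from this one identity by choosing
  \<open>X\<close>.\<close>

lemma phase_identity:
  fixes X :: "complex ^ 'n => complex ^ 'n"
  assumes V': "open V'" "K \<subseteq> V'" and X: "\<And>k. Ck_on 1 V' (\<lambda>x. X x $ k)"
    and tang: "\<And>x. x \<in> D ==> x \<in> K ==> \<bar>Re (bil (X x) (d_rho \<rho> x))\<bar> \<le> C * \<bar>\<rho> x\<bar>" and C: "C \<ge> 0"
  obtains B where "B \<ge> 0" "\<And>t. \<bar>avg t (\<lambda>x. Re ((dvg X x) + of_real t * bil (X x) (dPhi x)))\<bar> \<le> B * tail t"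
proof -
  define d\<theta> where "d\<theta> x = (\<chi> k. d_z k (\<lambda>x. complex_of_real (\<theta> x)) x)" for x
  have cX: "continuous_on K (\<lambda>x. X x $ k)" for k using Ck_on_1D(3)[OF X] continuous_on_subset V'(2) by blast
  have cdX: "continuous_on K (d_z k (\<lambda>x. X x $ k))" for k using d_z_continuous(1)[OF X] continuous_on_subset V'(2) by blast
  have cd\<theta>: "continuous_on S (\<lambda>x. d\<theta> x $ k)" for k S
    unfolding d\<theta>_def using d_z_continuous(1)[OF Ck_on_1_of_real[OF \<theta>(1)]] continuous_on_subset by fastforce
  have cb: "continuous_on K (\<lambda>x. 2 * bil (X x) (d\<theta> x))" unfolding bil_def by (intro continuous_intros cX cd\<theta>)
  have "bounded ((\<lambda>x. 2 * bil (X x) (d\<theta> x)) ` K)"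
    by (intro compact_imp_bounded compact_continuous_image cb) simp
  then obtain B where B: "B > 0" "\<And>x. x \<in> K ==> cmod (2 * bil (X x) (d\<theta> x)) \<le> B" by (auto simp: bounded_pos)
  have "\<bar>avg t (\<lambda>x. Re ((dvg X x) + of_real t * bil (X x) (dPhi x)))\<bar> \<le> B * tail t" for t
  proof -
    \<comment> \<open>The weight \<open>w t\<close> rewritten through the phase and its conjugate,
      so that the rules for Wirtinger derivatives apply.\<close>
    define W where "W x = complex_of_real (\<theta> x) * complex_of_real (\<theta> x) * exp (of_real t * (\<Psi> x + cnj (\<Psi> x)))" for x
    have Ww: "W x = complex_of_real (w t x)" for x
    proof -
      have "\<Psi> x + cnj (\<Psi> x) = of_real (2 * Re (\<Psi> x))" by (simp add: complex_eq_iff)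
      thus ?thesis unfolding W_def w_def by (simp add: power2_eq_square exp_of_real flip: of_real_mult)
    qed
    have WC1: "Ck_on 1 UNIV W" unfolding W_def by (intro Ck_on_1_intros \<theta>(1) \<Psi>(1))
    have dc: "(\<lambda>x. complex_of_real (\<theta> x)) differentiable (at x)" for x using Ck_on_1_of_real[OF \<theta>(1)] by simp
    have dcp: "(\<lambda>x. cnj (\<Psi> x)) differentiable (at x)" for x using Ck_on_1_cnj[OF \<Psi>(1)] by simp
    have dpp: "(\<lambda>x. \<Psi> x + cnj (\<Psi> x)) differentiable (at x)" for x
      using Ck_on_1_add[OF \<Psi>(1) Ck_on_1_cnj[OF \<Psi>(1)]] by simp
    have dcc: "(\<lambda>x. complex_of_real (\<theta> x) * complex_of_real (\<theta> x)) differentiable (at x)" for x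
      using Ck_on_1_mult[OF Ck_on_1_of_real[OF \<theta>(1)] Ck_on_1_of_real[OF \<theta>(1)]] by simp
    have dex: "(\<lambda>x. exp (of_real t * (\<Psi> x + cnj (\<Psi> x)))) differentiable (at x)" for x
      using Ck_on_1_exp[OF Ck_on_1_mult[OF Ck_on_1_const Ck_on_1_add[OF \<Psi>(1) Ck_on_1_cnj[OF \<Psi>(1)]]]] by simp
    have dW: "d_z k W x = of_real t * W x * dPhi x $ k + exp (of_real t * (\<Psi> x + cnj (\<Psi> x))) * (2 * of_real (\<theta> x)) * d\<theta> x $ k" for k x
      unfolding W_def[abs_def] d_z_mult(1)[OF dcc dex] d_z_mult(1)[OF dc dc] d_z_exp(1)[OF dpp]
        d_z_add(1)[OF \<Psi>_differentiable dcp] d_z_cnj(1)[OF \<Psi>_differentiable] dPhi_def d\<theta>_def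
      by (simp add: algebra_simps)
    define Y where "Y k x = W x * X x $ k" for k x
    have YK: "Y k x = 0" if "x \<notin> K" for k x using that by (simp add: Y_def Ww w_outside del: mem_cball)
    have Y: "C1_compact (Y k)" for k
    proof (rule C1_compactI[OF V'(1) _ compact_cball V'(2)])
      show "Ck_on 1 V' (Y k)" unfolding Y_def[abs_def]
        by (intro Ck_on_1_mult X Ck_on_1_subset[OF WC1]) simp
    qed (rule YK)
    have dY: "(\<Sum>k\<in>UNIV. d_z k (Y k) x) = W x * ((dvg X x) + of_real t * bil (X x) (dPhi x))
        + exp (of_real t * (\<Psi> x + cnj (\<Psi> x))) * of_real (\<theta> x) * (2 * bil (X x) (d\<theta> x))" for x
    proof (cases "x \<in> K")
      case True
      hence "(\<lambda>x. X x $ k) differentiable (at x)" for k using X[of k] V'(2) by auto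
      moreover have "W differentiable (at x)" using WC1 by simp
      ultimately have "d_z k (Y k) x = W x * d_z k (\<lambda>x. X x $ k) x + d_z k W x * X x $ k" for k
        unfolding Y_def[abs_def] by (rule d_z_mult(1)[rotated])
      hence "(\<Sum>k\<in>UNIV. d_z k (Y k) x) = (\<Sum>k\<in>UNIV. W x * d_z k (\<lambda>x. X x $ k) x + W x * of_real t * (X x $ k * dPhi x $ k)
          + exp (of_real t * (\<Psi> x + cnj (\<Psi> x))) * of_real (\<theta> x) * 2 * (X x $ k * d\<theta> x $ k))"
        unfolding dW by (intro sum.cong) (simp_all add: algebra_simps)
      thus ?thesis unfolding bil_def by (simp add: sum.distrib sum_distrib_left distrib_left mult.assoc)
    next
      case False
      hence "d_z k (Y k) x = 0" for k by (intro d_z_outside(1)[OF closed_cball YK]) (auto simp del: mem_cball)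
      thus ?thesis using False by (simp add: Ww w_outside \<theta>(5) del: mem_cball)
    qed
    have "bounded (w t ` K)" by (intro compact_imp_bounded compact_continuous_image w_continuous compact_cball)
    then obtain M where M: "M > 0" "\<And>x. x \<in> K ==> w t x \<le> M" by (force simp: bounded_pos)
    have z: "Re (LINT x|leb D. (\<Sum>k\<in>UNIV. d_z k (Y k) x)) = 0"
    proof (rule Re_integral_divergence_eq_0[OF D df C1 compact_cball cball Y YK])
      fix x assume x: "x \<in> D" "x \<in> K"
      have "(\<Sum>k\<in>UNIV. Y k x * d_rho \<rho> x $ k) = of_real (w t x) * bil (X x) (d_rho \<rho> x)"
        by (simp add: Y_def Ww bil_def sum_distrib_left mult_ac)
      hence "\<bar>Re (\<Sum>k\<in>UNIV. Y k x * d_rho \<rho> x $ k)\<bar> = w t x * \<bar>Re (bil (X x) (d_rho \<rho> x))\<bar>"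
        by (simp add: abs_mult w_nonneg)
      also have "\<dots> \<le> M * (C * \<bar>\<rho> x\<bar>)"
        using M(2)[OF x(2)] w_nonneg[of t x] by (intro mult_mono tang x) (use C M(1) in auto)
      finally show "\<bar>Re (\<Sum>k\<in>UNIV. Y k x * d_rho \<rho> x $ k)\<bar> \<le> M * C * \<bar>\<rho> x\<bar>" by (simp add: mult.assoc)
    qed (assumption, intro mult_nonneg_nonneg less_imp_le[OF M(1)] C)
    let ?g = "\<lambda>x. Re ((dvg X x) + of_real t * bil (X x) (dPhi x))"
    let ?r = "\<lambda>x. Re (exp (of_real t * (\<Psi> x + cnj (\<Psi> x))) * of_real (\<theta> x) * (2 * bil (X x) (d\<theta> x)))"
    have cg: "continuous_on K ?g"
      unfolding bil_def by (intro continuous_intros cX cdX continuous_on_component dPhi_continuous)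
    have d\<theta>0: "d\<theta> x = 0" if "x \<notin> annulus" for x
      using \<theta>_derivative_outside(1)[OF that] by (simp add: d\<theta>_def Finite_Cartesian_Product.vec_eq_iff)
    have ri: "integrable (leb D) ?r"
    proof (rule integrable_lebesgue_on_compact_piece[OF D compact_cball])
      show "continuous_on K ?r"
        by (intro continuous_on_Re continuous_on_mult[OF _ cb]) (intro continuous_intros \<Psi>_continuous \<theta>_continuous)
      show "?r x = 0" if "x \<notin> K" for x using that by (simp add: \<theta>(5) del: mem_cball)
    qed
    have Yi: "integrable (leb D) (\<lambda>x. \<Sum>k\<in>UNIV. d_z k (Y k) x)"
    proof (rule integrable_lebesgue_on_continuous_compact[OF D _ compact_cball])
      show "continuous_on UNIV (\<lambda>x. \<Sum>k\<in>UNIV. d_z k (Y k) x)"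
        using Y by (intro continuous_intros d_z_continuous) (auto simp: C1_compact_def)
      show "(\<Sum>k\<in>UNIV. d_z k (Y k) x) = 0" if "x \<notin> K" for x
        using d_z_outside(1)[OF closed_cball YK that] by simp
    qed
    have "(LINT x|leb D. Re (\<Sum>k\<in>UNIV. d_z k (Y k) x)) = 0" unfolding integral_Re[OF Yi] by (rule z)
    hence "0 = (LINT x|leb D. Re (\<Sum>k\<in>UNIV. d_z k (Y k) x))" ..
    also have "\<dots> = (LINT x|leb D. w t x * ?g x + ?r x)" unfolding dY Ww by (simp add: algebra_simps)
    also have "\<dots> = avg t ?g + (LINT x|leb D. ?r x)"
      unfolding avg_def by (rule Bochner_Integration.integral_add[OF avg_integrable[OF cg] ri])
    finally have "\<bar>avg t ?g\<bar> = \<bar>LINT x|leb D. ?r x\<bar>" by linarith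
    also have "\<dots> \<le> (LINT x|leb D. \<bar>?r x\<bar>)" using Bochner_Integration.integral_norm_bound[of "leb D" ?r] by simp
    also have "\<dots> \<le> (LINT x|leb D. B * (indicator annulus x * exp (t * (2 * Re (\<Psi> x)))))"
    proof (rule Bochner_Integration.integral_mono[OF _ integrable_mult_right[OF tail_integrable]])
      show "integrable (leb D) (\<lambda>x. \<bar>?r x\<bar>)" using integrable_norm[OF ri] by simp
      fix x
      show "\<bar>?r x\<bar> \<le> B * (indicator annulus x * exp (t * (2 * Re (\<Psi> x))))"
      proof (cases "x \<in> annulus")
        case True
        hence xK: "x \<in> K" by (auto simp: annulus_def)
        have "\<bar>?r x\<bar> \<le> cmod (exp (of_real t * (\<Psi> x + cnj (\<Psi> x))) * of_real (\<theta> x) * (2 * bil (X x) (d\<theta> x)))" by (rule abs_Re_le_cmod)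
        also have "\<dots> = (exp (t * (2 * Re (\<Psi> x))) * \<theta> x) * cmod (2 * bil (X x) (d\<theta> x))"
          using \<theta>(2)[of x] by (simp add: norm_mult)
        also have "\<dots> \<le> (exp (t * (2 * Re (\<Psi> x))) * 1) * B"
          using \<theta>(2,3)[of x] B(2)[OF xK] by (intro mult_mono) auto
        finally show ?thesis using True by (simp add: mult_ac)
      next
        case False
        thus ?thesis by (simp add: d\<theta>0 bil_def)
      qed
    qed
    also have "\<dots> = B * tail t" by (simp add: tail_def)
    finally show ?thesis .
  qed
  thus ?thesis using B(1) by (intro that[of B]) auto
qed

end

section \<open>Concentration at the boundary point, second moments, and stability of norms\<close>

context phase_cutoff
begin

definition d2 :: "complex ^ 'n => real" where "d2 x = (dist x x0)^2"

lemma \<rho>_continuous: "continuous_on K \<rho>"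
  using continuous_on_subset[OF Ck_on_1D(3)[OF C1] cball] .

lemma d2_continuous: "continuous_on S d2"
  unfolding d2_def[abs_def] by (intro continuous_intros)

lemma tail_eventually_small:
  assumes "\<delta> > 0" shows "\<forall>\<^sub>F t in at_top. B * tail t \<le> \<delta> * mass t"
proof -
  have "\<delta> / (\<bar>B\<bar> + 1) > 0" using assms by (simp add: add_nonneg_pos)
  from tail_negligible[OF this] show ?thesis using eventually_ge_at_top[of 1]
  proof eventually_elim
    case (elim t)
    have "B * tail t \<le> (\<bar>B\<bar> + 1) * tail t" using tail_nonneg[of t] by (intro mult_right_mono) auto
    also have "\<dots> \<le> (\<bar>B\<bar> + 1) * (t^2 * tail t)"
      using mult_right_mono[of 1 "t^2" "tail t"] elim(2) tail_nonneg[of t] by (intro mult_left_mono) (auto simp: one_le_power)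
    also have "\<dots> \<le> (\<bar>B\<bar> + 1) * (\<delta> / (\<bar>B\<bar> + 1) * mass t)" using elim(1) by (intro mult_left_mono) auto
    also have "\<dots> = \<delta> * mass t" by (simp add: field_simps)
    finally show ?case .
  qed
qed

lemma field_continuous:
  assumes "open V'" "K \<subseteq> V'" "\<And>k. Ck_on 1 V' (\<lambda>x. X x $ k)"
  shows "continuous_on K (\<lambda>x. \<Sum>k\<in>UNIV. d_z k (\<lambda>x. X x $ k) x)" "continuous_on K (\<lambda>x. bil (X x) (dPhi x))"
proof -
  have cX: "continuous_on K (\<lambda>x. X x $ k)" for k using Ck_on_1D(3)[OF assms(3)] continuous_on_subset assms(2) by blast
  have cdX: "continuous_on K (d_z k (\<lambda>x. X x $ k))" for k using d_z_continuous(1)[OF assms(3)] continuous_on_subset assms(2) by blast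
  have cP: "continuous_on K (\<lambda>x. dPhi x $ k)" for k by (rule continuous_on_component[OF dPhi_continuous])
  show "continuous_on K (\<lambda>x. \<Sum>k\<in>UNIV. d_z k (\<lambda>x. X x $ k) x)" by (intro continuous_on_sum cdX)
  show "continuous_on K (\<lambda>x. bil (X x) (dPhi x))" unfolding bil_def by (intro continuous_on_sum continuous_on_mult cX cP)
qed

lemma avg_affine:
  assumes "continuous_on K g"
  shows "avg t (\<lambda>x. a - b * g x) = a * mass t - b * avg t g" "avg t (\<lambda>x. a + b * g x) = a * mass t + b * avg t g"
proof -
  have 1: "continuous_on K (\<lambda>x. a)" and 2: "continuous_on K (\<lambda>x. b * g x)" by (intro continuous_intros assms)+
  show "avg t (\<lambda>x. a - b * g x) = a * mass t - b * avg t g" unfolding avg_diff[OF 1 2] avg_const avg_cmult ..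
  show "avg t (\<lambda>x. a + b * g x) = a * mass t + b * avg t g" unfolding avg_add[OF 1 2] avg_const avg_cmult ..
qed

lemma \<rho>_d2_continuous: "continuous_on K (\<lambda>x. \<bar>\<rho> x\<bar> + d2 x)"
  by (intro continuous_intros \<rho>_continuous d2_continuous)

text \<open>In the phase identity the divergence is bounded above, while the term with
  \<open>t\<close> is at most \<open>- t * a\<close> times the integrand; so \<open>t\<close> times
  its average is bounded by the mass. The 1 in \<open>C + 1\<close> absorbs the tail.\<close>

lemma concentration:
  fixes X :: "complex ^ 'n => complex ^ 'n"
  assumes V': "open V'" "K \<subseteq> V'" and X: "\<And>k. Ck_on 1 V' (\<lambda>x. X x $ k)"
    and tang: "\<And>x. x \<in> D ==> x \<in> K ==> \<bar>Re (bil (X x) (d_rho \<rho> x))\<bar> \<le> C * \<bar>\<rho> x\<bar>" and C: "C \<ge> 0"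
    and div: "\<And>x. x \<in> D ==> x \<in> K ==> Re (dvg X x) \<le> C"
    and inw: "\<And>x. x \<in> D ==> x \<in> K ==> Re (bil (X x) (dPhi x)) \<le> - a * (\<bar>\<rho> x\<bar> + d2 x)" and a: "a > 0"
  shows "\<forall>\<^sub>F t in at_top. t * avg t (\<lambda>x. \<bar>\<rho> x\<bar> + d2 x) \<le> ((C + 1) / a) * mass t"
proof -
  obtain B where B: "B \<ge> 0" "\<And>t. \<bar>avg t (\<lambda>x. Re ((dvg X x) + of_real t * bil (X x) (dPhi x)))\<bar> \<le> B * tail t"
    by (rule phase_identity[OF V' X _ C], rule tang, assumption, assumption) (rule that; assumption)
  note fc = field_continuous[OF V' X]
  have "\<forall>\<^sub>F t in at_top. B * tail t \<le> 1 * mass t" by (rule tail_eventually_small) simp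
  thus ?thesis using eventually_ge_at_top[of 0]
  proof eventually_elim
    case (elim t)
    have "avg t (\<lambda>x. Re ((dvg X x) + of_real t * bil (X x) (dPhi x)))
        \<le> avg t (\<lambda>x. C - (t * a) * (\<bar>\<rho> x\<bar> + d2 x))"
    proof (rule avg_mono)
      show "continuous_on K (\<lambda>x. Re ((dvg X x) + of_real t * bil (X x) (dPhi x)))"
        by (intro continuous_intros continuous_on_Re continuous_on_add fc continuous_on_mult)
      show "continuous_on K (\<lambda>x. C - (t * a) * (\<bar>\<rho> x\<bar> + d2 x))" by (intro continuous_intros \<rho>_continuous d2_continuous)
      fix x assume x: "x \<in> D" "x \<in> K"
      have "t * Re (bil (X x) (dPhi x)) \<le> t * (- a * (\<bar>\<rho> x\<bar> + d2 x))" by (intro mult_left_mono inw x elim(2))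
      thus "Re ((dvg X x) + of_real t * bil (X x) (dPhi x)) \<le> C - (t * a) * (\<bar>\<rho> x\<bar> + d2 x)"
        using div[OF x] by (simp del: Re_sum add: algebra_simps)
    qed
    also have "\<dots> = C * mass t - (t * a) * avg t (\<lambda>x. \<bar>\<rho> x\<bar> + d2 x)"
      by (rule avg_affine(1)[OF \<rho>_d2_continuous])
    finally have "(t * a) * avg t (\<lambda>x. \<bar>\<rho> x\<bar> + d2 x) \<le> (C + 1) * mass t"
      using B(2)[of t] elim(1) by (simp add: algebra_simps)
    thus ?case using a by (simp add: field_simps)
  qed
qed

text \<open>For a field with divergence close to 1 and with phase derivative close to
  \<open>- \<kappa>\<close> times \<open>|\<zeta>|^2\<close>, the identity is the second moment up
  to relative error \<open>s\<close>. The three summands of the constant come from the divergence,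
  from the phase derivative via concentration, and from the tail.\<close>

lemma second_moment:
  fixes X :: "complex ^ 'n => complex ^ 'n"
  assumes V': "open V'" "K \<subseteq> V'" and X: "\<And>k. Ck_on 1 V' (\<lambda>x. X x $ k)"
    and tang: "\<And>x. x \<in> D ==> x \<in> K ==> \<bar>Re (bil (X x) (d_rho \<rho> x))\<bar> \<le> C * \<bar>\<rho> x\<bar>" and C: "C \<ge> 0"
    and div: "\<And>x. x \<in> D ==> x \<in> K ==> \<bar>Re (dvg X x) - 1\<bar> \<le> C * s"
    and inw: "\<And>x. x \<in> D ==> x \<in> K ==> \<bar>Re (bil (X x) (dPhi x)) + \<kappa> * (cmod (\<zeta> x))^2\<bar> \<le> C * s * (\<bar>\<rho> x\<bar> + d2 x)"
    and s: "s > 0" and z: "continuous_on K \<zeta>"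
    and conc: "\<forall>\<^sub>F t in at_top. t * avg t (\<lambda>x. \<bar>\<rho> x\<bar> + d2 x) \<le> E * mass t"
  shows "\<forall>\<^sub>F t in at_top. \<bar>mass t - t * \<kappa> * avg t (\<lambda>x. (cmod (\<zeta> x))^2)\<bar> \<le> (C + C * E + 1) * s * mass t"
proof -
  obtain B where B: "B \<ge> 0" "\<And>t. \<bar>avg t (\<lambda>x. Re ((dvg X x) + of_real t * bil (X x) (dPhi x)))\<bar> \<le> B * tail t"
    by (rule phase_identity[OF V' X _ C], rule tang, assumption, assumption) (rule that; assumption)
  note fc = field_continuous[OF V' X]
  note cs = \<rho>_continuous d2_continuous z continuous_on_Re[OF fc(1)] continuous_on_Re[OF fc(2)]
  show ?thesis using tail_eventually_small[OF s, of B] conc eventually_ge_at_top[of 0]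
  proof eventually_elim
    case (elim t)
    let ?g = "\<lambda>x. Re ((dvg X x) + of_real t * bil (X x) (dPhi x))"
    let ?h = "\<lambda>x. 1 - (t * \<kappa>) * (cmod (\<zeta> x))^2"
    let ?r = "\<lambda>x. C * s + (t * (C * s)) * (\<bar>\<rho> x\<bar> + d2 x)"
    have cg: "continuous_on K ?g" by (intro continuous_on_Re continuous_on_add fc continuous_on_mult continuous_on_const)
    have ch: "continuous_on K ?h" by (intro continuous_intros z)
    have cr: "continuous_on K ?r" by (intro continuous_intros \<rho>_continuous d2_continuous)
    have p: "\<bar>?g x - ?h x\<bar> \<le> ?r x" if x: "x \<in> D" "x \<in> K" for x
    proof -
      have "?g x - ?h x = (Re (dvg X x) - 1) + t * (Re (bil (X x) (dPhi x)) + \<kappa> * (cmod (\<zeta> x))^2)"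
        by (simp del: Re_sum add: algebra_simps)
      also have "\<bar>\<dots>\<bar> \<le> \<bar>Re (dvg X x) - 1\<bar> + t * \<bar>Re (bil (X x) (dPhi x)) + \<kappa> * (cmod (\<zeta> x))^2\<bar>"
        using abs_triangle_ineq[of "Re (dvg X x) - 1" "t * (Re (bil (X x) (dPhi x)) + \<kappa> * (cmod (\<zeta> x))^2)"]
        unfolding abs_mult abs_of_nonneg[OF elim(3)] .
      also have "\<dots> \<le> C * s + t * (C * s * (\<bar>\<rho> x\<bar> + d2 x))" by (intro add_mono mult_left_mono div inw x elim(3))
      finally show ?thesis by (simp add: mult.assoc)
    qed
    have hm: "avg t ?h = mass t - t * \<kappa> * avg t (\<lambda>x. (cmod (\<zeta> x))^2)"
      by (subst avg_affine(1)) (intro continuous_intros z, simp)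
    have rm: "avg t ?r = C * s * mass t + (t * (C * s)) * avg t (\<lambda>x. \<bar>\<rho> x\<bar> + d2 x)"
      by (rule avg_affine(2)[OF \<rho>_d2_continuous])
    have "avg t ?h \<le> avg t (\<lambda>x. ?g x + ?r x)" using p by (intro avg_mono ch continuous_on_add cg cr) (auto simp: abs_le_iff algebra_simps simp del: Re_sum mem_cball)
    moreover have "avg t (\<lambda>x. ?g x - ?r x) \<le> avg t ?h" using p by (intro avg_mono ch continuous_on_diff cg cr) (auto simp: abs_le_iff algebra_simps simp del: Re_sum mem_cball)
    ultimately have "\<bar>avg t ?h\<bar> \<le> \<bar>avg t ?g\<bar> + avg t ?r"
      unfolding avg_add[OF cg cr] avg_diff[OF cg cr] by linarith
    moreover have "\<bar>avg t ?g\<bar> \<le> s * mass t" using B(2)[of t] elim(1) by linarith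
    moreover have "(t * (C * s)) * avg t (\<lambda>x. \<bar>\<rho> x\<bar> + d2 x) \<le> (C * s) * (E * mass t)"
      using mult_left_mono[OF elim(2), of "C * s"] C s by (simp add: mult_ac)
    ultimately show ?case unfolding hm rm by (simp add: algebra_simps)
  qed
qed

lemma square_sum_bound: "(a + b + e)^2 \<le> 3 * (a^2 + b^2 + (e::real)^2)"
proof -
  have "0 \<le> (a - b)^2 + (b - e)^2 + (a - e)^2" by simp
  thus ?thesis by (simp add: power2_eq_square algebra_simps)
qed

text \<open>The main term has order \<open>t * mass t\<close>, since \<open>|A|^2\<close> is at most
  quadratic in the distance and concentration gains a factor \<open>1 / t\<close>. The error has to
  be smaller by a factor \<open>s\<close>, with a constant free of \<open>s\<close> and of the
  annulus coefficient \<open>B\<close>.\<close>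

lemma norm_perturbation:
  fixes F :: "real => complex ^ 'n => complex" and A :: "complex ^ 'n => complex"
  assumes F: "\<And>t. continuous_on K (F t)" "\<And>t x. x \<notin> K ==> F t x = 0"
    and A: "continuous_on K A" "\<And>x. x \<in> D ==> x \<in> K ==> cmod (A x) \<le> C * dist x x0"
    and FA: "\<And>t x. t \<ge> 0 ==> x \<in> D ==> x \<in> K ==> cmod (F t x - of_real t * f t x * A x)
        \<le> C * cmod (f t x) * (1 + t * (s * dist x x0 + \<bar>\<rho> x\<bar>)) + B * indicator annulus x * exp (t * Re (\<Psi> x))"
    and s: "0 < s" "s \<le> 1" and small: "\<And>x. x \<in> D ==> x \<in> K ==> \<bar>\<rho> x\<bar> \<le> s^2"
    and C: "C \<ge> 0" and B: "B \<ge> 0" and E: "E \<ge> 0"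
    and conc: "\<forall>\<^sub>F t in at_top. t * avg t (\<lambda>x. \<bar>\<rho> x\<bar> + d2 x) \<le> E * mass t"
  shows "\<forall>\<^sub>F t in at_top. \<bar>(LINT x|leb D. (cmod (F t x))^2) - t^2 * avg t (\<lambda>x. (cmod (A x))^2)\<bar>
    \<le> (2 * (6 * C^2 * (1 + E) + 1) + C^2 * E) * s * t * mass t"
proof -
  have "\<forall>\<^sub>F t in at_top. 2 * B^2 * tail t \<le> 1 * mass t" by (rule tail_eventually_small) simp
  thus ?thesis using conc eventually_ge_at_top[of "1 / s^2"] eventually_ge_at_top[of 1]
  proof eventually_elim
    case (elim t)
    \<comment> \<open>Beyond \<open>1 / s^2\<close> the terms without a factor \<open>t\<close> are
      at most \<open>s^2 * t\<close> times the mass, hence as small as the others.\<close>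
    have t: "t \<ge> 1" "1 \<le> s^2 * t" using elim(3,4) s by (simp_all add: field_simps)
    let ?G = "\<lambda>x. of_real t * f t x * A x"
    let ?E = "\<lambda>x. w t x * (6 * C^2 * (1 + (t^2 * s^2) * (\<bar>\<rho> x\<bar> + d2 x))) + 2 * B^2 * (indicator annulus x * exp (t * (2 * Re (\<Psi> x))))"
    have Gsq: "(cmod (?G x))^2 = t^2 * (w t x * (cmod (A x))^2)" for x
      by (simp add: norm_mult power_mult_distrib cmod_f)
    have dsq: "(cmod (F t x - ?G x))^2 \<le> ?E x" if x: "x \<in> D" "x \<in> K" for x
    proof -
      let ?p = "cmod (f t x) * (1 + t * (s * dist x x0 + \<bar>\<rho> x\<bar>))" and ?q = "indicator annulus x * exp (t * Re (\<Psi> x)) :: real"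
      have "(cmod (F t x - ?G x))^2 \<le> (C * ?p + B * ?q)^2"
        using FA[OF _ x, of t] t(1) by (intro power_mono) (simp_all add: mult.assoc)
      also have "\<dots> \<le> 2 * (C * ?p)^2 + 2 * (B * ?q)^2"
        using zero_le_power2[of "C * ?p - B * ?q"] by (simp add: power2_eq_square algebra_simps)
      finally have 1: "(cmod (F t x - ?G x))^2 \<le> 2 * (C * ?p)^2 + 2 * (B * ?q)^2" .
      have 2: "2 * (B * ?q)^2 = 2 * B^2 * (indicator annulus x * exp (t * (2 * Re (\<Psi> x))))"
        by (simp add: power_mult_distrib indicator_def flip: exp_of_nat_mult)
      have "2 * (C * ?p)^2 = 2 * C^2 * (w t x * (1 + t * s * dist x x0 + t * \<bar>\<rho> x\<bar>)^2)"
        by (simp add: power_mult_distrib cmod_f) (simp add: algebra_simps)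
      also have "\<dots> \<le> 2 * C^2 * (w t x * (3 * (1 + (t^2 * s^2) * (\<bar>\<rho> x\<bar> + d2 x))))"
      proof (intro mult_left_mono w_nonneg)
        have "(1 + t * s * dist x x0 + t * \<bar>\<rho> x\<bar>)^2 \<le> 3 * (1^2 + (t * s * dist x x0)^2 + (t * \<bar>\<rho> x\<bar>)^2)" by (rule square_sum_bound)
        \<comment> \<open>Smallness of \<open>|\<rho>|\<close> turns its square into
          \<open>s^2 * |\<rho>|\<close>, which concentration controls.\<close>
        moreover have "(t * \<bar>\<rho> x\<bar>)^2 \<le> t^2 * (s^2 * \<bar>\<rho> x\<bar>)"
          unfolding power_mult_distrib using mult_right_mono[OF small[OF x], of "\<bar>\<rho> x\<bar>"] by (intro mult_left_mono) (simp_all add: power2_eq_square)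
        ultimately show "(1 + t * s * dist x x0 + t * \<bar>\<rho> x\<bar>)^2 \<le> 3 * (1 + (t^2 * s^2) * (\<bar>\<rho> x\<bar> + d2 x))"
          by (simp add: d2_def power_mult_distrib algebra_simps)
      qed simp
      also have "2 * C^2 * (w t x * (3 * (1 + (t^2 * s^2) * (\<bar>\<rho> x\<bar> + d2 x)))) = w t x * (6 * C^2 * (1 + (t^2 * s^2) * (\<bar>\<rho> x\<bar> + d2 x)))"
        by (simp only: mult_ac)
      finally have "2 * (C * ?p)^2 \<le> w t x * (6 * C^2 * (1 + (t^2 * s^2) * (\<bar>\<rho> x\<bar> + d2 x)))" .
      with 1 2 show ?thesis by linarith
    qed
    have Di: "integrable (leb D) ?E"
      by (intro Bochner_Integration.integrable_add avg_integrable integrable_mult_right tail_integrable)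
         (intro continuous_intros \<rho>_continuous d2_continuous)
    have Dint: "(LINT x|leb D. ?E x) \<le> (6 * C^2 * (1 + E) + 1) * (s^2 * t * mass t)"
    proof -
      have "(LINT x|leb D. ?E x) = avg t (\<lambda>x. 6 * C^2 * (1 + (t^2 * s^2) * (\<bar>\<rho> x\<bar> + d2 x))) + 2 * B^2 * tail t"
        unfolding avg_def tail_def
        by (subst Bochner_Integration.integral_add[OF avg_integrable integrable_mult_right[OF tail_integrable]])
           (intro continuous_intros \<rho>_continuous d2_continuous, simp)
      also have "avg t (\<lambda>x. 6 * C^2 * (1 + (t^2 * s^2) * (\<bar>\<rho> x\<bar> + d2 x))) = 6 * C^2 * (mass t + (t^2 * s^2) * avg t (\<lambda>x. \<bar>\<rho> x\<bar> + d2 x))"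
        unfolding avg_cmult avg_affine(2)[OF \<rho>_d2_continuous] by simp
      also have "\<dots> \<le> 6 * C^2 * (s^2 * t * mass t + s^2 * t * (E * mass t))"
      proof (intro mult_left_mono add_mono)
        show "mass t \<le> s^2 * t * mass t" using mult_right_mono[OF t(2), of "mass t"] mass_pos[of t] t(1) by simp
        have "s^2 * t * (t * avg t (\<lambda>x. \<bar>\<rho> x\<bar> + d2 x)) \<le> s^2 * t * (E * mass t)" using elim(2) t(1) by (intro mult_left_mono) auto
        thus "(t^2 * s^2) * avg t (\<lambda>x. \<bar>\<rho> x\<bar> + d2 x) \<le> s^2 * t * (E * mass t)" by (simp add: power2_eq_square mult_ac)
      qed simp
      finally have "(LINT x|leb D. ?E x) \<le> 6 * C^2 * (s^2 * t * mass t + s^2 * t * (E * mass t)) + 2 * B^2 * tail t" by simp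
      moreover have "mass t \<le> s^2 * t * mass t" using mult_right_mono[OF t(2), of "mass t"] mass_pos[of t] t(1) by simp
      hence "2 * B^2 * tail t \<le> s^2 * t * mass t" using elim(1) by linarith
      ultimately show ?thesis by (simp add: algebra_simps)
    qed
    have Gint: "t^2 * avg t (\<lambda>x. (cmod (A x))^2) \<le> C^2 * E * t * mass t"
    proof -
      have "avg t (\<lambda>x. (cmod (A x))^2) \<le> avg t (\<lambda>x. C^2 * (\<bar>\<rho> x\<bar> + d2 x))"
      proof (rule avg_mono)
        fix x assume x: "x \<in> D" "x \<in> K"
        have "(cmod (A x))^2 \<le> (C * dist x x0)^2" by (intro power_mono A(2) x) simp
        also have "\<dots> \<le> C^2 * (\<bar>\<rho> x\<bar> + d2 x)" by (simp add: power_mult_distrib d2_def mult_left_mono)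
        finally show "(cmod (A x))^2 \<le> C^2 * (\<bar>\<rho> x\<bar> + d2 x)" .
      qed (intro continuous_intros A(1) \<rho>_continuous d2_continuous)+
      hence "t^2 * avg t (\<lambda>x. (cmod (A x))^2) \<le> t^2 * (C^2 * avg t (\<lambda>x. \<bar>\<rho> x\<bar> + d2 x))"
        unfolding avg_cmult by (intro mult_left_mono) auto
      also have "\<dots> = C^2 * t * (t * avg t (\<lambda>x. \<bar>\<rho> x\<bar> + d2 x))" by (simp add: power2_eq_square mult_ac)
      also have "\<dots> \<le> C^2 * t * (E * mass t)" using elim(2) t(1) by (intro mult_left_mono) auto
      finally show ?thesis by (simp add: mult_ac)
    qed
    have Fi: "integrable (leb D) (\<lambda>x. (cmod (F t x))^2)"
      by (rule integrable_lebesgue_on_compact_piece[OF D compact_cball[of x0 \<epsilon>]]) (intro continuous_intros F(1), simp add: F(2) del: mem_cball)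
    have Gi: "integrable (leb D) (\<lambda>x. (cmod (?G x))^2)"
      unfolding Gsq by (intro integrable_mult_right avg_integrable continuous_intros A(1))
    have Gavg: "(LINT x|leb D. (cmod (?G x))^2) = t^2 * avg t (\<lambda>x. (cmod (A x))^2)"
      unfolding Gsq avg_def by simp
    have pt: "\<bar>(cmod (F t x))^2 - (cmod (?G x))^2\<bar> \<le> (2 / s) * ?E x + s * (cmod (?G x))^2" if "x \<in> D" for x
    proof (cases "x \<in> K")
      case True
      let ?a = "cmod (F t x)" and ?b = "cmod (?G x)" and ?e = "cmod (F t x - ?G x)"
      have ab: "\<bar>?a - ?b\<bar> \<le> ?e" by (rule norm_triangle_ineq3)
      have "\<bar>?a^2 - ?b^2\<bar> = \<bar>?a - ?b\<bar> * \<bar>?a + ?b\<bar>" unfolding abs_mult[symmetric] by (simp add: power2_eq_square algebra_simps)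
      also have "\<dots> \<le> ?e * (?e + 2 * ?b)" using ab by (intro mult_mono) auto
      also have "\<dots> = ?e^2 + 2 * ?e * ?b" by (simp add: power2_eq_square algebra_simps)
      \<comment> \<open>Young's inequality with weight \<open>s\<close>: the integral of the squared
        error is of order \<open>s^2 * t * mass t\<close> and can afford the division by
        \<open>s\<close>, while the main term only picks up a factor \<open>s\<close>.\<close>
      also have "2 * ?e * ?b \<le> ?e^2 / s + s * ?b^2"
      proof -
        have "0 \<le> (?e - s * ?b)^2 / s" using s by simp
        also have "\<dots> = ?e^2 / s + s * ?b^2 - 2 * ?e * ?b" using s by (simp add: power2_eq_square field_simps)
        finally show ?thesis by simp
      qed
      also have "?e^2 + (?e^2 / s + s * ?b^2) \<le> (2 / s) * ?e^2 + s * ?b^2"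
      proof -
        have "?e^2 \<le> ?e^2 / s" using s by (simp add: le_divide_eq mult_left_le)
        thus ?thesis by simp
      qed
      also have "\<dots> \<le> (2 / s) * ?E x + s * ?b^2" using dsq[OF that True] s by (intro add_right_mono mult_left_mono) auto
      finally show ?thesis by simp
    next
      case False
      thus ?thesis using s by (simp add: F(2) f_outside w_outside del: mem_cball)
    qed
    have "\<bar>(LINT x|leb D. (cmod (F t x))^2) - (LINT x|leb D. (cmod (?G x))^2)\<bar>
        = \<bar>LINT x|leb D. (cmod (F t x))^2 - (cmod (?G x))^2\<bar>"
      by (subst Bochner_Integration.integral_diff[OF Fi Gi]) simp
    also have "\<dots> \<le> (LINT x|leb D. \<bar>(cmod (F t x))^2 - (cmod (?G x))^2\<bar>)"
      using Bochner_Integration.integral_norm_bound[of "leb D" "\<lambda>x. (cmod (F t x))^2 - (cmod (?G x))^2"] by simp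
    also have "\<dots> \<le> (LINT x|leb D. (2 / s) * ?E x + s * (cmod (?G x))^2)"
    proof (rule Bochner_Integration.integral_mono)
      show "integrable (leb D) (\<lambda>x. \<bar>(cmod (F t x))^2 - (cmod (?G x))^2\<bar>)"
        by (intro integrable_abs Bochner_Integration.integrable_diff Fi Gi)
      show "integrable (leb D) (\<lambda>x. (2 / s) * ?E x + s * (cmod (?G x))^2)"
        by (intro Bochner_Integration.integrable_add integrable_mult_right Di Gi)
    qed (use pt in simp)
    also have "\<dots> = (2 / s) * (LINT x|leb D. ?E x) + s * (t^2 * avg t (\<lambda>x. (cmod (A x))^2))"
      by (subst Bochner_Integration.integral_add[OF integrable_mult_right[OF Di] integrable_mult_right[OF Gi]])
         (simp only: Bochner_Integration.integral_mult_right_zero Gavg)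
    also have "\<dots> \<le> (2 / s) * ((6 * C^2 * (1 + E) + 1) * (s^2 * t * mass t)) + s * (C^2 * E * t * mass t)"
      using s by (intro add_mono mult_left_mono Dint Gint) auto
    also have "\<dots> = (2 * (6 * C^2 * (1 + E) + 1) + C^2 * E) * s * t * mass t"
      using s by (simp add: power2_eq_square algebra_simps)
    finally show ?case unfolding Gavg .
  qed
qed

end

section \<open>The phase at a boundary point\<close>

lemma bil_simps:
  "bil (a + b) e = bil a e + bil b e" "bil (a - b) e = bil a e - bil b e" "bil (k *s a) e = k * bil a e"
  "bil e (a + b) = bil e a + bil e b" "bil e (a - b) = bil e a - bil e b" "bil e (k *s a) = k * bil e a"
  "bil 0 e = 0" "bil e 0 = 0" "bil e (- a) = - bil e a"
  by (simp_all add: bil_def algebra_simps sum.distrib sum_subtractf sum_distrib_left sum_negf)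

lemma bil_sum_left: "bil (\<Sum>i\<in>I. f i) e = (\<Sum>i\<in>I. bil (f i) e)"
  by (induction I rule: infinite_finite_induct) (simp_all add: bil_simps)

lemma cmod_bil_le: "cmod (bil a b) \<le> norm a * norm b"
proof -
  have "cmod (bil a b) \<le> (\<Sum>j\<in>UNIV. cmod (a $ j) * cmod (b $ j))"
    unfolding bil_def by (rule order_trans[OF norm_sum]) (simp add: norm_mult)
  also have "\<dots> \<le> norm a * norm b"
    using L2_set_mult_ineq[of "\<lambda>j. cmod (a $ j)" "\<lambda>j. cmod (b $ j)" UNIV] by (simp add: norm_vec_def)
  finally show ?thesis .
qed

lemma norm_cnj_vec [simp]: "norm (cnj_vec a) = norm a"
  by (simp add: norm_vec_def cnj_vec_def)

lemma herm_inner_cnj_vec: "herm_inner a (cnj_vec b) = bil a b"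
  by (simp add: herm_inner_def bil_def cnj_vec_def)

lemma cmod_herm_inner_le: "cmod (herm_inner a b) \<le> norm a * norm b"
  using cmod_bil_le[of a "cnj_vec b"] by (simp add: bil_cnj)

lemma bil_axis: "bil (axis k z) p = z * p $ k" "bil (cnj_vec (axis k z)) p = cnj z * p $ k"
proof -
  have "bil (axis k z) p = (\<Sum>j\<in>UNIV. if j = k then z * p $ k else 0)"
    unfolding bil_def by (rule sum.cong) (auto simp: axis_def)
  thus "bil (axis k z) p = z * p $ k" by simp
  have "bil (cnj_vec (axis k z)) p = (\<Sum>j\<in>UNIV. if j = k then cnj z * p $ k else 0)"
    unfolding bil_def by (rule sum.cong) (auto simp: axis_def cnj_vec_def)
  thus "bil (cnj_vec (axis k z)) p = cnj z * p $ k" by simp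
qed

lemma d_z_of_split:
  assumes "(f has_derivative (\<lambda>v. bil v p + bil (cnj_vec v) q)) (at x)"
  shows "d_z k f x = p $ k" "d_zbar k f x = q $ k"
  unfolding d_z_eq[OF assms] by (simp_all add: bil_axis algebra_simps)

lemma has_derivative_vec:
  fixes f :: "'a::real_normed_vector => complex ^ 'n::finite"
  assumes "\<And>k. ((\<lambda>x. f x $ k) has_derivative (\<lambda>v. f' v $ k)) (at a)"
  shows "(f has_derivative f') (at a)"
proof (subst has_derivative_componentwise_within, intro ballI)
  fix i :: "complex ^ 'n" assume "i \<in> Basis"
  then obtain k b where i: "i = axis k b" by (auto simp: Basis_vec_def)
  show "((\<lambda>x. inner (f x) i) has_derivative (\<lambda>v. inner (f' v) i)) (at a)"
    unfolding i inner_axis by (rule has_derivative_inner_left[OF assms])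
qed

lemma Ck_on_1_component: "Ck_on 1 S (\<lambda>x :: complex ^ 'n::finite. (x - a) $ k)"
  unfolding vector_minus_component
  by (intro Ck_on_1_diff Ck_on_1_linear Ck_on_1_const bounded_linear_vec_nth)

lemma Ck_on_1_bil: "(\<And>k. Ck_on 1 S (\<lambda>x. f x $ k)) ==> (\<And>k. Ck_on 1 S (\<lambda>x. g x $ k)) ==> Ck_on 1 S (\<lambda>x. bil (f x) (g x))"
  unfolding bil_def by (intro Ck_on_1_intros)

locale levi_point = C2_function \<rho> V for \<rho> :: "complex ^ 'n::finite => real" and V +
  fixes D :: "(complex ^ 'n) set" and x0 :: "complex ^ 'n" and Z :: "nat => complex ^ 'n" and lam c :: "nat => real" and m :: nat
  assumes m: "CARD('n) = Suc m" and D: "open D" and df: "defining_function D V \<rho>" and x0V: "x0 \<in> V" and x0f: "x0 \<in> frontier D"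
    and on: "orthonormal_family {..<m} Z"
    and ZT: "\<And>j. j < m ==> bil (Z j) (nu x0) = 0"
    and diag: "\<And>i j. i < m ==> j < m ==>
      levi_form \<rho> x0 (Z i) (Z j) = (if i = j then complex_of_real (lam i) else 0)"
    and kap: "\<And>j. j < m ==> lam j + 2 * c j > 0"
begin

abbreviation kp where "kp i \<equiv> lam i + 2 * c i"

definition nu0 where "nu0 = nu x0"
definition r where "r = norm nu0"
text \<open>The unit normal as a (1,0)-vector. The conjugate appears because conormals are paired
  bilinearly; it makes \<open>bil Nv nu0\<close> equal to the positive number
  \<open>r\<close>.\<close>

definition Nv :: "complex ^ 'n" where "Nv = complex_of_real (1 / r) *s cnj_vec nu0"
definition Zf where "Zf j = (if j < m then Z j else Nv)"
definition zc where "zc j x = herm_inner (x - x0) (Zf j)"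
definition A where "A l k = d_z l (\<lambda>x. nu x $ k) x0"
definition Bm where "Bm l k = d_zbar l (\<lambda>x. nu x $ k) x0"
definition eta where "eta j = levi_form \<rho> x0 (Z j) Nv"
definition hN where "hN = Re (levi_form \<rho> x0 Nv Nv)"

text \<open>The linear part of the holomorphic gradient of \<open>Psi\<close>, written out
  beforehand; \<open>Qv\<close> is its antiholomorphic counterpart.\<close>

definition Pv :: "complex ^ 'n => complex ^ 'n" where
  "Pv z = (\<chi> k. (\<Sum>l\<in>UNIV. A l k * z $ l)
     - (\<Sum>j<m. eta j * (herm_inner z Nv * cnj (Z j $ k) + herm_inner z (Z j) * cnj (Nv $ k)))
     + of_real (1 - hN) * herm_inner z Nv * cnj (Nv $ k)
     - (\<Sum>j<m. of_real (c j) * cnj (herm_inner z (Z j)) * cnj (Z j $ k)))"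

text \<open>Fields annihilating \<open>nu\<close> see the holomorphic gradient of the phase only
  through its difference from \<open>nu\<close>, and this difference vanishes at
  \<open>x0\<close>.\<close>

abbreviation pn where "pn x \<equiv> nu0 + Pv (x - x0) - nu x"

definition Qv :: "complex ^ 'n => complex ^ 'n" where
  "Qv z = (\<chi> k. - (\<Sum>j<m. of_real (c j) * herm_inner z (Z j) * Z j $ k))"

definition lin :: "complex ^ 'n => complex ^ 'n" where
  "lin z = (\<chi> k. \<Sum>l\<in>UNIV. z $ l * A l k + cnj (z $ l) * Bm l k)"

text \<open>The Levi polynomial plus quadratic corrections: the antiholomorphic dependence of the Levi
  form on the normal coordinate is replaced by a holomorphic one, which is harmless because the
  normal coordinate is almost imaginary along the boundary, and the weights \<open>c\<close> produce decay.\<close>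

definition Psi :: "complex ^ 'n => complex" where
  "Psi x = bil (x - x0) nu0 + (\<Sum>l\<in>UNIV. \<Sum>k\<in>UNIV. A l k * (x - x0) $ l * (x - x0) $ k) / 2
     - (\<Sum>j<m. eta j * herm_inner (x - x0) (Z j) * herm_inner (x - x0) Nv)
     + of_real (1 - hN) / 2 * herm_inner (x - x0) Nv * herm_inner (x - x0) Nv
     - (\<Sum>j<m. of_real (c j) * herm_inner (x - x0) (Z j) * cnj (herm_inner (x - x0) (Z j)))"

lemma r_pos: "r > 0"
proof -
  have d: "\<rho> differentiable (at x0)" by (rule differentiable[OF x0V])
  have "nu0 \<noteq> 0"
  proof
    assume "nu0 = 0"
    hence "fderiv \<rho> x0 v = 0" for v
      by (simp add: frechet_derivative_d_rho[OF d] nu0_def[symmetric] bil_simps)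
    thus False using defining_functionD(4)[OF df x0V x0f] by auto
  qed
  thus ?thesis by (simp add: r_def)
qed

lemma bil_nu0: "bil z nu0 = of_real r * herm_inner z Nv"
  using r_pos by (simp add: Nv_def herm_inner_simps herm_inner_cnj_vec)

lemma herm_ZN: "j < m ==> herm_inner (Z j) Nv = 0" "j < m ==> herm_inner Nv (Z j) = 0"
proof -
  show 1: "herm_inner (Z j) Nv = 0" if "j < m" using bil_nu0[of "Z j"] ZT[OF that] r_pos by (simp add: nu0_def)
  show "herm_inner Nv (Z j) = 0" if "j < m" using 1[OF that] herm_inner_commute[of Nv "Z j"] by simp
qed

lemma herm_NN: "herm_inner Nv Nv = 1"
proof -
  have "herm_inner (cnj_vec nu0) (cnj_vec nu0) = of_real (r^2)" by (simp add: herm_inner_self r_def)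
  thus ?thesis using r_pos by (simp add: Nv_def herm_inner_simps power2_eq_square)
qed

lemma norm_Nv: "norm Nv = 1"
  using herm_inner_self[of Nv] herm_NN by (metis norm_ge_zero of_real_eq_1_iff one_power2 power2_eq_imp_eq zero_le_one)

lemma herm_ZZ: "i < m ==> j < m ==> herm_inner (Z i) (Z j) = (if i = j then 1 else 0)"
  using on by (simp add: orthonormal_family_def)

lemma norm_Z: "j < m ==> norm (Z j) = 1"
  using herm_inner_self[of "Z j"] herm_ZZ[of j j] by (metis norm_ge_zero of_real_eq_1_iff one_power2 power2_eq_imp_eq zero_le_one)

lemma bil_Nv_nu0: "bil Nv nu0 = of_real r"
  by (simp add: bil_nu0 herm_NN)

lemma Zf_orthonormal: "orthonormal_family {..<CARD('n)} Zf"
  unfolding orthonormal_family_def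
proof (intro ballI)
  fix i j assume "i \<in> {..<CARD('n)}" "j \<in> {..<CARD('n)}"
  hence "i < m \<or> i = m" "j < m \<or> j = m" by (auto simp: m)
  thus "herm_inner (Zf i) (Zf j) = (if i = j then 1 else 0)"
    by (elim disjE) (simp_all add: Zf_def herm_ZZ herm_ZN herm_NN)
qed

lemma sum_Zf: "(\<Sum>j<CARD('n). F (Zf j) (zc j x)) = (\<Sum>j<m. F (Z j) (zc j x)) + (F Nv (zc m x) :: 'b::comm_monoid_add)"
proof -
  have "(\<Sum>j<CARD('n). F (Zf j) (zc j x)) = (\<Sum>j<Suc m. F (Zf j) (zc j x))" by (simp only: m)
  also have "\<dots> = (\<Sum>j<m. F (Zf j) (zc j x)) + F (Zf m) (zc m x)" by (rule sum.lessThan_Suc)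
  also have "(\<Sum>j<m. F (Zf j) (zc j x)) = (\<Sum>j<m. F (Z j) (zc j x))" by (rule sum.cong) (auto simp: Zf_def)
  finally show ?thesis by (simp add: Zf_def)
qed

lemma z_expansion: "x - x0 = (\<Sum>j<m. zc j x *s Z j) + zc m x *s Nv"
  using orthonormal_basis_expansion[OF Zf_orthonormal, of "x - x0"] sum_Zf[of "\<lambda>a b. b *s a" x]
  unfolding zc_def[symmetric] by simp

lemma norm_z: "(norm (x - x0))^2 = (\<Sum>j<m. (cmod (zc j x))^2) + (cmod (zc m x))^2"
proof -
  have "x - x0 = (\<Sum>j<CARD('n). zc j x *s Zf j)"
    using orthonormal_basis_expansion[OF Zf_orthonormal, of "x - x0"] unfolding zc_def[symmetric] by simp
  hence "(norm (x - x0))^2 = (\<Sum>j<CARD('n). (cmod (zc j x))^2)"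
    using norm_sum_orthonormal[OF Zf_orthonormal, of "\<lambda>j. zc j x"] by simp
  thus ?thesis using sum_Zf[of "\<lambda>a b. (cmod b)^2" x] by simp
qed

lemma zc_Z: "j < m ==> zc j x = herm_inner (x - x0) (Z j)" and zc_N: "zc m x = herm_inner (x - x0) Nv"
  by (simp_all add: zc_def Zf_def)

lemma cmod_zc: "j < CARD('n) ==> cmod (zc j x) \<le> norm (x - x0)"
proof -
  assume "j < CARD('n)"
  hence "j < m \<or> j = m" by (auto simp: m)
  thus ?thesis
    using cmod_herm_inner_le[of "x - x0" "Zf j"] by (auto simp: zc_def Zf_def norm_Z norm_Nv)
qed

lemma levi_coeff: "Bm l k = d_z k (d_zbar l (\<lambda>y. complex_of_real (\<rho> y))) x0"
  unfolding Bm_def d_rho_second(3)[OF x0V] by (rule d_rho_second(2)[OF x0V])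

lemma A_sym: "A l k = A k l"
  unfolding A_def by (rule d_rho_second(1)[OF x0V])

lemma levi_hermitian: "levi_form \<rho> x0 b a = cnj (levi_form \<rho> x0 a b)"
  unfolding levi_form_sesq
  by (rule sesq_hermitian) (metis d_rho_second(2,3)[OF x0V])

text \<open>The linearised conormal splits into the symmetric holomorphic Hessian, which the phase
  can cancel, and the Levi form, which it cannot cancel holomorphically.\<close>

lemma bil_lin: "bil a (lin z) = (\<Sum>l\<in>UNIV. \<Sum>k\<in>UNIV. A l k * z $ l * a $ k) + levi_form \<rho> x0 a z"
proof -
  have "bil a (lin z) = (\<Sum>k\<in>UNIV. \<Sum>l\<in>UNIV. A l k * z $ l * a $ k) + (\<Sum>k\<in>UNIV. \<Sum>l\<in>UNIV. a $ k * Bm l k * cnj (z $ l))"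
    unfolding bil_def lin_def by (simp add: sum_distrib_left sum.distrib algebra_simps)
  thus ?thesis unfolding levi_form_def levi_coeff by (subst sum.swap) simp
qed

lemma bil_Pv: "bil a (Pv z) = (\<Sum>l\<in>UNIV. \<Sum>k\<in>UNIV. A l k * z $ l * a $ k)
     - (\<Sum>j<m. eta j * (herm_inner z Nv * herm_inner a (Z j) + herm_inner z (Z j) * herm_inner a Nv))
     + of_real (1 - hN) * herm_inner z Nv * herm_inner a Nv
     - (\<Sum>j<m. of_real (c j) * cnj (herm_inner z (Z j)) * herm_inner a (Z j))"
proof -
  define S1 where "S1 = (\<chi> k. \<Sum>l\<in>UNIV. A l k * z $ l)"
  have "Pv z = S1 - (\<Sum>j<m. eta j *s (herm_inner z Nv *s cnj_vec (Z j) + herm_inner z (Z j) *s cnj_vec Nv))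
     + (of_real (1 - hN) * herm_inner z Nv) *s cnj_vec Nv
     - (\<Sum>j<m. (of_real (c j) * cnj (herm_inner z (Z j))) *s cnj_vec (Z j))"
    by (simp add: Finite_Cartesian_Product.vec_eq_iff Pv_def S1_def cnj_vec_def distrib_left mult.assoc)
  moreover have "bil a (\<Sum>i\<in>I. g i) = (\<Sum>i\<in>I. bil a (g i))" for I :: "nat set" and g
    by (induction I rule: infinite_finite_induct) (simp_all add: bil_simps)
  ultimately have "bil a (Pv z) = bil a S1
     - (\<Sum>j<m. eta j * (herm_inner z Nv * herm_inner a (Z j) + herm_inner z (Z j) * herm_inner a Nv))
     + of_real (1 - hN) * herm_inner z Nv * herm_inner a Nv
     - (\<Sum>j<m. of_real (c j) * cnj (herm_inner z (Z j)) * herm_inner a (Z j))"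
    by (simp only: bil_simps bil_cnj mult.assoc)
  moreover have "bil a S1 = (\<Sum>l\<in>UNIV. \<Sum>k\<in>UNIV. A l k * z $ l * a $ k)"
    unfolding bil_def S1_def by (subst sum.swap) (simp add: sum_distrib_left mult_ac)
  ultimately show ?thesis by simp
qed

lemma bil_Qv: "bil (cnj_vec a) (Qv z) = - (\<Sum>j<m. of_real (c j) * herm_inner z (Z j) * cnj (herm_inner a (Z j)))"
proof -
  have "bil (cnj_vec a) (Qv z) = - (\<Sum>k\<in>UNIV. \<Sum>j<m. of_real (c j) * herm_inner z (Z j) * (cnj (a $ k) * Z j $ k))"
    unfolding bil_def Qv_def cnj_vec_def by (simp add: sum_distrib_left sum_negf mult_ac)
  also have "\<dots> = - (\<Sum>j<m. of_real (c j) * herm_inner z (Z j) * cnj (herm_inner a (Z j)))"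
    by (subst sum.swap) (simp add: herm_inner_def sum_distrib_left)
  finally show ?thesis .
qed

lemma Psi_deriv: "(Psi has_derivative (\<lambda>v. bil v (nu0 + Pv (x - x0)) + bil (cnj_vec v) (Qv (x - x0)))) (at x)"
proof -
  have h: "((\<lambda>x. herm_inner (x - x0) a) has_derivative (\<lambda>v. herm_inner v a)) (at x)" for a :: "complex ^ 'n"
    unfolding herm_inner_def
    by (auto intro!: derivative_eq_intros bounded_linear.has_derivative[OF bounded_linear_vec_nth])
  have k: "((\<lambda>x. (x - x0) $ k) has_derivative (\<lambda>v. v $ k)) (at x)" for k
    by (auto intro!: derivative_eq_intros bounded_linear.has_derivative[OF bounded_linear_vec_nth])
  let ?z = "x - x0"
  have "(Psi has_derivative (\<lambda>v. bil v nu0 + (\<Sum>l\<in>UNIV. \<Sum>k\<in>UNIV. A l k * ?z $ l * v $ k + A l k * v $ l * ?z $ k) / 2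
     - (\<Sum>j<m. eta j * herm_inner ?z (Z j) * herm_inner v Nv + eta j * herm_inner v (Z j) * herm_inner ?z Nv)
     + (of_real (1 - hN) / 2 * herm_inner ?z Nv * herm_inner v Nv + of_real (1 - hN) / 2 * herm_inner v Nv * herm_inner ?z Nv)
     - (\<Sum>j<m. of_real (c j) * herm_inner ?z (Z j) * cnj (herm_inner v (Z j)) + of_real (c j) * herm_inner v (Z j) * cnj (herm_inner ?z (Z j))))) (at x)"
    unfolding Psi_def[abs_def] bil_nu0
    by (intro has_derivative_add has_derivative_diff has_derivative_sum bounded_linear.has_derivative[OF bounded_linear_divide]
        has_derivative_mult has_derivative_mult_right h k bounded_linear.has_derivative[OF bounded_linear_cnj])
  thus ?thesis
  proof (rule has_derivative_eq_rhs, intro ext)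
    fix v
    \<comment> \<open>Symmetry of \<open>A\<close> makes the two halves of the differentiated Levi
      polynomial equal, which cancels the factor 1/2.\<close>
    have sw: "(\<Sum>l\<in>UNIV. \<Sum>k\<in>UNIV. A l k * v $ l * z $ k) = (\<Sum>l\<in>UNIV. \<Sum>k\<in>UNIV. A l k * z $ l * v $ k)" for z
      by (subst sum.swap, intro sum.cong refl, subst A_sym) (simp add: mult_ac)
    have s: "(\<Sum>l\<in>UNIV. \<Sum>k\<in>UNIV. A l k * z $ l * v $ k + A l k * v $ l * z $ k) / 2 = (\<Sum>l\<in>UNIV. \<Sum>k\<in>UNIV. A l k * z $ l * v $ k)" for z
      unfolding sum.distrib sw by simp
    show "bil v nu0 + (\<Sum>l\<in>UNIV. \<Sum>k\<in>UNIV. A l k * ?z $ l * v $ k + A l k * v $ l * ?z $ k) / 2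
     - (\<Sum>j<m. eta j * herm_inner ?z (Z j) * herm_inner v Nv + eta j * herm_inner v (Z j) * herm_inner ?z Nv)
     + (of_real (1 - hN) / 2 * herm_inner ?z Nv * herm_inner v Nv + of_real (1 - hN) / 2 * herm_inner v Nv * herm_inner ?z Nv)
     - (\<Sum>j<m. of_real (c j) * herm_inner ?z (Z j) * cnj (herm_inner v (Z j)) + of_real (c j) * herm_inner v (Z j) * cnj (herm_inner ?z (Z j)))
     = bil v (nu0 + Pv ?z) + bil (cnj_vec v) (Qv ?z)"
      unfolding s unfolding bil_simps bil_Pv bil_Qv sum.distrib
      by (simp add: sum.distrib algebra_simps add_divide_distrib diff_divide_distrib)
  qed
qed

lemma d_Psi: "d_z k Psi x = (nu0 + Pv (x - x0)) $ k" "d_zbar k Psi x = Qv (x - x0) $ k"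
  by (rule d_z_of_split[OF Psi_deriv])+

lemma linear_PQ: "linear Pv" "linear Qv" "linear lin"
proof -
  have hs: "herm_inner (t *\<^sub>R z) a = of_real t * herm_inner z a" for t z and a :: "complex ^ 'n"
    by (simp add: scaleR_vec_eq_smult herm_inner_simps)
  show "linear Pv"
    by (rule linearI; simp add: Finite_Cartesian_Product.vec_eq_iff Pv_def herm_inner_simps hs;
        simp add: algebra_simps sum.distrib sum_distrib_left scaleR_conv_of_real)
  show "linear Qv"
    by (rule linearI; simp add: Finite_Cartesian_Product.vec_eq_iff Qv_def herm_inner_simps hs;
        simp add: algebra_simps sum.distrib sum_distrib_left scaleR_conv_of_real)
  show "linear lin"
    by (rule linearI; simp add: Finite_Cartesian_Product.vec_eq_iff lin_def;
        simp add: algebra_simps sum.distrib sum_distrib_left scaleR_conv_of_real)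
qed

lemma Psi_C1: "Ck_on 1 UNIV Psi"
proof (rule Ck_on_1I[OF Psi_deriv])
  have cP: "continuous_on UNIV (\<lambda>x. Pv (x - x0))" and cQ: "continuous_on UNIV (\<lambda>x. Qv (x - x0))"
    by (intro linear_continuous_on_compose[OF _ linear_PQ(1)] linear_continuous_on_compose[OF _ linear_PQ(2)] continuous_intros)+
  show "continuous_on UNIV (\<lambda>x. bil v (nu0 + Pv (x - x0)) + bil (cnj_vec v) (Qv (x - x0)))" for v
    unfolding bil_def by (intro continuous_intros continuous_on_component cP cQ)
qed

lemma Psi_x0: "Psi x0 = 0"
  by (simp add: Psi_def bil_simps herm_inner_simps)

lemma d_rho_deriv: "(nu has_derivative lin) (at x0)"
proof (rule has_derivative_vec)
  fix k
  have d: "(\<lambda>x. nu x $ k) differentiable (at x0)" using d_rho_C1[of k] x0V by simp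
  have "fderiv (\<lambda>x. nu x $ k) x0 = (\<lambda>v. lin v $ k)"
    by (rule ext) (simp add: frechet_derivative_Wirtinger[OF d] lin_def A_def Bm_def)
  thus "((\<lambda>x. nu x $ k) has_derivative (\<lambda>v. lin v $ k)) (at x0)"
    using d frechet_derivative_works by metis
qed

text \<open>The holomorphic gradient of \<open>2 Re Psi - \<rho>\<close>. Its sign along rays yields
  the decay of the phase, and along fields annihilating \<open>nu\<close> it coincides with the
  gradient of \<open>2 Re Psi\<close>.\<close>

definition G where "G x = nu0 + Pv (x - x0) + cnj_vec (Qv (x - x0)) - nu x"
definition rem where "rem x = nu x - nu0 - lin (x - x0)"

lemma levi_z: "levi_form \<rho> x0 a (x - x0) = (\<Sum>j<m. cnj (zc j x) * levi_form \<rho> x0 a (Z j)) + cnj (zc m x) * levi_form \<rho> x0 a Nv"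
  by (subst z_expansion) (simp add: levi_form_sesq sesq_simps sesq_sum_right)

text \<open>The holomorphic Hessian occurs alike in the phase and in the linearised conormal and
  drops out: this is the purpose of the Levi polynomial in \<open>Psi\<close>.\<close>

lemma bil_p_nu:
  "bil a (pn x) = - levi_form \<rho> x0 a (x - x0) - bil a (rem x)
     - (\<Sum>j<m. eta j * (zc m x * herm_inner a (Z j) + zc j x * herm_inner a Nv))
     + of_real (1 - hN) * zc m x * herm_inner a Nv
     - (\<Sum>j<m. of_real (c j) * cnj (zc j x) * herm_inner a (Z j))"
proof -
  have e: "pn x = Pv (x - x0) - lin (x - x0) - rem x" by (simp add: rem_def)
  have s1: "(\<Sum>j<m. eta j * (zc m x * herm_inner a (Z j) + zc j x * herm_inner a Nv))
      = (\<Sum>j<m. eta j * (herm_inner (x - x0) Nv * herm_inner a (Z j) + herm_inner (x - x0) (Z j) * herm_inner a Nv))"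
    by (rule sum.cong) (simp_all add: zc_Z zc_N)
  have s2: "(\<Sum>j<m. of_real (c j) * cnj (zc j x) * herm_inner a (Z j)) = (\<Sum>j<m. of_real (c j) * cnj (herm_inner (x - x0) (Z j)) * herm_inner a (Z j))"
    by (rule sum.cong) (simp_all add: zc_Z)
  show ?thesis unfolding e bil_simps bil_lin bil_Pv s1 s2 zc_N[symmetric] by simp
qed

lemma sum_delta_Z:
  assumes "i < m" shows "(\<Sum>j<m. F j * herm_inner (Z i) (Z j)) = F i" "(\<Sum>j<m. cnj (zc j x) * levi_form \<rho> x0 (Z i) (Z j)) = of_real (lam i) * cnj (zc i x)"
proof -
  have "(\<Sum>j<m. F j * herm_inner (Z i) (Z j)) = (\<Sum>j<m. if j = i then F i else 0)"
    using assms by (intro sum.cong) (auto simp: herm_ZZ)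
  thus "(\<Sum>j<m. F j * herm_inner (Z i) (Z j)) = F i" using assms by simp
  have "(\<Sum>j<m. cnj (zc j x) * levi_form \<rho> x0 (Z i) (Z j)) = (\<Sum>j<m. if j = i then of_real (lam i) * cnj (zc i x) else 0)"
    using assms by (intro sum.cong) (auto simp: diag)
  thus "(\<Sum>j<m. cnj (zc j x) * levi_form \<rho> x0 (Z i) (Z j)) = of_real (lam i) * cnj (zc i x)" using assms by simp
qed

text \<open>The correction with \<open>eta\<close> in the phase contributes \<open>zc m\<close>, the
  Levi form its conjugate. Together they give twice the real part of the normal coordinate, which
  Taylor expansion of \<open>\<rho>\<close> bounds by \<open>|\<rho>|\<close> and a small multiple
  of the distance.\<close>

lemma bil_Z_p_nu:
  assumes "i < m"
  shows "bil (Z i) (pn x) = - of_real (lam i + c i) * cnj (zc i x) - 2 * eta i * of_real (Re (zc m x)) - bil (Z i) (rem x)"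
proof -
  have 1: "(\<Sum>j<m. eta j * (zc m x * herm_inner (Z i) (Z j) + zc j x * herm_inner (Z i) Nv)) = eta i * zc m x"
    using sum_delta_Z(1)[OF assms, of "\<lambda>j. eta j * zc m x"] by (simp add: herm_ZN[OF assms] mult_ac)
  have 2: "(\<Sum>j<m. of_real (c j) * cnj (zc j x) * herm_inner (Z i) (Z j)) = of_real (c i) * cnj (zc i x)"
    by (rule sum_delta_Z(1)[OF assms])
  have 3: "levi_form \<rho> x0 (Z i) (x - x0) = of_real (lam i) * cnj (zc i x) + cnj (zc m x) * eta i"
    unfolding levi_z sum_delta_Z(2)[OF assms] eta_def ..
  have 4: "zc m x + cnj (zc m x) = 2 * of_real (Re (zc m x))" by (simp add: complex_eq_iff)
  have "bil (Z i) (pn x) = - of_real (lam i + c i) * cnj (zc i x) - eta i * (zc m x + cnj (zc m x)) - bil (Z i) (rem x)"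
    unfolding bil_p_nu 1 2 3 by (simp add: herm_ZN[OF assms] algebra_simps)
  thus ?thesis unfolding 4 by (simp add: mult_ac)
qed

lemma bil_cnj_Qv: "bil a (cnj_vec (Qv (x - x0))) = - (\<Sum>j<m. of_real (c j) * cnj (zc j x) * herm_inner a (Z j))"
proof -
  have "bil a (cnj_vec (Qv (x - x0))) = cnj (bil (cnj_vec a) (Qv (x - x0)))" by (simp add: bil_def cnj_vec_def)
  also have "\<dots> = - (\<Sum>j<m. of_real (c j) * cnj (zc j x) * herm_inner a (Z j))"
    unfolding bil_Qv by (simp add: zc_Z cong: sum.cong_simp)
  finally show ?thesis .
qed

lemma bil_Z_G:
  assumes "i < m"
  shows "bil (Z i) (G x) = - of_real (kp i) * cnj (zc i x) - 2 * eta i * of_real (Re (zc m x)) - bil (Z i) (rem x)"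
proof -
  have "G x = (pn x) + cnj_vec (Qv (x - x0))" by (simp add: G_def)
  thus ?thesis
    by (simp only: bil_simps(4) bil_Z_p_nu[OF assms] bil_cnj_Qv sum_delta_Z(1)[OF assms]) (simp add: algebra_simps)
qed

lemma bil_N_G:
  "bil Nv (G x) = - of_real (2 * Re (\<Sum>j<m. eta j * zc j x)) - of_real hN * cnj (zc m x) + of_real (1 - hN) * zc m x - bil Nv (rem x)"
proof -
  define S where "S = (\<Sum>j<m. eta j * zc j x)"
  have "G x = (pn x) + cnj_vec (Qv (x - x0))" by (simp add: G_def)
  hence "bil Nv (G x) = bil Nv (pn x)"
    by (simp only: bil_simps(4) bil_cnj_Qv) (simp add: herm_ZN cong: sum.cong_simp)
  also have "\<dots> = - levi_form \<rho> x0 Nv (x - x0) - bil Nv (rem x) - (\<Sum>j<m. eta j * zc j x) + of_real (1 - hN) * zc m x"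
    unfolding bil_p_nu by (simp add: herm_ZN herm_NN cong: sum.cong_simp)
  also have "levi_form \<rho> x0 Nv (x - x0) = cnj (\<Sum>j<m. eta j * zc j x) + of_real hN * cnj (zc m x)"
  proof -
    have "levi_form \<rho> x0 Nv Nv = of_real hN"
      using levi_hermitian[of Nv Nv] by (simp add: hN_def complex_eq_iff)
    moreover have "levi_form \<rho> x0 Nv (Z j) = cnj (eta j)" for j unfolding eta_def by (rule levi_hermitian)
    ultimately show ?thesis unfolding levi_z by (simp add: mult_ac)
  qed
  finally have e: "bil Nv (G x) = - (cnj S + of_real hN * cnj (zc m x)) - bil Nv (rem x) - S + of_real (1 - hN) * zc m x"
    unfolding S_def .
  have "S + cnj S = of_real (2 * Re S)" by (simp add: complex_eq_iff)
  hence "- (cnj S + w) - b - S + w' = - of_real (2 * Re S) - w + w' - b" for w b w' by (simp add: algebra_simps)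
  thus ?thesis using e unfolding S_def by simp
qed

text \<open>Negative definite up to terms carrying a factor \<open>Re (zc m x)\<close> and the
  remainder. The coefficient \<open>1 - hN\<close> in the phase is tuned so that the square of
  \<open>Im (zc m x)\<close> gets the coefficient -1 whatever the normal entry \<open>hN\<close> of
  the Levi form is.\<close>

lemma Re_bil_z_G:
  "Re (bil (x - x0) (G x)) = - (\<Sum>i<m. (kp i) * (cmod (zc i x))^2) - (Im (zc m x))^2 + (1 - 2 * hN) * (Re (zc m x))^2
     - 4 * Re (zc m x) * Re (\<Sum>j<m. eta j * zc j x) - Re (bil (x - x0) (rem x))"
proof -
  have sp: "bil (x - x0) u = (\<Sum>i<m. zc i x * bil (Z i) u) + zc m x * bil Nv u" for u
    by (subst z_expansion) (simp add: bil_simps bil_sum_left)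
  have "(\<Sum>i<m. zc i x * bil (Z i) (G x)) = (\<Sum>i<m. - of_real ((kp i) * (cmod (zc i x))^2) - 2 * of_real (Re (zc m x)) * (eta i * zc i x) - zc i x * bil (Z i) (rem x))"
  proof (rule sum.cong[OF refl])
    fix i assume "i \<in> {..<m}"
    hence i: "i < m" by simp
    have "zc i x * (of_real (kp i) * cnj (zc i x)) = of_real ((kp i) * (cmod (zc i x))^2)"
      unfolding of_real_mult complex_norm_square by (simp only: mult_ac)
    thus "zc i x * bil (Z i) (G x) = - of_real ((kp i) * (cmod (zc i x))^2) - 2 * of_real (Re (zc m x)) * (eta i * zc i x) - zc i x * bil (Z i) (rem x)"
      unfolding bil_Z_G[OF i] by (simp add: algebra_simps)
  qed
  hence "(\<Sum>i<m. zc i x * bil (Z i) (G x)) = - of_real (\<Sum>i<m. (kp i) * (cmod (zc i x))^2)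
      - 2 * of_real (Re (zc m x)) * (\<Sum>i<m. eta i * zc i x) - (\<Sum>i<m. zc i x * bil (Z i) (rem x))"
    by (simp only: sum_subtractf sum_negf sum_distrib_left of_real_sum)
  hence "bil (x - x0) (G x) = - of_real (\<Sum>i<m. (kp i) * (cmod (zc i x))^2)
      - 2 * of_real (Re (zc m x)) * (\<Sum>i<m. eta i * zc i x)
      + zc m x * (- of_real (2 * Re (\<Sum>j<m. eta j * zc j x)) - of_real hN * cnj (zc m x) + of_real (1 - hN) * zc m x) - bil (x - x0) (rem x)"
    unfolding sp[of "G x"] sp[of "rem x"] bil_N_G by (simp only:) (simp only: algebra_simps)
  thus ?thesis by (simp only: minus_complex.sel plus_complex.sel uminus_complex.sel times_complex.sel Re_complex_of_real Im_complex_of_real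
        complex_cnj one_complex.sel cnj.sel) (simp add: power2_eq_square algebra_simps)
qed

end

section \<open>Local estimates for the phase\<close>

context levi_point
begin

definition dP where "dP x = nu0 + Pv (x - x0) + cnj_vec (Qv (x - x0))"

lemma dP_G: "dP x = nu x + G x" by (simp add: G_def dP_def)

lemma rho_x0: "\<rho> x0 = 0" using defining_functionD(3)[OF df x0V] x0f by simp

lemma G_x0: "G x0 = 0"
proof -
  have "Pv 0 = 0" "Qv 0 = 0" using linear_PQ(1,2) linear_0 by blast+
  thus ?thesis by (simp add: G_def nu0_def cnj_vec_def Finite_Cartesian_Product.vec_eq_iff)
qed

lemma eventually_dist: "s > 0 ==> \<forall>\<^sub>F x in nhds x0. dist x x0 \<le> s"
  unfolding eventually_nhds_metric by (intro exI[of _ s]) auto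

lemma eventually_V: "\<forall>\<^sub>F x in nhds x0. x \<in> V"
  by (rule eventually_nhds_in_open[OF V x0V])

lemma eventually_rem: "s > 0 ==> \<forall>\<^sub>F x in nhds x0. norm (rem x) \<le> s * dist x x0"
  using d_rho_deriv unfolding has_derivative_at_alt eventually_nhds_metric rem_def nu0_def by (metis dist_norm)

lemma eventually_nu:
  assumes "s > 0" shows "\<forall>\<^sub>F x in nhds x0. norm (nu x - nu0) \<le> s"
proof -
  have "nu \<midarrow>x0\<rightarrow> nu x0" using has_derivative_continuous[OF d_rho_deriv] by (simp add: isCont_def)
  hence "(nu \<longlongrightarrow> nu x0) (nhds x0)" by (simp add: tendsto_at_iff_tendsto_nhds)
  from tendstoD[OF this assms] show ?thesis by eventually_elim (simp add: dist_norm nu0_def)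
qed

lemma eventually_rho_taylor:
  assumes "s > 0" shows "\<forall>\<^sub>F x in nhds x0. \<bar>\<rho> x - 2 * r * Re (zc m x)\<bar> \<le> s * dist x x0"
proof -
  have d: "\<rho> differentiable (at x0)" by (rule differentiable[OF x0V])
  have "(\<rho> has_derivative (\<lambda>v. 2 * Re (bil v nu0))) (at x0)"
    using d unfolding frechet_derivative_works frechet_derivative_d_rho[OF d] nu0_def
    by (metis (no_types, lifting) frechet_derivative_d_rho[OF d] ext has_derivative_eq_rhs)
  then obtain e where e: "e > 0" "\<And>y. norm (y - x0) < e ==> norm (\<rho> y - \<rho> x0 - 2 * Re (bil (y - x0) nu0)) \<le> s * norm (y - x0)"
    using assms unfolding has_derivative_at_alt by meson
  have eq: "Re (bil (y - x0) nu0) = r * Re (zc m y)" for y by (simp add: bil_nu0 zc_N)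
  show ?thesis unfolding eventually_nhds_metric
    using e by (intro exI[of _ e]) (auto simp: dist_norm rho_x0 eq mult.assoc)
qed

lemma eventually_rho:
  assumes "s > 0" shows "\<forall>\<^sub>F x in nhds x0. \<bar>\<rho> x\<bar> \<le> s"
proof -
  have "\<rho> \<midarrow>x0\<rightarrow> \<rho> x0" using differentiable_imp_continuous_within[OF differentiable[OF x0V]] by (simp add: continuous_within)
  hence "(\<rho> \<longlongrightarrow> \<rho> x0) (nhds x0)" by (simp add: tendsto_at_iff_tendsto_nhds)
  from tendstoD[OF this assms] show ?thesis by eventually_elim (simp add: rho_x0)
qed

lemma Re_zc_m_le:
  assumes "\<bar>\<rho> x - 2 * r * Re (zc m x)\<bar> \<le> s * dist x x0"
  shows "\<bar>Re (zc m x)\<bar> \<le> (\<bar>\<rho> x\<bar> + s * dist x x0) / (2 * r)"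
proof -
  have "\<bar>2 * r * Re (zc m x)\<bar> \<le> \<bar>\<rho> x\<bar> + s * dist x x0" using assms by linarith
  thus ?thesis using r_pos by (simp add: abs_mult field_simps)
qed

lemma linear_bounds: "\<exists>C\<ge>0. \<forall>z. norm (Pv z) \<le> C * norm z \<and> norm (Qv z) \<le> C * norm z \<and> norm (lin z) \<le> C * norm z"
proof -
  obtain B1 B2 B3 where B: "B1 > 0" "\<And>x. norm (Pv x) \<le> B1 * norm x" "B2 > 0" "\<And>x. norm (Qv x) \<le> B2 * norm x"
    "B3 > 0" "\<And>x. norm (lin x) \<le> B3 * norm x"
    using linear_bounded_pos[OF linear_PQ(1)] linear_bounded_pos[OF linear_PQ(2)] linear_bounded_pos[OF linear_PQ(3)] by metis
  have "norm (Pv z) \<le> (B1 + B2 + B3) * norm z \<and> norm (Qv z) \<le> (B1 + B2 + B3) * norm z \<and> norm (lin z) \<le> (B1 + B2 + B3) * norm z" for z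
  proof -
    have "0 \<le> B1 * norm z" "0 \<le> B2 * norm z" "0 \<le> B3 * norm z" using B(1,3,5) by simp_all
    thus ?thesis using B(2)[of z] B(4)[of z] B(6)[of z] unfolding distrib_right by (intro conjI) linarith+
  qed
  thus ?thesis using B(1,3,5) by (intro exI[of _ "B1 + B2 + B3"]) auto
qed

lemma eventually_Pv_Qv: "\<exists>C\<ge>0. \<forall>\<^sub>F x in nhds x0. norm (pn x) \<le> C * dist x x0
    \<and> norm (Qv (x - x0)) \<le> C * dist x x0 \<and> norm (G x) \<le> C * dist x x0"
proof -
  obtain C where C: "C \<ge> 0" "\<And>z. norm (Pv z) \<le> C * norm z" "\<And>z. norm (Qv z) \<le> C * norm z" "\<And>z. norm (lin z) \<le> C * norm z"
    using linear_bounds by blast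
  have "\<forall>\<^sub>F x in nhds x0. norm (rem x) \<le> 1 * dist x x0" by (rule eventually_rem) simp
  hence "\<forall>\<^sub>F x in nhds x0. norm (pn x) \<le> (3 * C + 1) * dist x x0
    \<and> norm (Qv (x - x0)) \<le> (3 * C + 1) * dist x x0 \<and> norm (G x) \<le> (3 * C + 1) * dist x x0"
  proof eventually_elim
    case (elim x)
    have e: "pn x = Pv (x - x0) - lin (x - x0) - rem x" by (simp add: rem_def)
    have 1: "norm (pn x) \<le> (2 * C + 1) * dist x x0"
      unfolding e using norm_triangle_ineq4[of "Pv (x - x0) - lin (x - x0)" "rem x"] norm_triangle_ineq4[of "Pv (x - x0)" "lin (x - x0)"]
        C(2)[of "x - x0"] C(4)[of "x - x0"] elim by (simp add: dist_norm algebra_simps)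
    have g: "G x = (pn x) + cnj_vec (Qv (x - x0))" by (simp add: G_def)
    have 2: "norm (G x) \<le> (3 * C + 1) * dist x x0"
      unfolding g using norm_triangle_ineq[of "pn x" "cnj_vec (Qv (x - x0))"] 1 C(3)[of "x - x0"]
      by (simp add: dist_norm algebra_simps)
    have n: "0 \<le> C * dist x x0" using C(1) by simp
    show ?case using 1 2 C(3)[of "x - x0"] n zero_le_dist[of x x0] unfolding dist_norm[symmetric] distrib_right by (intro conjI) linarith+
  qed
  thus ?thesis using C(1) by (intro exI[of _ "3 * C + 1"]) auto
qed

text \<open>The constant is fixed before \<open>s\<close>; only the neighbourhood shrinks with
  \<open>s\<close>. This uniformity is what permits \<open>s\<close> to tend to 0 after
  \<open>t\<close> has tended to infinity.\<close>

lemma eventually_Z_p: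
  "\<exists>C\<ge>0. \<forall>s>0. \<forall>\<^sub>F x in nhds x0. \<forall>i<m. cmod (bil (Z i) (pn x) + of_real (lam i + c i) * cnj (zc i x))
    \<le> C * (\<bar>\<rho> x\<bar> + s * dist x x0) \<and> cmod (bil (Z i) (G x) + of_real (kp i) * cnj (zc i x)) \<le> C * (\<bar>\<rho> x\<bar> + s * dist x x0)"
proof -
  define E where "E = (\<Sum>i<m. cmod (eta i))"
  have E: "E \<ge> 0" "\<And>i. i < m ==> cmod (eta i) \<le> E" unfolding E_def by (auto intro!: sum_nonneg member_le_sum)
  have main: "\<forall>\<^sub>F x in nhds x0. \<forall>i<m. cmod (bil (Z i) (pn x) + of_real (lam i + c i) * cnj (zc i x))
    \<le> (E / r + 1) * (\<bar>\<rho> x\<bar> + s * dist x x0) \<and> cmod (bil (Z i) (G x) + of_real (kp i) * cnj (zc i x)) \<le> (E / r + 1) * (\<bar>\<rho> x\<bar> + s * dist x x0)"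
    if s: "s > 0" for s
    using eventually_rem[OF s] eventually_rho_taylor[OF s]
  proof eventually_elim
    case (elim x)
    let ?R = "\<bar>\<rho> x\<bar> + s * dist x x0"
    have k: "cmod (- 2 * eta i * of_real (Re (zc m x)) - bil (Z i) (rem x)) \<le> (E / r + 1) * ?R" if i: "i < m" for i
    proof -
      have "cmod (- 2 * eta i * of_real (Re (zc m x)) - bil (Z i) (rem x)) \<le> cmod (- 2 * eta i * of_real (Re (zc m x))) + cmod (bil (Z i) (rem x))"
        by (rule norm_triangle_ineq4)
      also have "cmod (- 2 * eta i * of_real (Re (zc m x))) = 2 * cmod (eta i) * \<bar>Re (zc m x)\<bar>" by (simp add: norm_mult)
      also have "\<dots> \<le> 2 * E * (?R / (2 * r))" using E(2)[OF i] Re_zc_m_le[OF elim(2)] E(1) by (intro mult_mono) auto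
      also have "cmod (bil (Z i) (rem x)) \<le> ?R" using cmod_bil_le[of "Z i" "rem x"] elim(1) norm_Z[OF i] by simp
      finally show ?thesis by (simp add: distrib_right)
    qed
    show ?case
    proof (intro allI impI conjI)
      fix i assume i: "i < m"
      have "bil (Z i) (pn x) + of_real (lam i + c i) * cnj (zc i x) = - 2 * eta i * of_real (Re (zc m x)) - bil (Z i) (rem x)"
        unfolding bil_Z_p_nu[OF i] by (simp add: algebra_simps)
      thus "cmod (bil (Z i) (pn x) + of_real (lam i + c i) * cnj (zc i x)) \<le> (E / r + 1) * ?R" using k[OF i] by simp
      have "bil (Z i) (G x) + of_real (kp i) * cnj (zc i x) = - 2 * eta i * of_real (Re (zc m x)) - bil (Z i) (rem x)"
        unfolding bil_Z_G[OF i] by (simp add: algebra_simps)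
      thus "cmod (bil (Z i) (G x) + of_real (kp i) * cnj (zc i x)) \<le> (E / r + 1) * ?R" using k[OF i] by simp
    qed
  qed
  show ?thesis using main E(1) r_pos by (intro exI[of _ "E / r + 1"]) auto
qed

lemma Re_bil_z_G_le:
  "\<exists>k>0. \<exists>C\<ge>0. \<forall>x. Re (bil (x - x0) (G x)) \<le> - k * (dist x x0)^2 + C * \<bar>Re (zc m x)\<bar> * dist x x0 + dist x x0 * norm (rem x)"
proof -
  \<comment> \<open>The 1 stands for the coefficient of the squared imaginary part of the normal
    coordinate, and it keeps the set nonempty.\<close>
  define k where "k = Min (insert 1 ((\<lambda>i. kp i) ` {..<m}))"
  have k: "k > 0" "k \<le> 1" "\<And>i. i < m ==> k \<le> kp i"
    unfolding k_def by (auto simp: kap)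
  define E where "E = (\<Sum>i<m. cmod (eta i))"
  have E: "E \<ge> 0" unfolding E_def by (intro sum_nonneg) auto
  have "Re (bil (x - x0) (G x)) \<le> - k * (dist x x0)^2 + (2 + \<bar>1 - 2 * hN\<bar> + 4 * E) * \<bar>Re (zc m x)\<bar> * dist x x0 + dist x x0 * norm (rem x)" for x
  proof -
    let ?d = "dist x x0" and ?t = "\<bar>Re (zc m x)\<bar>"
    have t: "?t \<le> ?d" using cmod_zc[of m x] abs_Re_le_cmod[of "zc m x"] m by (simp add: dist_norm)
    have 1: "k * (\<Sum>i<m. (cmod (zc i x))^2) \<le> (\<Sum>i<m. (kp i) * (cmod (zc i x))^2)"
      unfolding sum_distrib_left by (intro sum_mono mult_right_mono k) auto
    have 2: "k * (Im (zc m x))^2 \<le> (Im (zc m x))^2" using k mult_right_mono[of k 1 "(Im (zc m x))^2"] by simp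
    have 3: "?d^2 = (\<Sum>i<m. (cmod (zc i x))^2) + (Re (zc m x))^2 + (Im (zc m x))^2"
      using norm_z[of x] by (simp add: dist_norm cmod_power2)
    have tt: "(Re (zc m x))^2 \<le> ?t * ?d" using mult_left_mono[OF t, of ?t] by (simp add: power2_eq_square abs_mult_self_eq flip: abs_mult)
    have 4: "(k + (1 - 2 * hN)) * (Re (zc m x))^2 \<le> (1 + \<bar>1 - 2 * hN\<bar>) * (?t * ?d)"
      using tt k(1,2) by (intro mult_mono) auto
    have "cmod (\<Sum>j<m. eta j * zc j x) \<le> (\<Sum>j<m. cmod (eta j) * ?d)"
      using cmod_zc[of _ x] by (intro order_trans[OF norm_sum] sum_mono) (simp add: norm_mult mult_left_mono m dist_norm)
    hence "\<bar>Re (\<Sum>j<m. eta j * zc j x)\<bar> \<le> E * ?d"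
      unfolding E_def sum_distrib_right using abs_Re_le_cmod order_trans by blast
    hence "?t * \<bar>Re (\<Sum>j<m. eta j * zc j x)\<bar> \<le> ?t * (E * ?d)" by (intro mult_left_mono) auto
    hence 5: "- 4 * Re (zc m x) * Re (\<Sum>j<m. eta j * zc j x) \<le> 4 * (?t * (E * ?d))"
      using abs_ge_minus_self[of "Re (zc m x) * Re (\<Sum>j<m. eta j * zc j x)"] unfolding abs_mult by linarith
    have 6: "- Re (bil (x - x0) (rem x)) \<le> ?d * norm (rem x)"
      using cmod_bil_le[of "x - x0" "rem x"] abs_Re_le_cmod[of "bil (x - x0) (rem x)"] by (simp add: dist_norm)
    have "0 \<le> ?t * ?d" by simp
    have "Re (bil (x - x0) (G x)) \<le> - k * (\<Sum>i<m. (cmod (zc i x))^2) - k * (Im (zc m x))^2 + (1 - 2 * hN) * (Re (zc m x))^2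
      + 4 * (?t * (E * ?d)) + ?d * norm (rem x)"
      unfolding Re_bil_z_G using 1 2 5 6 by linarith
    also have "\<dots> = - k * ?d^2 + (k + (1 - 2 * hN)) * (Re (zc m x))^2 + 4 * (?t * (E * ?d)) + ?d * norm (rem x)"
      unfolding 3 by (simp add: algebra_simps)
    also have "\<dots> \<le> - k * ?d^2 + (1 + \<bar>1 - 2 * hN\<bar>) * (?t * ?d) + 4 * (?t * (E * ?d)) + ?d * norm (rem x)"
      using 4 by linarith
    also have "\<dots> \<le> - k * ?d^2 + (2 + \<bar>1 - 2 * hN\<bar> + 4 * E) * ?t * ?d + ?d * norm (rem x)"
      using \<open>0 \<le> ?t * ?d\<close> by (simp add: algebra_simps)
    finally show ?thesis .
  qed
  thus ?thesis using k(1) E by (intro exI[of _ k] conjI exI[of _ "2 + \<bar>1 - 2 * hN\<bar> + 4 * E"]) auto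
qed

lemma Psi_ray_deriv:
  assumes "x0 + t *\<^sub>R z \<in> V"
  shows "((\<lambda>t. 2 * Re (Psi (x0 + t *\<^sub>R z)) - \<rho> (x0 + t *\<^sub>R z)) has_real_derivative 2 * Re (bil z (G (x0 + t *\<^sub>R z)))) (at t)"
proof -
  let ?y = "x0 + t *\<^sub>R z"
  have l: "((\<lambda>t. x0 + t *\<^sub>R z) has_derivative (\<lambda>h. h *\<^sub>R z)) (at t)" by (auto intro!: derivative_eq_intros)
  have d: "\<rho> differentiable (at ?y)" by (rule differentiable[OF assms])
  have P: "((\<lambda>x. 2 * Re (Psi x)) has_derivative (\<lambda>v. 2 * Re (bil v (nu0 + Pv (?y - x0)) + bil (cnj_vec v) (Qv (?y - x0))))) (at ?y)"
    by (intro has_derivative_mult_right bounded_linear.has_derivative[OF bounded_linear_Re] Psi_deriv)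
  have hs: "bil (h *\<^sub>R z) p = of_real h * bil z p" "bil (cnj_vec (h *\<^sub>R z)) p = of_real h * bil (cnj_vec z) p" for h p
    by (simp_all add: bil_def cnj_vec_def sum_distrib_left scaleR_conv_of_real[where 'a=complex] mult.assoc)
  have cq: "Re (bil (cnj_vec z) q) = Re (bil z (cnj_vec q))" for q
  proof -
    have "bil (cnj_vec z) q = cnj (bil z (cnj_vec q))" by (simp add: bil_def cnj_vec_def)
    thus ?thesis by simp
  qed
  have "((\<lambda>x. 2 * Re (Psi x) - \<rho> x) has_derivative (\<lambda>v. 2 * Re (bil v (nu0 + Pv (?y - x0)) + bil (cnj_vec v) (Qv (?y - x0))) - fderiv \<rho> ?y v)) (at ?y)"
    using d unfolding frechet_derivative_works by (intro has_derivative_diff P)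
  from has_derivative_compose[OF l this]
  have "((\<lambda>t. 2 * Re (Psi (x0 + t *\<^sub>R z)) - \<rho> (x0 + t *\<^sub>R z)) has_derivative
      (\<lambda>h. 2 * Re (bil (h *\<^sub>R z) (nu0 + Pv (?y - x0)) + bil (cnj_vec (h *\<^sub>R z)) (Qv (?y - x0))) - fderiv \<rho> ?y (h *\<^sub>R z))) (at t)" .
  thus ?thesis unfolding has_field_derivative_def
  proof (rule has_derivative_eq_rhs, intro ext)
    fix h
    show "2 * Re (bil (h *\<^sub>R z) (nu0 + Pv (?y - x0)) + bil (cnj_vec (h *\<^sub>R z)) (Qv (?y - x0))) - fderiv \<rho> ?y (h *\<^sub>R z)
       = 2 * Re (bil z (G ?y)) * h"
      unfolding frechet_derivative_d_rho[OF d] hs G_def bil_simps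
      by (simp add: cq algebra_simps)
  qed
qed

text \<open>The bound on \<open>G\<close> is integrated along the ray from \<open>x0\<close>. The
  term with the real part of the normal coordinate is not negative by itself, but it is of size
  \<open>|\<rho>|\<close> times the distance, up to small quadratic terms, and so is absorbed by
  \<open>\<rho> \<le> 0\<close>.\<close>

lemma eventually_decay: "\<exists>a>0. \<forall>\<^sub>F x in nhds x0. \<rho> x \<le> 0 --> 2 * Re (Psi x) \<le> - a * (dist x x0)^2"
proof -
  obtain k C where k: "k > 0" and C: "C \<ge> 0" and b:
    "\<And>x. Re (bil (x - x0) (G x)) \<le> - k * (dist x x0)^2 + C * \<bar>Re (zc m x)\<bar> * dist x x0 + dist x x0 * norm (rem x)"
    using Re_bil_z_G_le by blast
  define C' where "C' = C / (2 * r)"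
  have C': "C' \<ge> 0" using C r_pos by (simp add: C'_def)
  \<comment> \<open>All errors quadratic in the distance together use up half of \<open>k\<close>;
    the bound \<open>s1\<close> on the distance below keeps the \<open>|\<rho>|\<close> error at
    most \<open>|\<rho>|\<close>.\<close>
  define s where "s = k / (2 * (1 + C'))"
  have s: "s > 0" "s * (1 + C') = k / 2" using k C' by (simp_all add: s_def field_simps)
  define s1 where "s1 = 1 / (1 + C')"
  have s1: "s1 > 0" "C' * s1 \<le> 1" using C' by (simp_all add: s1_def)
  obtain \<delta> where \<delta>: "\<delta> > 0" "\<And>x. dist x x0 < \<delta> ==> x \<in> V \<and> norm (rem x) \<le> s * dist x x0"
    using eventually_conj[OF eventually_V eventually_rem[OF s(1)]] unfolding eventually_nhds_metric by blast
  have "\<forall>\<^sub>F x in nhds x0. dist x x0 < \<delta>" unfolding eventually_nhds_metric using \<delta>(1) by auto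
  hence "\<forall>\<^sub>F x in nhds x0. \<rho> x \<le> 0 --> 2 * Re (Psi x) \<le> - (k / 2) * (dist x x0)^2"
    using eventually_rho_taylor[OF s(1)] eventually_dist[OF s1(1)]
  proof eventually_elim
    case (elim x)
    let ?d = "dist x x0" and ?z = "x - x0"
    define Q where "Q = - k * ?d^2 + C * \<bar>Re (zc m x)\<bar> * ?d + s * ?d^2"
    \<comment> \<open>The derivative of the phase difference at parameter \<open>t\<close> is at
      most \<open>2 * t * Q\<close>; subtracting \<open>t^2 * Q\<close> makes it monotone, so no
      integral has to be evaluated.\<close>
    let ?\<phi> = "\<lambda>t. 2 * Re (Psi (x0 + t *\<^sub>R ?z)) - \<rho> (x0 + t *\<^sub>R ?z) - t^2 * Q"
    have "?\<phi> 1 \<le> ?\<phi> 0"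
    proof (rule DERIV_nonpos_imp_nonincreasing[of 0 1])
      fix t :: real assume t: "0 \<le> t" "t \<le> 1"
      let ?y = "x0 + t *\<^sub>R ?z"
      have dy: "dist ?y x0 = t * ?d" using t by (simp add: dist_norm)
      have "dist ?y x0 < \<delta>" unfolding dy using elim(1) t mult_right_mono[of t 1 ?d] by simp
      hence y: "?y \<in> V" "norm (rem ?y) \<le> s * (t * ?d)" using \<delta>(2)[of ?y] dy by simp_all
      have zy: "zc m ?y = of_real t * zc m x" by (simp only: zc_def scaleR_vec_eq_smult herm_inner_simps add_diff_cancel_left')
      have bt: "bil (?y - x0) p = of_real t * bil ?z p" for p by (simp only: scaleR_vec_eq_smult bil_simps add_diff_cancel_left')
      have "t * Re (bil ?z (G ?y)) \<le> - k * (t * ?d)^2 + C * \<bar>t * Re (zc m x)\<bar> * (t * ?d) + (t * ?d) * norm (rem ?y)"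
        using b[of ?y] unfolding bt dy zy by simp
      also have "(t * ?d) * norm (rem ?y) \<le> (t * ?d) * (s * (t * ?d))" using y(2) t by (intro mult_left_mono) auto
      finally have "t * Re (bil ?z (G ?y)) \<le> t * (t * Q)"
        using t by (simp add: Q_def abs_mult power2_eq_square algebra_simps)
      hence le: "Re (bil ?z (G ?y)) \<le> t * Q"
      proof (cases "t = 0")
        case True thus ?thesis by (simp add: G_x0 bil_simps)
      next
        case False thus ?thesis using \<open>t * Re (bil ?z (G ?y)) \<le> t * (t * Q)\<close> t by simp
      qed
      have "(?\<phi> has_real_derivative (2 * Re (bil ?z (G ?y)) - (2 * t) * Q)) (at t)"
        by (intro DERIV_diff Psi_ray_deriv y(1)) (auto intro!: derivative_eq_intros)
      thus "\<exists>y. (?\<phi> has_real_derivative y) (at t) \<and> y \<le> 0" using le by (intro exI conjI) auto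
    qed simp
    hence 1: "2 * Re (Psi x) \<le> \<rho> x + Q" by (simp add: Psi_x0 rho_x0)
    show ?case
    proof
      assume neg: "\<rho> x \<le> 0"
      have "C * \<bar>Re (zc m x)\<bar> * ?d \<le> C * ((\<bar>\<rho> x\<bar> + s * ?d) / (2 * r)) * ?d"
        using Re_zc_m_le[OF elim(2)] C by (intro mult_right_mono mult_left_mono) auto
      also have "\<dots> = (C' * ?d) * \<bar>\<rho> x\<bar> + C' * s * ?d^2" by (simp add: C'_def power2_eq_square add_divide_distrib algebra_simps)
      also have "(C' * ?d) * \<bar>\<rho> x\<bar> \<le> 1 * \<bar>\<rho> x\<bar>"
        using mult_left_mono[OF elim(3) C'] s1(2) by (intro mult_right_mono) auto
      finally have "Q \<le> - k * ?d^2 + \<bar>\<rho> x\<bar> + (s * (1 + C')) * ?d^2" unfolding Q_def by (simp add: algebra_simps)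
      thus "2 * Re (Psi x) \<le> - (k / 2) * ?d^2" using 1 neg unfolding s(2) by simp
    qed
  qed
  thus ?thesis using k by (intro exI[of _ "k / 2"]) auto
qed

end

section \<open>Vector fields tangent to the boundary near the point\<close>

context levi_point
begin

lemma nondegenerate_near:
  assumes "norm (nu x - nu0) \<le> r / 2"
  shows "r / 2 \<le> Re (bil Nv (nu x))" "r / 2 \<le> cmod (bil Nv (nu x))"
proof -
  have "nu x = nu0 + (nu x - nu0)" by simp
  hence "bil Nv (nu x) = of_real r + bil Nv (nu x - nu0)" using bil_Nv_nu0 bil_simps(4) by metis
  moreover have "\<bar>Re (bil Nv (nu x - nu0))\<bar> \<le> r / 2"
    using abs_Re_le_cmod[of "bil Nv (nu x - nu0)"] cmod_bil_le[of Nv "nu x - nu0"] assms norm_Nv by simp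
  ultimately show 1: "r / 2 \<le> Re (bil Nv (nu x))" by simp
  show "r / 2 \<le> cmod (bil Nv (nu x))" using 1 complex_Re_le_cmod[of "bil Nv (nu x)"] by linarith
qed

text \<open>\<open>fieldX\<close> flows into \<open>x0\<close> and yields the concentration of the mass there; \<open>fieldZ i\<close> isolates
  the second moment of the \<open>i\<close>-th eigencoordinate.\<close>

definition fieldX where
  "fieldX x = (x - x0) - (of_real (2 * Re (bil (x - x0) (nu x)) - \<rho> x) * inverse (of_real (2 * Re (bil Nv (nu x))))) *s Nv"
text \<open>The eigenvector projected along the normal direction onto the complex tangent spaces of
  the level sets of \<open>\<rho>\<close>.\<close>

definition fieldV where
  "fieldV i x = Z i - (bil (Z i) (nu x) * inverse (bil Nv (nu x))) *s Nv"
definition fieldZ where "fieldZ i x = zc i x *s fieldV i x"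

lemma zc_C1: "Ck_on 1 S (zc i)"
  unfolding zc_def[abs_def] herm_inner_def by (intro Ck_on_1_intros Ck_on_1_component)

lemma fields_C1:
  assumes "open W" "W \<subseteq> V" and nd: "\<And>x. x \<in> W ==> norm (nu x - nu0) \<le> r / 2"
  shows "Ck_on 1 W (\<lambda>x. fieldX x $ k)" "Ck_on 1 W (\<lambda>x. fieldV i x $ k)" "Ck_on 1 W (\<lambda>x. fieldZ i x $ k)"
proof -
  have n: "Ck_on 1 W (\<lambda>x. nu x $ k)" for k by (rule Ck_on_1_subset[OF d_rho_C1 assms(2)])
  have b: "Ck_on 1 W (\<lambda>x. bil a (nu x))" for a by (intro Ck_on_1_bil Ck_on_1_const n)
  have rho: "Ck_on 1 W \<rho>" by (rule Ck_on_1_subset[OF C1 assms(2)])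
  have z: "Re (bil Nv (nu x)) \<noteq> 0 \<and> bil Nv (nu x) \<noteq> 0" if "x \<in> W" for x
    using nondegenerate_near[OF nd[OF that]] r_pos by auto
  have c2: "Ck_on 1 W (\<lambda>x. 2 * Re (bil a (nu x)))" for a
    using Ck_on_1_compose_linear[OF bounded_linear_mult_right[of 2] Ck_on_1_Re[OF b]] .
  have c3: "Ck_on 1 W (\<lambda>x. 2 * Re (bil (x - x0) (nu x)))"
    using Ck_on_1_compose_linear[OF bounded_linear_mult_right[of 2] Ck_on_1_Re[OF Ck_on_1_bil[OF Ck_on_1_component n]]] .
  have "Ck_on 1 W (\<lambda>x. (x - x0) $ k - (of_real (2 * Re (bil (x - x0) (nu x)) - \<rho> x) * inverse (of_real (2 * Re (bil Nv (nu x))))) * Nv $ k)"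
    using z by (intro Ck_on_1_diff Ck_on_1_component Ck_on_1_mult Ck_on_1_of_real Ck_on_1_inverse Ck_on_1_const c2 c3 rho) auto
  thus "Ck_on 1 W (\<lambda>x. fieldX x $ k)" by (simp only: fieldX_def vector_minus_component vector_smult_component)
  have "Ck_on 1 W (\<lambda>x. Z i $ k - (bil (Z i) (nu x) * inverse (bil Nv (nu x))) * Nv $ k)"
    using z by (intro Ck_on_1_diff Ck_on_1_mult Ck_on_1_inverse Ck_on_1_const b) auto
  thus v: "Ck_on 1 W (\<lambda>x. fieldV i x $ k)" by (simp only: fieldV_def vector_minus_component vector_smult_component)
  show "Ck_on 1 W (\<lambda>x. fieldZ i x $ k)"
    unfolding fieldZ_def vector_smult_component by (intro Ck_on_1_mult zc_C1 v)
qed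

text \<open>Along \<open>fieldX\<close> the function \<open>\<rho>\<close> is differentiated to
  itself, as by a dilation. The normal part thus vanishes at the boundary, and inside it supplies
  the term \<open>\<rho> / 2\<close> through which concentration also controls
  \<open>|\<rho>|\<close>.\<close>

lemma field_tangent:
  assumes "norm (nu x - nu0) \<le> r / 2"
  shows "Re (bil (fieldX x) (nu x)) = \<rho> x / 2" "bil (fieldV i x) (nu x) = 0" "bil (fieldZ i x) (nu x) = 0"
proof -
  have z: "Re (bil Nv (nu x)) \<noteq> 0" "bil Nv (nu x) \<noteq> 0"
    using nondegenerate_near[OF assms] r_pos by auto
  have "of_real a * inverse (of_real b) = complex_of_real (a / b)" for a b by (simp add: divide_inverse)
  thus "Re (bil (fieldX x) (nu x)) = \<rho> x / 2"
    using z(1) unfolding fieldX_def bil_simps by (simp add: field_simps)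
  show v: "bil (fieldV i x) (nu x) = 0" using z(2) by (simp add: fieldV_def bil_simps)
  show "bil (fieldZ i x) (nu x) = 0" by (simp add: fieldZ_def bil_simps v)
qed

lemma d_z_zc: "d_z k (zc i) x = cnj (Zf i $ k)"
proof -
  have "(zc i has_derivative (\<lambda>v. bil v (cnj_vec (Zf i)) + bil (cnj_vec v) 0)) (at x)"
    unfolding zc_def[abs_def] bil_def herm_inner_def cnj_vec_def
    by (auto intro!: derivative_eq_intros bounded_linear.has_derivative[OF bounded_linear_vec_nth])
  from d_z_of_split(1)[OF this] show ?thesis by (simp add: cnj_vec_def)
qed

text \<open>The coordinate \<open>zc i\<close> differentiated along its own direction gives the
  leading 1, exactly so because the correction along \<open>Nv\<close> is orthogonal to
  \<open>Z i\<close>.\<close>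

lemma div_fieldZ:
  assumes "open W" "W \<subseteq> V" "\<And>x. x \<in> W ==> norm (nu x - nu0) \<le> r / 2" "x \<in> W" "i < m"
  shows "(dvg (fieldZ i) x) = 1 + zc i x * (dvg (fieldV i) x)"
proof -
  have d: "(\<lambda>x. fieldV i x $ k) differentiable (at x)" for k
    using fields_C1(2)[OF assms(1-3), of i k] assms(4) by simp
  have zd: "zc i differentiable (at x)" using zc_C1[of UNIV i] by simp
  have "(dvg (fieldZ i) x) = (\<Sum>k\<in>UNIV. zc i x * d_z k (\<lambda>x. fieldV i x $ k) x + cnj (Z i $ k) * fieldV i x $ k)"
    unfolding fieldZ_def vector_smult_component d_z_mult(1)[OF zd d] d_z_zc using assms(5) by (simp add: Zf_def)
  also have "\<dots> = zc i x * (dvg (fieldV i) x) + herm_inner (fieldV i x) (Z i)"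
    by (simp add: sum.distrib sum_distrib_left herm_inner_def mult.commute)
  also have "herm_inner (fieldV i x) (Z i) = 1"
    using assms(5) by (simp add: fieldV_def herm_inner_simps herm_ZZ herm_ZN)
  finally show ?thesis by (simp add: add.commute)
qed

lemma local_fields:
  obtains e C where "e > 0" "C \<ge> 0" "ball x0 (2 * e) \<subseteq> V" "\<And>x. x \<in> ball x0 (2 * e) ==> norm (nu x - nu0) \<le> r / 2"
    "\<And>x. x \<in> cball x0 e ==> Re (dvg fieldX x) \<le> C"
    "\<And>x i. x \<in> cball x0 e ==> i < m ==> \<bar>Re (dvg (fieldZ i) x) - 1\<bar> \<le> C * dist x x0"
proof -
  have "\<forall>\<^sub>F x in nhds x0. x \<in> V \<and> norm (nu x - nu0) \<le> r / 2"
    using r_pos by (intro eventually_conj eventually_V eventually_nu) simp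
  then obtain d where d: "d > 0" "\<And>x. dist x x0 < d ==> x \<in> V \<and> norm (nu x - nu0) \<le> r / 2"
    unfolding eventually_nhds_metric by blast
  define e where "e = d / 2"
  define W where "W = ball x0 (2 * e)"
  have e: "e > 0" "open W" "W \<subseteq> V" "\<And>x. x \<in> W ==> norm (nu x - nu0) \<le> r / 2"
    using d by (auto simp: e_def W_def dist_commute)
  have sub: "cball x0 e \<subseteq> W" using e(1) by (auto simp: W_def)
  have bd: "\<exists>B\<ge>0. \<forall>x\<in>cball x0 e. cmod (dvg Y x) \<le> B"
    if Y: "\<And>k. Ck_on 1 W (\<lambda>x. Y x $ k)" for Y
  proof -
    have "continuous_on (cball x0 e) (\<lambda>x. \<Sum>k\<in>UNIV. d_z k (\<lambda>x. Y x $ k) x)"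
      using continuous_on_subset[OF d_z_continuous(1)[OF Y] sub] by (intro continuous_on_sum)
    from continuous_on_compact_bounded[OF this compact_cball order_refl] show ?thesis .
  qed
  obtain BX where BX: "BX \<ge> 0" "\<And>x. x \<in> cball x0 e ==> cmod (dvg fieldX x) \<le> BX"
    using bd[OF fields_C1(1)[OF e(2-4)]] by blast
  have "\<forall>i. \<exists>B\<ge>0. \<forall>x\<in>cball x0 e. cmod (dvg (fieldV i) x) \<le> B"
    using bd[OF fields_C1(2)[OF e(2-4)]] by blast
  then obtain BV where BV: "\<And>i. BV i \<ge> 0" "\<And>i x. x \<in> cball x0 e ==> cmod (dvg (fieldV i) x) \<le> BV i"
    by metis
  define C where "C = BX + (\<Sum>i<m. BV i)"
  have C: "BX \<le> C" "\<And>i. i < m ==> BV i \<le> C"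
    using BX(1) BV(1) by (auto simp: C_def sum_nonneg intro!: add_increasing member_le_sum)
  show thesis
  proof
    show "e > 0" "C \<ge> 0" "ball x0 (2 * e) \<subseteq> V" using e(1,3) C(1) BX(1) by (auto simp: W_def)
    show "norm (nu x - nu0) \<le> r / 2" if "x \<in> ball x0 (2 * e)" for x using e(4) that by (simp add: W_def)
    show "Re (dvg fieldX x) \<le> C" if "x \<in> cball x0 e" for x
      using BX(2)[OF that] C(1) complex_Re_le_cmod[of "\<Sum>k\<in>UNIV. d_z k (\<lambda>x. fieldX x $ k) x"] by linarith
    show "\<bar>Re (dvg (fieldZ i) x) - 1\<bar> \<le> C * dist x x0" if x: "x \<in> cball x0 e" and i: "i < m" for x i
    proof -
      have xW: "x \<in> W" using x sub by blast
      have "\<bar>Re (dvg (fieldZ i) x) - 1\<bar> = \<bar>Re (zc i x * (dvg (fieldV i) x))\<bar>"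
        using arg_cong[OF div_fieldZ[OF e(2-4) xW i], of Re] unfolding plus_complex.sel(1) one_complex.sel(1) by linarith
      also have "\<dots> \<le> cmod (zc i x) * cmod (dvg (fieldV i) x)"
        unfolding norm_mult[symmetric] by (rule abs_Re_le_cmod)
      also have "\<dots> \<le> dist x x0 * C"
        using cmod_zc[of i x] i m BV(2)[OF x, of i] C(2)[OF i] by (intro mult_mono) (auto simp: dist_norm)
      finally show ?thesis by (simp add: mult.commute)
    qed
  qed
qed

text \<open>The radial part decreases the phase quadratically, the boundary part contributes
  \<open>\<rho> / 2\<close>, and the normal correction is of second order since its coefficient and
  \<open>G\<close> are both small near \<open>x0\<close>.\<close>

lemma eventually_fieldX: "\<exists>a>0. \<forall>\<^sub>F x in nhds x0. \<rho> x \<le> 0 --> Re (bil (fieldX x) (dP x)) \<le> - a * (\<bar>\<rho> x\<bar> + (dist x x0)^2)"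
proof -
  obtain k C where k: "k > 0" and C: "C \<ge> 0" and b:
    "\<And>x. Re (bil (x - x0) (G x)) \<le> - k * (dist x x0)^2 + C * \<bar>Re (zc m x)\<bar> * dist x x0 + dist x x0 * norm (rem x)"
    using Re_bil_z_G_le by blast
  obtain C1 where C1: "C1 \<ge> 0" "\<forall>\<^sub>F x in nhds x0. norm (pn x) \<le> C1 * dist x x0
    \<and> norm (Qv (x - x0)) \<le> C1 * dist x x0 \<and> norm (G x) \<le> C1 * dist x x0" using eventually_Pv_Qv by blast
  define C' where "C' = C / (2 * r)"
  have C': "C' \<ge> 0" using C r_pos by (simp add: C'_def)
  \<comment> \<open>The summands belong to the remainder of the conormal, to the real part of the
    normal coordinate, and to the normal correction; \<open>s\<close> is chosen so that together
    they cost half of \<open>k\<close>, and \<open>s1\<close> so that half of the available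
    \<open>|\<rho>| / 2\<close> remains.\<close>
  define C2 where "C2 = 1 + C' + 3 * C1 / r"
  have C2: "C2 > 0" using C' C1(1) r_pos by (simp add: C2_def add_pos_nonneg)
  define s where "s = k / (2 * C2)"
  have s: "s > 0" "s * C2 = k / 2" using k C2 by (simp_all add: s_def)
  define s1 where "s1 = 1 / (4 * (1 + C'))"
  have s1: "s1 > 0" "C' * s1 \<le> 1 / 4" using C' by (simp_all add: s1_def field_simps)
  define a where "a = min (1 / 4) (k / 2)"
  have a: "a > 0" using k by (simp add: a_def)
  have r2: "r / 2 > 0" using r_pos by simp
  have "\<forall>\<^sub>F x in nhds x0. \<rho> x \<le> 0 --> Re (bil (fieldX x) (dP x)) \<le> - a * (\<bar>\<rho> x\<bar> + (dist x x0)^2)"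
    using eventually_rho_taylor[OF s(1)] eventually_dist[OF s1(1)] eventually_nu[OF s(1)] eventually_nu[OF r2]
      eventually_rem[OF s(1)] C1(2)
  proof eventually_elim
    case (elim x)
    let ?d = "dist x x0" and ?z = "x - x0"
    \<comment> \<open>Numerator: twice the real part of \<open>bil (x - x0) (nu x)\<close> and
      \<open>\<rho> x\<close> have the same linear part, so their difference is a small multiple of
      the distance.\<close>
    define co where "co = (2 * Re (bil ?z (nu x)) - \<rho> x) / (2 * Re (bil Nv (nu x)))"
    have X: "fieldX x = ?z - of_real co *s Nv" unfolding fieldX_def co_def divide_inverse of_real_mult of_real_inverse ..
    have num: "\<bar>2 * Re (bil ?z (nu x)) - \<rho> x\<bar> \<le> 3 * s * ?d"
    proof -
      have "nu x = nu0 + (nu x - nu0)" by simp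
      hence "bil ?z (nu x) = bil ?z nu0 + bil ?z (nu x - nu0)" unfolding bil_simps(4)[symmetric] by (rule arg_cong)
      hence "bil ?z (nu x) = of_real r * zc m x + bil ?z (nu x - nu0)" unfolding bil_nu0 zc_N[symmetric] .
      hence "Re (bil ?z (nu x)) = r * Re (zc m x) + Re (bil ?z (nu x - nu0))" by simp
      moreover have "\<bar>Re (bil ?z (nu x - nu0))\<bar> \<le> ?d * s"
        using abs_Re_le_cmod[of "bil ?z (nu x - nu0)"] cmod_bil_le[of ?z "nu x - nu0"] mult_left_mono[OF elim(3), of ?d]
        by (simp add: dist_norm)
      moreover have "\<bar>2 * (a + b) - p\<bar> \<le> 3 * s * ?d" if "\<bar>b\<bar> \<le> ?d * s" "\<bar>p - 2 * a\<bar> \<le> s * ?d" for a b p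
        using that by (simp add: abs_le_iff algebra_simps)
      ultimately show ?thesis using elim(1) unfolding mult.assoc by metis
    qed
    have "\<bar>co\<bar> \<le> 3 * s * ?d / r"
      unfolding co_def abs_divide
    proof (rule frac_le)
      show "0 \<le> 3 * s * ?d" "0 < r" using s(1) r_pos by auto
      show "r \<le> \<bar>2 * Re (bil Nv (nu x))\<bar>" using nondegenerate_near(1)[OF elim(4)] by linarith
    qed (rule num)
    moreover have "\<bar>Re (bil Nv (G x))\<bar> \<le> C1 * ?d"
      using abs_Re_le_cmod[of "bil Nv (G x)"] cmod_bil_le[of Nv "G x"] norm_Nv elim(6) by simp
    ultimately have 2: "\<bar>co * Re (bil Nv (G x))\<bar> \<le> (3 * s * ?d / r) * (C1 * ?d)" unfolding abs_mult by (intro mult_mono) auto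
    have 3: "C * \<bar>Re (zc m x)\<bar> * ?d \<le> C' * ?d * \<bar>\<rho> x\<bar> + C' * s * ?d^2"
    proof -
      have "C * \<bar>Re (zc m x)\<bar> * ?d \<le> C * ((\<bar>\<rho> x\<bar> + s * ?d) / (2 * r)) * ?d"
        using Re_zc_m_le[OF elim(1)] C by (intro mult_right_mono mult_left_mono) auto
      also have "\<dots> = C' * ?d * \<bar>\<rho> x\<bar> + C' * s * ?d^2" by (simp add: C'_def power2_eq_square add_divide_distrib algebra_simps)
      finally show ?thesis .
    qed
    have 4: "C' * ?d * \<bar>\<rho> x\<bar> \<le> 1 / 4 * \<bar>\<rho> x\<bar>"
      using mult_left_mono[OF elim(2) C'] s1(2) by (intro mult_right_mono) auto
    have 5: "?d * norm (rem x) \<le> s * ?d^2" using mult_left_mono[OF elim(5), of ?d] by (simp add: power2_eq_square mult_ac)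
    show ?case
    proof
      assume neg: "\<rho> x \<le> 0"
      have "Re (bil (fieldX x) (dP x)) = \<rho> x / 2 + Re (bil ?z (G x)) - co * Re (bil Nv (G x))"
      proof -
        have "bil (fieldX x) (dP x) = bil (fieldX x) (nu x) + bil (fieldX x) (G x)" unfolding dP_G by (rule bil_simps(4))
        moreover have "bil (fieldX x) (G x) = bil ?z (G x) - of_real co * bil Nv (G x)" unfolding X by (simp only: bil_simps)
        ultimately show ?thesis using field_tangent(1)[OF elim(4)] by simp
      qed
      also have "\<dots> \<le> \<rho> x / 2 - k * ?d^2 + (1 / 4 * \<bar>\<rho> x\<bar> + C' * s * ?d^2) + s * ?d^2 + (3 * s * ?d / r) * (C1 * ?d)"
        using b[of x] 2 3 4 5 by linarith
      also have "\<dots> = - (1 / 4) * \<bar>\<rho> x\<bar> - k * ?d^2 + (s * C2) * ?d^2"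
        using neg r_pos by (simp add: C2_def power2_eq_square field_simps)
      also have "\<dots> \<le> - a * (\<bar>\<rho> x\<bar> + ?d^2)"
      proof -
        have "a * \<bar>\<rho> x\<bar> \<le> 1 / 4 * \<bar>\<rho> x\<bar>" "a * ?d^2 \<le> k / 2 * ?d^2" by (intro mult_right_mono; simp add: a_def)+
        thus ?thesis unfolding s(2) by (simp add: algebra_simps)
      qed
      finally show "Re (bil (fieldX x) (dP x)) \<le> - a * (\<bar>\<rho> x\<bar> + ?d^2)" .
    qed
  qed
  thus ?thesis using a by blast
qed

text \<open>The field is tangential, so only \<open>G\<close> counts, and \<open>G\<close> in the
  direction \<open>Z i\<close> is \<open>- kp i\<close> times the conjugate coordinate to leading
  order. The normal correction has a coefficient of size \<open>s\<close>, because
  \<open>Z i\<close> is tangential at \<open>x0\<close>.\<close>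

lemma eventually_fieldZ:
  "\<exists>C\<ge>0. \<forall>s>0. \<forall>\<^sub>F x in nhds x0. \<forall>i<m. \<bar>Re (bil (fieldZ i x) (dP x)) + (kp i) * (cmod (zc i x))^2\<bar> \<le> C * s * (\<bar>\<rho> x\<bar> + (dist x x0)^2)"
proof -
  obtain C1 where C1: "C1 \<ge> 0" "\<forall>\<^sub>F x in nhds x0. norm (pn x) \<le> C1 * dist x x0
    \<and> norm (Qv (x - x0)) \<le> C1 * dist x x0 \<and> norm (G x) \<le> C1 * dist x x0" using eventually_Pv_Qv by blast
  obtain C2 where C2: "C2 \<ge> 0" "\<And>s. s > 0 ==> \<forall>\<^sub>F x in nhds x0. \<forall>i<m. cmod (bil (Z i) (pn x) + of_real (lam i + c i) * cnj (zc i x))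
    \<le> C2 * (\<bar>\<rho> x\<bar> + s * dist x x0) \<and> cmod (bil (Z i) (G x) + of_real (kp i) * cnj (zc i x)) \<le> C2 * (\<bar>\<rho> x\<bar> + s * dist x x0)"
    using eventually_Z_p by blast
  have r2: "r / 2 > 0" using r_pos by simp
  have "\<forall>\<^sub>F x in nhds x0. \<forall>i<m. \<bar>Re (bil (fieldZ i x) (dP x)) + (kp i) * (cmod (zc i x))^2\<bar> \<le> (C2 + 2 * C1 / r) * s * (\<bar>\<rho> x\<bar> + (dist x x0)^2)"
    if s: "s > 0" for s
    using C2(2)[OF s] C1(2) eventually_dist[OF s] eventually_nu[OF s] eventually_nu[OF r2]
  proof eventually_elim
    case (elim x)
    let ?d = "dist x x0"
    show ?case
    proof (intro allI impI)
      fix i assume i: "i < m"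
      define qv where "qv = bil (Z i) (nu x) * inverse (bil Nv (nu x))"
      define h where "h = bil (Z i) (G x) + of_real (kp i) * cnj (zc i x)"
      have h: "cmod h \<le> C2 * (\<bar>\<rho> x\<bar> + s * ?d)" using elim(1) i by (simp add: h_def)
      have zi: "cmod (zc i x) \<le> ?d" using cmod_zc[of i x] i m by (simp add: dist_norm)
      have "bil (Z i) (nu x) = bil (Z i) (nu x - nu0)" using ZT[OF i] by (simp add: bil_simps nu0_def)
      hence "cmod (bil (Z i) (nu x)) \<le> s" using cmod_bil_le[of "Z i" "nu x - nu0"] norm_Z[OF i] elim(4) by simp
      hence q: "cmod qv \<le> s / (r / 2)"
        unfolding qv_def norm_mult norm_inverse divide_inverse[symmetric, where 'a=real] using nondegenerate_near(2)[OF elim(5)] r2 s by (intro frac_le) auto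
      have NG: "cmod (bil Nv (G x)) \<le> C1 * ?d" using cmod_bil_le[of Nv "G x"] norm_Nv elim(2) by simp
      have e: "bil (fieldZ i x) (dP x) = zc i x * (h - qv * bil Nv (G x)) - of_real ((kp i) * (cmod (zc i x))^2)"
      proof -
        have "bil (fieldZ i x) (dP x) = bil (fieldZ i x) (G x)" unfolding dP_G bil_simps field_tangent(3)[OF elim(5)] by simp
        also have "\<dots> = zc i x * (bil (Z i) (G x) - qv * bil Nv (G x))" by (simp only: fieldZ_def fieldV_def bil_simps qv_def)
        also have "bil (Z i) (G x) = h - of_real (kp i) * cnj (zc i x)" by (simp add: h_def)
        also have "zc i x * (h - of_real (kp i) * cnj (zc i x) - qv * bil Nv (G x))
            = zc i x * (h - qv * bil Nv (G x)) - of_real (kp i) * (zc i x * cnj (zc i x))"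
          by (simp only: algebra_simps)
        finally show ?thesis unfolding of_real_mult complex_norm_square .
      qed
      have "\<bar>Re (bil (fieldZ i x) (dP x)) + (kp i) * (cmod (zc i x))^2\<bar> = \<bar>Re (zc i x * (h - qv * bil Nv (G x)))\<bar>"
        unfolding e by (simp del: times_complex.sel of_real_mult)
      also have "\<dots> \<le> cmod (zc i x) * cmod (h - qv * bil Nv (G x))" unfolding norm_mult[symmetric] by (rule abs_Re_le_cmod)
      also have "\<dots> \<le> ?d * (C2 * (\<bar>\<rho> x\<bar> + s * ?d) + s / (r / 2) * (C1 * ?d))"
      proof (intro mult_mono zi)
        have "cmod (qv * bil Nv (G x)) \<le> s / (r / 2) * (C1 * ?d)" unfolding norm_mult using q NG s r2 by (intro mult_mono) auto
        thus "cmod (h - qv * bil Nv (G x)) \<le> C2 * (\<bar>\<rho> x\<bar> + s * ?d) + s / (r / 2) * (C1 * ?d)"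
          using norm_triangle_ineq4[of h "qv * bil Nv (G x)"] h by linarith
      qed auto
      also have "\<dots> = C2 * (?d * \<bar>\<rho> x\<bar>) + (C2 + 2 * C1 / r) * s * ?d^2" by (simp add: power2_eq_square algebra_simps)
      also have "\<dots> \<le> (C2 + 2 * C1 / r) * (s * \<bar>\<rho> x\<bar>) + (C2 + 2 * C1 / r) * s * ?d^2"
        using elim(3) C1(1) C2(1) r_pos s by (intro add_mono mult_mono) auto
      finally show "\<bar>Re (bil (fieldZ i x) (dP x)) + (kp i) * (cmod (zc i x))^2\<bar> \<le> (C2 + 2 * C1 / r) * s * (\<bar>\<rho> x\<bar> + ?d^2)"
        by (simp only: distrib_left mult.assoc)
    qed
  qed
  thus ?thesis using C1(1) C2(1) r_pos by (intro exI[of _ "C2 + 2 * C1 / r"]) auto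
qed

end

section \<open>Leading terms of derivatives of peaked functions\<close>

context phase_cutoff
begin

text \<open>To leading order in \<open>t\<close>, differentiation of \<open>f t\<close> is multiplication by \<open>t\<close> times a
  symbol. The constant \<open>C\<close> is kept explicit since it has to be independent of the cutoff, while the
  coefficient of the second error term is arbitrary because its contribution is exponentially small.\<close>

definition principal :: "real => (real => complex ^ 'n => complex) => (complex ^ 'n => complex) => bool" where
  "principal C F P \<longleftrightarrow> (\<exists>B\<ge>0. \<forall>t\<ge>0. \<forall>x\<in>D \<inter> K.
     cmod (F t x - of_real t * f t x * P x) \<le> C * cmod (f t x) + B * indicator annulus x * exp (t * Re (\<Psi> x)))"

lemma principal_mono: "principal C F P ==> C \<le> C' ==> principal C' F P"
  unfolding principal_def by (meson add_right_mono mult_right_mono norm_ge_zero order_trans)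

lemma principal_0: "principal 0 (\<lambda>t x. 0) (\<lambda>x. 0)"
  unfolding principal_def by (intro exI[of _ 0]) auto

lemma principal_add:
  assumes "principal C F P" "principal C' F' P'"
  shows "principal (C + C') (\<lambda>t x. F t x + F' t x) (\<lambda>x. P x + P' x)"
proof -
  obtain B B' where B: "B \<ge> 0" "\<And>t x. t \<ge> 0 ==> x \<in> D \<inter> K ==>
      cmod (F t x - of_real t * f t x * P x) \<le> C * cmod (f t x) + B * indicator annulus x * exp (t * Re (\<Psi> x))"
    and B': "B' \<ge> 0" "\<And>t x. t \<ge> 0 ==> x \<in> D \<inter> K ==>
      cmod (F' t x - of_real t * f t x * P' x) \<le> C' * cmod (f t x) + B' * indicator annulus x * exp (t * Re (\<Psi> x))"
    using assms unfolding principal_def by blast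
  have "cmod (F t x + F' t x - of_real t * f t x * (P x + P' x)) \<le> (C + C') * cmod (f t x) + (B + B') * indicator annulus x * exp (t * Re (\<Psi> x))"
    if "t \<ge> 0" "x \<in> D \<inter> K" for t x
  proof -
    have "F t x + F' t x - of_real t * f t x * (P x + P' x) = (F t x - of_real t * f t x * P x) + (F' t x - of_real t * f t x * P' x)"
      by (simp add: algebra_simps)
    thus ?thesis using norm_triangle_mono[OF B(2)[OF that] B'(2)[OF that]] by (simp add: algebra_simps)
  qed
  thus ?thesis unfolding principal_def using B(1) B'(1) by (intro exI[of _ "B + B'"]) auto
qed

lemma principal_sum:
  assumes "finite I" "\<And>i. i \<in> I ==> principal (C i) (F i) (P i)"
  shows "principal (\<Sum>i\<in>I. C i) (\<lambda>t x. \<Sum>i\<in>I. F i t x) (\<lambda>x. \<Sum>i\<in>I. P i x)"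
  using assms by (induction I rule: finite_induct) (simp_all add: principal_0 principal_add)

lemma principal_mult:
  assumes "principal C F P" and M: "M \<ge> 0" "\<And>x. x \<in> D \<inter> K ==> cmod (g x) \<le> M" and C: "C \<ge> 0"
  shows "principal (M * C) (\<lambda>t x. g x * F t x) (\<lambda>x. g x * P x)"
proof -
  obtain B where B: "B \<ge> 0" "\<And>t x. t \<ge> 0 ==> x \<in> D \<inter> K ==>
      cmod (F t x - of_real t * f t x * P x) \<le> C * cmod (f t x) + B * indicator annulus x * exp (t * Re (\<Psi> x))"
    using assms(1) unfolding principal_def by blast
  have "cmod (g x * F t x - of_real t * f t x * (g x * P x)) \<le> (M * C) * cmod (f t x) + (M * B) * indicator annulus x * exp (t * Re (\<Psi> x))"
    if "t \<ge> 0" "x \<in> D \<inter> K" for t x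
  proof -
    have "g x * F t x - of_real t * f t x * (g x * P x) = g x * (F t x - of_real t * f t x * P x)"
      by (simp add: algebra_simps)
    hence "cmod (g x * F t x - of_real t * f t x * (g x * P x)) = cmod (g x) * cmod (F t x - of_real t * f t x * P x)" by (simp add: norm_mult)
    also have "\<dots> \<le> M * (C * cmod (f t x) + B * indicator annulus x * exp (t * Re (\<Psi> x)))"
      using M(2)[OF that(2)] B(2)[OF that] M(1) by (intro mult_mono) auto
    finally show ?thesis by (simp add: algebra_simps)
  qed
  thus ?thesis unfolding principal_def using B(1) M(1) by (intro exI[of _ "M * B"]) auto
qed

text \<open>The three terms of the product rule: the derivative of the phase is the symbol, that of
  \<open>h\<close> the bounded error, that of the cutoff the annulus error.\<close>

lemma principal_derivative:
  assumes "open V" and h: "Ck_on 1 V h"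
  shows "(\<And>x. x \<in> K ==> cmod (d_z k h x) \<le> C) ==> principal C (\<lambda>t. d_z k (\<lambda>x. f t x * h x)) (\<lambda>x. h x * d_z k \<Psi> x)"
    and "(\<And>x. x \<in> K ==> cmod (d_zbar k h x) \<le> C) ==> principal C (\<lambda>t. d_zbar k (\<lambda>x. f t x * h x)) (\<lambda>x. h x * d_zbar k \<Psi> x)"
proof -
  let ?\<theta> = "\<lambda>x. complex_of_real (\<theta> x)"
  have hK: "continuous_on K h" using Ck_on_1D(3)[OF h] continuous_on_subset cball by blast
  have dt: "continuous_on K (d_z k ?\<theta>)" "continuous_on K (d_zbar k ?\<theta>)"
    using d_z_continuous[OF Ck_on_1_of_real[OF \<theta>(1)]] continuous_on_subset by blast+
  have bd: "\<exists>B\<ge>0. \<forall>x\<in>K. cmod (g x * h x) \<le> B" if "continuous_on K g" for g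
    by (rule continuous_on_compact_bounded[OF continuous_on_mult[OF that hK] compact_cball order_refl])
  have df: "f t differentiable (at x)" for t x using f_C1[of t] by simp
  have dh: "h differentiable (at x)" if "x \<in> K" for x using h that cball by auto
  have alg: "cmod (a * dh + (t * a * p + e * dt) * b - t * a * (b * p)) \<le> C * cmod a + B * i * ex"
    if "cmod dh \<le> C" "cmod e = ex" "cmod (dt * b) \<le> B * i" for a dh t p e dt b :: complex and C B i ex :: real
  proof -
    have "a * dh + (t * a * p + e * dt) * b - t * a * (b * p) = a * dh + e * (dt * b)" by (simp add: algebra_simps)
    moreover have "cmod (a * dh) \<le> cmod a * C" "cmod (e * (dt * b)) \<le> ex * (B * i)"
      unfolding norm_mult[of a] norm_mult[of e] using that by (auto intro!: mult_left_mono)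
    ultimately show ?thesis using norm_triangle_mono by (metis (no_types, lifting) mult.commute)
  qed
  have ind: "cmod (g x * h x) \<le> B * indicator annulus x" if "x \<notin> annulus ==> g x = 0" "x \<in> K" "\<forall>x\<in>K. cmod (g x * h x) \<le> B" for g B x
    using that by (cases "x \<in> annulus") (auto simp del: mem_cball)
  have ex: "cmod (exp (of_real t * \<Psi> x)) = exp (t * Re (\<Psi> x))" for t x by (simp add: norm_exp_eq_Re)
  show "principal C (\<lambda>t. d_z k (\<lambda>x. f t x * h x)) (\<lambda>x. h x * d_z k \<Psi> x)" if C: "\<And>x. x \<in> K ==> cmod (d_z k h x) \<le> C"
  proof -
    obtain B where B: "B \<ge> 0" "\<forall>x\<in>K. cmod (d_z k ?\<theta> x * h x) \<le> B" using bd[OF dt(1)] by blast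
    show ?thesis unfolding principal_def
    proof (intro exI[of _ B] conjI B(1) allI impI ballI)
      fix t :: real and x assume "x \<in> D \<inter> K"
      hence x: "x \<in> K" by blast
      show "cmod (d_z k (\<lambda>x. f t x * h x) x - of_real t * f t x * (h x * d_z k \<Psi> x)) \<le> C * cmod (f t x) + B * indicator annulus x * exp (t * Re (\<Psi> x))"
        unfolding d_z_mult(1)[OF df dh[OF x]] d_f
        by (rule alg[OF C[OF x] ex ind[OF \<theta>_derivative_outside(1) x B(2)]])
    qed
  qed
  show "principal C (\<lambda>t. d_zbar k (\<lambda>x. f t x * h x)) (\<lambda>x. h x * d_zbar k \<Psi> x)" if C: "\<And>x. x \<in> K ==> cmod (d_zbar k h x) \<le> C"
  proof -
    obtain B where B: "B \<ge> 0" "\<forall>x\<in>K. cmod (d_zbar k ?\<theta> x * h x) \<le> B" using bd[OF dt(2)] by blast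
    show ?thesis unfolding principal_def
    proof (intro exI[of _ B] conjI B(1) allI impI ballI)
      fix t :: real and x assume "x \<in> D \<inter> K"
      hence x: "x \<in> K" by blast
      show "cmod (d_zbar k (\<lambda>x. f t x * h x) x - of_real t * f t x * (h x * d_zbar k \<Psi> x)) \<le> C * cmod (f t x) + B * indicator annulus x * exp (t * Re (\<Psi> x))"
        unfolding d_z_mult(2)[OF df dh[OF x]] d_f
        by (rule alg[OF C[OF x] ex ind[OF \<theta>_derivative_outside(2) x B(2)]])
    qed
  qed
qed

text \<open>The exact symbol \<open>P\<close> is replaced by its linear model \<open>A\<close>. The
  discrepancy, \<open>s\<close> times the distance plus \<open>|\<rho>|\<close>, is of the kind that
  \<open>norm_perturbation\<close> tolerates.\<close>

lemma principal_norm: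
  assumes F: "\<And>t. continuous_on K (F t)" "\<And>t x. x \<notin> K ==> F t x = 0" and P: "principal C F P"
    and A: "continuous_on K A" "\<And>x. x \<in> D ==> x \<in> K ==> cmod (A x) \<le> C * dist x x0"
    and PA: "\<And>x. x \<in> D ==> x \<in> K ==> cmod (P x - A x) \<le> C * (s * dist x x0 + \<bar>\<rho> x\<bar>)"
    and s: "0 < s" "s \<le> 1" and small: "\<And>x. x \<in> D ==> x \<in> K ==> \<bar>\<rho> x\<bar> \<le> s^2"
    and C: "C \<ge> 0" and E: "E \<ge> 0"
    and conc: "\<forall>\<^sub>F t in at_top. t * avg t (\<lambda>x. \<bar>\<rho> x\<bar> + d2 x) \<le> E * mass t"
  shows "\<forall>\<^sub>F t in at_top. \<bar>(LINT x|leb D. (cmod (F t x))^2) - t^2 * avg t (\<lambda>x. (cmod (A x))^2)\<bar>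
    \<le> (2 * (6 * C^2 * (1 + E) + 1) + C^2 * E) * s * t * mass t"
proof -
  obtain B where B: "B \<ge> 0" "\<And>t x. t \<ge> 0 ==> x \<in> D \<inter> K ==>
      cmod (F t x - of_real t * f t x * P x) \<le> C * cmod (f t x) + B * indicator annulus x * exp (t * Re (\<Psi> x))"
    using P unfolding principal_def by blast
  show ?thesis
  proof (rule norm_perturbation[OF F A _ s small C B(1) E conc])
    fix t :: real and x assume t: "t \<ge> 0" and x: "x \<in> D" "x \<in> K"
    have "F t x - of_real t * f t x * A x = (F t x - of_real t * f t x * P x) + of_real t * f t x * (P x - A x)"
      by (simp add: algebra_simps)
    also have "cmod \<dots> \<le> (C * cmod (f t x) + B * indicator annulus x * exp (t * Re (\<Psi> x))) + t * cmod (f t x) * (C * (s * dist x x0 + \<bar>\<rho> x\<bar>))"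
    proof (rule norm_triangle_mono[OF B(2)[OF t]])
      show "cmod (of_real t * f t x * (P x - A x)) \<le> t * cmod (f t x) * (C * (s * dist x x0 + \<bar>\<rho> x\<bar>))"
        unfolding norm_mult using t PA[OF x] by (intro mult_mono) auto
    qed (use x in blast)
    finally show "cmod (F t x - of_real t * f t x * A x)
      \<le> C * cmod (f t x) * (1 + t * (s * dist x x0 + \<bar>\<rho> x\<bar>)) + B * indicator annulus x * exp (t * Re (\<Psi> x))"
      by (simp add: algebra_simps)
  qed (assumption | blast)+
qed

end

section \<open>The coefficient form\<close>

lemma sum_squares_le_square_sum:
  fixes a :: "'a => real" assumes "\<And>i. i \<in> I ==> 0 \<le> a i" shows "(\<Sum>i\<in>I. (a i)^2) \<le> (\<Sum>i\<in>I. a i)^2"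
proof -
  have "L2_set a I \<le> sum a I" by (rule L2_set_le_sum) (rule assms)
  hence "(L2_set a I)^2 \<le> (sum a I)^2" by (intro power_mono L2_set_nonneg)
  thus ?thesis by (simp add: L2_set_def sum_nonneg)
qed

definition ext_l1 :: "('n::finite set => complex) => real" where "ext_l1 u = (\<Sum>J\<in>UNIV. cmod (u J))"

lemma ext_l1_nonneg: "0 \<le> ext_l1 u" by (simp add: ext_l1_def sum_nonneg)

lemma cmod_le_ext_l1: "cmod (u J) \<le> ext_l1 u"
  unfolding ext_l1_def by (rule member_le_sum) auto

lemma norm_ext_sign [simp]: "cmod (ext_sign j K) = 1"
  by (simp add: ext_sign_def norm_power)

lemma cmod_contr_le: "cmod (contr b u I) \<le> norm b * ext_l1 u"
proof -
  have "cmod (contr b u I) \<le> (\<Sum>j\<in>-I. norm b * cmod (u (insert j I)))"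
    unfolding contr_def
    by (intro order_trans[OF norm_sum] sum_mono) (auto simp: norm_mult intro!: mult_right_mono Finite_Cartesian_Product.norm_nth_le)
  also have "\<dots> = norm b * (\<Sum>J\<in>(\<lambda>j. insert j I) ` (-I). cmod (u J))"
  proof -
    have "inj_on (\<lambda>j. insert j I) (-I)" by (auto simp: inj_on_def)
    thus ?thesis by (simp add: sum.reindex sum_distrib_left)
  qed
  also have "\<dots> \<le> norm b * ext_l1 u" unfolding ext_l1_def by (intro mult_left_mono sum_mono2) auto
  finally show ?thesis .
qed

lemma cmod_wedge_le: "cmod (wedge b u K) \<le> norm b * ext_l1 u"
proof -
  have "cmod (wedge b u K) \<le> (\<Sum>j\<in>K. norm b * cmod (u (K - {j})))"
    unfolding wedge_def
    by (intro order_trans[OF norm_sum] sum_mono) (auto simp: norm_mult intro!: mult_right_mono Finite_Cartesian_Product.norm_nth_le)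
  also have "\<dots> = norm b * (\<Sum>J\<in>(\<lambda>j. K - {j}) ` K. cmod (u J))"
  proof -
    have "inj_on (\<lambda>j. K - {j}) K" by (auto simp: inj_on_def)
    thus ?thesis by (simp add: sum.reindex sum_distrib_left)
  qed
  also have "\<dots> \<le> norm b * ext_l1 u" unfolding ext_l1_def by (intro mult_left_mono sum_mono2) auto
  finally show ?thesis .
qed

lemma contr_linear:
  "contr (a - b) u I = contr a u I - contr b u I" "contr b (\<lambda>J. u J - v J) I = contr b u I - contr b v I"
  "contr b (\<lambda>J. k * u J) I = k * contr b u I" "contr (a + b) u I = contr a u I + contr b u I"
  by (simp_all add: contr_def sum_subtractf[symmetric] sum.distrib[symmetric] sum_distrib_left algebra_simps)

lemma wedge_linear: "wedge b (\<lambda>J. u J - v J) I = wedge b u I - wedge b v I" "wedge b (\<lambda>J. k * u J) I = k * wedge b u I"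
  by (simp_all add: wedge_def sum_subtractf[symmetric] sum_distrib_left algebra_simps)

lemma ext_l1_diff_le:
  fixes u :: "'n::finite set => complex"
  assumes "\<And>J. cmod (u J) \<le> e" shows "ext_l1 u \<le> real (card (UNIV :: 'n set set)) * e"
  unfolding ext_l1_def using sum_bounded_above[of UNIV "\<lambda>J. cmod (u J)" e] assms by simp

context levi_point
begin

lemma tangent_expansion:
  assumes "bil a nu0 = 0" shows "a = (\<Sum>i<m. herm_inner a (Z i) *s Z i)"
proof -
  have "herm_inner a Nv = 0" using assms r_pos by (simp add: bil_nu0)
  moreover have "a = (\<Sum>j<CARD('n). herm_inner a (Zf j) *s Zf j)" by (rule orthonormal_basis_expansion[OF Zf_orthonormal]) simp
  moreover have "(\<Sum>j<CARD('n). herm_inner a (Zf j) *s Zf j) = (\<Sum>j<m. herm_inner a (Z j) *s Z j) + herm_inner a Nv *s Nv"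
    unfolding m sum.lessThan_Suc by (simp add: Zf_def cong: sum.cong_simp)
  ultimately show ?thesis by simp
qed

text \<open>Carries estimates known for the eigenvectors over to an arbitrary unit tangential
  vector, in particular to the given frame at \<open>x0\<close>.\<close>

lemma tangent_bil_le:
  assumes "bil a nu0 = 0" "norm a = 1" shows "cmod (bil a v) \<le> (\<Sum>i<m. cmod (bil (Z i) v))"
proof -
  have "bil a v = (\<Sum>i<m. herm_inner a (Z i) * bil (Z i) v)"
    by (subst tangent_expansion[OF assms(1)]) (simp add: bil_sum_left bil_simps)
  also have "cmod \<dots> \<le> (\<Sum>i<m. 1 * cmod (bil (Z i) v))"
  proof (intro order_trans[OF norm_sum] sum_mono)
    fix i assume "i \<in> {..<m}"
    hence "cmod (herm_inner a (Z i)) \<le> 1" using cmod_herm_inner_le[of a "Z i"] norm_Z assms(2) by simp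
    thus "cmod (herm_inner a (Z i) * bil (Z i) v) \<le> 1 * cmod (bil (Z i) v)" unfolding norm_mult by (intro mult_right_mono) auto
  qed
  finally show ?thesis by simp
qed

text \<open>The linear model of \<open>pn\<close> on tangential vectors: the leading term of the
  holomorphic derivatives of the phase, without a normal component.\<close>

definition Gt where "Gt x = - (\<Sum>i<m. (of_real (lam i + c i) * cnj (zc i x)) *s cnj_vec (Z i))"

lemma bil_sum_right: "bil e (\<Sum>i\<in>I. g i) = (\<Sum>i\<in>I. bil e (g i))"
  by (induction I rule: infinite_finite_induct) (simp_all add: bil_simps)

lemma bil_Gt: "bil a (Gt x) = - (\<Sum>i<m. of_real (lam i + c i) * cnj (zc i x) * herm_inner a (Z i))"
  unfolding Gt_def bil_simps bil_sum_right bil_cnj ..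

lemma bil_Z_Gt: "i < m ==> bil (Z i) (Gt x) = - of_real (lam i + c i) * cnj (zc i x)"
  unfolding bil_Gt by (subst sum_delta_Z(1)) (auto simp: algebra_simps)

lemma Qv_eq: "Qv (x - x0) = (\<Sum>i<m. (- of_real (c i) * zc i x) *s Z i)"
  by (simp add: Finite_Cartesian_Product.vec_eq_iff Qv_def zc_Z sum_negf cong: sum.cong_simp)

lemma norm_Qv: "(norm (Qv (x - x0)))^2 = (\<Sum>i<m. (c i)^2 * (cmod (zc i x))^2)"
  unfolding Qv_eq norm_sum_orthonormal[OF on finite_lessThan] by (simp add: norm_mult power_mult_distrib)

lemma sum_Qv: "(\<Sum>j\<in>UNIV. (cmod (Qv (x - x0) $ j))^2) = (\<Sum>i<m. (c i)^2 * (cmod (zc i x))^2)"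
  unfolding norm_Qv[symmetric] norm_vec_def L2_set_def by (simp add: sum_nonneg)

lemma norm_Gt: "(norm (Gt x))^2 = (\<Sum>i<m. (lam i + c i)^2 * (cmod (zc i x))^2)"
proof -
  have "cnj_vec (Gt x) = (\<Sum>i<m. (- of_real (lam i + c i) * zc i x) *s Z i)"
    by (simp add: Finite_Cartesian_Product.vec_eq_iff Gt_def cnj_vec_def flip: sum_negf) (intro allI sum.cong refl, simp add: algebra_simps)
  hence "(norm (cnj_vec (Gt x)))^2 = (\<Sum>i<m. (cmod (- of_real (lam i + c i) * zc i x))^2)"
    by (simp only: norm_sum_orthonormal[OF on finite_lessThan])
  thus ?thesis by (simp add: norm_mult power_mult_distrib del: of_real_add)
qed

lemma norm_Gt_le: "norm (Gt x) \<le> (\<Sum>i<m. \<bar>lam i + c i\<bar>) * dist x x0"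
proof -
  have "norm (- of_real (lam i + c i) * zc i x) \<le> \<bar>lam i + c i\<bar> * dist x x0" if "i < m" for i
    using cmod_zc[of i x] m that by (simp add: norm_mult dist_norm mult_left_mono del: of_real_add)
  moreover have "norm (k *s cnj_vec (Z i)) = cmod k" if "i < m" for k i
  proof -
    have "norm (k *s a) = cmod k * norm a" for a :: "complex ^ 'n"
      by (simp add: norm_vec_def norm_mult L2_set_right_distrib)
    thus ?thesis using norm_Z[OF that] by simp
  qed
  ultimately show ?thesis unfolding Gt_def norm_minus_cancel sum_distrib_right
    by (intro order_trans[OF norm_sum] sum_mono) (auto simp: norm_mult simp del: of_real_add)
qed

text \<open>Unitary invariance: the tangential part of any frame adapted to the boundary sees the same norm.\<close>

lemma sum_adapted_frame_Gt:
  assumes L: "orthonormal_family {1..CARD('n)} L" and T: "\<And>j. j \<in> {1..m} ==> bil (L j) nu0 = 0"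
  shows "(\<Sum>j = 1..m. (cmod (bil (L j) (Gt x)))^2) = (\<Sum>i<m. (lam i + c i)^2 * (cmod (zc i x))^2)"
proof -
  define g where "g = cnj_vec (Gt x)"
  have ex: "v = (\<Sum>j = 1..CARD('n). herm_inner v (L j) *s L j)" for v by (rule orthonormal_basis_expansion[OF L]) simp
  have set: "{1..CARD('n)} = insert (Suc m) {1..m}" using m by auto
  \<comment> \<open>Hence \<open>Nv\<close> is a nonzero multiple of the last frame vector, and
    \<open>g\<close>, being orthogonal to \<open>Nv\<close>, has no component along it: the first
    \<open>m\<close> vectors already carry the whole norm.\<close>
  have "herm_inner Nv (L j) = 0" if "j \<in> {1..m}" for j
    using T[OF that] r_pos herm_inner_commute[of Nv "L j"] by (simp add: bil_nu0)
  hence Nv: "Nv = herm_inner Nv (L (Suc m)) *s L (Suc m)" using ex[of Nv] unfolding set by simp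
  have "herm_inner g Nv = 0"
  proof -
    have "g = - (\<Sum>i<m. (of_real (lam i + c i) * zc i x) *s Z i)"
      by (simp add: Finite_Cartesian_Product.vec_eq_iff g_def Gt_def cnj_vec_def)
    hence "herm_inner g Nv = - herm_inner (\<Sum>i<m. (of_real (lam i + c i) * zc i x) *s Z i) Nv" by (simp add: herm_inner_def sum_negf)
    also have "\<dots> = 0" unfolding herm_inner_sum_left herm_inner_simps by (simp add: herm_ZN)
    finally show ?thesis .
  qed
  hence "cnj (herm_inner Nv (L (Suc m))) * herm_inner g (L (Suc m)) = 0" using Nv herm_inner_simps(5) by metis
  moreover have "herm_inner Nv (L (Suc m)) \<noteq> 0" using Nv norm_Nv by (metis norm_zero vector_smult_lzero zero_neq_one)
  ultimately have 0: "herm_inner g (L (Suc m)) = 0" by simp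
  have "(norm g)^2 = (\<Sum>j = 1..CARD('n). (cmod (herm_inner g (L j)))^2)"
    by (subst ex[of g]) (rule norm_sum_orthonormal[OF L], simp)
  also have "\<dots> = (\<Sum>j = 1..m. (cmod (herm_inner g (L j)))^2)" unfolding set using 0 by simp
  also have "\<dots> = (\<Sum>j = 1..m. (cmod (bil (L j) (Gt x)))^2)"
  proof (rule sum.cong[OF refl])
    fix j
    have "herm_inner g (L j) = cnj (bil (L j) (Gt x))" by (simp add: g_def herm_inner_def bil_def cnj_vec_def mult.commute)
    thus "(cmod (herm_inner g (L j)))^2 = (cmod (bil (L j) (Gt x)))^2" by simp
  qed
  finally show ?thesis using norm_Gt[of x] by (simp add: g_def)
qed

end

locale levi_form_point = levi_point \<rho> V D x0 Z lam c m
  for \<rho> :: "complex ^ 'n::{finite,linorder} => real" and V D x0 Z lam c m +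
  fixes q :: nat assumes q: "1 \<le> q" "q \<le> m"
begin

definition om0 where "om0 = wedge_list Z q"
text \<open>The normal direction wedged onto \<open>om0\<close>, scaled so that contraction with the
  conormal restores \<open>om0\<close> at \<open>x0\<close>.\<close>

definition beta where "beta J = of_real (1 / r) * wedge Nv om0 J"

text \<open>Contraction with the conormal makes the form tangential at every boundary point.\<close>

definition om where "om x = contr (nu x) beta"

lemma on_q: "orthonormal_family {..<q} Z" using on q(2) by (auto simp: orthonormal_family_def)

lemma contr_om0_le: "cmod (contr v om0 I) \<le> (\<Sum>j<q. cmod (bil (Z j) v))"
proof -
  have "(cmod (contr v om0 I))^2 \<le> ext_normsq (contr v om0)" unfolding ext_normsq_def by (rule member_le_sum) auto
  also have "\<dots> = (\<Sum>j<q. (cmod (bil (Z j) v))^2)" using ext_normsq_contr_wedge_list[OF on_q] by (simp add: om0_def)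
  also have "\<dots> \<le> (\<Sum>j<q. cmod (bil (Z j) v))^2" by (rule sum_squares_le_square_sum) simp
  finally show ?thesis by (rule power2_le_imp_le) (simp add: sum_nonneg)
qed

text \<open>By the Clifford relation, contracting with the conormal removes the normal factor again,
  because \<open>om0\<close> itself is already tangential at \<open>x0\<close>.\<close>

lemma om_x0: "om x0 = om0"
proof
  fix I
  have "contr nu0 om0 = (\<lambda>I. 0)"
    unfolding om0_def using ZT q by (intro contr_wedge_list_orthogonal) (simp add: nu0_def)
  hence "contr nu0 (wedge Nv om0) I = of_real r * om0 I"
    using clifford[of nu0 Nv om0 I] by (simp add: wedge_zero bil_Nv_nu0)
  thus "om x0 I = om0 I"
    using r_pos unfolding om_def beta_def[abs_def] contr_linear nu0_def[symmetric] by simp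
qed

lemma contr_nu_om: "contr (nu x) (om x) I = 0"
  unfolding om_def by (rule contr_contr_self)

lemma om_C1: "Ck_on 1 V (\<lambda>x. om x J)"
  unfolding om_def contr_def by (intro Ck_on_1_intros d_rho_C1)

lemma om_close: "cmod (om x J - om0 J) \<le> norm (nu x - nu0) * ext_l1 beta"
proof -
  have "om x J - om0 J = contr (nu x - nu0) beta J"
    unfolding om_x0[symmetric] om_def contr_linear nu0_def ..
  thus ?thesis by (simp add: cmod_contr_le)
qed

lemma om0_normsq: "(\<Sum>J\<in>multi_idx q. (cmod (om0 J))^2) = 1"
proof -
  have "(\<Sum>J\<in>multi_idx q. (cmod (om0 J))^2) = ext_normsq om0"
    unfolding ext_normsq_def by (rule sum.mono_neutral_left) (auto simp: multi_idx_def om0_def wedge_list_card)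
  thus ?thesis using ext_normsq_contr_wedge_list[OF on_q] by (simp add: om0_def)
qed

text \<open>The first \<open>q\<close> eigendirections are factors of \<open>om0\<close> already, so
  wedging with them gives nothing; this is why dbar contributes only the indices from
  \<open>q\<close> on.\<close>

lemma normsq_wedge_Qv: "ext_normsq (wedge (Qv (x - x0)) om0) = (\<Sum>i = q..<m. (c i)^2 * (cmod (zc i x))^2)"
proof -
  let ?Q = "Qv (x - x0)"
  have b: "bil (Z j) (cnj_vec ?Q) = - of_real (c j) * cnj (zc j x)" if "j < m" for j
    unfolding bil_cnj_Qv using sum_delta_Z(1)[OF that, of "\<lambda>j. of_real (c j) * cnj (zc j x)"] by simp
  have "ext_normsq (contr (cnj_vec ?Q) om0) = (\<Sum>j<q. (cmod (bil (Z j) (cnj_vec ?Q)))^2)"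
    using ext_normsq_contr_wedge_list[OF on_q] by (simp add: om0_def)
  also have "\<dots> = (\<Sum>j<q. (c j)^2 * (cmod (zc j x))^2)"
    using q(2) by (intro sum.cong refl) (simp add: b norm_mult power_mult_distrib)
  finally have 1: "ext_normsq (contr (cnj_vec ?Q) om0) = (\<Sum>j<q. (c j)^2 * (cmod (zc j x))^2)" .
  have 2: "Re (herm_inner ?Q ?Q) = (\<Sum>j<m. (c j)^2 * (cmod (zc j x))^2)"
    unfolding herm_inner_self norm_Qv by simp
  have 3: "ext_normsq om0 = 1" using ext_normsq_contr_wedge_list[OF on_q] by (simp add: om0_def)
  have "(\<Sum>j<m. (c j)^2 * (cmod (zc j x))^2) = (\<Sum>j<q. (c j)^2 * (cmod (zc j x))^2) + (\<Sum>j = q..<m. (c j)^2 * (cmod (zc j x))^2)"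
    using sum.atLeastLessThan_concat[of 0 q m "\<lambda>j. (c j)^2 * (cmod (zc j x))^2"] q(2) by (simp add: lessThan_atLeast0)
  thus ?thesis unfolding ext_normsq_wedge 1 2 3 by simp
qed

text \<open>Contraction sees only the factors of \<open>om0\<close>, so the adjoint contributes only
  the first \<open>q\<close> indices.\<close>

lemma normsq_contr_Gt: "ext_normsq (contr (Gt x) om0) = (\<Sum>i<q. (lam i + c i)^2 * (cmod (zc i x))^2)"
proof -
  have "ext_normsq (contr (Gt x) om0) = (\<Sum>j<q. (cmod (bil (Z j) (Gt x)))^2)"
    using ext_normsq_contr_wedge_list[OF on_q] by (simp add: om0_def)
  also have "\<dots> = (\<Sum>j<q. (lam j + c j)^2 * (cmod (zc j x))^2)"
    using q(2) by (intro sum.cong refl) (simp add: bil_Z_Gt norm_mult power_mult_distrib del: of_real_add)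
  finally show ?thesis .
qed

end

section \<open>The normal component of a Lipschitz frame tangent at the boundary\<close>

context levi_point
begin

text \<open>The frame is tangential at boundary points only. From \<open>x\<close> one moves along
  \<open>Nv\<close> to the boundary, over a distance of at most \<open>|\<rho> x| / r\<close>; both
  the Lipschitz field and the conormal change by a multiple of that distance.\<close>

lemma cmod_bil_tangent_field_le:
  fixes Y :: "complex ^ 'n => complex ^ 'n"
  assumes U: "open U" "x0 \<in> U" and lip: "M-lipschitz_on U Y" and n1: "\<And>x. x \<in> U ==> norm (Y x) = 1"
    and T: "\<And>x. x \<in> U ==> x \<in> V ==> x \<in> frontier D ==> bil (Y x) (nu x) = 0"
  shows "\<exists>C\<ge>0. \<forall>\<^sub>F x in nhds x0. \<rho> x \<le> 0 --> cmod (bil (Y x) (nu x)) \<le> C * \<bar>\<rho> x\<bar>"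
proof -
  have "\<forall>\<^sub>F x in nhds x0. x \<in> U \<and> x \<in> V \<and> norm (nu x - nu0) \<le> r / 2"
    using r_pos by (intro eventually_conj eventually_nhds_in_open U eventually_V eventually_nu) simp
  then obtain d where d: "d > 0" "\<And>x. dist x x0 < d ==> x \<in> U \<and> x \<in> V \<and> norm (nu x - nu0) \<le> r / 2"
    unfolding eventually_nhds_metric by blast
  define e where "e = d / 3"
  have e: "e > 0" using d(1) by (simp add: e_def)
  have nd: "x \<in> U" "x \<in> V" "norm (nu x - nu0) \<le> r / 2" if "dist x x0 \<le> 2 * e" for x
    using d(2)[of x] that d(1) by (auto simp: e_def)
  have "\<forall>k. \<exists>B\<ge>0. \<forall>x\<in>cball x0 (2 * e). cmod (fderiv (\<lambda>x. nu x $ k) x Nv) \<le> B"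
  proof
    fix k
    show "\<exists>B\<ge>0. \<forall>x\<in>cball x0 (2 * e). cmod (fderiv (\<lambda>x. nu x $ k) x Nv) \<le> B"
      using nd(2) by (intro continuous_on_compact_bounded[OF Ck_on_1D(2)[OF d_rho_C1]]) (auto simp: dist_commute)
  qed
  then obtain Bk where Bk: "\<And>k. Bk k \<ge> 0" "\<And>k x. x \<in> cball x0 (2 * e) ==> cmod (fderiv (\<lambda>x. nu x $ k) x Nv) \<le> Bk k"
    by metis
  define B where "B = (\<Sum>k\<in>UNIV. Bk k)"
  have B0: "B \<ge> 0" unfolding B_def using Bk(1) by (intro sum_nonneg) auto
  have M: "M \<ge> 0" using lip by (rule lipschitz_on_nonneg)
  have line: "((\<lambda>t. x + t *\<^sub>R Nv) has_derivative (\<lambda>h. h *\<^sub>R Nv)) (at t)" for x t by (auto intro!: derivative_eq_intros)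
  define C where "C = (M * (2 * r) + B) / r"
  have C: "C \<ge> 0" using M B0 r_pos by (simp add: C_def)
  have re: "r * e > 0" using r_pos e by simp
  have "\<forall>\<^sub>F x in nhds x0. \<rho> x \<le> 0 --> cmod (bil (Y x) (nu x)) \<le> C * \<bar>\<rho> x\<bar>"
    using eventually_dist[OF e] eventually_rho[OF re]
  proof eventually_elim
    case (elim x)
    show ?case
    proof
      assume neg: "\<rho> x \<le> 0"
      \<comment> \<open>Near \<open>x0\<close> the function \<open>\<rho>\<close> grows along
        \<open>Nv\<close> at rate at least \<open>r\<close>, so the boundary is met no later than at
        \<open>t0\<close>.\<close>
      define t0 where "t0 = \<bar>\<rho> x\<bar> / r"
      have t0: "0 \<le> t0" "t0 \<le> e" "r * t0 = \<bar>\<rho> x\<bar>" using elim(2) r_pos by (simp_all add: t0_def field_simps)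
      let ?y = "\<lambda>t. x + t *\<^sub>R Nv"
      have near: "dist (?y t) x0 \<le> 2 * e" if "0 \<le> t" "t \<le> t0" for t
      proof -
        have "dist (?y t) x = t" using that by (simp add: dist_norm norm_Nv)
        thus ?thesis using dist_triangle[of "?y t" x0 x] elim(1) that t0(2) by simp
      qed
      have dh: "((\<lambda>t. \<rho> (?y t)) has_real_derivative 2 * Re (bil Nv (nu (?y t)))) (at t)" if t: "0 \<le> t" "t \<le> t0" for t
      proof -
        have df: "\<rho> differentiable (at (?y t))" by (rule differentiable[OF nd(2)[OF near[OF t]]])
        have "((\<lambda>t. \<rho> (?y t)) has_derivative (\<lambda>h. fderiv \<rho> (?y t) (h *\<^sub>R Nv))) (at t)"
          using has_derivative_compose[OF line] df unfolding frechet_derivative_works by blast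
        thus ?thesis unfolding has_field_derivative_def
        proof (rule has_derivative_eq_rhs, intro ext)
          fix h
          show "fderiv \<rho> (?y t) (h *\<^sub>R Nv) = 2 * Re (bil Nv (nu (?y t))) * h"
            unfolding frechet_derivative_d_rho[OF df] scaleR_vec_eq_smult[of h] bil_simps by simp
        qed
      qed
      have "\<rho> (?y 0) - r * 0 \<le> \<rho> (?y t0) - r * t0"
      proof (rule DERIV_nonneg_imp_nondecreasing[OF t0(1)])
        fix t assume t: "0 \<le> t" "t \<le> t0"
        have "((\<lambda>t. \<rho> (?y t) - r * t) has_real_derivative 2 * Re (bil Nv (nu (?y t))) - r) (at t)"
          by (intro DERIV_diff dh t) (auto intro!: derivative_eq_intros)
        thus "\<exists>y. ((\<lambda>t. \<rho> (?y t) - r * t) has_real_derivative y) (at t) \<and> 0 \<le> y"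
          using nondegenerate_near(1)[OF nd(3)[OF near[OF t]]] by (intro exI conjI) auto
      qed
      hence "\<rho> (?y t0) \<ge> 0" using t0(3) neg by simp
      moreover have "\<rho> (?y 0) \<le> 0" using neg by simp
      moreover have "\<forall>t. 0 \<le> t \<and> t \<le> t0 --> isCont (\<lambda>t. \<rho> (?y t)) t" using dh DERIV_isCont by blast
      ultimately obtain t where t: "0 \<le> t" "t \<le> t0" "\<rho> (?y t) = 0" using IVT[of "\<lambda>t. \<rho> (?y t)" 0 0 t0] t0(1) by auto
      note y = nd[OF near[OF t(1,2)]]
      have x: "x \<in> U" "x \<in> V" "norm (nu x - nu0) \<le> r / 2" using nd[of x] near[of 0] t0(1) by auto
      have fr: "?y t \<in> frontier D" using defining_functionD(3)[OF df y(2)] t(3) by simp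
      have k: "cmod (nu (?y t) $ k - nu x $ k) \<le> t * Bk k" for k
      proof (cases "t = 0")
        case False
        hence tp: "0 < t" using t(1) by simp
        have der: "((\<lambda>s. nu (?y s) $ k) has_derivative (\<lambda>h. fderiv (\<lambda>x. nu x $ k) (?y s) (h *\<^sub>R Nv))) (at s)"
          if s: "0 \<le> s" "s \<le> t" for s
          using has_derivative_compose[OF line Ck_on_1D(1)[OF d_rho_C1 nd(2)[OF near]]] s t(2) by auto
        have "continuous_on {0..t} (\<lambda>s. nu (?y s) $ k)"
          using der has_derivative_continuous by (intro continuous_at_imp_continuous_on) fastforce
        from mvt_general[OF tp this der] obtain s where s: "0 < s" "s < t"
          "cmod (nu (?y t) $ k - nu (?y 0) $ k) \<le> cmod (fderiv (\<lambda>x. nu x $ k) (?y s) ((t - 0) *\<^sub>R Nv))"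
          by auto
        have ys: "?y s \<in> cball x0 (2 * e)" using near[of s] s(1,2) t(2) by (simp add: dist_commute)
        have "linear (fderiv (\<lambda>x. nu x $ k) (?y s))"
          using Ck_on_1D(1)[OF d_rho_C1 nd(2)[OF near[of s]]] s(1,2) t(2) by (intro has_derivative_linear) auto
        hence "cmod (fderiv (\<lambda>x. nu x $ k) (?y s) ((t - 0) *\<^sub>R Nv)) = t * cmod (fderiv (\<lambda>x. nu x $ k) (?y s) Nv)"
          using tp by (simp add: linear_scale)
        also have "\<dots> \<le> t * Bk k" using Bk(2)[OF ys] tp by (intro mult_left_mono) auto
        finally show ?thesis using s(3) by simp
      qed simp
      have "norm (nu (?y t) - nu x) \<le> (\<Sum>k\<in>UNIV. norm ((nu (?y t) - nu x) $ k))"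
        unfolding norm_vec_def by (rule L2_set_le_sum) auto
      also have "\<dots> \<le> (\<Sum>k\<in>UNIV. t * Bk k)" using k by (intro sum_mono) auto
      finally have nn: "norm (nu (?y t) - nu x) \<le> t * B" by (simp add: B_def sum_distrib_left)
      have nux: "norm (nu x) \<le> 2 * r"
        using norm_triangle_ineq[of nu0 "nu x - nu0"] x(3) r_pos by (simp add: r_def[symmetric])
      have Yd: "norm (Y x - Y (?y t)) \<le> M * t"
        using lipschitz_onD[OF lip x(1) y(1)] t(1) by (simp add: dist_norm norm_Nv)
      \<comment> \<open>At the boundary point \<open>?y t\<close> the pairing vanishes, so only the
        changes of the field and of the conormal remain.\<close>
      have "bil (Y x) (nu x) = bil (Y x - Y (?y t)) (nu x) - bil (Y (?y t)) (nu (?y t) - nu x)"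
        unfolding bil_simps T[OF y(1,2) fr] by simp
      hence "cmod (bil (Y x) (nu x)) \<le> cmod (bil (Y x - Y (?y t)) (nu x)) + cmod (bil (Y (?y t)) (nu (?y t) - nu x))"
        using norm_triangle_ineq4 by metis
      also have "\<dots> \<le> (M * t) * (2 * r) + 1 * (t * B)"
      proof (intro add_mono)
        show "cmod (bil (Y x - Y (?y t)) (nu x)) \<le> (M * t) * (2 * r)"
          using M t(1) by (intro order_trans[OF cmod_bil_le] mult_mono Yd nux) auto
        show "cmod (bil (Y (?y t)) (nu (?y t) - nu x)) \<le> 1 * (t * B)"
          by (rule order_trans[OF cmod_bil_le]) (simp only: n1[OF y(1)] mult_1_left nn)
      qed
      also have "\<dots> = (M * (2 * r) + B) * t" by (simp add: algebra_simps)
      also have "\<dots> \<le> (M * (2 * r) + B) * t0" using t(2) M B0 r_pos by (intro mult_left_mono) auto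
      also have "\<dots> = C * \<bar>\<rho> x\<bar>" by (simp add: C_def t0_def)
      finally show "cmod (bil (Y x) (nu x)) \<le> C * \<bar>\<rho> x\<bar>" .
    qed
  qed
  thus ?thesis using C by blast
qed

end

section \<open>The peaked test form and the leading terms of its derivatives\<close>

locale peaked_form = levi_form_point \<rho> V D x0 Z lam c m q
  for \<rho> :: "complex ^ 'n::{finite,linorder} => real" and V D x0 Z lam c m q +
  fixes \<theta> :: "complex ^ 'n::{finite,linorder} => real" and \<epsilon> a s C :: real and U W :: "(complex ^ 'n::{finite,linorder}) set"
    and L :: "nat => complex ^ 'n::{finite,linorder} => complex ^ 'n::{finite,linorder}"
  assumes pcut: "phase_cutoff D V \<rho> \<theta> x0 Psi \<epsilon> a"
    and s: "0 < s" "s \<le> 1" and C1le: "1 \<le> C" and KU: "cball x0 \<epsilon> \<subseteq> U"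
    and W: "open W" "W \<subseteq> V" "cball x0 \<epsilon> \<subseteq> W" "\<And>x. x \<in> W ==> norm (nu x - nu0) \<le> r / 2"
    and om_bounds: "\<And>x J. x \<in> cball x0 \<epsilon> ==> cmod (om x J) \<le> C" "ext_l1 beta \<le> C" "ext_l1 om0 \<le> C"
      "\<And>x J k. x \<in> cball x0 \<epsilon> ==> cmod (d_z k (\<lambda>x. om x J) x) \<le> C"
      "\<And>x J k. x \<in> cball x0 \<epsilon> ==> cmod (d_zbar k (\<lambda>x. om x J) x) \<le> C"
    and sum_c: "(\<Sum>i<m. \<bar>lam i + c i\<bar>) \<le> C"
    and div: "\<And>x. x \<in> cball x0 \<epsilon> ==> Re (dvg fieldX x) \<le> C"
      "\<And>x i. x \<in> cball x0 \<epsilon> ==> i < m ==> \<bar>Re (dvg (fieldZ i) x) - 1\<bar> \<le> C * dist x x0"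
    and small: "\<And>x. x \<in> cball x0 \<epsilon> ==> dist x x0 \<le> s" "\<And>x. x \<in> cball x0 \<epsilon> ==> \<bar>\<rho> x\<bar> \<le> s^2"
      "\<And>x. x \<in> cball x0 \<epsilon> ==> norm (nu x - nu0) \<le> s"
    and PQ: "\<And>x. x \<in> cball x0 \<epsilon> ==> norm (pn x) \<le> C * dist x x0"
      "\<And>x. x \<in> cball x0 \<epsilon> ==> norm (Qv (x - x0)) \<le> C * dist x x0"
    and Zp: "\<And>x i. x \<in> cball x0 \<epsilon> ==> i < m ==>
      cmod (bil (Z i) (pn x) + of_real (lam i + c i) * cnj (zc i x)) \<le> C * (\<bar>\<rho> x\<bar> + s * dist x x0)"
    and Xd: "\<And>x. x \<in> D ==> x \<in> cball x0 \<epsilon> ==> Re (bil (fieldX x) (dP x)) \<le> - a * (\<bar>\<rho> x\<bar> + (dist x x0)^2)"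
    and Zd: "\<And>x i. x \<in> cball x0 \<epsilon> ==> i < m ==>
      \<bar>Re (bil (fieldZ i x) (dP x)) + (kp i) * (cmod (zc i x))^2\<bar> \<le> C * s * (\<bar>\<rho> x\<bar> + (dist x x0)^2)"
    and Lon: "orthonormal_family {1..CARD('n)} (\<lambda>j. L j x0)" and Lnorm: "\<And>j x. j \<in> {1..m} ==> x \<in> cball x0 \<epsilon> ==> norm (L j x) = 1"
    and Lx0: "\<And>j. j \<in> {1..m} ==> bil (L j x0) nu0 = 0" and Lcont: "\<And>j. j \<in> {1..m} ==> continuous_on (cball x0 \<epsilon>) (L j)"
    and Llip: "\<And>j x. j \<in> {1..m} ==> x \<in> cball x0 \<epsilon> ==> norm (L j x - L j x0) \<le> C * dist x x0"
    and Ltan: "\<And>j x. j \<in> {1..m} ==> x \<in> D ==> x \<in> cball x0 \<epsilon> ==> cmod (bil (L j x) (nu x)) \<le> C * \<bar>\<rho> x\<bar>"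
begin

lemma C: "0 \<le> C" using C1le by simp

sublocale pc: phase_cutoff D V \<rho> \<theta> x0 Psi \<epsilon> a by (rule pcut)

abbreviation K where "K \<equiv> cball x0 \<epsilon>"

definition u where "u t J x = pc.f t x * om x J"

lemma u_C1_compact: "C1_compact (u t J)"
  unfolding u_def[abs_def]
  by (rule C1_compactI[OF V _ compact_cball pc.cball])
    (intro Ck_on_1_mult Ck_on_1_subset[OF pc.f_C1] om_C1 subset_UNIV, simp add: pc.f_outside del: mem_cball)

lemma u_outside: "x \<notin> K ==> u t J x = 0"
  by (simp add: u_def pc.f_outside del: mem_cball)

lemma u_derivative_continuous: "continuous_on S (d_z k (u t J))" "continuous_on S (d_zbar k (u t J))"
  using u_C1_compact[of t J] d_z_continuous[of UNIV "u t J" k] continuous_on_subset unfolding C1_compact_def by blast+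

lemma u_derivative_outside: "x \<notin> K ==> d_z k (u t J) x = 0" "x \<notin> K ==> d_zbar k (u t J) x = 0"
  by (rule d_z_outside[OF closed_cball u_outside]; assumption)+

definition p where "p x = nu0 + Pv (x - x0)"

lemma principal_u:
  "pc.principal C (\<lambda>t. d_z k (u t J)) (\<lambda>x. om x J * p x $ k)"
  "pc.principal C (\<lambda>t. d_zbar k (u t J)) (\<lambda>x. om x J * Qv (x - x0) $ k)"
  using pc.principal_derivative(1)[OF V om_C1 om_bounds(4)] pc.principal_derivative(2)[OF V om_C1 om_bounds(5)]
  unfolding u_def[abs_def] d_Psi p_def by (simp_all del: mem_cball)

lemma om_diff: assumes "x \<in> K" shows "cmod (om x J - om0 J) \<le> C * s"
  using om_close[of x J] small(3)[OF assms] om_bounds(2) s C mult_mono[OF small(3)[OF assms] om_bounds(2)] ext_l1_nonneg[of beta]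
  by (simp add: mult.commute)

definition NN :: real where "NN = real (card (UNIV :: 'n set set))"
definition nn :: real where "nn = real CARD('n)"
text \<open>One constant dominating all symbol errors below. Like \<open>DD\<close> and
  \<open>err\<close> it is built from \<open>C\<close>, \<open>a\<close> and dimensions only, so it
  does not change when \<open>s\<close> tends to 0.\<close>

definition KK :: real where "KK = nn * C + 2 * (C * C) + C * C * C + NN * (C * C) + real m * (C * C) + real m * C"
definition DD :: real where "DD = (C + 1) / a"
definition err :: real where "err = 2 * (6 * KK^2 * (1 + DD) + 1) + KK^2 * DD"

lemma NN: "NN \<ge> 1" "nn \<ge> 1" by (simp_all add: NN_def nn_def Suc_le_eq)

lemma a_pos: "a > 0" by (rule pc.c)

lemma DD: "DD \<ge> 0" using C a_pos by (simp add: DD_def)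

lemma KK_ge: "KK \<ge> 0" "nn * C \<le> KK" "C \<le> KK" "C * C \<le> KK" "NN * (C * C) \<le> KK" "NN * (C * C) + real m * C \<le> KK"
  "2 * (C * C) + C * C * C + real m * (C * C) \<le> KK"
proof -
  have n: "0 \<le> nn * C" "0 \<le> C * C" "0 \<le> C * C * C" "0 \<le> NN * (C * C)" "0 \<le> real m * (C * C)" "0 \<le> real m * C"
    using C NN by simp_all
  have "C \<le> nn * C" using mult_right_mono[OF NN(2) C] by simp
  thus "KK \<ge> 0" "nn * C \<le> KK" "C \<le> KK" "C * C \<le> KK" "NN * (C * C) \<le> KK" "NN * (C * C) + real m * C \<le> KK"
  "2 * (C * C) + C * C * C + real m * (C * C) \<le> KK" using n unfolding KK_def by linarith+
qed

lemma dPhi: "pc.dPhi x = dP x"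
  by (simp add: pc.dPhi_def dP_def d_Psi Finite_Cartesian_Product.vec_eq_iff cnj_vec_def)

lemma concentrated: "\<forall>\<^sub>F t in at_top. t * pc.avg t (\<lambda>x. \<bar>\<rho> x\<bar> + pc.d2 x) \<le> DD * pc.mass t"
  unfolding DD_def
proof (rule pc.concentration[OF W(1,3) fields_C1(1)[OF W(1,2,4)] _ _ _ _ a_pos])
  fix x assume x: "x \<in> D" "x \<in> K"
  show "\<bar>Re (bil (fieldX x) (nu x))\<bar> \<le> C * \<bar>\<rho> x\<bar>"
    unfolding field_tangent(1)[OF W(4)[OF subsetD[OF W(3) x(2)]]] using mult_right_mono[OF C1le, of "\<bar>\<rho> x\<bar>"] by simp
  show "Re (bil (fieldX x) (pc.dPhi x)) \<le> - a * (\<bar>\<rho> x\<bar> + pc.d2 x)" using Xd[OF x] by (simp add: dPhi pc.d2_def)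
  show "Re (dvg fieldX x) \<le> C" by (rule div(1)[OF x(2)])
qed (use C in auto)

lemma second_moments:
  assumes i: "i < m"
  shows "\<forall>\<^sub>F t in at_top. \<bar>pc.mass t - t * (kp i) * pc.avg t (\<lambda>x. (cmod (zc i x))^2)\<bar> \<le> (C + C * DD + 1) * s * pc.mass t"
proof (rule pc.second_moment[OF W(1,3) fields_C1(3)[OF W(1,2,4)] _ C _ _ s(1) _ concentrated])
  fix x assume x: "x \<in> D" "x \<in> K"
  show "\<bar>Re (bil (fieldZ i x) (nu x))\<bar> \<le> C * \<bar>\<rho> x\<bar>"
    unfolding field_tangent(3)[OF W(4)[OF subsetD[OF W(3) x(2)]]] using C by simp
  show "\<bar>Re (bil (fieldZ i x) (pc.dPhi x)) + (kp i) * (cmod (zc i x))^2\<bar> \<le> C * s * (\<bar>\<rho> x\<bar> + pc.d2 x)"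
    using Zd[OF x(2) i] by (simp add: dPhi pc.d2_def)
  show "\<bar>Re (dvg (fieldZ i) x) - 1\<bar> \<le> C * s"
    by (rule order_trans[OF div(2)[OF x(2) i] mult_left_mono[OF small(1)[OF x(2)] C]])
next
  show "continuous_on K (zc i)" by (rule Ck_on_1D(3)[OF zc_C1])
qed (assumption | blast)+

text \<open>The norm of \<open>F t\<close> is that of \<open>t * f t * T\<close>, up to a relative
  error of order \<open>s\<close> on the common scale \<open>t * mass t\<close>.\<close>

definition leads where
  "leads F T \<longleftrightarrow> (\<forall>\<^sub>F t in at_top. \<bar>(LINT x|leb D. (cmod (F t x))^2) - t^2 * pc.avg t (\<lambda>x. (cmod (T x))^2)\<bar> \<le> err * s * t * pc.mass t)"

lemma leading_norm:
  assumes F: "\<And>t. continuous_on K (F t)" "\<And>t x. x \<notin> K ==> F t x = 0" and P: "pc.principal C0 F P" and C0: "C0 \<le> KK"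
    and T: "continuous_on K T" "\<And>x. x \<in> D ==> x \<in> K ==> cmod (T x) \<le> C1 * dist x x0" and C1: "C1 \<le> KK"
    and PA: "\<And>x. x \<in> D ==> x \<in> K ==> cmod (P x - T x) \<le> C2 * (s * dist x x0 + \<bar>\<rho> x\<bar>)" and C2: "C2 \<le> KK"
  shows "leads F T"
  unfolding leads_def err_def
proof (rule pc.principal_norm[OF F pc.principal_mono[OF P C0] T(1) _ _ s _ KK_ge(1) DD concentrated])
  fix x assume x: "x \<in> D" "x \<in> K"
  show "cmod (T x) \<le> KK * dist x x0" by (rule order_trans[OF T(2)[OF x] mult_right_mono[OF C1 zero_le_dist]])
  show "cmod (P x - T x) \<le> KK * (s * dist x x0 + \<bar>\<rho> x\<bar>)"
    by (rule order_trans[OF PA[OF x] mult_right_mono[OF C2]]) (use s in simp)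
  show "\<bar>\<rho> x\<bar> \<le> s^2" by (rule small(2)[OF x(2)])
qed (assumption | blast)+

lemma u_forms_continuous:
  "j \<in> {1..m} ==> continuous_on K (vf_apply (L j) (u t J))" "continuous_on K (dbar_form (u t) J)" "continuous_on K (dbar_adjoint_form (u t) J)"
  unfolding vf_apply_def dbar_form_def dbar_adjoint_form_def
  by (intro continuous_on_minus continuous_on_sum continuous_on_mult continuous_on_const continuous_on_component Lcont u_derivative_continuous; assumption)+

lemma u_forms_outside:
  assumes "x \<notin> K" shows "vf_apply (L j) (u t J) x = 0" "dbar_form (u t) J x = 0" "dbar_adjoint_form (u t) J x = 0"
  by (simp_all add: vf_apply_def dbar_form_def dbar_adjoint_form_def u_derivative_outside[OF assms])

lemma Qv_continuous: "continuous_on S (\<lambda>x. Qv (x - x0))"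
  by (intro linear_continuous_on_compose[OF _ linear_PQ(2)] continuous_intros)

lemma zc_continuous: "continuous_on S (zc i)"
  by (rule Ck_on_1D(3)[OF zc_C1])

lemma Gt_cont: "continuous_on S (\<lambda>x. Gt x $ k)"
  unfolding Gt_def by (simp add: sum_component) (intro continuous_intros zc_continuous)

lemma cmod_om0: "cmod (om0 J) \<le> C"
  by (rule order_trans[OF cmod_le_ext_l1 om_bounds(3)])

lemma Gt_le: "norm (Gt x) \<le> C * dist x x0"
  by (rule order_trans[OF norm_Gt_le mult_right_mono[OF sum_c zero_le_dist]])

lemma Z_rest:
  assumes "x \<in> K" "i < m" shows "cmod (bil (Z i) (p x - nu x - Gt x)) \<le> C * (s * dist x x0 + \<bar>\<rho> x\<bar>)"
proof -
  have "bil (Z i) (p x - nu x - Gt x) = bil (Z i) (pn x) + of_real (lam i + c i) * cnj (zc i x)"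
    unfolding bil_simps(5)[of _ _ "Gt x"] bil_Z_Gt[OF assms(2)] p_def by (simp add: algebra_simps)
  thus ?thesis using Zp[OF assms] by (simp only: add.commute[of "\<bar>\<rho> x\<bar>"])
qed

lemma ext_l1_om_diff: "x \<in> K ==> ext_l1 (\<lambda>J. om x J - om0 J) \<le> NN * (C * s)"
  unfolding NN_def by (rule ext_l1_diff_le[OF om_diff])

lemma dist_rho_nonneg: "0 \<le> s * dist x x0" "0 \<le> C * \<bar>\<rho> x\<bar>" "0 \<le> \<bar>\<rho> x\<bar>"
  using s C by simp_all

text \<open>The antiholomorphic gradient of the phase is linear already, so only the coefficient
  form has to be frozen at \<open>x0\<close>.\<close>

lemma leading_dbar_derivative:
  "leads (\<lambda>t. d_zbar j (u t J)) (\<lambda>x. om0 J * Qv (x - x0) $ j)"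
proof (rule leading_norm[OF _ _ principal_u(2) KK_ge(3) _ _ KK_ge(4) _ KK_ge(4)])
  show "continuous_on K (d_zbar j (u t J))" for t by (rule u_derivative_continuous)
  show "d_zbar j (u t J) x = 0" if "x \<notin> K" for t x by (rule u_derivative_outside(2)[OF that])
  show "continuous_on K (\<lambda>x. om0 J * Qv (x - x0) $ j)"
    by (intro continuous_on_mult continuous_on_const continuous_on_component Qv_continuous)
  fix x assume x: "x \<in> D" "x \<in> K"
  have Q: "cmod (Qv (x - x0) $ j) \<le> C * dist x x0" by (rule order_trans[OF Finite_Cartesian_Product.norm_nth_le PQ(2)[OF x(2)]])
  show "cmod (om0 J * Qv (x - x0) $ j) \<le> C * C * dist x x0"
    unfolding norm_mult mult.assoc using Q cmod_om0 C by (intro mult_mono) auto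
  have "cmod (om x J * Qv (x - x0) $ j - om0 J * Qv (x - x0) $ j) = cmod (om x J - om0 J) * cmod (Qv (x - x0) $ j)"
    by (simp only: left_diff_distrib[symmetric] norm_mult)
  also have "\<dots> \<le> (C * s) * (C * dist x x0)" using Q om_diff[OF x(2)] C s by (intro mult_mono) auto
  also have "\<dots> \<le> C * C * (s * dist x x0 + \<bar>\<rho> x\<bar>)" using C by (simp add: distrib_left mult_ac)
  finally show "cmod (om x J * Qv (x - x0) $ j - om0 J * Qv (x - x0) $ j) \<le> C * C * (s * dist x x0 + \<bar>\<rho> x\<bar>)" .
qed

text \<open>The holomorphic gradient does not vanish at \<open>x0\<close>, where it equals
  \<open>nu0\<close>; it becomes small only because the frame is tangential up to
  \<open>|\<rho>|\<close>.\<close>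

lemma leading_tangential_derivative:
  assumes j: "j \<in> {1..m}"
  shows "leads (\<lambda>t. vf_apply (L j) (u t J)) (\<lambda>x. om0 J * bil (L j x0) (Gt x))"
proof (rule leading_norm[where P="\<lambda>x. \<Sum>k\<in>UNIV. L j x $ k * (om x J * p x $ k)", OF _ _ _ _ _ _ KK_ge(4) _ KK_ge(7)])
  show "continuous_on K (vf_apply (L j) (u t J))" for t by (rule u_forms_continuous(1)[OF j])
  show "vf_apply (L j) (u t J) x = 0" if "x \<notin> K" for t x by (rule u_forms_outside(1)[OF that])
  show "continuous_on K (\<lambda>x. om0 J * bil (L j x0) (Gt x))"
    unfolding bil_def by (intro continuous_intros Gt_cont)
  have "pc.principal (\<Sum>k\<in>(UNIV::'n set). 1 * C) (\<lambda>t x. \<Sum>k\<in>UNIV. L j x $ k * d_z k (u t J) x) (\<lambda>x. \<Sum>k\<in>UNIV. L j x $ k * (om x J * p x $ k))"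
  proof (intro pc.principal_sum pc.principal_mult[OF principal_u(1)] C)
    fix k x assume "x \<in> D \<inter> K"
    thus "cmod (L j x $ k) \<le> 1" using Lnorm[OF j, of x] Finite_Cartesian_Product.norm_nth_le[of "L j x" k] by simp
  qed auto
  thus "pc.principal (nn * C) (\<lambda>t. vf_apply (L j) (u t J)) (\<lambda>x. \<Sum>k\<in>UNIV. L j x $ k * (om x J * p x $ k))"
    by (simp add: vf_apply_def[abs_def] nn_def)
  show "nn * C \<le> KK" by (rule KK_ge)
  fix x assume x: "x \<in> D" "x \<in> K"
  have nL0: "norm (L j x0) = 1" using Lnorm[OF j, of x0] pc.\<epsilon> by simp
  have G: "cmod (bil (L j x0) (Gt x)) \<le> C * dist x x0"
    using cmod_bil_le[of "L j x0" "Gt x"] nL0 Gt_le[of x] by simp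
  show "cmod (om0 J * bil (L j x0) (Gt x)) \<le> C * C * dist x x0"
    unfolding norm_mult mult.assoc using G cmod_om0 C by (intro mult_mono) auto
  let ?R = "s * dist x x0 + \<bar>\<rho> x\<bar>"
  have R: "0 \<le> ?R" using dist_rho_nonneg(1,3)[of x] by linarith
  let ?v = "p x - nu x"
  have v: "norm ?v \<le> C * dist x x0" using PQ(1)[OF x(2)] by (simp add: p_def)
  have ps: "p x = nu x + ?v" by simp
  have Lp: "bil (L j x) (p x) = bil (L j x) (nu x) + bil (L j x) ?v" by (subst ps) (rule bil_simps(4))
  have b1: "cmod (bil (L j x) (nu x)) \<le> C * \<bar>\<rho> x\<bar>" by (rule Ltan[OF j x])
  have b2: "cmod (bil (L j x) ?v) \<le> C * dist x x0" using cmod_bil_le[of "L j x" ?v] Lnorm[OF j x(2)] v by simp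
  have b3: "cmod (bil (L j x - L j x0) ?v) \<le> C * C * (s * dist x x0)"
  proof -
    have "cmod (bil (L j x - L j x0) ?v) \<le> (C * s) * (C * dist x x0)"
      using order_trans[OF Llip[OF j x(2)] mult_left_mono[OF small(1)[OF x(2)] C]] v C s
      by (intro order_trans[OF cmod_bil_le] mult_mono) auto
    thus ?thesis by (simp add: mult_ac)
  qed
  have b4: "cmod (bil (L j x0) (?v - Gt x)) \<le> real m * (C * ?R)"
  proof -
    have "cmod (bil (L j x0) (?v - Gt x)) \<le> (\<Sum>i<m. cmod (bil (Z i) (?v - Gt x)))" by (rule tangent_bil_le[OF Lx0[OF j] nL0])
    also have "\<dots> \<le> (\<Sum>i<m. C * ?R)" using Z_rest[OF x(2)] by (intro sum_mono) auto
    finally show ?thesis by simp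
  qed
  \<comment> \<open>Three errors: the normal component of the frame, its variation away from
    \<open>x0\<close>, and the linearisation of \<open>pn\<close> on vectors tangential at
    \<open>x0\<close>.\<close>
  have e: "bil (L j x) (p x) - bil (L j x0) (Gt x) = bil (L j x) (nu x) + (bil (L j x - L j x0) ?v + bil (L j x0) (?v - Gt x))"
    unfolding Lp bil_simps(2) bil_simps(5)[of _ _ "Gt x"] by simp
  have d1: "cmod (bil (L j x) (p x) - bil (L j x0) (Gt x)) \<le> C * \<bar>\<rho> x\<bar> + (C * C * (s * dist x x0) + real m * (C * ?R))"
    unfolding e by (intro norm_triangle_mono b1 b3 b4)
  have d2: "cmod (bil (L j x) (p x)) \<le> C * \<bar>\<rho> x\<bar> + C * dist x x0" unfolding Lp by (intro norm_triangle_mono b1 b2)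
  have Ps: "(\<Sum>k\<in>UNIV. L j x $ k * (om x J * p x $ k)) = om x J * bil (L j x) (p x)"
    by (simp add: bil_def sum_distrib_left mult_ac)
  have "om x J * bil (L j x) (p x) - om0 J * bil (L j x0) (Gt x)
      = (om x J - om0 J) * bil (L j x) (p x) + om0 J * (bil (L j x) (p x) - bil (L j x0) (Gt x))" by (simp add: algebra_simps)
  also have "cmod \<dots> \<le> (C * s) * (C * \<bar>\<rho> x\<bar> + C * dist x x0) + C * (C * \<bar>\<rho> x\<bar> + (C * C * (s * dist x x0) + real m * (C * ?R)))"
  proof (rule norm_triangle_mono)
    show "cmod ((om x J - om0 J) * bil (L j x) (p x)) \<le> (C * s) * (C * \<bar>\<rho> x\<bar> + C * dist x x0)"
      unfolding norm_mult using C s by (intro mult_mono om_diff[OF x(2)] d2) auto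
    show "cmod (om0 J * (bil (L j x) (p x) - bil (L j x0) (Gt x))) \<le> C * (C * \<bar>\<rho> x\<bar> + (C * C * (s * dist x x0) + real m * (C * ?R)))"
      unfolding norm_mult using C by (intro mult_mono cmod_om0 d1) auto
  qed
  also have "\<dots> \<le> (2 * (C * C) + C * C * C + real m * (C * C)) * ?R"
  proof -
    have "s * \<bar>\<rho> x\<bar> \<le> 1 * \<bar>\<rho> x\<bar>" using s by (intro mult_right_mono) auto
    hence "(C * C) * (s * \<bar>\<rho> x\<bar>) \<le> (C * C) * \<bar>\<rho> x\<bar>" using C by (intro mult_left_mono) auto
    moreover have "0 \<le> C * C * C * \<bar>\<rho> x\<bar>" "0 \<le> C * C * (s * dist x x0)" using C s by simp_all
    ultimately show ?thesis by (simp add: algebra_simps)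
  qed
  finally show "cmod ((\<Sum>k\<in>UNIV. L j x $ k * (om x J * p x $ k)) - om0 J * bil (L j x0) (Gt x)) \<le> (2 * (C * C) + C * C * C + real m * (C * C)) * ?R"
    unfolding Ps .
qed

lemma leading_dbar:
  "leads (\<lambda>t. dbar_form (u t) M) (\<lambda>x. wedge (Qv (x - x0)) om0 M)"
proof (rule leading_norm[where P="\<lambda>x. wedge (Qv (x - x0)) (om x) M", OF _ _ _ _ _ _ KK_ge(4) _ KK_ge(5)])
  show "continuous_on K (dbar_form (u t) M)" for t by (rule u_forms_continuous(2))
  show "dbar_form (u t) M x = 0" if "x \<notin> K" for t x by (rule u_forms_outside(2)[OF that])
  show "continuous_on K (\<lambda>x. wedge (Qv (x - x0)) om0 M)"
    unfolding wedge_def by (intro continuous_intros Qv_continuous continuous_on_component)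
  have "pc.principal (\<Sum>k\<in>M. 1 * C) (\<lambda>t x. \<Sum>k\<in>M. ext_sign k M * d_zbar k (u t (M - {k})) x)
     (\<lambda>x. \<Sum>k\<in>M. ext_sign k M * (om x (M - {k}) * Qv (x - x0) $ k))"
    by (intro pc.principal_sum pc.principal_mult[OF principal_u(2)] C) auto
  thus "pc.principal (real (card M) * C) (\<lambda>t. dbar_form (u t) M) (\<lambda>x. wedge (Qv (x - x0)) (om x) M)"
    by (simp add: dbar_form_def[abs_def] wedge_def mult_ac)
  have "real (card M) \<le> nn" unfolding nn_def using card_mono[of UNIV M] by simp
  thus "real (card M) * C \<le> KK" using mult_right_mono[OF _ C] KK_ge(2) order_trans by blast
  fix x assume x: "x \<in> D" "x \<in> K"
  show "cmod (wedge (Qv (x - x0)) om0 M) \<le> C * C * dist x x0"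
    using order_trans[OF cmod_wedge_le mult_mono[OF PQ(2)[OF x(2)] om_bounds(3)]] C ext_l1_nonneg[of om0] by (simp add: mult_ac)
  have "cmod (wedge (Qv (x - x0)) (om x) M - wedge (Qv (x - x0)) om0 M) \<le> (C * dist x x0) * (NN * (C * s))"
    unfolding wedge_linear[symmetric]
    using order_trans[OF cmod_wedge_le mult_mono[OF PQ(2)[OF x(2)] ext_l1_om_diff[OF x(2)]]] C ext_l1_nonneg[of "\<lambda>J. om x J - om0 J"] by simp
  also have "\<dots> \<le> NN * (C * C) * (s * dist x x0 + \<bar>\<rho> x\<bar>)" using C NN by (simp add: distrib_left mult_ac)
  finally show "cmod (wedge (Qv (x - x0)) (om x) M - wedge (Qv (x - x0)) om0 M) \<le> NN * (C * C) * (s * dist x x0 + \<bar>\<rho> x\<bar>)" .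
qed

lemma leading_adjoint:
  "leads (\<lambda>t. dbar_adjoint_form (u t) I) (\<lambda>x. - contr (Gt x) om0 I)"
proof (rule leading_norm[where P="\<lambda>x. - contr (p x) (om x) I", OF _ _ _ _ _ _ KK_ge(4) _ KK_ge(6)])
  show "continuous_on K (dbar_adjoint_form (u t) I)" for t by (rule u_forms_continuous(3))
  show "dbar_adjoint_form (u t) I x = 0" if "x \<notin> K" for t x by (rule u_forms_outside(3)[OF that])
  show "continuous_on K (\<lambda>x. - contr (Gt x) om0 I)"
    unfolding contr_def by (intro continuous_intros Gt_cont)
  have "pc.principal (\<Sum>k\<in>-I. 1 * C) (\<lambda>t x. \<Sum>k\<in>-I. (- ext_sign k I) * d_z k (u t (insert k I)) x)
     (\<lambda>x. \<Sum>k\<in>-I. (- ext_sign k I) * (om x (insert k I) * p x $ k))"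
    by (intro pc.principal_sum pc.principal_mult[OF principal_u(1)] C) auto
  thus "pc.principal (real (card (-I)) * C) (\<lambda>t. dbar_adjoint_form (u t) I) (\<lambda>x. - contr (p x) (om x) I)"
    by (simp add: dbar_adjoint_form_def[abs_def] contr_def mult_ac sum_negf)
  have "real (card (-I)) \<le> nn" unfolding nn_def using card_mono[of UNIV "-I"] by simp
  thus "real (card (-I)) * C \<le> KK" using mult_right_mono[OF _ C] KK_ge(2) order_trans by blast
  fix x assume x: "x \<in> D" "x \<in> K"
  let ?R = "s * dist x x0 + \<bar>\<rho> x\<bar>" and ?v = "p x - nu x"
  have v: "norm ?v \<le> C * dist x x0" using PQ(1)[OF x(2)] by (simp add: p_def)
  show "cmod (- contr (Gt x) om0 I) \<le> C * C * dist x x0"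
    using order_trans[OF cmod_contr_le mult_mono[OF Gt_le om_bounds(3)]] C ext_l1_nonneg[of om0] by (simp add: mult_ac)
  have 1: "cmod (contr ?v (\<lambda>J. om x J - om0 J) I) \<le> NN * (C * C) * ?R"
  proof -
    have "cmod (contr ?v (\<lambda>J. om x J - om0 J) I) \<le> (C * dist x x0) * (NN * (C * s))"
      using order_trans[OF cmod_contr_le mult_mono[OF v ext_l1_om_diff[OF x(2)]]] C ext_l1_nonneg[of "\<lambda>J. om x J - om0 J"] by simp
    also have "\<dots> \<le> NN * (C * C) * ?R" using C NN by (simp add: distrib_left mult_ac)
    finally show ?thesis .
  qed
  have 2: "cmod (contr (?v - Gt x) om0 I) \<le> real m * C * ?R"
  proof -
    have "cmod (contr (?v - Gt x) om0 I) \<le> (\<Sum>j<q. cmod (bil (Z j) (?v - Gt x)))" by (rule contr_om0_le)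
    also have "\<dots> \<le> (\<Sum>j<q. C * ?R)" using Z_rest[OF x(2)] q(2) by (intro sum_mono) auto
    also have "\<dots> = real q * (C * ?R)" by simp
    also have "\<dots> \<le> real m * (C * ?R)" using q(2) C dist_rho_nonneg(1,3)[of x] by (intro mult_right_mono) auto
    finally show ?thesis by (simp add: mult_ac)
  qed
  \<comment> \<open>The part of the gradient that does not vanish at \<open>x0\<close> is the
    conormal, and it drops out because \<open>om x\<close> is tangential at every \<open>x\<close>,
    not just at \<open>x0\<close>.\<close>
  have "contr (p x) (om x) I = contr ?v (om x) I" unfolding contr_linear contr_nu_om by simp
  hence eq: "- contr (p x) (om x) I - - contr (Gt x) om0 I = - (contr ?v (\<lambda>J. om x J - om0 J) I + contr (?v - Gt x) om0 I)"
    unfolding contr_linear(2) contr_linear(1)[of ?v "Gt x"] by simp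
  show "cmod (- contr (p x) (om x) I - - contr (Gt x) om0 I) \<le> (NN * (C * C) + real m * C) * ?R"
    unfolding eq norm_minus_cancel using norm_triangle_mono[OF 1 2] by (simp only: distrib_right)
qed

end

section \<open>Testing the maximal estimate\<close>

lemma sum_close:
  fixes F T :: "'a => real"
  assumes "finite P" "\<And>p. p \<in> P ==> \<bar>F p - t * T p\<bar> \<le> e"
  shows "t * sum T P - real (card P) * e \<le> sum F P" "sum F P \<le> t * sum T P + real (card P) * e"
proof -
  have "\<bar>\<Sum>p\<in>P. F p - t * T p\<bar> \<le> real (card P) * e"
    using sum_bounded_above[of P "\<lambda>p. \<bar>F p - t * T p\<bar>" e] assms(2) by (intro order_trans[OF sum_abs]) auto
  thus "t * sum T P - real (card P) * e \<le> sum F P" "sum F P \<le> t * sum T P + real (card P) * e"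
    by (simp_all add: sum_subtractf sum_distrib_left abs_le_iff)
qed

section \<open>The maximal estimate applied to the peaked form\<close>

context peaked_form
begin

definition nsq :: "(complex ^ 'n::{finite,linorder} => complex) => real" where
  "nsq h = (LINT x|leb D. (cmod (h x))^2)"

lemma nsq_nonneg: "0 \<le> nsq h"
  unfolding nsq_def by (rule Bochner_Integration.integral_nonneg) simp

lemma L2_nsq: "continuous_on K h ==> (\<And>x. x \<notin> K ==> h x = 0) ==> L2_normsq D h = ennreal (nsq h)"
  unfolding nsq_def by (rule L2_normsq_compact_piece[OF pc.D compact_cball])

lemma form_ennreal:
  assumes "\<And>J. continuous_on K (v J)" "\<And>J x. x \<notin> K ==> v J x = 0"
  shows "form_normsq D k v = ennreal (\<Sum>J\<in>multi_idx k. nsq (v J))"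
proof -
  have e: "L2_normsq D (v J) = ennreal (nsq (v J))" for J by (rule L2_nsq[OF assms(1)]) (rule assms(2))
  show ?thesis unfolding form_normsq_def e by (rule sum_ennreal) (rule nsq_nonneg)
qed

text \<open>The test form is C1 with compact support and tangential, so it lies in all three
  domains. The operators chosen by \<open>SOME\<close> become explicit derivatives and all norms are
  finite, which permits the passage to real numbers.\<close>

lemma maximal_estimate_real:
  assumes max: "maximal_estimate D q pt U Ac Bc L"
  shows "(\<Sum>j\<in>UNIV. \<Sum>J\<in>multi_idx q. nsq (d_zbar j (u t J))) + (\<Sum>j = 1..m. \<Sum>J\<in>multi_idx q. nsq (vf_apply (L j) (u t J)))
    \<le> Ac * ((\<Sum>M\<in>multi_idx (q + 1). nsq (dbar_form (u t) M)) + (\<Sum>I\<in>multi_idx (q - 1). nsq (dbar_adjoint_form (u t) I)))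
      + Bc * (\<Sum>J\<in>multi_idx q. nsq (u t J))"
proof -
  have A: "Ac > 0" "Bc > 0" using max by (auto simp: maximal_estimate_def)
  have uc: "continuous_on S (u t J)" for J S
    using u_C1_compact[of t J] Ck_on_1D(3)[of UNIV "u t J"] continuous_on_subset unfolding C1_compact_def by blast
  have "u t \<in> C1_form D q"
    unfolding C1_form_def C1_closure_def
  proof (intro CollectI ballI conjI allI)
    fix J :: "'n set" and v
    show "continuous_on (closure D) (u t J)" by (rule uc)
    have c: "Ck_on 1 UNIV (u t J)" using u_C1_compact[of t J] by (simp only: C1_compact_def)
    show "u t J differentiable (at x)" for x using c by simp
    show "\<exists>g. continuous_on (closure D) g \<and> (\<forall>x\<in>D. g x = fderiv (u t J) x v)"
      using continuous_on_subset[OF Ck_on_1D(2)[OF c, of v] subset_UNIV] by blast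
  qed
  have dbar: "u t \<in> dom_dbar D q" "form_normsq D (q + 1) (dbar D q (u t)) = form_normsq D (q + 1) (dbar_form (u t))"
    by (rule form_normsq_dbar[OF pc.D u_C1_compact compact_cball[of x0 \<epsilon>]]; erule u_outside)+
  have tang: "contr (nu x) (\<lambda>J. u t J x) I = 0" for x I
    unfolding u_def contr_linear contr_nu_om by simp
  have star: "u t \<in> dom_dbar_star D q" "form_normsq D (q - 1) (dbar_star D q (u t)) = form_normsq D (q - 1) (dbar_adjoint_form (u t))"
    by (rule form_normsq_dbar_star[OF pc.D df C1 compact_cball pc.cball u_C1_compact _ q(1) tang]; erule u_outside)+
  have mem: "u t \<in> C1_form D q \<inter> dom_dbar D q \<inter> dom_dbar_star D q"
    using \<open>u t \<in> C1_form D q\<close> dbar(1) star(1) by blast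
  have "form_support D q (u t) \<subseteq> closure D \<inter> K"
    unfolding form_support_def
  proof (rule closure_minimal)
    show "{x \<in> closure D. \<exists>J\<in>multi_idx q. u t J x \<noteq> 0} \<subseteq> closure D \<inter> K" using u_outside by blast
  qed (intro closed_Int closed_closure closed_cball)
  hence supp: "form_support D q (u t) \<subseteq> closure D \<inter> U" using KU by blast
  have cm: "CARD('n) - 1 = m" using m by simp
  have est: "(\<Sum>j\<in>UNIV. \<Sum>J\<in>multi_idx q. L2_normsq D (d_zbar j (u t J)))
        + (\<Sum>j = 1..m. \<Sum>J\<in>multi_idx q. L2_normsq D (vf_apply (L j) (u t J)))
        \<le> ennreal Ac * (form_normsq D (q + 1) (dbar_form (u t)) + form_normsq D (q - 1) (dbar_adjoint_form (u t)))
          + ennreal Bc * form_normsq D q (u t)"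
  proof -
    have "\<forall>u \<in> C1_form D q \<inter> dom_dbar D q \<inter> dom_dbar_star D q. form_support D q u \<subseteq> closure D \<inter> U -->
        (\<Sum>j\<in>UNIV. \<Sum>J\<in>multi_idx q. L2_normsq D (d_zbar j (u J))) + (\<Sum>j = 1..m. \<Sum>J\<in>multi_idx q. L2_normsq D (vf_apply (L j) (u J)))
        \<le> ennreal Ac * (form_normsq D (q + 1) (dbar D q u) + form_normsq D (q - 1) (dbar_star D q u)) + ennreal Bc * form_normsq D q u"
      using max unfolding maximal_estimate_def cm by (elim conjE)
    from this[rule_format, OF mem supp] show ?thesis unfolding dbar(2) star(2) .
  qed
  have e1: "L2_normsq D (d_zbar j (u t J)) = ennreal (nsq (d_zbar j (u t J)))" for j J
    by (intro L2_nsq u_derivative_continuous u_derivative_outside)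
  have e2: "L2_normsq D (vf_apply (L j) (u t J)) = ennreal (nsq (vf_apply (L j) (u t J)))" if j: "j \<in> {1..m}" for j J
    by (rule L2_nsq[OF u_forms_continuous(1)[OF j] u_forms_outside(1)])
  have e3: "form_normsq D k (dbar_form (u t)) = ennreal (\<Sum>M\<in>multi_idx k. nsq (dbar_form (u t) M))" for k
    by (rule form_ennreal[OF u_forms_continuous(2) u_forms_outside(2)])
  have e4: "form_normsq D k (dbar_adjoint_form (u t)) = ennreal (\<Sum>M\<in>multi_idx k. nsq (dbar_adjoint_form (u t) M))" for k
    by (rule form_ennreal[OF u_forms_continuous(3) u_forms_outside(3)])
  have e5: "form_normsq D q (u t) = ennreal (\<Sum>J\<in>multi_idx q. nsq (u t J))" by (rule form_ennreal[OF uc u_outside])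
  have s1: "(\<Sum>j\<in>UNIV. \<Sum>J\<in>multi_idx q. L2_normsq D (d_zbar j (u t J))) = ennreal (\<Sum>j\<in>UNIV. \<Sum>J\<in>multi_idx q. nsq (d_zbar j (u t J)))"
    unfolding e1 by (simp add: sum_ennreal sum_nonneg nsq_nonneg)
  have s2: "(\<Sum>j = 1..m. \<Sum>J\<in>multi_idx q. L2_normsq D (vf_apply (L j) (u t J))) = ennreal (\<Sum>j = 1..m. \<Sum>J\<in>multi_idx q. nsq (vf_apply (L j) (u t J)))"
    by (simp add: e2 sum_ennreal sum_nonneg nsq_nonneg cong: sum.cong_simp)
  have n: "0 \<le> (\<Sum>M\<in>S. nsq (v M))" for S v by (intro sum_nonneg nsq_nonneg)
  have nn: "0 \<le> (\<Sum>j\<in>R. \<Sum>J\<in>S. nsq (v j J))" for R S v by (intro sum_nonneg nsq_nonneg)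
  show ?thesis
    using est A unfolding s1 s2 e3 e4 e5
    by (simp add: n nn ennreal_plus[symmetric] ennreal_mult[symmetric] ennreal_le_iff del: ennreal_plus)
qed

definition Zm where "Zm t i = pc.avg t (\<lambda>x. (cmod (zc i x))^2)"

lemma avg_weighted: "pc.avg t (\<lambda>x. \<Sum>i\<in>I. k i * (cmod (zc i x))^2) = (\<Sum>i\<in>I. k i * Zm t i)"
proof -
  have "pc.avg t (\<lambda>x. \<Sum>i\<in>I. k i * (cmod (zc i x))^2) = (\<Sum>i\<in>I. pc.avg t (\<lambda>x. k i * (cmod (zc i x))^2))"
    by (intro pc.avg_sum continuous_intros zc_continuous)
  thus ?thesis by (simp only: pc.avg_cmult Zm_def)
qed

lemma weighted_continuous: "continuous_on S (\<lambda>x. \<Sum>i\<in>I. k i * (cmod (zc i x))^2)"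
  by (intro continuous_intros zc_continuous)

text \<open>Since \<open>om0\<close> has norm 1, the sum over \<open>J\<close> disappears and the
  squared length of \<open>Qv\<close> remains.\<close>

lemma avg_dbar_derivative:
  "(\<Sum>(j, J)\<in>UNIV \<times> multi_idx q. pc.avg t (\<lambda>x. (cmod (om0 J * Qv (x - x0) $ j))^2)) = (\<Sum>i<m. (c i)^2 * Zm t i)"
proof -
  have "(\<Sum>(j, J)\<in>UNIV \<times> multi_idx q. pc.avg t (\<lambda>x. (cmod (om0 J * Qv (x - x0) $ j))^2))
      = pc.avg t (\<lambda>x. \<Sum>p\<in>UNIV \<times> multi_idx q. (cmod (om0 (snd p) * Qv (x - x0) $ fst p))^2)"
    unfolding case_prod_beta
    by (intro pc.avg_sum[symmetric] continuous_intros continuous_on_component Qv_continuous)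
  also have "(\<lambda>x. \<Sum>p\<in>UNIV \<times> multi_idx q. (cmod (om0 (snd p) * Qv (x - x0) $ fst p))^2) = (\<lambda>x. \<Sum>i<m. (c i)^2 * (cmod (zc i x))^2)"
  proof
    fix x
    have "(\<Sum>p\<in>UNIV \<times> multi_idx q. (cmod (om0 (snd p) * Qv (x - x0) $ fst p))^2) = (\<Sum>j\<in>UNIV. \<Sum>J\<in>multi_idx q. (cmod (Qv (x - x0) $ j))^2 * (cmod (om0 J))^2)"
      by (subst sum.cartesian_product) (simp add: case_prod_beta norm_mult power_mult_distrib mult.commute)
    also have "\<dots> = (\<Sum>i<m. (c i)^2 * (cmod (zc i x))^2)"
      unfolding sum_distrib_left[symmetric] om0_normsq by (simp add: sum_Qv)
    finally show "(\<Sum>p\<in>UNIV \<times> multi_idx q. (cmod (om0 (snd p) * Qv (x - x0) $ fst p))^2) = (\<Sum>i<m. (c i)^2 * (cmod (zc i x))^2)" .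
  qed
  finally show ?thesis unfolding avg_weighted .
qed

text \<open>The frame of the estimate is unrelated to the eigenbasis; unitary invariance replaces
  one by the other without loss of constants.\<close>

lemma avg_tangential_derivative:
  "(\<Sum>(j, J)\<in>{1..m} \<times> multi_idx q. pc.avg t (\<lambda>x. (cmod (om0 J * bil (L j x0) (Gt x)))^2)) = (\<Sum>i<m. (lam i + c i)^2 * Zm t i)"
proof -
  have cont: "continuous_on K (\<lambda>x. bil (L j x0) (Gt x))" for j unfolding bil_def by (intro continuous_intros Gt_cont)
  have "(\<Sum>(j, J)\<in>{1..m} \<times> multi_idx q. pc.avg t (\<lambda>x. (cmod (om0 J * bil (L j x0) (Gt x)))^2))
      = pc.avg t (\<lambda>x. \<Sum>p\<in>{1..m} \<times> multi_idx q. (cmod (om0 (snd p) * bil (L (fst p) x0) (Gt x)))^2)"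
    unfolding case_prod_beta by (intro pc.avg_sum[symmetric] continuous_intros cont)
  also have "(\<lambda>x. \<Sum>p\<in>{1..m} \<times> multi_idx q. (cmod (om0 (snd p) * bil (L (fst p) x0) (Gt x)))^2) = (\<lambda>x. \<Sum>i<m. (lam i + c i)^2 * (cmod (zc i x))^2)"
  proof
    fix x
    have "(\<Sum>p\<in>{1..m} \<times> multi_idx q. (cmod (om0 (snd p) * bil (L (fst p) x0) (Gt x)))^2) = (\<Sum>j\<in>{1..m}. \<Sum>J\<in>multi_idx q. (cmod (bil (L j x0) (Gt x)))^2 * (cmod (om0 J))^2)"
      by (subst sum.cartesian_product) (simp add: case_prod_beta norm_mult power_mult_distrib mult.commute)
    also have "\<dots> = (\<Sum>i<m. (lam i + c i)^2 * (cmod (zc i x))^2)"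
      unfolding sum_distrib_left[symmetric] om0_normsq using sum_adapted_frame_Gt[OF Lon Lx0] by simp
    finally show "(\<Sum>p\<in>{1..m} \<times> multi_idx q. (cmod (om0 (snd p) * bil (L (fst p) x0) (Gt x)))^2) = (\<Sum>i<m. (lam i + c i)^2 * (cmod (zc i x))^2)" .
  qed
  finally show ?thesis unfolding avg_weighted .
qed

text \<open>This term stands on the right of the estimate and an upper bound suffices, so the sum
  over sets of size \<open>q + 1\<close> is enlarged to all sets.\<close>

lemma avg_dbar: "(\<Sum>M\<in>multi_idx (q + 1). pc.avg t (\<lambda>x. (cmod (wedge (Qv (x - x0)) om0 M))^2)) \<le> (\<Sum>i = q..<m. (c i)^2 * Zm t i)"
proof -
  have cont: "continuous_on K (\<lambda>x. wedge (Qv (x - x0)) om0 M)" for M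
    unfolding wedge_def by (intro continuous_intros Qv_continuous continuous_on_component)
  have "(\<Sum>M\<in>multi_idx (q + 1). pc.avg t (\<lambda>x. (cmod (wedge (Qv (x - x0)) om0 M))^2)) = pc.avg t (\<lambda>x. \<Sum>M\<in>multi_idx (q + 1). (cmod (wedge (Qv (x - x0)) om0 M))^2)"
    by (intro pc.avg_sum[symmetric] continuous_intros cont)
  also have "\<dots> \<le> pc.avg t (\<lambda>x. \<Sum>i = q..<m. (c i)^2 * (cmod (zc i x))^2)"
  proof (rule pc.avg_mono)
    show "(\<Sum>M\<in>multi_idx (q + 1). (cmod (wedge (Qv (x - x0)) om0 M))^2) \<le> (\<Sum>i = q..<m. (c i)^2 * (cmod (zc i x))^2)" for x
      unfolding normsq_wedge_Qv[symmetric] ext_normsq_def by (intro sum_mono2) auto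
  qed (intro weighted_continuous continuous_intros cont)+
  finally show ?thesis unfolding avg_weighted .
qed

lemma avg_adjoint: "(\<Sum>I\<in>multi_idx (q - 1). pc.avg t (\<lambda>x. (cmod (- contr (Gt x) om0 I))^2)) \<le> (\<Sum>i<q. (lam i + c i)^2 * Zm t i)"
proof -
  have cont: "continuous_on K (\<lambda>x. - contr (Gt x) om0 I)" for I
    unfolding contr_def by (intro continuous_intros Gt_cont)
  have "(\<Sum>I\<in>multi_idx (q - 1). pc.avg t (\<lambda>x. (cmod (- contr (Gt x) om0 I))^2)) = pc.avg t (\<lambda>x. \<Sum>I\<in>multi_idx (q - 1). (cmod (- contr (Gt x) om0 I))^2)"
    by (intro pc.avg_sum[symmetric] continuous_on_power continuous_on_norm cont)
  also have "\<dots> \<le> pc.avg t (\<lambda>x. \<Sum>i<q. (lam i + c i)^2 * (cmod (zc i x))^2)"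
  proof (rule pc.avg_mono)
    show "(\<Sum>I\<in>multi_idx (q - 1). (cmod (- contr (Gt x) om0 I))^2) \<le> (\<Sum>i<q. (lam i + c i)^2 * (cmod (zc i x))^2)" for x
      unfolding normsq_contr_Gt[symmetric] ext_normsq_def norm_minus_cancel by (intro sum_mono2) auto
  qed (intro weighted_continuous continuous_on_sum continuous_on_power continuous_on_norm cont)+
  finally show ?thesis unfolding avg_weighted .
qed

lemma nsq_u: "(\<Sum>J\<in>multi_idx q. nsq (u t J)) \<le> NN * (C^2 * pc.mass t)" if "t \<ge> 0"
proof -
  have "nsq (u t J) \<le> C^2 * pc.mass t" for J
  proof -
    have oc: "continuous_on K (\<lambda>x. om x J)" using continuous_on_subset[OF Ck_on_1D(3)[OF om_C1] pc.cball] .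
    have "nsq (u t J) = pc.avg t (\<lambda>x. (cmod (om x J))^2)"
      unfolding nsq_def pc.avg_def u_def norm_mult power_mult_distrib pc.cmod_f ..
    also have "\<dots> \<le> pc.avg t (\<lambda>x. C^2)"
      using om_bounds(1) by (intro pc.avg_mono continuous_intros oc power_mono) auto
    finally show ?thesis by (simp only: pc.avg_const)
  qed
  hence "(\<Sum>J\<in>multi_idx q. nsq (u t J)) \<le> real (card (multi_idx q :: 'n set set)) * (C^2 * pc.mass t)"
    by (intro sum_bounded_above) auto
  also have "\<dots> \<le> NN * (C^2 * pc.mass t)"
    unfolding NN_def using pc.mass_pos[OF that] by (intro mult_right_mono of_nat_mono card_mono) auto
  finally show ?thesis .
qed

lemma leads_sum:
  assumes "finite P" "\<forall>p\<in>P. leads (F p) (T p)"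
  shows "\<forall>\<^sub>F t in at_top. t^2 * (\<Sum>p\<in>P. pc.avg t (\<lambda>x. (cmod (T p x))^2)) - real (card P) * (err * s * t * pc.mass t) \<le> (\<Sum>p\<in>P. nsq (F p t)) \<and>
    (\<Sum>p\<in>P. nsq (F p t)) \<le> t^2 * (\<Sum>p\<in>P. pc.avg t (\<lambda>x. (cmod (T p x))^2)) + real (card P) * (err * s * t * pc.mass t)"
proof -
  have "\<forall>\<^sub>F t in at_top. \<forall>p\<in>P. \<bar>nsq (F p t) - t^2 * pc.avg t (\<lambda>x. (cmod (T p x))^2)\<bar> \<le> err * s * t * pc.mass t"
    unfolding nsq_def using assms(2) by (intro eventually_ball_finite assms(1) ballI) (simp add: leads_def)
  thus ?thesis by eventually_elim (intro conjI sum_close assms(1); blast)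
qed

text \<open>The relative error of the second moments, per unit of \<open>s\<close>.\<close>

definition sm where "sm = C + C * DD + 1"

text \<open>The coefficient of \<open>s\<close> in the final error. Its terms come from the leading
  norms, from the term with \<open>Bc\<close> (the summand 1), and from replacing second moments by
  their limits; neither \<open>s\<close> nor \<open>t\<close> occurs.\<close>

definition lim_const where
  "lim_const Ac = (nn + real m) * NN * err + Ac * (2 * NN * err) + 1
     + sm * (\<Sum>i<m. ((c i)^2 + (lam i + c i)^2) / (lam i + 2 * c i))
     + Ac * sm * ((\<Sum>i = q..<m. (c i)^2 / (lam i + 2 * c i)) + (\<Sum>i<q. (lam i + c i)^2 / (lam i + 2 * c i)))"

text \<open>Each derivative norm is of order \<open>t * mass t\<close>, so the estimate is divided
  by this quantity.\<close>

lemma approximate_inequality: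
  assumes max: "maximal_estimate D q pt U Ac Bc L"
  shows "(\<Sum>i<m. ((c i)^2 + (lam i + c i)^2) / (lam i + 2 * c i))
    \<le> Ac * ((\<Sum>i = q..<m. (c i)^2 / (lam i + 2 * c i)) + (\<Sum>i<q. (lam i + c i)^2 / (lam i + 2 * c i))) + lim_const Ac * s"
proof -
  have A: "Ac > 0" "Bc > 0" using max by (auto simp: maximal_estimate_def)
  let ?\<kappa> = "\<lambda>i. lam i + 2 * c i"
  \<comment> \<open>Beyond this threshold the term with \<open>Bc\<close>, which has no factor
    \<open>t\<close>, is at most \<open>s * t * mass t\<close>.\<close>
  have l: "\<forall>\<^sub>F t::real in at_top. 1 \<le> t \<and> Bc * (NN * C^2) / s \<le> t"
    by (intro eventually_conj eventually_ge_at_top)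
  have ev5: "\<forall>\<^sub>F t in at_top. \<forall>i\<in>{..<m}. \<bar>pc.mass t - t * kp i * Zm t i\<bar> \<le> sm * s * pc.mass t"
    unfolding Zm_def sm_def by (intro eventually_ball_finite ballI second_moments) auto
  have ev1: "\<forall>p\<in>UNIV \<times> multi_idx q. leads (\<lambda>t. d_zbar (fst p) (u t (snd p))) (\<lambda>x. om0 (snd p) * Qv (x - x0) $ fst p)"
    by (intro ballI leading_dbar_derivative)
  have ev2: "\<forall>p\<in>{1..m} \<times> multi_idx q. leads (\<lambda>t. vf_apply (L (fst p)) (u t (snd p))) (\<lambda>x. om0 (snd p) * bil (L (fst p) x0) (Gt x))"
    by (intro ballI leading_tangential_derivative) auto
  have err0: "err \<ge> 0" using DD by (simp add: err_def)
  have card: "real (card (multi_idx k :: 'n set set)) \<le> NN" for k unfolding NN_def by (intro of_nat_mono card_mono) auto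
  have fin: "finite ({1..m} \<times> (multi_idx q :: 'n set set))" by simp
  have ev3: "\<forall>M\<in>multi_idx (q + 1). leads (\<lambda>t. dbar_form (u t) M) (\<lambda>x. wedge (Qv (x - x0)) om0 M)"
    by (intro ballI leading_dbar)
  have ev4: "\<forall>I\<in>multi_idx (q - 1). leads (\<lambda>t. dbar_adjoint_form (u t) I) (\<lambda>x. - contr (Gt x) om0 I)"
    by (intro ballI leading_adjoint)
  have cards: "real (card ((UNIV :: 'n set) \<times> (multi_idx q :: 'n set set))) \<le> nn * NN" "real (card ({1..m} \<times> (multi_idx q :: 'n set set))) \<le> real m * NN"
    unfolding card_cartesian_product of_nat_mult nn_def using card by (simp_all add: mult_left_mono)
  have "\<forall>\<^sub>F t::real in at_top. ?thesis"
    using leads_sum[OF finite ev1] leads_sum[OF fin ev2] leads_sum[OF finite ev3] leads_sum[OF finite ev4] ev5 l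
  proof eventually_elim
    case (elim t)
    define M where "M = pc.mass t"
    define e where "e = err * s * t * M"
    have t: "1 \<le> t" "Bc * (NN * C^2) / s \<le> t" using elim(6) by auto
    have M: "M > 0" unfolding M_def using t(1) by (intro pc.mass_pos) simp
    have e0: "e \<ge> 0" using err0 s t(1) M by (simp add: e_def)
    \<comment> \<open>On the scale of the mass this tends to \<open>1 / kp i\<close>; one factor of
      \<open>t^2\<close> is spent on it, the other is divided out.\<close>
    define y where "y i = t * Zm t i" for i
    have l1: "t^2 * (\<Sum>i<m. (c i)^2 * Zm t i) - nn * NN * e \<le> (\<Sum>j\<in>UNIV. \<Sum>J\<in>multi_idx q. nsq (d_zbar j (u t J)))"
      using conjunct1[OF elim(1)] mult_right_mono[OF cards(1) e0]
      unfolding avg_dbar_derivative[unfolded case_prod_beta] sum.cartesian_product case_prod_beta e_def M_def by linarith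
    have l2: "t^2 * (\<Sum>i<m. (lam i + c i)^2 * Zm t i) - real m * NN * e \<le> (\<Sum>j = 1..m. \<Sum>J\<in>multi_idx q. nsq (vf_apply (L j) (u t J)))"
      using conjunct1[OF elim(2)] mult_right_mono[OF cards(2) e0]
      unfolding avg_tangential_derivative[unfolded case_prod_beta] sum.cartesian_product case_prod_beta e_def M_def by linarith
    have l3: "(\<Sum>M\<in>multi_idx (q + 1). nsq (dbar_form (u t) M)) \<le> t^2 * (\<Sum>i = q..<m. (c i)^2 * Zm t i) + NN * e"
      using conjunct2[OF elim(3)] mult_left_mono[OF avg_dbar[of t], of "t^2"] mult_right_mono[OF card[of "q + 1"] e0]
      unfolding e_def M_def by fastforce
    have l4: "(\<Sum>I\<in>multi_idx (q - 1). nsq (dbar_adjoint_form (u t) I)) \<le> t^2 * (\<Sum>i<q. (lam i + c i)^2 * Zm t i) + NN * e"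
      using conjunct2[OF elim(4)] mult_left_mono[OF avg_adjoint[of t], of "t^2"] mult_right_mono[OF card[of "q - 1"] e0]
      unfolding e_def M_def by fastforce
    have l5: "Bc * (\<Sum>J\<in>multi_idx q. nsq (u t J)) \<le> s * t * M"
    proof -
      have "Bc * (\<Sum>J\<in>multi_idx q. nsq (u t J)) \<le> Bc * (NN * (C^2 * M))"
        unfolding M_def using nsq_u[of t] t(1) A by (intro mult_left_mono) auto
      also have "\<dots> = (Bc * (NN * C^2)) * M" by simp
      also have "\<dots> \<le> (s * t) * M" using t(2) s M by (intro mult_right_mono) (auto simp: field_simps)
      finally show ?thesis .
    qed
    have ty: "t^2 * (\<Sum>i\<in>I. k i * Zm t i) = t * (\<Sum>i\<in>I. k i * y i)" for I k
      unfolding y_def power2_eq_square by (simp add: sum_distrib_left mult_ac)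
    have "t * (\<Sum>i<m. (c i)^2 * y i) + t * (\<Sum>i<m. (lam i + c i)^2 * y i) - (nn + real m) * NN * e
        \<le> Ac * (t * (\<Sum>i = q..<m. (c i)^2 * y i) + t * (\<Sum>i<q. (lam i + c i)^2 * y i) + 2 * NN * e) + s * t * M"
    proof -
      have "Ac * ((\<Sum>M\<in>multi_idx (q + 1). nsq (dbar_form (u t) M)) + (\<Sum>I\<in>multi_idx (q - 1). nsq (dbar_adjoint_form (u t) I)))
        \<le> Ac * (t * (\<Sum>i = q..<m. (c i)^2 * y i) + t * (\<Sum>i<q. (lam i + c i)^2 * y i) + 2 * NN * e)"
        using l3 l4 A unfolding ty by (intro mult_left_mono) auto
      thus ?thesis using maximal_estimate_real[OF max, of t] l1 l2 l5 unfolding ty by (simp add: algebra_simps)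
    qed
    hence "t * ((\<Sum>i<m. ((c i)^2 + (lam i + c i)^2) * y i) - (nn + real m) * NN * (err * s * M))
        \<le> t * (Ac * ((\<Sum>i = q..<m. (c i)^2 * y i) + (\<Sum>i<q. (lam i + c i)^2 * y i) + 2 * NN * (err * s * M)) + s * M)"
      unfolding e_def distrib_right sum.distrib by (simp add: algebra_simps)
    hence main: "(\<Sum>i<m. ((c i)^2 + (lam i + c i)^2) * y i) - (nn + real m) * NN * (err * s * M)
        \<le> Ac * ((\<Sum>i = q..<m. (c i)^2 * y i) + (\<Sum>i<q. (lam i + c i)^2 * y i) + 2 * NN * (err * s * M)) + s * M"
      using t(1) by simp
    \<comment> \<open>Positivity of \<open>kp i\<close> is used to solve the two-sided moment bound
      for \<open>y i\<close>.\<close>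
    have yb: "(1 - sm * s) * M / ?\<kappa> i \<le> y i" "y i \<le> (1 + sm * s) * M / ?\<kappa> i" if "i < m" for i
      using elim(5) that kap[OF that] unfolding y_def M_def abs_le_iff by (simp_all add: field_simps)
    have lower: "(1 - sm * s) * M * (\<Sum>i<m. ((c i)^2 + (lam i + c i)^2) / ?\<kappa> i) \<le> (\<Sum>i<m. ((c i)^2 + (lam i + c i)^2) * y i)"
      unfolding sum_distrib_left
    proof (rule sum_mono)
      fix i assume "i \<in> {..<m}"
      hence "((c i)^2 + (lam i + c i)^2) * ((1 - sm * s) * M / ?\<kappa> i) \<le> ((c i)^2 + (lam i + c i)^2) * y i"
        using yb(1)[of i] by (intro mult_left_mono) auto
      thus "(1 - sm * s) * M * (((c i)^2 + (lam i + c i)^2) / ?\<kappa> i) \<le> ((c i)^2 + (lam i + c i)^2) * y i" by (simp add: mult.commute)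
    qed
    have upper: "(\<Sum>i\<in>I. (k i)^2 * y i) \<le> (1 + sm * s) * M * (\<Sum>i\<in>I. (k i)^2 / ?\<kappa> i)" if "I \<subseteq> {..<m}" for I k
      unfolding sum_distrib_left
    proof (rule sum_mono)
      fix i assume "i \<in> I"
      hence "(k i)^2 * y i \<le> (k i)^2 * ((1 + sm * s) * M / ?\<kappa> i)"
        using yb(2)[of i] that by (intro mult_left_mono) auto
      thus "(k i)^2 * y i \<le> (1 + sm * s) * M * ((k i)^2 / ?\<kappa> i)" by (simp add: mult.commute)
    qed
    define l where "l = (\<Sum>i<m. ((c i)^2 + (lam i + c i)^2) / ?\<kappa> i)"
    define r' where "r' = (\<Sum>i = q..<m. (c i)^2 / ?\<kappa> i) + (\<Sum>i<q. (lam i + c i)^2 / ?\<kappa> i)"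
    have "Ac * ((\<Sum>i = q..<m. (c i)^2 * y i) + (\<Sum>i<q. (lam i + c i)^2 * y i) + 2 * NN * (err * s * M)) \<le> Ac * ((1 + sm * s) * M * r' + 2 * NN * (err * s * M))"
    proof -
      have "(\<Sum>i = q..<m. (c i)^2 * y i) \<le> (1 + sm * s) * M * (\<Sum>i = q..<m. (c i)^2 / ?\<kappa> i)" by (rule upper) auto
      moreover have "(\<Sum>i<q. (lam i + c i)^2 * y i) \<le> (1 + sm * s) * M * (\<Sum>i<q. (lam i + c i)^2 / ?\<kappa> i)" by (rule upper) (use q(2) in auto)
      ultimately show ?thesis using A(1) unfolding r'_def distrib_left[of "(1 + sm * s) * M"] by (intro mult_left_mono) auto
    qed
    with main lower have "(1 - sm * s) * M * l - (nn + real m) * NN * (err * s * M) \<le> Ac * ((1 + sm * s) * M * r' + 2 * NN * (err * s * M)) + s * M"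
      unfolding l_def by linarith
    hence "M * ((1 - sm * s) * l - (nn + real m) * NN * (err * s)) \<le> M * (Ac * ((1 + sm * s) * r' + 2 * NN * (err * s)) + s)"
      by (simp add: algebra_simps)
    hence "(1 - sm * s) * l - (nn + real m) * NN * (err * s) \<le> Ac * ((1 + sm * s) * r' + 2 * NN * (err * s)) + s"
      using M by simp
    hence "l \<le> Ac * r' + ((nn + real m) * NN * err + Ac * (2 * NN * err) + 1 + sm * l + Ac * sm * r') * s"
      by (simp add: algebra_simps)
    thus ?case unfolding l_def r'_def lim_const_def .
  qed
  \<comment> \<open>The inequality no longer mentions \<open>t\<close>, so its eventual truth is its
    truth.\<close>
  thus ?thesis by simp
qed

end

section \<open>Existence of the test data and the limit of small neighbourhoods\<close>

lemma cutoff_exists: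
  fixes x0 :: "'a::euclidean_space" assumes "\<epsilon> > 0"
  obtains \<theta> :: "'a => real" where "Ck_on 1 UNIV \<theta>" "\<And>x. 0 \<le> \<theta> x" "\<And>x. \<theta> x \<le> 1"
    "\<And>x. x \<in> ball x0 (\<epsilon> / 2) ==> \<theta> x = 1" "\<And>x. x \<notin> cball x0 \<epsilon> ==> \<theta> x = 0"
proof -
  obtain S S' :: "real => real" and B where S: "\<And>y. (S has_real_derivative S' y) (at y)" "continuous_on UNIV S'" "\<And>y. 0 \<le> S y" "\<And>y. S y \<le> 1"
    "\<And>y. y \<le> 0 ==> S y = 0" "\<And>y. 1 \<le> y ==> S y = 1" "\<And>y. y \<le> 0 \<or> 1 \<le> y ==> S' y = 0" "\<And>y. \<bar>S' y\<bar> \<le> B" "B > 0"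
    by (rule smoothstep_exists) (rule that; assumption)
  \<comment> \<open>On the ball of half the radius \<open>\<epsilon>^2\<close> exceeds the squared
    distance by at least three quarters of itself; this factor scales that to 1.\<close>
  define k where "k = 4 / (3 * \<epsilon>^2)"
  define g where "g x = (\<epsilon>^2 - inner (x - x0) (x - x0)) * k" for x :: 'a
  have g: "Ck_on 1 UNIV g"
  proof (rule Ck_on_1I)
    show "(g has_derivative (\<lambda>v. - (2 * inner (x - x0) v) * k)) (at x)" for x
      unfolding g_def by (auto intro!: derivative_eq_intros simp: inner_commute)
    show "continuous_on UNIV (\<lambda>x. - (2 * inner (x - x0) v) * k)" for v by (intro continuous_intros)
  qed
  have i: "inner (x - x0) (x - x0) = (dist x0 x)^2" for x
    by (metis dist_commute dist_norm power2_norm_eq_inner)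
  show thesis
  proof
    show "Ck_on 1 UNIV (\<lambda>x. S (g x))" by (rule Ck_on_1_compose_DERIV[OF g S(1,2)]) simp
    show "0 \<le> S (g x)" "S (g x) \<le> 1" for x by (rule S)+
    show "S (g x) = 1" if "x \<in> ball x0 (\<epsilon> / 2)" for x
    proof (rule S(6))
      have "(dist x0 x)^2 \<le> (\<epsilon> / 2)^2" using that by (intro power_mono) auto
      hence "3 / 4 * \<epsilon>^2 \<le> \<epsilon>^2 - (dist x0 x)^2" by (simp add: power2_eq_square)
      hence "3 / 4 * \<epsilon>^2 * (4 / (3 * \<epsilon>^2)) \<le> g x" unfolding g_def i k_def by (intro mult_right_mono) auto
      thus "1 \<le> g x" using assms by simp
    qed
    show "S (g x) = 0" if "x \<notin> cball x0 \<epsilon>" for x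
    proof (rule S(5))
      have "\<epsilon>^2 \<le> (dist x0 x)^2" using that assms by (intro power_mono) auto
      thus "g x \<le> 0" unfolding g_def i k_def by (intro mult_nonpos_nonneg) auto
    qed
  qed
qed

text \<open>Used twice: for the size \<open>s\<close> of the neighbourhood, and for the perturbation
  of the weights at zero eigenvalues.\<close>

lemma linear_error_limit:
  assumes "\<And>s::real. 0 < s ==> s \<le> 1 ==> l \<le> r + E * s" shows "l \<le> (r::real)"
proof (rule field_le_epsilon)
  fix e :: real assume e: "e > 0"
  define s where "s = min 1 (e / (\<bar>E\<bar> + 1))"
  have s: "0 < s" "s \<le> 1" using e by (auto simp: s_def)
  have "E * s \<le> (\<bar>E\<bar> + 1) * s" using s by (intro mult_right_mono) auto
  also have "\<dots> \<le> (\<bar>E\<bar> + 1) * (e / (\<bar>E\<bar> + 1))" by (intro mult_left_mono) (auto simp: s_def)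
  also have "\<dots> = e" by (simp add: field_simps)
  finally show "l \<le> r + e" using assms[OF s] by linarith
qed

context levi_form_point
begin

lemma om_bounds_exist:
  assumes "cball x0 e \<subseteq> V"
  shows "\<exists>C\<ge>0. \<forall>x\<in>cball x0 e. \<forall>J. cmod (om x J) \<le> C \<and> (\<forall>k. cmod (d_z k (\<lambda>x. om x J) x) \<le> C \<and> cmod (d_zbar k (\<lambda>x. om x J) x) \<le> C)"
proof -
  have bd: "\<exists>B\<ge>0. \<forall>x\<in>cball x0 e. cmod (g x) \<le> B" if "continuous_on V g" for g :: "complex ^ 'n::{finite,linorder} => complex"
    by (rule continuous_on_compact_bounded[OF that compact_cball assms])
  have "\<forall>J. \<exists>B\<ge>0. \<forall>x\<in>cball x0 e. cmod (om x J) \<le> B" using bd[OF Ck_on_1D(3)[OF om_C1]] by blast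
  then obtain B1 where B1: "\<And>J. B1 J \<ge> 0" "\<And>J x. x \<in> cball x0 e ==> cmod (om x J) \<le> B1 J" by metis
  have "\<forall>J k. \<exists>B\<ge>0. \<forall>x\<in>cball x0 e. cmod (d_z k (\<lambda>x. om x J) x) \<le> B" using bd[OF d_z_continuous(1)[OF om_C1]] by blast
  then obtain B2 where B2: "\<And>J k. B2 J k \<ge> 0" "\<And>J k x. x \<in> cball x0 e ==> cmod (d_z k (\<lambda>x. om x J) x) \<le> B2 J k" by metis
  have "\<forall>J k. \<exists>B\<ge>0. \<forall>x\<in>cball x0 e. cmod (d_zbar k (\<lambda>x. om x J) x) \<le> B" using bd[OF d_z_continuous(2)[OF om_C1]] by blast
  then obtain B3 where B3: "\<And>J k. B3 J k \<ge> 0" "\<And>J k x. x \<in> cball x0 e ==> cmod (d_zbar k (\<lambda>x. om x J) x) \<le> B3 J k" by metis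
  define B where "B J k = B1 J + B2 J k + B3 J k" for J k
  have B: "B J k \<ge> 0" "B1 J \<le> B J k" "B2 J k \<le> B J k" "B3 J k \<le> B J k" for J k
    using B1(1)[of J] B2(1)[of J k] B3(1)[of J k] by (auto simp: B_def)
  define C where "C = (\<Sum>J\<in>UNIV. \<Sum>k\<in>UNIV. B J k)"
  have C: "B J k \<le> C" for J k
  proof -
    have "B J k \<le> (\<Sum>k\<in>UNIV. B J k)" using B(1) by (intro member_le_sum) auto
    also have "\<dots> \<le> C" unfolding C_def using B(1) by (intro member_le_sum[of J UNIV "\<lambda>J. \<Sum>k\<in>UNIV. B J k"] sum_nonneg) auto
    finally show ?thesis .
  qed
  have "C \<ge> 0" unfolding C_def using B(1) by (intro sum_nonneg)
  moreover have "cmod (om x J) \<le> C \<and> (\<forall>k. cmod (d_z k (\<lambda>x. om x J) x) \<le> C \<and> cmod (d_zbar k (\<lambda>x. om x J) x) \<le> C)" if "x \<in> cball x0 e" for x J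
    using B1(2)[OF that] B2(2)[OF that] B3(2)[OF that] B C by (meson order_trans)
  ultimately show ?thesis by blast
qed

text \<open>The order of quantifiers is the point: \<open>C\<close> and \<open>a\<close> come from
  the boundary point, the weights and the frame alone, while the radius of the ball and with it the
  cutoff depend on \<open>s\<close>.\<close>

lemma peaked_form_exists:
  assumes U: "open U" "x0 \<in> U" and frame: "adapted_frame D U L"
  shows "\<exists>C a. \<forall>s. 0 < s --> s \<le> 1 --> (\<exists>\<theta> \<epsilon> W. peaked_form \<rho> V D x0 Z lam c m q \<theta> \<epsilon> a s C U W L)"
proof -
  have cm: "CARD('n) - 1 = m" using m by simp
  have Lon: "orthonormal_family {1..CARD('n)} (\<lambda>j. L j x)" if "x \<in> U" for x using frame that by (simp add: adapted_frame_def)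
  have Ln: "norm (L j x) = 1" if "x \<in> U" "j \<in> {1..m}" for j x
  proof -
    have "herm_inner (L j x) (L j x) = 1" using Lon[OF that(1)] that(2) m by (simp add: orthonormal_family_def)
    hence "(norm (L j x))^2 = 1^2" unfolding herm_inner_self by (simp only: of_real_eq_1_iff one_power2)
    thus ?thesis by (rule power2_eq_imp_eq) auto
  qed
  have LT: "bil (L j x) (nu x) = 0" if "x \<in> U" "x \<in> V" "x \<in> frontier D" "j \<in> {1..m}" for j x
    using frame that T10_boundary_eq[OF df C1 that(2,3)] unfolding adapted_frame_def cm by auto
  have "\<forall>j. \<exists>M. j \<in> {1..m} --> (M::real)-lipschitz_on U (L j)" using frame m unfolding adapted_frame_def by auto
  then obtain M :: "nat => real" where M: "\<And>j. j \<in> {1..m} ==> (M j)-lipschitz_on U (L j)" by metis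
  have M0: "j \<in> {1..m} ==> M j \<ge> 0" for j using M lipschitz_on_nonneg by blast
  have "\<forall>j. \<exists>C\<ge>0. j \<in> {1..m} --> (\<forall>\<^sub>F x in nhds x0. \<rho> x \<le> 0 --> cmod (bil (L j x) (nu x)) \<le> C * \<bar>\<rho> x\<bar>)"
  proof
    fix j
    show "\<exists>C\<ge>0. j \<in> {1..m} --> (\<forall>\<^sub>F x in nhds x0. \<rho> x \<le> 0 --> cmod (bil (L j x) (nu x)) \<le> C * \<bar>\<rho> x\<bar>)"
    proof (cases "j \<in> {1..m}")
      case True
      from cmod_bil_tangent_field_le[OF U M[OF True] Ln[OF _ True] LT[OF _ _ _ True]] show ?thesis by blast
    qed auto
  qed
  from choice[OF this] obtain T :: "nat => real" where T: "\<And>j. T j \<ge> 0" "\<And>j. j \<in> {1..m} ==> \<forall>\<^sub>F x in nhds x0. \<rho> x \<le> 0 --> cmod (bil (L j x) (nu x)) \<le> T j * \<bar>\<rho> x\<bar>" by blast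
  obtain e C0 where e: "e > 0" "C0 \<ge> 0" "ball x0 (2 * e) \<subseteq> V" "\<And>x. x \<in> ball x0 (2 * e) ==> norm (nu x - nu0) \<le> r / 2"
    "\<And>x. x \<in> cball x0 e ==> Re (dvg fieldX x) \<le> C0"
    "\<And>x i. x \<in> cball x0 e ==> i < m ==> \<bar>Re (dvg (fieldZ i) x) - 1\<bar> \<le> C0 * dist x x0"
    by (rule local_fields) (rule that; assumption)
  have eW: "cball x0 e \<subseteq> ball x0 (2 * e)" using e(1) by auto
  obtain C1 where C1: "C1 \<ge> 0" "\<forall>\<^sub>F x in nhds x0. norm (pn x) \<le> C1 * dist x x0
    \<and> norm (Qv (x - x0)) \<le> C1 * dist x x0 \<and> norm (G x) \<le> C1 * dist x x0" using eventually_Pv_Qv by blast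
  obtain C2 where C2: "C2 \<ge> 0" "\<And>s. s > 0 ==> \<forall>\<^sub>F x in nhds x0. \<forall>i<m. cmod (bil (Z i) (pn x) + of_real (lam i + c i) * cnj (zc i x))
    \<le> C2 * (\<bar>\<rho> x\<bar> + s * dist x x0) \<and> cmod (bil (Z i) (G x) + of_real (kp i) * cnj (zc i x)) \<le> C2 * (\<bar>\<rho> x\<bar> + s * dist x x0)"
    using eventually_Z_p by blast
  obtain C3 where C3: "C3 \<ge> 0" "\<And>s. s > 0 ==> \<forall>\<^sub>F x in nhds x0. \<forall>i<m. \<bar>Re (bil (fieldZ i x) (dP x)) + (kp i) * (cmod (zc i x))^2\<bar> \<le> C3 * s * (\<bar>\<rho> x\<bar> + (dist x x0)^2)"
    using eventually_fieldZ by blast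
  obtain a1 where a1: "a1 > 0" "\<forall>\<^sub>F x in nhds x0. \<rho> x \<le> 0 --> 2 * Re (Psi x) \<le> - a1 * (dist x x0)^2" using eventually_decay by blast
  obtain a2 where a2: "a2 > 0" "\<forall>\<^sub>F x in nhds x0. \<rho> x \<le> 0 --> Re (bil (fieldX x) (dP x)) \<le> - a2 * (\<bar>\<rho> x\<bar> + (dist x x0)^2)" using eventually_fieldX by blast
  obtain C4 where C4: "C4 \<ge> 0" "\<And>x J. x \<in> cball x0 e ==> cmod (om x J) \<le> C4"
    "\<And>x J k. x \<in> cball x0 e ==> cmod (d_z k (\<lambda>x. om x J) x) \<le> C4" "\<And>x J k. x \<in> cball x0 e ==> cmod (d_zbar k (\<lambda>x. om x J) x) \<le> C4"
    using om_bounds_exist[OF order_trans[OF eW e(3)]] by blast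
  \<comment> \<open>One rate serves both the decay of the phase and the inward field; each estimate
    only becomes weaker.\<close>
  define a where "a = min a1 a2"
  have a: "a > 0" "a \<le> a1" "a \<le> a2" using a1(1) a2(1) by (auto simp: a_def)
  define C where "C = 1 + C0 + C1 + C2 + C3 + C4 + (\<Sum>j = 1..m. M j) + (\<Sum>j = 1..m. T j) + ext_l1 beta + ext_l1 om0 + (\<Sum>i<m. \<bar>lam i + c i\<bar>)"
  have nn: "0 \<le> (\<Sum>j = 1..m. M j)" "0 \<le> (\<Sum>j = 1..m. T j)" "0 \<le> ext_l1 beta" "0 \<le> ext_l1 om0" "0 \<le> (\<Sum>i<m. \<bar>lam i + c i\<bar>)"
    using M0 T(1) by (auto intro!: sum_nonneg ext_l1_nonneg)
  have C: "1 \<le> C" "C0 \<le> C" "C1 \<le> C" "C2 \<le> C" "C3 \<le> C" "C4 \<le> C" "ext_l1 beta \<le> C" "ext_l1 om0 \<le> C" "(\<Sum>i<m. \<bar>lam i + c i\<bar>) \<le> C"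
    "(\<Sum>j = 1..m. M j) \<le> C" "(\<Sum>j = 1..m. T j) \<le> C"
    using e(2) C1(1) C2(1) C3(1) C4(1) nn unfolding C_def by linarith+
  have MC: "M j \<le> C" "T j \<le> C" if j: "j \<in> {1..m}" for j
    using member_le_sum[OF j, of M] member_le_sum[OF j, of T] M0 T(1) C(10,11) by auto
  have "\<exists>\<theta> \<epsilon> W. peaked_form \<rho> V D x0 Z lam c m q \<theta> \<epsilon> a s C U W L" if s: "0 < s" "s \<le> 1" for s
  proof -
    have s2: "s^2 > 0" using s by simp
    have "\<forall>\<^sub>F x in nhds x0. \<forall>j\<in>{1..m}. \<rho> x \<le> 0 --> cmod (bil (L j x) (nu x)) \<le> T j * \<bar>\<rho> x\<bar>"
      by (intro eventually_ball_finite ballI T(2)) auto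
    note ev = eventually_conj[OF this eventually_conj[OF eventually_dist[OF s(1)] eventually_conj[OF eventually_rho[OF s2] eventually_conj[OF eventually_nu[OF s(1)]
      eventually_conj[OF C1(2) eventually_conj[OF C2(2)[OF s(1)] eventually_conj[OF C3(2)[OF s(1)] eventually_conj[OF a1(2) eventually_conj[OF a2(2)
      eventually_nhds_in_open[OF U]]]]]]]]]]
    obtain d where d: "d > 0" "\<And>x. dist x x0 < d ==> (\<forall>j\<in>{1..m}. \<rho> x \<le> 0 --> cmod (bil (L j x) (nu x)) \<le> T j * \<bar>\<rho> x\<bar>)"
      "\<And>x. dist x x0 < d ==> dist x x0 \<le> s" "\<And>x. dist x x0 < d ==> \<bar>\<rho> x\<bar> \<le> s^2" "\<And>x. dist x x0 < d ==> norm (nu x - nu0) \<le> s"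
      "\<And>x. dist x x0 < d ==> norm (pn x) \<le> C1 * dist x x0" "\<And>x. dist x x0 < d ==> norm (Qv (x - x0)) \<le> C1 * dist x x0"
      "\<And>x i. dist x x0 < d ==> i < m ==> cmod (bil (Z i) (pn x) + of_real (lam i + c i) * cnj (zc i x)) \<le> C2 * (\<bar>\<rho> x\<bar> + s * dist x x0)"
      "\<And>x i. dist x x0 < d ==> i < m ==> \<bar>Re (bil (fieldZ i x) (dP x)) + (kp i) * (cmod (zc i x))^2\<bar> \<le> C3 * s * (\<bar>\<rho> x\<bar> + (dist x x0)^2)"
      "\<And>x. dist x x0 < d ==> \<rho> x \<le> 0 ==> 2 * Re (Psi x) \<le> - a1 * (dist x x0)^2"
      "\<And>x. dist x x0 < d ==> \<rho> x \<le> 0 ==> Re (bil (fieldX x) (dP x)) \<le> - a2 * (\<bar>\<rho> x\<bar> + (dist x x0)^2)"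
      "\<And>x. dist x x0 < d ==> x \<in> U"
      using ev unfolding eventually_nhds_metric by (elim exE conjE)
        (rule that; (assumption | (drule spec, drule mp, assumption, elim conjE, (assumption | (drule mp, assumption, assumption)
          | (drule spec, drule mp, assumption, (elim conjE)?, assumption)))))
    \<comment> \<open>The closed ball has to lie inside the open ball of radius \<open>d\<close>, on
      which the local estimates hold, and inside the fixed ball of radius \<open>e\<close>, on which
      the constants were obtained.\<close>
    define \<epsilon> where "\<epsilon> = min e (d / 2)"
    have \<epsilon>: "\<epsilon> > 0" "\<epsilon> \<le> e" using e(1) d(1) by (auto simp: \<epsilon>_def)
    have K: "dist x x0 < d" "x \<in> cball x0 e" "x \<in> V" if "x \<in> cball x0 \<epsilon>" for x
    proof -
      have "dist x x0 \<le> \<epsilon>" using that by (simp add: dist_commute)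
      thus "dist x x0 < d" using d(1) by (simp add: \<epsilon>_def)
      show "x \<in> cball x0 e" using that \<epsilon>(2) by auto
      thus "x \<in> V" using eW e(3) by blast
    qed
    have neg: "\<rho> x \<le> 0" if "x \<in> D" "x \<in> cball x0 \<epsilon>" for x
      using defining_functionD(2)[OF df K(3)[OF that(2)]] that(1) by simp
    obtain \<theta> :: "complex ^ 'n::{finite,linorder} => real" where \<theta>: "Ck_on 1 UNIV \<theta>" "\<And>x. 0 \<le> \<theta> x" "\<And>x. \<theta> x \<le> 1"
      "\<And>x. x \<in> ball x0 (\<epsilon> / 2) ==> \<theta> x = 1" "\<And>x. x \<notin> cball x0 \<epsilon> ==> \<theta> x = 0"
      by (rule cutoff_exists[OF \<epsilon>(1), of x0]) (rule that; assumption)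
    have KV: "cball x0 \<epsilon> \<subseteq> V" using K(3) by blast
    have mono: "b \<le> C * t" if "b \<le> k * t" "k \<le> C" "0 \<le> t" for b k t :: real
      using that mult_right_mono order_trans by blast
    have mono2: "b \<le> - a * t" if "b \<le> - k * t" "a \<le> k" "0 \<le> t" for b k t :: real
      using that mult_right_mono[OF that(2,3)] by simp
    have "peaked_form \<rho> V D x0 Z lam c m q \<theta> \<epsilon> a s C U (ball x0 (2 * e)) L"
    proof (rule peaked_form.intro[OF levi_form_point_axioms], rule peaked_form_axioms.intro)
      show "phase_cutoff D V \<rho> \<theta> x0 Psi \<epsilon> a"
      proof (rule phase_cutoff.intro)
        show "2 * Re (Psi x) \<le> - a * (dist x x0)^2" if "x \<in> D" "x \<in> cball x0 \<epsilon>" for x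
          by (rule mono2[OF d(10)[OF K(1)[OF that(2)] neg[OF that]] a(2)]) simp
      qed (fact D df C2_function.C1[OF C2_function_axioms] \<epsilon>(1) KV x0f Psi_C1 Psi_x0 \<theta> a(1))+
      show "0 < s" "s \<le> 1" "1 \<le> C" by (fact s C(1))+
      show "cball x0 \<epsilon> \<subseteq> U" using d(12) K(1) by blast
      show "open (ball x0 (2 * e))" by simp
      show "ball x0 (2 * e) \<subseteq> V" by (fact e(3))
      show "cball x0 \<epsilon> \<subseteq> ball x0 (2 * e)" using K(2) eW by blast
      show "norm (nu x - nu0) \<le> r / 2" if "x \<in> ball x0 (2 * e)" for x by (rule e(4)[OF that])
      show "ext_l1 beta \<le> C" "ext_l1 om0 \<le> C" "(\<Sum>i<m. \<bar>lam i + c i\<bar>) \<le> C" by (fact C)+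
      show "orthonormal_family {1..CARD('n)} (\<lambda>j. L j x0)" by (rule Lon[OF U(2)])
    next
      fix x assume x: "x \<in> cball x0 \<epsilon>"
      show "cmod (om x J) \<le> C" for J using C4(2)[OF K(2)[OF x]] C(6) order_trans by blast
      show "cmod (d_z k (\<lambda>x. om x J) x) \<le> C" for J k using C4(3)[OF K(2)[OF x]] C(6) order_trans by blast
      show "cmod (d_zbar k (\<lambda>x. om x J) x) \<le> C" for J k using C4(4)[OF K(2)[OF x]] C(6) order_trans by blast
      show "Re (dvg fieldX x) \<le> C" by (rule order_trans[OF e(5)[OF K(2)[OF x]] C(2)])
      show "\<bar>Re (dvg (fieldZ i) x) - 1\<bar> \<le> C * dist x x0" if "i < m" for i
        by (rule mono[OF e(6)[OF K(2)[OF x] that] C(2)]) simp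
      show "dist x x0 \<le> s" "\<bar>\<rho> x\<bar> \<le> s^2" "norm (nu x - nu0) \<le> s" by (rule d(3-5)[OF K(1)[OF x]])+
      show "norm (pn x) \<le> C * dist x x0" by (rule mono[OF d(6)[OF K(1)[OF x]] C(3)]) simp
      show "norm (Qv (x - x0)) \<le> C * dist x x0" by (rule mono[OF d(7)[OF K(1)[OF x]] C(3)]) simp
      show "cmod (bil (Z i) (pn x) + of_real (lam i + c i) * cnj (zc i x)) \<le> C * (\<bar>\<rho> x\<bar> + s * dist x x0)" if "i < m" for i
        by (rule mono[OF d(8)[OF K(1)[OF x] that] C(4)]) (use s in simp)
      show "\<bar>Re (bil (fieldZ i x) (dP x)) + (kp i) * (cmod (zc i x))^2\<bar> \<le> C * s * (\<bar>\<rho> x\<bar> + (dist x x0)^2)" if "i < m" for i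
        unfolding mult.assoc[of C] by (rule mono[OF d(9)[OF K(1)[OF x] that, unfolded mult.assoc[of C3]] C(5)]) (use s in simp)
    next
      fix x assume x: "x \<in> D" "x \<in> cball x0 \<epsilon>"
      show "Re (bil (fieldX x) (dP x)) \<le> - a * (\<bar>\<rho> x\<bar> + (dist x x0)^2)"
        by (rule mono2[OF d(11)[OF K(1)[OF x(2)] neg[OF x]] a(3)]) simp
    next
      fix j assume j: "j \<in> {1..m}"
      show "bil (L j x0) nu0 = 0" unfolding nu0_def by (rule LT[OF U(2) x0V x0f j])
      show "continuous_on (cball x0 \<epsilon>) (L j)"
        using lipschitz_on_continuous_on[OF M[OF j]] by (rule continuous_on_subset) (use d(12) K(1) in blast)
      fix x assume x: "x \<in> cball x0 \<epsilon>"
      show "norm (L j x) = 1" by (rule Ln[OF d(12)[OF K(1)[OF x]] j])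
      show "norm (L j x - L j x0) \<le> C * dist x x0"
        using mono[OF lipschitz_onD[OF M[OF j] d(12)[OF K(1)[OF x]] U(2)] MC(1)[OF j]] by (simp add: dist_norm)
      show "cmod (bil (L j x) (nu x)) \<le> C * \<bar>\<rho> x\<bar>" if "x \<in> D"
        using d(2)[OF K(1)[OF x]] neg[OF that x] j by (intro mono[OF _ MC(2)[OF j]]) auto
    qed
    thus ?thesis by blast
  qed
  thus ?thesis by blast
qed

text \<open>The coefficient \<open>lim_const\<close> is the same for all \<open>s\<close>, so the
  error term vanishes in the limit and \<open>Ac\<close> is unchanged.\<close>

lemma eigenvalue_inequality:
  assumes max: "maximal_estimate D q pt U Ac Bc L" and x0U: "x0 \<in> U"
  shows "(\<Sum>i<m. ((c i)^2 + (lam i + c i)^2) / (kp i))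
    \<le> Ac * ((\<Sum>i = q..<m. (c i)^2 / (kp i)) + (\<Sum>i<q. (lam i + c i)^2 / (kp i)))"
proof -
  have U: "open U" "adapted_frame D U L" using max by (auto simp: maximal_estimate_def)
  obtain C a where pf: "\<And>s. 0 < s ==> s \<le> 1 ==> \<exists>\<theta> \<epsilon> W. peaked_form \<rho> V D x0 Z lam c m q \<theta> \<epsilon> a s C U W L"
    using peaked_form_exists[OF U(1) x0U U(2)] by blast
  show ?thesis
  proof (rule linear_error_limit)
    fix s :: real assume "0 < s" "s \<le> 1"
    then obtain \<theta> \<epsilon> W where "peaked_form \<rho> V D x0 Z lam c m q \<theta> \<epsilon> a s C U W L" using pf by blast
    from peaked_form.approximate_inequality[OF this max]
    show "(\<Sum>i<m. ((c i)^2 + (lam i + c i)^2) / (kp i))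
    \<le> Ac * ((\<Sum>i = q..<m. (c i)^2 / (kp i)) + (\<Sum>i<q. (lam i + c i)^2 / (kp i))) + peaked_form.lim_const TYPE('n) lam c m q a C Ac * s" .
  qed
qed

end

text \<open>Put \<open>\<kappa> = l + 2 * k\<close>. The quotient with both squares is
  \<open>(\<kappa> + l^2 / \<kappa>) / 2\<close>, the other two are
  \<open>(\<kappa> - 2 * l + l^2 / \<kappa>) / 4\<close> and
  \<open>(\<kappa> + 2 * l + l^2 / \<kappa>) / 4\<close>; all are smallest at
  \<open>\<kappa> = |l|\<close>, which is the choice of \<open>k\<close> for nonzero
  \<open>l\<close>. For \<open>l = 0\<close> that would violate positivity, and \<open>d\<close>
  takes over.\<close>

lemma weight_terms:
  fixes l d :: real
  assumes d: "d > 0"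
  defines "k \<equiv> max 0 (- l) + (if l = 0 then d else 0)"
  shows "l + 2 * k > 0" "\<bar>l\<bar> \<le> (k^2 + (l + k)^2) / (l + 2 * k)"
    "k^2 / (l + 2 * k) \<le> max 0 (- l) + d" "(l + k)^2 / (l + 2 * k) \<le> max 0 l + d"
proof -
  consider "l > 0" | "l < 0" | "l = 0" by linarith
  hence "l + 2 * k > 0 \<and> \<bar>l\<bar> \<le> (k^2 + (l + k)^2) / (l + 2 * k) \<and>
    k^2 / (l + 2 * k) \<le> max 0 (- l) + d \<and> (l + k)^2 / (l + 2 * k) \<le> max 0 l + d"
  proof cases
    case 1 thus ?thesis using d by (simp add: k_def power2_eq_square)
  next
    case 2
    hence k: "k = - l" "l + k = 0" "l + 2 * k = - l" by (simp_all add: k_def)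
    show ?thesis unfolding k(2,3) using 2 d by (simp add: k(1) power2_eq_square)
  next
    case 3
    hence k: "k = d" "l + k = d" "l + 2 * k = 2 * d" by (simp_all add: k_def)
    show ?thesis unfolding k using 3 d by (simp add: power2_eq_square)
  qed
  thus "l + 2 * k > 0" "\<bar>l\<bar> \<le> (k^2 + (l + k)^2) / (l + 2 * k)"
    "k^2 / (l + 2 * k) \<le> max 0 (- l) + d" "(l + k)^2 / (l + 2 * k) \<le> max 0 l + d" by blast+
qed

theorem theorem2p2:
  fixes \<Omega> U V :: "(complex ^ 'n::{finite,linorder}) set"
    and \<rho> :: "complex ^ 'n::{finite,linorder} \<Rightarrow> real"
    and L :: "nat \<Rightarrow> complex ^ 'n::{finite,linorder} \<Rightarrow> complex ^ 'n::{finite,linorder}"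
    and \<mu> :: "complex ^ 'n::{finite,linorder} \<Rightarrow> nat \<Rightarrow> real"
    and p :: "complex ^ 'n::{finite,linorder}" and q :: nat and \<alpha> A B :: real
  assumes "open \<Omega>" and "connected \<Omega>" and "\<Omega> \<noteq> {}"
    and "\<alpha> > 0" and "Ck_holder_boundary 2 \<alpha> \<Omega>"
    and "1 \<le> q" and "q \<le> CARD('n) - 1"
    and "p \<in> frontier \<Omega>"
    and "maximal_estimate \<Omega> q p U A B L"
    and "defining_function \<Omega> V \<rho>" and "Ck_holder_on 2 \<alpha> V \<rho>" and "U \<inter> frontier \<Omega> \<subseteq> V"
    and "\<And>x. x \<in> U \<inter> frontier \<Omega> \<Longrightarrow> levi_eigenvalues \<Omega> \<rho> x (\<mu> x)"
  shows "\<forall>x\<in>U \<inter> frontier \<Omega>.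
    (\<Sum>j = 1..q. \<mu> x j) + (\<Sum>j | 1 \<le> j \<and> j \<le> CARD('n) - 1 \<and> \<mu> x j < 0. \<bar>\<mu> x j\<bar>)
      \<ge> 1 / A * (\<Sum>j = 1..CARD('n) - 1. \<bar>\<mu> x j\<bar>)"
proof
  fix x0 assume x0: "x0 \<in> U \<inter> frontier \<Omega>"
  hence x0V: "x0 \<in> V" and x0U: "x0 \<in> U" and x0f: "x0 \<in> frontier \<Omega>" using assms(12) by auto
  define m where "m = CARD('n) - 1"
  have m: "CARD('n) = Suc m" and qm: "q \<le> m" using assms(6,7) by (simp_all add: m_def)
  have A: "A > 0" using assms(9) by (simp add: maximal_estimate_def)
  interpret C2_function \<rho> V
    using Ck_holder_on_2D[OF assms(11)] defining_functionD(1)[OF assms(10)] by unfold_locales auto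
  have herm: "d_z k (d_zbar j (\<lambda>y. complex_of_real (\<rho> y))) x0 = cnj (d_z j (d_zbar k (\<lambda>y. complex_of_real (\<rho> y))) x0)" for j k
    unfolding d_rho_second(3)[OF x0V] complex_cnj_cnj using d_rho_second(2)[OF x0V] by (metis complex_cnj_cnj)
  obtain Z where Z: "orthonormal_family {..<m} Z" "vec.span (Z ` {..<m}) = T10_boundary \<Omega> x0"
    "\<And>i j. i < m ==> j < m ==> levi_form \<rho> x0 (Z i) (Z j) = (if i = j then complex_of_real (\<mu> x0 (Suc i)) else 0)"
    using levi_eigenbasis[OF assms(13)[OF x0] herm] unfolding m_def by blast
  define lam where "lam i = \<mu> x0 (Suc i)" for i
  have ZT: "bil (Z j) (d_rho \<rho> x0) = 0" if "j < m" for j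
  proof -
    have "Z j \<in> T10_boundary \<Omega> x0" unfolding Z(2)[symmetric] using that by (intro vec.span_base) auto
    thus ?thesis unfolding T10_boundary_eq[OF assms(10) C1 x0V x0f] by simp
  qed
  \<comment> \<open>The negative parts come from dbar, the positive parts from its adjoint.\<close>
  define R where "R = (\<Sum>i = q..<m. max 0 (- lam i)) + (\<Sum>i<q. max 0 (lam i))"
  have "(\<Sum>i<m. \<bar>lam i\<bar>) \<le> A * R"
  proof (rule linear_error_limit)
    fix d :: real assume d: "0 < d" "d \<le> 1"
    \<comment> \<open>The phase depends on the weights, so the point data are interpreted anew for
      every \<open>d\<close>.\<close>
    define c where "c i = max 0 (- lam i) + (if lam i = 0 then d else 0)" for i
    note w = weight_terms[OF d(1), of "lam i" for i, folded c_def]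
    interpret levi_form_point \<rho> V \<Omega> x0 Z lam c m q
      using assms(1,6,10) x0V x0f m Z(1) ZT Z(3)[folded lam_def] w(1) qm by unfold_locales auto
    have "(\<Sum>i<m. \<bar>lam i\<bar>) \<le> (\<Sum>i<m. ((c i)\<^sup>2 + (lam i + c i)\<^sup>2) / (lam i + 2 * c i))"
      by (intro sum_mono w)
    also have "\<dots> \<le> A * ((\<Sum>i = q..<m. (c i)\<^sup>2 / (lam i + 2 * c i)) + (\<Sum>i<q. (lam i + c i)\<^sup>2 / (lam i + 2 * c i)))"
      by (rule eigenvalue_inequality[OF assms(9) x0U])
    also have "\<dots> \<le> A * ((\<Sum>i = q..<m. max 0 (- lam i) + d) + (\<Sum>i<q. max 0 (lam i) + d))"
      using A by (intro mult_left_mono add_mono sum_mono w) auto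
    also have "\<dots> = A * R + (A * real m) * d"
      using qm by (simp add: R_def sum.distrib algebra_simps of_nat_diff)
    finally show "(\<Sum>i<m. \<bar>lam i\<bar>) \<le> A * R + (A * real m) * d" .
  qed
  \<comment> \<open>For the first \<open>q\<close> eigenvalues, adding the negative part to the
    eigenvalue leaves its positive part; for the others only the negative part is present.\<close>
  moreover have "(\<Sum>j = 1..q. \<mu> x0 j) + (\<Sum>j | 1 \<le> j \<and> j \<le> m \<and> \<mu> x0 j < 0. \<bar>\<mu> x0 j\<bar>) = R"
  proof -
    have set: "{j. 1 \<le> j \<and> j \<le> m \<and> \<mu> x0 j < 0} = {j \<in> {1..m}. \<mu> x0 j < 0}" by auto
    have "(\<Sum>j | 1 \<le> j \<and> j \<le> m \<and> \<mu> x0 j < 0. \<bar>\<mu> x0 j\<bar>) = (\<Sum>j = 1..m. if \<mu> x0 j < 0 then \<bar>\<mu> x0 j\<bar> else 0)"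
      unfolding set by (rule sum.inter_filter) simp
    also have "\<dots> = (\<Sum>i<m. max 0 (- lam i))"
      unfolding One_nat_def sum.atLeast1_atMost_eq lam_def by (intro sum.cong) auto
    also have "\<dots> = (\<Sum>i<q. max 0 (- lam i)) + (\<Sum>i = q..<m. max 0 (- lam i))"
      using sum.atLeastLessThan_concat[of 0 q m "\<lambda>i. max 0 (- lam i)"] qm by (simp add: lessThan_atLeast0)
    finally have "(\<Sum>j = 1..q. \<mu> x0 j) + (\<Sum>j | 1 \<le> j \<and> j \<le> m \<and> \<mu> x0 j < 0. \<bar>\<mu> x0 j\<bar>)
        = (\<Sum>i<q. lam i + max 0 (- lam i)) + (\<Sum>i = q..<m. max 0 (- lam i))"
      unfolding One_nat_def sum.atLeast1_atMost_eq[of "\<mu> x0"] lam_def by (simp add: sum.distrib)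
    also have "(\<Sum>i<q. lam i + max 0 (- lam i)) = (\<Sum>i<q. max 0 (lam i))" by (intro sum.cong) auto
    finally show ?thesis by (simp add: R_def)
  qed
  moreover have "(\<Sum>j = 1..m. \<bar>\<mu> x0 j\<bar>) = (\<Sum>i<m. \<bar>lam i\<bar>)"
    unfolding One_nat_def sum.atLeast1_atMost_eq lam_def ..
  ultimately show "(\<Sum>j = 1..q. \<mu> x0 j) + (\<Sum>j | 1 \<le> j \<and> j \<le> CARD('n) - 1 \<and> \<mu> x0 j < 0. \<bar>\<mu> x0 j\<bar>)
      \<ge> 1 / A * (\<Sum>j = 1..CARD('n) - 1. \<bar>\<mu> x0 j\<bar>)"
    using A unfolding m_def[symmetric] by (simp add: field_simps)
qed

end
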